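(* The interpretation $(\|-\|_t,\|-\|_T)$ described in the context is an interpretation of the type theory $\mathbf{mTT}_{cind}+\mathbf{AC}+\mathbf{CT}$ into the type theory $\mathbf{MLtt}_{cind}+\mathbf{CT}$, so that the consistency of $\mathbf{mTT}_{cind}+\mathbf{AC}+\mathbf{CT}$ is reduced to the consistency of $\mathbf{MLtt}_{cind}+\mathbf{CT}$ (if $\mathbf{MLtt}_{cind}+\mathbf{CT}$ is consistent, then so is $\mathbf{mTT}_{cind}+\mathbf{AC}+\mathbf{CT}$).
   Context: General conventions. All type theories are dependent type theories with judgements $A\ type\ [\Gamma]$, $A=B\ type\ [\Gamma]$, $a\in A\ [\Gamma]$, $a=b\in A\ [\Gamma]$. In place of the usual congruence rules for terms (in particular without the $\xi$-rule "$c=c'\in C\ [x\in B]$ implies $\lambda x.c=\lambda x.c'\in(\Pi x\in B)C$") only the replacement rule is postulated: from $c(x_1,\dots,x_n)\in C(x_1,\dots,x_n)\ [x_1\in A_1,\dots,x_n\in A_n(x_1,\dots,x_{n-1})]$ and $a_1=b_1\in A_1,\dots,a_n=b_n\in A_n(a_1,\dots,a_{n-1})$ infer $c(a_1,\dots,a_n)=c(b_1,\dots,b_n)\in C(a_1,\dots,a_n)$. Consistent means that the falsum $\bot$ (respectively the empty type $\mathsf N_0$) has no closed element. $\mathsf{Ap}$ is function application. The theory $\mathbf{mTT}_{cind}$. $\mathbf{mTT}$ is the intensional level of the Minimalist Foundation. It has four kinds of types: collections, sets, propositions, small propositions; small propositions are sets and propositions, sets and propositions are collections. Sets: $\mathsf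 N_0$, $\mathsf N_1$, $\mathsf{List}(A)$, $A+B$, $(\Sigma x\in A)B$, $(\Pi x\in A)B$ with the usual rules of intensional Martin-Löf type theory (eliminations towards collections); $\mathsf N$ is the set of natural numbers. Propositions: $\bot$, $\wedge$, $\vee$, $\to$, $\forall_{x\in A}$, $\exists_{x\in A}$, $\mathsf{Id}(A,a,b)$ for collections $A$, with proof-terms as in intensional Martin-Löf type theory, but with eliminations only towards propositions not depending on proof-terms. Small propositions: those propositions built with quantifiers and equalities restricted to sets. Collections: also the universe à la Russell $\mathsf{prop_s}$ of small propositions, function collections $A\to\mathsf{prop_s}$ ($A$ a set), and $\Sigma$-types of collections. For $V\in A\to\mathsf{prop_s}$, $a\,\epsilon\,V$ means $\mathsf{Ap}(V,a)$. An axiom set is: $A\ set$, $I(x)\ set\ [x\in A]$, $C(x,j)\in A\to\mathsf{prop_s}\ [x\in A,j\in I(x)]$. $\mathbf{mTT}_{ind}$ adds, for each axiom set, $V\in A\to\mathsf{prop_s}$ and $a\in A$, a small proposition $a\triangleleft_{I,C}V$ with: $\mathsf{rf}(a,r)\in a\triangleleft_{I,C}V$ for $r\in a\,\epsilon\,V$; $\mathsf{tr}(a,j,r)\in a\triangleleft_{I,C}V$ for $j\in I(a)$, $r\in\forall_{z\in A}(z\,\epsilon\,C(a,j)\to z\triangleleft_{I,C}V)$; and, for $P(x)\ prop\ [x\in A]$, $m\in a\triangleleft_{I,C}V$, $q_1(x,w)\in P(x)\ [x\in A,w\in x\,\epsilon\,V]$, $q_2(x,h,k,f)\in P(x)\ [x\in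 A,h\in I(x),k\in\forall_{z\in A}(z\,\epsilon\,C(x,h)\to z\triangleleft_{I,C}V),f\in\forall_{z\in A}(z\,\epsilon\,C(x,h)\to P(z))]$, an eliminator $\mathsf{ind}(m,q_1,q_2)\in P(a)$ with $\mathsf{ind}(\mathsf{rf}(a,r),q_1,q_2)=q_1(a,r)$ and $\mathsf{ind}(\mathsf{tr}(a,j,r),q_1,q_2)=q_2(a,j,r,\lambda z.\lambda u.\mathsf{ind}(\mathsf{Ap}(\mathsf{Ap}(r,z),u),q_1,q_2))$. $\mathbf{mTT}_{cind}$ adds, for each axiom set, $V\in A\to\mathsf{prop_s}$ and $a\in A$, a small proposition $a\ltimes_{I,C}V$ with (no equality rules): $\mathsf{ax_1}(a,q)\in a\,\epsilon\,V$ for $q\in a\ltimes_{I,C}V$; $\mathsf{ax_2}(a,i,q)\in\exists_{y\in A}(y\,\epsilon\,C(a,i)\wedge y\ltimes_{I,C}V)$ for $i\in I(a)$, $q\in a\ltimes_{I,C}V$; and, for $P(x)\ prop\ [x\in A]$, $m\in P(a)$, $q_1(x,z)\in V(x)\ [x\in A,z\in P(x)]$, $q_2(x,j,z)\in\exists_{y\in A}(P(y)\wedge y\,\epsilon\,C(x,j))\ [x\in A,j\in I(x),z\in P(x)]$, a term $\mathsf{ax_3}(a,m,q_1,q_2)\in a\ltimes_{I,C}V$. The axioms. $\mathbf{AC}$: $(\forall x\in A)(\exists y\in B)R(x,y)\to(\exists f\in(\Pi x\in A)B)(\forall x\in A)R(x,\mathsf{Ap}(f,x))$ for collections $A,B$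 (for which the function type $(\Pi x\in A)B$ is available) and any relation $R$. $\mathbf{CT}$: $(\forall f\in\mathsf N\to\mathsf N)(\exists e\in\mathsf N)(\forall x\in\mathsf N)(\exists z\in\mathsf N)(T(e,x,z)\wedge\mathsf{Ap}(f,x)=_{\mathsf N}U(z))$, with $T$ Kleene's predicate and $U$ the result-extracting function; in Martin-Löf type theories it is read via propositions-as-types. The theory $\mathbf{MLtt}_{cind}$. It is intensional Martin-Löf type theory with types $\mathsf N_0,\mathsf N_1,\mathsf N,\mathsf{List}(A),A+B,(\Sigma x\in A)B,(\Pi x\in A)B,\mathsf{Id}(A,a,b)$ and one universe $\mathsf U_0$ à la Tarski with decoding $\mathsf T$, closed under codes for all these type constructors and under the following. Write $t\,\epsilon\,v$ for $\mathsf T(\mathsf{Ap}(v,t))$. An axiom-set is $s\in\mathsf U_0$, $i(x)\in\mathsf U_0\ [x\in\mathsf T(s)]$, $c(x,j)\in\mathsf T(s)\to\mathsf U_0\ [x\in\mathsf T(s),j\in\mathsf T(i(x))]$. For $v\in\mathsf T(s)\to\mathsf U_0$, $a\in\mathsf T(s)$ there are codes $a\,\widehat\triangleleft_{s,i,c}v\in\mathsf U_0$ and $a\,\widehat\ltimes_{s,i,c}v\in\mathsf U_0$, with decodings $a\triangleleft_{s,i,c}v$ and $a\ltimes_{s,i,c}v$. Covers: constructors $\mathsf{rf}(a,r)$ ($r\in a\,\epsilon\,v$) and $\mathsf{tr}(a,j,r)$ ($j\in\mathsf T(i(a))$, $r\in(\Pi z\in\mathsf T(s))(z\,\epsilon\,c(a,j)\to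 z\triangleleft_{s,i,c}v)$) of $a\triangleleft_{s,i,c}v$; for any $P(x,u)\ type\ [x\in\mathsf T(s),u\in x\triangleleft_{s,i,c}v]$, $m\in a\triangleleft_{s,i,c}v$, $q_1(x,w)\in P(x,\mathsf{rf}(x,w))\ [x\in \mathsf T(s),w\in x\,\epsilon\,v]$ and $q_2(x,h,k,f)\in P(x,\mathsf{tr}(x,h,k))\ [x\in\mathsf T(s),h\in\mathsf T(i(x)),k\in(\Pi z\in\mathsf T(s))(z\,\epsilon\,c(x,h)\to z\triangleleft_{s,i,c}v),f\in(\Pi z\in\mathsf T(s))(\Pi u\in z\,\epsilon\,c(x,h))P(z,\mathsf{Ap}(\mathsf{Ap}(k,z),u))]$, an eliminator $\mathsf{ind}(m,q_1,q_2)\in P(a,m)$, with the two computation rules $\mathsf{ind}(\mathsf{rf}(a,r),q_1,q_2)=q_1(a,r)$ and $\mathsf{ind}(\mathsf{tr}(a,j,r),q_1,q_2)=q_2(a,j,r,\lambda z.\lambda u.\mathsf{ind}(\mathsf{Ap}(\mathsf{Ap}(r,z),u),q_1,q_2))$. Positivity: $\mathsf{ax_1}(a,q)\in a\,\epsilon\,v$ for $q\in a\ltimes_{s,i,c}v$; $\mathsf{ax_2}(a,j,q)\in(\Sigma y\in\mathsf T(s))(y\,\epsilon\,c(a,j)\times y\ltimes_{s,i,c}v)$ for $j\in\mathsf T(i(a))$, $q\in a\ltimes_{s,i,c}v$; and, for $P(x)\ type\ [x\in\mathsf T(s)]$, $m\in P(a)$, $q_1(x,z)\in\mathsf T(v(x))\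 [x\in\mathsf T(s),z\in P(x)]$, $q_2(x,j,z)\in(\Sigma y\in\mathsf T(s))(y\,\epsilon\,c(x,j)\times P(y))\ [x\in\mathsf T(s),j\in\mathsf T(i(x)),z\in P(x)]$, a term $\mathsf{ax_3}(m,q_1,q_2)\in a\ltimes_{s,i,c}v$. The interpretation. On a pre-syntax of $\mathbf{mTT}_{cind}$ in which pre-types contained in $\mathsf{prop_s}$ are also pre-terms, define by mutual recursion $\|-\|_t$ (pre-terms to pre-terms) and $\|-\|_T$ (pre-types to pre-types), following propositions-as-types ($\bot\mapsto\mathsf N_0$, $\wedge\mapsto\times$, $\vee\mapsto+$, implication to function type, $\forall\mapsto\Pi$, $\exists\mapsto\Sigma$, $\mathsf{Id}\mapsto\mathsf{Id}$, set constructors to the corresponding type constructors, proof-terms to the corresponding terms), sending $\mathsf{prop_s}$ to $\mathsf U_0$, sending covers and positivity relations with their terms to the corresponding types and terms of $\mathbf{MLtt}_{cind}$, and sending a small proposition regarded as a pre-term to the code in $\mathsf U_0$ of its interpretation as a pre-type. A judgement is interpreted by applying $\|-\|_t$ or $\|-\|_T$ according as an expression plays the role of a term or of a type; e.g. $a\in\varphi$ becomes $\|a\|_t\in\|\varphi\|_T$ and $\varphi\in\mathsf{prop_s}$ becomes $\|\varphi\|_t\in\mathsf U_0$. *)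

theory Defs
  imports Main
begin

section \<open>Kleene's predicate\<close>

datatype recf =
    RZero
  | RSucc
  | RProj nat
  | RComp recf "recf list"
  | RPrec recf recf
  | RMin recf

inductive rec_arity :: "nat \<Rightarrow> recf \<Rightarrow> bool" where
  "rec_arity n RZero"
| "rec_arity 1 RSucc"
| "i < n \<Longrightarrow> rec_arity n (RProj i)"
| "rec_arity (length gs) f \<Longrightarrow> \<forall>g\<in>set gs. rec_arity n g \<Longrightarrow> rec_arity n (RComp f gs)"
| "rec_arity n g \<Longrightarrow> rec_arity (n + 2) h \<Longrightarrow> rec_arity (n + 1) (RPrec g h)"
| "rec_arity (n + 1) f \<Longrightarrow> rec_arity n (RMin f)"

fun mu_free :: "recf \<Rightarrow> bool" where
  "mu_free (RComp f gs) \<longleftrightarrow> mu_free f \<and> (\<forall>g\<in>set gs. mu_free g)"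
| "mu_free (RPrec g h) \<longleftrightarrow> mu_free g \<and> mu_free h"
| "mu_free (RMin f) \<longleftrightarrow> False"
| "mu_free _ \<longleftrightarrow> True"

definition prim_rec :: "nat \<Rightarrow> recf \<Rightarrow> bool" where
  "prim_rec n f \<longleftrightarrow> rec_arity n f \<and> mu_free f"

text \<open>\<open>rec_eval f xs y\<close>: the partial recursive function \<open>f\<close> is defined at \<open>xs\<close> with value \<open>y\<close>.\<close>

inductive rec_eval :: "recf \<Rightarrow> nat list \<Rightarrow> nat \<Rightarrow> bool" where
  "rec_eval RZero xs 0"
| "rec_eval RSucc [x] (Suc x)"
| "i < length xs \<Longrightarrow> rec_eval (RProj i) xs (xs ! i)"
| "length ys = length gs \<Longrightarrow> \<forall>i<length gs. rec_eval (gs ! i) xs (ys ! i) \<Longrightarrow> rec_eval f ys z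
    \<Longrightarrow> rec_eval (RComp f gs) xs z"
| "rec_eval g xs y \<Longrightarrow> rec_eval (RPrec g h) (0 # xs) y"
| "rec_eval (RPrec g h) (n # xs) r \<Longrightarrow> rec_eval h (n # r # xs) y
    \<Longrightarrow> rec_eval (RPrec g h) (Suc n # xs) y"
| "rec_eval f (z # xs) 0 \<Longrightarrow> \<forall>k<z. \<exists>y. rec_eval f (k # xs) (Suc y) \<Longrightarrow> rec_eval (RMin f) xs z"

text \<open>
  Kleene's predicate \<open>T\<close> and the result-extracting function \<open>U\<close> are determined only up to the
  choice of a Goedel numbering.  A pair \<open>(t, u)\<close> is admissible if \<open>t\<close> is a definition of the
  characteristic function of \<open>T\<close> (value 1 for truth) and \<open>u\<close> a definition of \<open>U\<close>, both by
  primitive recursion, such that there is at most one computation for each \<open>e\<close> and \<open>x\<close>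
  and Kleene's normal form theorem holds.
\<close>

definition kleene_TU :: "recf \<Rightarrow> recf \<Rightarrow> bool" where
  "kleene_TU t u \<longleftrightarrow> prim_rec 3 t \<and> prim_rec 1 u
     \<and> (\<forall>e x z. rec_eval t [e, x, z] 0 \<or> rec_eval t [e, x, z] 1)
     \<and> (\<forall>e x z z'. rec_eval t [e, x, z] 1 \<longrightarrow> rec_eval t [e, x, z'] 1 \<longrightarrow> z = z')
     \<and> (\<forall>f. rec_arity 1 f \<longrightarrow>
          (\<exists>e. \<forall>x y. rec_eval f [x] y \<longleftrightarrow> (\<exists>z. rec_eval t [e, x, z] 1 \<and> rec_eval u [z] y)))"


section \<open>The theory \<open>mTT_cind + AC + CT\<close>\<close>

text \<open>
  Pre-types and pre-terms form a single syntactic category, since \<open>prop_s\<close> is a universe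
  a la Russell.  Variables are de Bruijn indices; the comments give, for each argument that
  binds variables, the variables bound in it (the last one is index 0).  Function types,
  universal quantifiers and implications share abstraction and application, and
  \<open>A \<rightarrow> prop_s\<close> is \<open>MPi A MPropS\<close>.
\<close>

datatype mexp =
    MVar nat
  | MN0 | MN1 | MNat
  | MList mexp
  | MPlus mexp mexp
  | MSigma mexp mexp              (* A, (x)B *)
  | MPi mexp mexp                 (* A, (x)B *)
  | MFalsum
  | MAnd mexp mexp
  | MOr mexp mexp
  | MImp mexp mexp
  | MAll mexp mexp                (* A, (x)B *)
  | MEx mexp mexp                 (* A, (x)B *)
  | MId mexp mexp mexp
  | MPropS
  | MCov mexp mexp mexp mexp mexp (* A, (x)I, (x,j)C, V, a *)
  | MPos mexp mexp mexp mexp mexp (* A, (x)I, (x,j)C, V, a *)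
  | MEl0 mexp
  | MStar
  | MEl1 mexp mexp
  | MZero
  | MSuc mexp
  | MElN mexp mexp mexp           (* n, c, (x,y)l *)
  | MNil
  | MCons mexp mexp               (* list, new last element *)
  | MElList mexp mexp mexp        (* s, c, (x,y,z)l *)
  | MInl mexp
  | MInr mexp
  | MElPlus mexp mexp mexp        (* w, (x)c, (y)d *)
  | MPair mexp mexp
  | MElSigma mexp mexp            (* d, (x,y)m *)
  | MLam mexp                     (* (x)b *)
  | MAp mexp mexp
  | MElFalsum mexp
  | MAndPair mexp mexp
  | MPr1 mexp
  | MPr2 mexp
  | MOrInl mexp
  | MOrInr mexp
  | MElOr mexp mexp mexp          (* w, (x)c, (y)d *)
  | MExPair mexp mexp
  | MElEx mexp mexp               (* d, (x,y)m *)
  | MRefl mexp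
  | MElId mexp mexp               (* p, (x)c *)
  | MRf mexp mexp
  | MTr mexp mexp mexp
  | MInd mexp mexp mexp           (* m, (x,w)q1, (x,h,k,f)q2 *)
  | MAx1 mexp mexp
  | MAx2 mexp mexp mexp
  | MAx3 mexp mexp mexp mexp      (* a, m, (x,z)q1, (x,j,z)q2 *)
  | MAc                           (* the proof-term postulated by AC *)
  | MCt                           (* the proof-term postulated by CT *)

definition upr :: "nat \<Rightarrow> (nat \<Rightarrow> nat) \<Rightarrow> nat \<Rightarrow> nat" where
  "upr k \<rho> i = (if i < k then i else \<rho> (i - k) + k)"

primrec mren :: "(nat \<Rightarrow> nat) \<Rightarrow> mexp \<Rightarrow> mexp" where
  "mren \<rho> (MVar i) = MVar (\<rho> i)"
| "mren \<rho> MN0 = MN0"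
| "mren \<rho> MN1 = MN1"
| "mren \<rho> MNat = MNat"
| "mren \<rho> (MList a) = MList (mren \<rho> a)"
| "mren \<rho> (MPlus a b) = MPlus (mren \<rho> a) (mren \<rho> b)"
| "mren \<rho> (MSigma a b) = MSigma (mren \<rho> a) (mren (upr 1 \<rho>) b)"
| "mren \<rho> (MPi a b) = MPi (mren \<rho> a) (mren (upr 1 \<rho>) b)"
| "mren \<rho> MFalsum = MFalsum"
| "mren \<rho> (MAnd a b) = MAnd (mren \<rho> a) (mren \<rho> b)"
| "mren \<rho> (MOr a b) = MOr (mren \<rho> a) (mren \<rho> b)"
| "mren \<rho> (MImp a b) = MImp (mren \<rho> a) (mren \<rho> b)"
| "mren \<rho> (MAll a b) = MAll (mren \<rho> a) (mren (upr 1 \<rho>) b)"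
| "mren \<rho> (MEx a b) = MEx (mren \<rho> a) (mren (upr 1 \<rho>) b)"
| "mren \<rho> (MId a b c) = MId (mren \<rho> a) (mren \<rho> b) (mren \<rho> c)"
| "mren \<rho> MPropS = MPropS"
| "mren \<rho> (MCov a b c d e) = MCov (mren \<rho> a) (mren (upr 1 \<rho>) b) (mren (upr 2 \<rho>) c) (mren \<rho> d) (mren \<rho> e)"
| "mren \<rho> (MPos a b c d e) = MPos (mren \<rho> a) (mren (upr 1 \<rho>) b) (mren (upr 2 \<rho>) c) (mren \<rho> d) (mren \<rho> e)"
| "mren \<rho> (MEl0 a) = MEl0 (mren \<rho> a)"
| "mren \<rho> MStar = MStar"
| "mren \<rho> (MEl1 a b) = MEl1 (mren \<rho> a) (mren \<rho> b)"
| "mren \<rho> MZero = MZero"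
| "mren \<rho> (MSuc a) = MSuc (mren \<rho> a)"
| "mren \<rho> (MElN a b c) = MElN (mren \<rho> a) (mren \<rho> b) (mren (upr 2 \<rho>) c)"
| "mren \<rho> MNil = MNil"
| "mren \<rho> (MCons a b) = MCons (mren \<rho> a) (mren \<rho> b)"
| "mren \<rho> (MElList a b c) = MElList (mren \<rho> a) (mren \<rho> b) (mren (upr 3 \<rho>) c)"
| "mren \<rho> (MInl a) = MInl (mren \<rho> a)"
| "mren \<rho> (MInr a) = MInr (mren \<rho> a)"
| "mren \<rho> (MElPlus a b c) = MElPlus (mren \<rho> a) (mren (upr 1 \<rho>) b) (mren (upr 1 \<rho>) c)"
| "mren \<rho> (MPair a b) = MPair (mren \<rho> a) (mren \<rho> b)"
| "mren \<rho> (MElSigma a b) = MElSigma (mren \<rho> a) (mren (upr 2 \<rho>) b)"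
| "mren \<rho> (MLam a) = MLam (mren (upr 1 \<rho>) a)"
| "mren \<rho> (MAp a b) = MAp (mren \<rho> a) (mren \<rho> b)"
| "mren \<rho> (MElFalsum a) = MElFalsum (mren \<rho> a)"
| "mren \<rho> (MAndPair a b) = MAndPair (mren \<rho> a) (mren \<rho> b)"
| "mren \<rho> (MPr1 a) = MPr1 (mren \<rho> a)"
| "mren \<rho> (MPr2 a) = MPr2 (mren \<rho> a)"
| "mren \<rho> (MOrInl a) = MOrInl (mren \<rho> a)"
| "mren \<rho> (MOrInr a) = MOrInr (mren \<rho> a)"
| "mren \<rho> (MElOr a b c) = MElOr (mren \<rho> a) (mren (upr 1 \<rho>) b) (mren (upr 1 \<rho>) c)"
| "mren \<rho> (MExPair a b) = MExPair (mren \<rho> a) (mren \<rho> b)"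
| "mren \<rho> (MElEx a b) = MElEx (mren \<rho> a) (mren (upr 2 \<rho>) b)"
| "mren \<rho> (MRefl a) = MRefl (mren \<rho> a)"
| "mren \<rho> (MElId a b) = MElId (mren \<rho> a) (mren (upr 1 \<rho>) b)"
| "mren \<rho> (MRf a b) = MRf (mren \<rho> a) (mren \<rho> b)"
| "mren \<rho> (MTr a b c) = MTr (mren \<rho> a) (mren \<rho> b) (mren \<rho> c)"
| "mren \<rho> (MInd a b c) = MInd (mren \<rho> a) (mren (upr 2 \<rho>) b) (mren (upr 4 \<rho>) c)"
| "mren \<rho> (MAx1 a b) = MAx1 (mren \<rho> a) (mren \<rho> b)"
| "mren \<rho> (MAx2 a b c) = MAx2 (mren \<rho> a) (mren \<rho> b) (mren \<rho> c)"
| "mren \<rho> (MAx3 a b c d) = MAx3 (mren \<rho> a) (mren \<rho> b) (mren (upr 2 \<rho>) c) (mren (upr 3 \<rho>) d)"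
| "mren \<rho> MAc = MAc"
| "mren \<rho> MCt = MCt"

text \<open>\<open>mlift k n e\<close> inserts \<open>n\<close> fresh variables beneath the \<open>k\<close> innermost ones.\<close>

definition mlift :: "nat \<Rightarrow> nat \<Rightarrow> mexp \<Rightarrow> mexp" where
  "mlift k n = mren (upr k (\<lambda>i. i + n))"

definition mups :: "nat \<Rightarrow> (nat \<Rightarrow> mexp) \<Rightarrow> nat \<Rightarrow> mexp" where
  "mups k \<sigma> i = (if i < k then MVar i else mlift 0 k (\<sigma> (i - k)))"

primrec msub :: "(nat \<Rightarrow> mexp) \<Rightarrow> mexp \<Rightarrow> mexp" where
  "msub \<sigma> (MVar i) = \<sigma> i"
| "msub \<sigma> MN0 = MN0"
| "msub \<sigma> MN1 = MN1"
| "msub \<sigma> MNat = MNat"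
| "msub \<sigma> (MList a) = MList (msub \<sigma> a)"
| "msub \<sigma> (MPlus a b) = MPlus (msub \<sigma> a) (msub \<sigma> b)"
| "msub \<sigma> (MSigma a b) = MSigma (msub \<sigma> a) (msub (mups 1 \<sigma>) b)"
| "msub \<sigma> (MPi a b) = MPi (msub \<sigma> a) (msub (mups 1 \<sigma>) b)"
| "msub \<sigma> MFalsum = MFalsum"
| "msub \<sigma> (MAnd a b) = MAnd (msub \<sigma> a) (msub \<sigma> b)"
| "msub \<sigma> (MOr a b) = MOr (msub \<sigma> a) (msub \<sigma> b)"
| "msub \<sigma> (MImp a b) = MImp (msub \<sigma> a) (msub \<sigma> b)"
| "msub \<sigma> (MAll a b) = MAll (msub \<sigma> a) (msub (mups 1 \<sigma>) b)"
| "msub \<sigma> (MEx a b) = MEx (msub \<sigma> a) (msub (mups 1 \<sigma>) b)"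
| "msub \<sigma> (MId a b c) = MId (msub \<sigma> a) (msub \<sigma> b) (msub \<sigma> c)"
| "msub \<sigma> MPropS = MPropS"
| "msub \<sigma> (MCov a b c d e) = MCov (msub \<sigma> a) (msub (mups 1 \<sigma>) b) (msub (mups 2 \<sigma>) c) (msub \<sigma> d) (msub \<sigma> e)"
| "msub \<sigma> (MPos a b c d e) = MPos (msub \<sigma> a) (msub (mups 1 \<sigma>) b) (msub (mups 2 \<sigma>) c) (msub \<sigma> d) (msub \<sigma> e)"
| "msub \<sigma> (MEl0 a) = MEl0 (msub \<sigma> a)"
| "msub \<sigma> MStar = MStar"
| "msub \<sigma> (MEl1 a b) = MEl1 (msub \<sigma> a) (msub \<sigma> b)"
| "msub \<sigma> MZero = MZero"
| "msub \<sigma> (MSuc a) = MSuc (msub \<sigma> a)"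
| "msub \<sigma> (MElN a b c) = MElN (msub \<sigma> a) (msub \<sigma> b) (msub (mups 2 \<sigma>) c)"
| "msub \<sigma> MNil = MNil"
| "msub \<sigma> (MCons a b) = MCons (msub \<sigma> a) (msub \<sigma> b)"
| "msub \<sigma> (MElList a b c) = MElList (msub \<sigma> a) (msub \<sigma> b) (msub (mups 3 \<sigma>) c)"
| "msub \<sigma> (MInl a) = MInl (msub \<sigma> a)"
| "msub \<sigma> (MInr a) = MInr (msub \<sigma> a)"
| "msub \<sigma> (MElPlus a b c) = MElPlus (msub \<sigma> a) (msub (mups 1 \<sigma>) b) (msub (mups 1 \<sigma>) c)"
| "msub \<sigma> (MPair a b) = MPair (msub \<sigma> a) (msub \<sigma> b)"
| "msub \<sigma> (MElSigma a b) = MElSigma (msub \<sigma> a) (msub (mups 2 \<sigma>) b)"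
| "msub \<sigma> (MLam a) = MLam (msub (mups 1 \<sigma>) a)"
| "msub \<sigma> (MAp a b) = MAp (msub \<sigma> a) (msub \<sigma> b)"
| "msub \<sigma> (MElFalsum a) = MElFalsum (msub \<sigma> a)"
| "msub \<sigma> (MAndPair a b) = MAndPair (msub \<sigma> a) (msub \<sigma> b)"
| "msub \<sigma> (MPr1 a) = MPr1 (msub \<sigma> a)"
| "msub \<sigma> (MPr2 a) = MPr2 (msub \<sigma> a)"
| "msub \<sigma> (MOrInl a) = MOrInl (msub \<sigma> a)"
| "msub \<sigma> (MOrInr a) = MOrInr (msub \<sigma> a)"
| "msub \<sigma> (MElOr a b c) = MElOr (msub \<sigma> a) (msub (mups 1 \<sigma>) b) (msub (mups 1 \<sigma>) c)"
| "msub \<sigma> (MExPair a b) = MExPair (msub \<sigma> a) (msub \<sigma> b)"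
| "msub \<sigma> (MElEx a b) = MElEx (msub \<sigma> a) (msub (mups 2 \<sigma>) b)"
| "msub \<sigma> (MRefl a) = MRefl (msub \<sigma> a)"
| "msub \<sigma> (MElId a b) = MElId (msub \<sigma> a) (msub (mups 1 \<sigma>) b)"
| "msub \<sigma> (MRf a b) = MRf (msub \<sigma> a) (msub \<sigma> b)"
| "msub \<sigma> (MTr a b c) = MTr (msub \<sigma> a) (msub \<sigma> b) (msub \<sigma> c)"
| "msub \<sigma> (MInd a b c) = MInd (msub \<sigma> a) (msub (mups 2 \<sigma>) b) (msub (mups 4 \<sigma>) c)"
| "msub \<sigma> (MAx1 a b) = MAx1 (msub \<sigma> a) (msub \<sigma> b)"
| "msub \<sigma> (MAx2 a b c) = MAx2 (msub \<sigma> a) (msub \<sigma> b) (msub \<sigma> c)"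
| "msub \<sigma> (MAx3 a b c d) = MAx3 (msub \<sigma> a) (msub \<sigma> b) (msub (mups 2 \<sigma>) c) (msub (mups 3 \<sigma>) d)"
| "msub \<sigma> MAc = MAc"
| "msub \<sigma> MCt = MCt"

text \<open>
  For \<open>e\<close> over \<open>\<Gamma>, x\<^sub>1, \<dots>, x\<^sub>k\<close> and \<open>a\<^sub>1, \<dots>, a\<^sub>k\<close> over an extension of \<open>\<Gamma>\<close> by \<open>n\<close> variables,
  \<open>minst n e [a\<^sub>1, \<dots>, a\<^sub>k]\<close> is \<open>e(a\<^sub>1, \<dots>, a\<^sub>k)\<close> over that extension.
\<close>

definition minst :: "nat \<Rightarrow> mexp \<Rightarrow> mexp list \<Rightarrow> mexp" where
  "minst n e as =
     msub (\<lambda>i. if i < length as then rev as ! i else MVar (i - length as + n)) e"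

text \<open>Contexts are lists with the most recent assumption first; \<open>mvty \<Gamma> i\<close> is the type of
  variable \<open>i\<close>, over the whole of \<open>\<Gamma>\<close>.\<close>

definition mvty :: "mexp list \<Rightarrow> nat \<Rightarrow> mexp" where
  "mvty \<Gamma> i = mlift 0 (Suc i) (\<Gamma> ! i)"

text \<open>
  The term computing a primitive recursive function, by iterated elimination of \<open>MNat\<close>
  (its value on \<open>RMin\<close> is irrelevant).
\<close>

fun mpr :: "recf \<Rightarrow> mexp list \<Rightarrow> mexp" where
  "mpr RZero as = MZero"
| "mpr RSucc as = MSuc (as ! 0)"
| "mpr (RProj i) as = as ! i"
| "mpr (RComp f gs) as = mpr f (map (\<lambda>g. mpr g as) gs)"
| "mpr (RPrec g h) as =
     MElN (as ! 0) (mpr g (tl as)) (mpr h ([MVar 1, MVar 0] @ map (mlift 0 2) (tl as)))"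
| "mpr (RMin f) as = MZero"

text \<open>Variables 3, 2, 1, 0 are \<open>f\<close>, \<open>e\<close>, \<open>x\<close>, \<open>z\<close>.\<close>

definition mCT :: "recf \<Rightarrow> recf \<Rightarrow> mexp" where
  "mCT t u =
     MAll (MPi MNat MNat) (MEx MNat (MAll MNat (MEx MNat
       (MAnd (MId MNat (mpr t [MVar 2, MVar 1, MVar 0]) (MSuc MZero))
             (MId MNat (MAp (MVar 3) (MVar 1)) (mpr u [MVar 0]))))))"

text \<open>\<open>R\<close> lives over \<open>\<Gamma>, x \<in> A, y \<in> B\<close>; in the conclusion \<open>f\<close> and \<open>x\<close> are variables 1 and 0.\<close>

definition mAC :: "mexp \<Rightarrow> mexp \<Rightarrow> mexp \<Rightarrow> mexp" where
  "mAC A B R =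
     MImp (MAll A (MEx B R))
          (MEx (MPi A B) (MAll (mlift 0 1 A) (minst 2 R [MVar 0, MAp (MVar 1) (MVar 0)])))"

datatype kind = KCol | KSet | KProp | KProps

text \<open>The kind of types over which propositions of a given kind may quantify.\<close>

fun dom_kind :: "kind \<Rightarrow> kind" where
  "dom_kind KProps = KSet"
| "dom_kind _ = KCol"

datatype mjudg =
    MCtx "mexp list"
  | MTy "mexp list" kind mexp
  | MTyEq "mexp list" kind mexp mexp
  | MTm "mexp list" mexp mexp           (* \<Gamma>, a, A: a is an element of A *)
  | MTmEq "mexp list" mexp mexp mexp    (* \<Gamma>, a, b, A *)

abbreviation m_subst :: "(mjudg \<Rightarrow> bool) \<Rightarrow> mexp list \<Rightarrow> (nat \<Rightarrow> mexp) \<Rightarrow> mexp list \<Rightarrow> bool" where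
  "m_subst D \<Gamma> \<sigma> \<Delta> \<equiv> D (MCtx \<Gamma>) \<and> D (MCtx \<Delta>)
     \<and> (\<forall>i<length \<Delta>. D (MTm \<Gamma> (\<sigma> i) (msub \<sigma> (mvty \<Delta> i))))"

abbreviation m_subst_eq ::
    "(mjudg \<Rightarrow> bool) \<Rightarrow> mexp list \<Rightarrow> (nat \<Rightarrow> mexp) \<Rightarrow> (nat \<Rightarrow> mexp) \<Rightarrow> mexp list \<Rightarrow> bool" where
  "m_subst_eq D \<Gamma> \<sigma> \<tau> \<Delta> \<equiv> m_subst D \<Gamma> \<sigma> \<Delta> \<and> m_subst D \<Gamma> \<tau> \<Delta>
     \<and> (\<forall>i<length \<Delta>. D (MTmEq \<Gamma> (\<sigma> i) (\<tau> i) (msub \<sigma> (mvty \<Delta> i))))"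

text \<open>An axiom set over \<open>\<Gamma>\<close>, together with \<open>V \<in> A \<rightarrow> prop_s\<close>.\<close>

abbreviation m_axset ::
    "(mjudg \<Rightarrow> bool) \<Rightarrow> mexp list \<Rightarrow> mexp \<Rightarrow> mexp \<Rightarrow> mexp \<Rightarrow> mexp \<Rightarrow> bool" where
  "m_axset D \<Gamma> A I C V \<equiv> D (MTy \<Gamma> KSet A) \<and> D (MTy (A # \<Gamma>) KSet I)
     \<and> D (MTm (I # A # \<Gamma>) C (MPi (mlift 0 2 A) MPropS)) \<and> D (MTm \<Gamma> V (MPi A MPropS))"

text \<open>The families \<open>x \<triangleleft> V\<close> and \<open>x \<ltimes> V\<close> over \<open>\<Gamma>, x \<in> A\<close>.\<close>

definition mcov_fam :: "mexp \<Rightarrow> mexp \<Rightarrow> mexp \<Rightarrow> mexp \<Rightarrow> mexp" where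
  "mcov_fam A I C V = MCov (mlift 0 1 A) (mlift 1 1 I) (mlift 2 1 C) (mlift 0 1 V) (MVar 0)"

definition mpos_fam :: "mexp \<Rightarrow> mexp \<Rightarrow> mexp \<Rightarrow> mexp \<Rightarrow> mexp" where
  "mpos_fam A I C V = MPos (mlift 0 1 A) (mlift 1 1 I) (mlift 2 1 C) (mlift 0 1 V) (MVar 0)"

text \<open>
  \<open>\<forall>z \<in> A. (z \<epsilon> C(x,j) \<rightarrow> F(z))\<close> over an extension of \<open>\<Gamma>\<close> by \<open>n\<close> variables, where \<open>F\<close> is a family
  over \<open>\<Gamma>, z \<in> A\<close>.
\<close>

definition mall_in :: "nat \<Rightarrow> mexp \<Rightarrow> mexp \<Rightarrow> mexp \<Rightarrow> mexp \<Rightarrow> mexp \<Rightarrow> mexp" where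
  "mall_in n A C F x j =
     MAll (mlift 0 n A)
       (MImp (MAp (minst (n + 1) C [mlift 0 1 x, mlift 0 1 j]) (MVar 0)) (minst (n + 1) F [MVar 0]))"

text \<open>
  Rules carry their presuppositions as explicit premises where convenient.  Types satisfy
  the usual congruence rules, but equality of terms (hence of elements of \<open>prop_s\<close>) is preserved
  by term formers only through replacement; so equality in \<open>prop_s\<close> yields equality of types but
  not conversely.  For \<open>\<triangleleft>\<close> and \<open>\<ltimes>\<close>, in both theories, there is only replacement: in \<open>MLtt_cind\<close>
  they depend on the codes of \<open>A\<close> and \<open>I\<close>, and distinct codes may decode to equal types.  The
  substitution \<open>\<sigma>\<close> may be a renaming, so the substitution rules include weakening.
\<close>

inductive mTT_cind_AC_CT :: "recf \<Rightarrow> recf \<Rightarrow> mjudg \<Rightarrow> bool" (\<open>\<turnstile>\<^sub>m\<close>)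
  for t u :: recf where
  m_ctx_nil: "\<turnstile>\<^sub>m t u (MCtx [])"
| m_ctx_cons: "\<turnstile>\<^sub>m t u (MCtx \<Gamma>) \<Longrightarrow> \<turnstile>\<^sub>m t u (MTy \<Gamma> KCol A) \<Longrightarrow> \<turnstile>\<^sub>m t u (MCtx (A # \<Gamma>))"
| m_var: "\<turnstile>\<^sub>m t u (MCtx \<Gamma>) \<Longrightarrow> i < length \<Gamma> \<Longrightarrow> \<turnstile>\<^sub>m t u (MTm \<Gamma> (MVar i) (mvty \<Gamma> i))"

| m_ty_sub: "m_subst (\<turnstile>\<^sub>m t u) \<Gamma> \<sigma> \<Delta> \<Longrightarrow> \<turnstile>\<^sub>m t u (MTy \<Delta> k A) \<Longrightarrow> \<turnstile>\<^sub>m t u (MTy \<Gamma> k (msub \<sigma> A))"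
| m_tyeq_sub: "m_subst (\<turnstile>\<^sub>m t u) \<Gamma> \<sigma> \<Delta> \<Longrightarrow> \<turnstile>\<^sub>m t u (MTyEq \<Delta> k A B) \<Longrightarrow> \<turnstile>\<^sub>m t u (MTyEq \<Gamma> k (msub \<sigma> A) (msub \<sigma> B))"
| m_tm_sub: "m_subst (\<turnstile>\<^sub>m t u) \<Gamma> \<sigma> \<Delta> \<Longrightarrow> \<turnstile>\<^sub>m t u (MTm \<Delta> a A) \<Longrightarrow> \<turnstile>\<^sub>m t u (MTm \<Gamma> (msub \<sigma> a) (msub \<sigma> A))"
| m_tmeq_sub: "m_subst (\<turnstile>\<^sub>m t u) \<Gamma> \<sigma> \<Delta> \<Longrightarrow> \<turnstile>\<^sub>m t u (MTmEq \<Delta> a b A)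
    \<Longrightarrow> \<turnstile>\<^sub>m t u (MTmEq \<Gamma> (msub \<sigma> a) (msub \<sigma> b) (msub \<sigma> A))"
| m_ty_repl: "m_subst_eq (\<turnstile>\<^sub>m t u) \<Gamma> \<sigma> \<tau> \<Delta> \<Longrightarrow> \<turnstile>\<^sub>m t u (MTy \<Delta> k A) \<Longrightarrow> \<turnstile>\<^sub>m t u (MTyEq \<Gamma> k (msub \<sigma> A) (msub \<tau> A))"
| m_repl: "m_subst_eq (\<turnstile>\<^sub>m t u) \<Gamma> \<sigma> \<tau> \<Delta> \<Longrightarrow> \<turnstile>\<^sub>m t u (MTm \<Delta> c C)
    \<Longrightarrow> \<turnstile>\<^sub>m t u (MTmEq \<Gamma> (msub \<sigma> c) (msub \<tau> c) (msub \<sigma> C))"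

| m_tyeq_refl: "\<turnstile>\<^sub>m t u (MTy \<Gamma> k A) \<Longrightarrow> \<turnstile>\<^sub>m t u (MTyEq \<Gamma> k A A)"
| m_tyeq_sym: "\<turnstile>\<^sub>m t u (MTyEq \<Gamma> k A B) \<Longrightarrow> \<turnstile>\<^sub>m t u (MTyEq \<Gamma> k B A)"
| m_tyeq_trans: "\<turnstile>\<^sub>m t u (MTyEq \<Gamma> k A B) \<Longrightarrow> \<turnstile>\<^sub>m t u (MTyEq \<Gamma> k B C) \<Longrightarrow> \<turnstile>\<^sub>m t u (MTyEq \<Gamma> k A C)"
| m_tmeq_refl: "\<turnstile>\<^sub>m t u (MTm \<Gamma> a A) \<Longrightarrow> \<turnstile>\<^sub>m t u (MTmEq \<Gamma> a a A)"
| m_tmeq_sym: "\<turnstile>\<^sub>m t u (MTmEq \<Gamma> a b A) \<Longrightarrow> \<turnstile>\<^sub>m t u (MTmEq \<Gamma> b a A)"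
| m_tmeq_trans: "\<turnstile>\<^sub>m t u (MTmEq \<Gamma> a b A) \<Longrightarrow> \<turnstile>\<^sub>m t u (MTmEq \<Gamma> b c A) \<Longrightarrow> \<turnstile>\<^sub>m t u (MTmEq \<Gamma> a c A)"
| m_tm_conv: "\<turnstile>\<^sub>m t u (MTm \<Gamma> a A) \<Longrightarrow> \<turnstile>\<^sub>m t u (MTyEq \<Gamma> KCol A B) \<Longrightarrow> \<turnstile>\<^sub>m t u (MTm \<Gamma> a B)"
| m_tmeq_conv: "\<turnstile>\<^sub>m t u (MTmEq \<Gamma> a b A) \<Longrightarrow> \<turnstile>\<^sub>m t u (MTyEq \<Gamma> KCol A B) \<Longrightarrow> \<turnstile>\<^sub>m t u (MTmEq \<Gamma> a b B)"

| m_props_set: "\<turnstile>\<^sub>m t u (MTy \<Gamma> KProps A) \<Longrightarrow> \<turnstile>\<^sub>m t u (MTy \<Gamma> KSet A)"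
| m_props_prop: "\<turnstile>\<^sub>m t u (MTy \<Gamma> KProps A) \<Longrightarrow> \<turnstile>\<^sub>m t u (MTy \<Gamma> KProp A)"
| m_set_col: "\<turnstile>\<^sub>m t u (MTy \<Gamma> KSet A) \<Longrightarrow> \<turnstile>\<^sub>m t u (MTy \<Gamma> KCol A)"
| m_prop_col: "\<turnstile>\<^sub>m t u (MTy \<Gamma> KProp A) \<Longrightarrow> \<turnstile>\<^sub>m t u (MTy \<Gamma> KCol A)"
| m_props_set_eq: "\<turnstile>\<^sub>m t u (MTyEq \<Gamma> KProps A B) \<Longrightarrow> \<turnstile>\<^sub>m t u (MTyEq \<Gamma> KSet A B)"
| m_props_prop_eq: "\<turnstile>\<^sub>m t u (MTyEq \<Gamma> KProps A B) \<Longrightarrow> \<turnstile>\<^sub>m t u (MTyEq \<Gamma> KProp A B)"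
| m_set_col_eq: "\<turnstile>\<^sub>m t u (MTyEq \<Gamma> KSet A B) \<Longrightarrow> \<turnstile>\<^sub>m t u (MTyEq \<Gamma> KCol A B)"
| m_prop_col_eq: "\<turnstile>\<^sub>m t u (MTyEq \<Gamma> KProp A B) \<Longrightarrow> \<turnstile>\<^sub>m t u (MTyEq \<Gamma> KCol A B)"

| m_propS_F: "\<turnstile>\<^sub>m t u (MCtx \<Gamma>) \<Longrightarrow> \<turnstile>\<^sub>m t u (MTy \<Gamma> KCol MPropS)"
| m_propS_I: "\<turnstile>\<^sub>m t u (MTy \<Gamma> KProps A) \<Longrightarrow> \<turnstile>\<^sub>m t u (MTm \<Gamma> A MPropS)"
| m_propS_E: "\<turnstile>\<^sub>m t u (MTm \<Gamma> A MPropS) \<Longrightarrow> \<turnstile>\<^sub>m t u (MTy \<Gamma> KProps A)"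
| m_propS_E_eq: "\<turnstile>\<^sub>m t u (MTy \<Gamma> KProps A) \<Longrightarrow> \<turnstile>\<^sub>m t u (MTy \<Gamma> KProps B) \<Longrightarrow> \<turnstile>\<^sub>m t u (MTmEq \<Gamma> A B MPropS)
    \<Longrightarrow> \<turnstile>\<^sub>m t u (MTyEq \<Gamma> KProps A B)"

| m_N0_F: "\<turnstile>\<^sub>m t u (MCtx \<Gamma>) \<Longrightarrow> \<turnstile>\<^sub>m t u (MTy \<Gamma> KSet MN0)"
| m_N0_E: "\<turnstile>\<^sub>m t u (MTy (MN0 # \<Gamma>) KCol M) \<Longrightarrow> \<turnstile>\<^sub>m t u (MTm \<Gamma> c MN0) \<Longrightarrow> \<turnstile>\<^sub>m t u (MTm \<Gamma> (MEl0 c) (minst 0 M [c]))"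

| m_N1_F: "\<turnstile>\<^sub>m t u (MCtx \<Gamma>) \<Longrightarrow> \<turnstile>\<^sub>m t u (MTy \<Gamma> KSet MN1)"
| m_N1_I: "\<turnstile>\<^sub>m t u (MCtx \<Gamma>) \<Longrightarrow> \<turnstile>\<^sub>m t u (MTm \<Gamma> MStar MN1)"
| m_N1_E: "\<turnstile>\<^sub>m t u (MTy (MN1 # \<Gamma>) KCol M) \<Longrightarrow> \<turnstile>\<^sub>m t u (MTm \<Gamma> a MN1) \<Longrightarrow> \<turnstile>\<^sub>m t u (MTm \<Gamma> c (minst 0 M [MStar]))
    \<Longrightarrow> \<turnstile>\<^sub>m t u (MTm \<Gamma> (MEl1 a c) (minst 0 M [a]))"
| m_N1_C: "\<turnstile>\<^sub>m t u (MTy (MN1 # \<Gamma>) KCol M) \<Longrightarrow> \<turnstile>\<^sub>m t u (MTm \<Gamma> c (minst 0 M [MStar]))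
    \<Longrightarrow> \<turnstile>\<^sub>m t u (MTmEq \<Gamma> (MEl1 MStar c) c (minst 0 M [MStar]))"

| m_N_F: "\<turnstile>\<^sub>m t u (MCtx \<Gamma>) \<Longrightarrow> \<turnstile>\<^sub>m t u (MTy \<Gamma> KSet MNat)"
| m_N_I1: "\<turnstile>\<^sub>m t u (MCtx \<Gamma>) \<Longrightarrow> \<turnstile>\<^sub>m t u (MTm \<Gamma> MZero MNat)"
| m_N_I2: "\<turnstile>\<^sub>m t u (MTm \<Gamma> a MNat) \<Longrightarrow> \<turnstile>\<^sub>m t u (MTm \<Gamma> (MSuc a) MNat)"
| m_N_E: "\<turnstile>\<^sub>m t u (MTy (MNat # \<Gamma>) KCol M) \<Longrightarrow> \<turnstile>\<^sub>m t u (MTm \<Gamma> a MNat) \<Longrightarrow> \<turnstile>\<^sub>m t u (MTm \<Gamma> c (minst 0 M [MZero]))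
    \<Longrightarrow> \<turnstile>\<^sub>m t u (MTm (M # MNat # \<Gamma>) l (minst 2 M [MSuc (MVar 1)]))
    \<Longrightarrow> \<turnstile>\<^sub>m t u (MTm \<Gamma> (MElN a c l) (minst 0 M [a]))"
| m_N_C1: "\<turnstile>\<^sub>m t u (MTy (MNat # \<Gamma>) KCol M) \<Longrightarrow> \<turnstile>\<^sub>m t u (MTm \<Gamma> c (minst 0 M [MZero]))
    \<Longrightarrow> \<turnstile>\<^sub>m t u (MTm (M # MNat # \<Gamma>) l (minst 2 M [MSuc (MVar 1)]))
    \<Longrightarrow> \<turnstile>\<^sub>m t u (MTmEq \<Gamma> (MElN MZero c l) c (minst 0 M [MZero]))"
| m_N_C2: "\<turnstile>\<^sub>m t u (MTy (MNat # \<Gamma>) KCol M) \<Longrightarrow> \<turnstile>\<^sub>m t u (MTm \<Gamma> a MNat) \<Longrightarrow> \<turnstile>\<^sub>m t u (MTm \<Gamma> c (minst 0 M [MZero]))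
    \<Longrightarrow> \<turnstile>\<^sub>m t u (MTm (M # MNat # \<Gamma>) l (minst 2 M [MSuc (MVar 1)]))
    \<Longrightarrow> \<turnstile>\<^sub>m t u (MTmEq \<Gamma> (MElN (MSuc a) c l) (minst 0 l [a, MElN a c l]) (minst 0 M [MSuc a]))"

| m_List_F: "\<turnstile>\<^sub>m t u (MTy \<Gamma> KSet A) \<Longrightarrow> \<turnstile>\<^sub>m t u (MTy \<Gamma> KSet (MList A))"
| m_List_F_eq: "\<turnstile>\<^sub>m t u (MTyEq \<Gamma> KSet A A') \<Longrightarrow> \<turnstile>\<^sub>m t u (MTyEq \<Gamma> KSet (MList A) (MList A'))"
| m_List_I1: "\<turnstile>\<^sub>m t u (MTy \<Gamma> KSet A) \<Longrightarrow> \<turnstile>\<^sub>m t u (MTm \<Gamma> MNil (MList A))"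
| m_List_I2: "\<turnstile>\<^sub>m t u (MTy \<Gamma> KSet A) \<Longrightarrow> \<turnstile>\<^sub>m t u (MTm \<Gamma> s (MList A)) \<Longrightarrow> \<turnstile>\<^sub>m t u (MTm \<Gamma> a A)
    \<Longrightarrow> \<turnstile>\<^sub>m t u (MTm \<Gamma> (MCons s a) (MList A))"
| m_List_E: "\<turnstile>\<^sub>m t u (MTy \<Gamma> KSet A) \<Longrightarrow> \<turnstile>\<^sub>m t u (MTy (MList A # \<Gamma>) KCol M) \<Longrightarrow> \<turnstile>\<^sub>m t u (MTm \<Gamma> s (MList A))
    \<Longrightarrow> \<turnstile>\<^sub>m t u (MTm \<Gamma> c (minst 0 M [MNil]))
    \<Longrightarrow> \<turnstile>\<^sub>m t u (MTm (minst 2 M [MVar 1] # mlift 0 1 A # MList A # \<Gamma>) l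
             (minst 3 M [MCons (MVar 2) (MVar 1)]))
    \<Longrightarrow> \<turnstile>\<^sub>m t u (MTm \<Gamma> (MElList s c l) (minst 0 M [s]))"
| m_List_C1: "\<turnstile>\<^sub>m t u (MTy \<Gamma> KSet A) \<Longrightarrow> \<turnstile>\<^sub>m t u (MTy (MList A # \<Gamma>) KCol M)
    \<Longrightarrow> \<turnstile>\<^sub>m t u (MTm \<Gamma> c (minst 0 M [MNil]))
    \<Longrightarrow> \<turnstile>\<^sub>m t u (MTm (minst 2 M [MVar 1] # mlift 0 1 A # MList A # \<Gamma>) l
             (minst 3 M [MCons (MVar 2) (MVar 1)]))
    \<Longrightarrow> \<turnstile>\<^sub>m t u (MTmEq \<Gamma> (MElList MNil c l) c (minst 0 M [MNil]))"
| m_List_C2: "\<turnstile>\<^sub>m t u (MTy \<Gamma> KSet A) \<Longrightarrow> \<turnstile>\<^sub>m t u (MTy (MList A # \<Gamma>) KCol M) \<Longrightarrow> \<turnstile>\<^sub>m t u (MTm \<Gamma> s (MList A))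
    \<Longrightarrow> \<turnstile>\<^sub>m t u (MTm \<Gamma> a A) \<Longrightarrow> \<turnstile>\<^sub>m t u (MTm \<Gamma> c (minst 0 M [MNil]))
    \<Longrightarrow> \<turnstile>\<^sub>m t u (MTm (minst 2 M [MVar 1] # mlift 0 1 A # MList A # \<Gamma>) l
             (minst 3 M [MCons (MVar 2) (MVar 1)]))
    \<Longrightarrow> \<turnstile>\<^sub>m t u (MTmEq \<Gamma> (MElList (MCons s a) c l) (minst 0 l [s, a, MElList s c l])
             (minst 0 M [MCons s a]))"

| m_Plus_F: "\<turnstile>\<^sub>m t u (MTy \<Gamma> KSet A) \<Longrightarrow> \<turnstile>\<^sub>m t u (MTy \<Gamma> KSet B) \<Longrightarrow> \<turnstile>\<^sub>m t u (MTy \<Gamma> KSet (MPlus A B))"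
| m_Plus_F_eq: "\<turnstile>\<^sub>m t u (MTyEq \<Gamma> KSet A A') \<Longrightarrow> \<turnstile>\<^sub>m t u (MTyEq \<Gamma> KSet B B')
    \<Longrightarrow> \<turnstile>\<^sub>m t u (MTyEq \<Gamma> KSet (MPlus A B) (MPlus A' B'))"
| m_Plus_I1: "\<turnstile>\<^sub>m t u (MTy \<Gamma> KSet A) \<Longrightarrow> \<turnstile>\<^sub>m t u (MTy \<Gamma> KSet B) \<Longrightarrow> \<turnstile>\<^sub>m t u (MTm \<Gamma> a A)
    \<Longrightarrow> \<turnstile>\<^sub>m t u (MTm \<Gamma> (MInl a) (MPlus A B))"
| m_Plus_I2: "\<turnstile>\<^sub>m t u (MTy \<Gamma> KSet A) \<Longrightarrow> \<turnstile>\<^sub>m t u (MTy \<Gamma> KSet B) \<Longrightarrow> \<turnstile>\<^sub>m t u (MTm \<Gamma> b B)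
    \<Longrightarrow> \<turnstile>\<^sub>m t u (MTm \<Gamma> (MInr b) (MPlus A B))"
| m_Plus_E: "\<turnstile>\<^sub>m t u (MTy \<Gamma> KSet A) \<Longrightarrow> \<turnstile>\<^sub>m t u (MTy \<Gamma> KSet B) \<Longrightarrow> \<turnstile>\<^sub>m t u (MTy (MPlus A B # \<Gamma>) KCol M)
    \<Longrightarrow> \<turnstile>\<^sub>m t u (MTm \<Gamma> w (MPlus A B))
    \<Longrightarrow> \<turnstile>\<^sub>m t u (MTm (A # \<Gamma>) c (minst 1 M [MInl (MVar 0)])) \<Longrightarrow> \<turnstile>\<^sub>m t u (MTm (B # \<Gamma>) d (minst 1 M [MInr (MVar 0)]))
    \<Longrightarrow> \<turnstile>\<^sub>m t u (MTm \<Gamma> (MElPlus w c d) (minst 0 M [w]))"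
| m_Plus_C1: "\<turnstile>\<^sub>m t u (MTy \<Gamma> KSet A) \<Longrightarrow> \<turnstile>\<^sub>m t u (MTy \<Gamma> KSet B) \<Longrightarrow> \<turnstile>\<^sub>m t u (MTy (MPlus A B # \<Gamma>) KCol M)
    \<Longrightarrow> \<turnstile>\<^sub>m t u (MTm \<Gamma> a A)
    \<Longrightarrow> \<turnstile>\<^sub>m t u (MTm (A # \<Gamma>) c (minst 1 M [MInl (MVar 0)])) \<Longrightarrow> \<turnstile>\<^sub>m t u (MTm (B # \<Gamma>) d (minst 1 M [MInr (MVar 0)]))
    \<Longrightarrow> \<turnstile>\<^sub>m t u (MTmEq \<Gamma> (MElPlus (MInl a) c d) (minst 0 c [a]) (minst 0 M [MInl a]))"
| m_Plus_C2: "\<turnstile>\<^sub>m t u (MTy \<Gamma> KSet A) \<Longrightarrow> \<turnstile>\<^sub>m t u (MTy \<Gamma> KSet B) \<Longrightarrow> \<turnstile>\<^sub>m t u (MTy (MPlus A B # \<Gamma>) KCol M)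
    \<Longrightarrow> \<turnstile>\<^sub>m t u (MTm \<Gamma> b B)
    \<Longrightarrow> \<turnstile>\<^sub>m t u (MTm (A # \<Gamma>) c (minst 1 M [MInl (MVar 0)])) \<Longrightarrow> \<turnstile>\<^sub>m t u (MTm (B # \<Gamma>) d (minst 1 M [MInr (MVar 0)]))
    \<Longrightarrow> \<turnstile>\<^sub>m t u (MTmEq \<Gamma> (MElPlus (MInr b) c d) (minst 0 d [b]) (minst 0 M [MInr b]))"

| m_Sigma_F: "k \<in> {KCol, KSet} \<Longrightarrow> \<turnstile>\<^sub>m t u (MTy \<Gamma> k A) \<Longrightarrow> \<turnstile>\<^sub>m t u (MTy (A # \<Gamma>) k B)
    \<Longrightarrow> \<turnstile>\<^sub>m t u (MTy \<Gamma> k (MSigma A B))"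
| m_Sigma_F_eq: "k \<in> {KCol, KSet} \<Longrightarrow> \<turnstile>\<^sub>m t u (MTyEq \<Gamma> k A A') \<Longrightarrow> \<turnstile>\<^sub>m t u (MTyEq (A # \<Gamma>) k B B')
    \<Longrightarrow> \<turnstile>\<^sub>m t u (MTyEq \<Gamma> k (MSigma A B) (MSigma A' B'))"
| m_Sigma_I: "\<turnstile>\<^sub>m t u (MTy \<Gamma> KCol A) \<Longrightarrow> \<turnstile>\<^sub>m t u (MTy (A # \<Gamma>) KCol B) \<Longrightarrow> \<turnstile>\<^sub>m t u (MTm \<Gamma> a A)
    \<Longrightarrow> \<turnstile>\<^sub>m t u (MTm \<Gamma> b (minst 0 B [a])) \<Longrightarrow> \<turnstile>\<^sub>m t u (MTm \<Gamma> (MPair a b) (MSigma A B))"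
| m_Sigma_E: "\<turnstile>\<^sub>m t u (MTy \<Gamma> KCol A) \<Longrightarrow> \<turnstile>\<^sub>m t u (MTy (A # \<Gamma>) KCol B) \<Longrightarrow> \<turnstile>\<^sub>m t u (MTy (MSigma A B # \<Gamma>) KCol M)
    \<Longrightarrow> \<turnstile>\<^sub>m t u (MTm \<Gamma> d (MSigma A B)) \<Longrightarrow> \<turnstile>\<^sub>m t u (MTm (B # A # \<Gamma>) m (minst 2 M [MPair (MVar 1) (MVar 0)]))
    \<Longrightarrow> \<turnstile>\<^sub>m t u (MTm \<Gamma> (MElSigma d m) (minst 0 M [d]))"
| m_Sigma_C: "\<turnstile>\<^sub>m t u (MTy \<Gamma> KCol A) \<Longrightarrow> \<turnstile>\<^sub>m t u (MTy (A # \<Gamma>) KCol B) \<Longrightarrow> \<turnstile>\<^sub>m t u (MTy (MSigma A B # \<Gamma>) KCol M)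
    \<Longrightarrow> \<turnstile>\<^sub>m t u (MTm \<Gamma> a A) \<Longrightarrow> \<turnstile>\<^sub>m t u (MTm \<Gamma> b (minst 0 B [a]))
    \<Longrightarrow> \<turnstile>\<^sub>m t u (MTm (B # A # \<Gamma>) m (minst 2 M [MPair (MVar 1) (MVar 0)]))
    \<Longrightarrow> \<turnstile>\<^sub>m t u (MTmEq \<Gamma> (MElSigma (MPair a b) m) (minst 0 m [a, b]) (minst 0 M [MPair a b]))"

| m_Pi_F: "\<turnstile>\<^sub>m t u (MTy \<Gamma> KSet A) \<Longrightarrow> \<turnstile>\<^sub>m t u (MTy (A # \<Gamma>) KSet B) \<Longrightarrow> \<turnstile>\<^sub>m t u (MTy \<Gamma> KSet (MPi A B))"
| m_Pi_F_eq: "\<turnstile>\<^sub>m t u (MTyEq \<Gamma> KSet A A') \<Longrightarrow> \<turnstile>\<^sub>m t u (MTyEq (A # \<Gamma>) KSet B B')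
    \<Longrightarrow> \<turnstile>\<^sub>m t u (MTyEq \<Gamma> KSet (MPi A B) (MPi A' B'))"
| m_Fun_F: "\<turnstile>\<^sub>m t u (MTy \<Gamma> KSet A) \<Longrightarrow> \<turnstile>\<^sub>m t u (MTy \<Gamma> KCol (MPi A MPropS))"
| m_Fun_F_eq: "\<turnstile>\<^sub>m t u (MTyEq \<Gamma> KSet A A') \<Longrightarrow> \<turnstile>\<^sub>m t u (MTyEq \<Gamma> KCol (MPi A MPropS) (MPi A' MPropS))"
| m_Pi_I: "\<turnstile>\<^sub>m t u (MTy \<Gamma> KCol (MPi A B)) \<Longrightarrow> \<turnstile>\<^sub>m t u (MTy (A # \<Gamma>) KCol B) \<Longrightarrow> \<turnstile>\<^sub>m t u (MTm (A # \<Gamma>) b B)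
    \<Longrightarrow> \<turnstile>\<^sub>m t u (MTm \<Gamma> (MLam b) (MPi A B))"
| m_Pi_E: "\<turnstile>\<^sub>m t u (MTy (A # \<Gamma>) KCol B) \<Longrightarrow> \<turnstile>\<^sub>m t u (MTm \<Gamma> f (MPi A B)) \<Longrightarrow> \<turnstile>\<^sub>m t u (MTm \<Gamma> a A)
    \<Longrightarrow> \<turnstile>\<^sub>m t u (MTm \<Gamma> (MAp f a) (minst 0 B [a]))"
| m_Pi_C: "\<turnstile>\<^sub>m t u (MTy \<Gamma> KCol (MPi A B)) \<Longrightarrow> \<turnstile>\<^sub>m t u (MTy (A # \<Gamma>) KCol B) \<Longrightarrow> \<turnstile>\<^sub>m t u (MTm (A # \<Gamma>) b B)
    \<Longrightarrow> \<turnstile>\<^sub>m t u (MTm \<Gamma> a A) \<Longrightarrow> \<turnstile>\<^sub>m t u (MTmEq \<Gamma> (MAp (MLam b) a) (minst 0 b [a]) (minst 0 B [a]))"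

| m_Falsum_F: "\<turnstile>\<^sub>m t u (MCtx \<Gamma>) \<Longrightarrow> \<turnstile>\<^sub>m t u (MTy \<Gamma> KProps MFalsum)"
| m_Falsum_E: "\<turnstile>\<^sub>m t u (MTy \<Gamma> KProp P) \<Longrightarrow> \<turnstile>\<^sub>m t u (MTm \<Gamma> c MFalsum) \<Longrightarrow> \<turnstile>\<^sub>m t u (MTm \<Gamma> (MElFalsum c) P)"

| m_And_F: "k \<in> {KProp, KProps} \<Longrightarrow> \<turnstile>\<^sub>m t u (MTy \<Gamma> k A) \<Longrightarrow> \<turnstile>\<^sub>m t u (MTy \<Gamma> k B) \<Longrightarrow> \<turnstile>\<^sub>m t u (MTy \<Gamma> k (MAnd A B))"
| m_And_F_eq: "k \<in> {KProp, KProps} \<Longrightarrow> \<turnstile>\<^sub>m t u (MTyEq \<Gamma> k A A') \<Longrightarrow> \<turnstile>\<^sub>m t u (MTyEq \<Gamma> k B B')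
    \<Longrightarrow> \<turnstile>\<^sub>m t u (MTyEq \<Gamma> k (MAnd A B) (MAnd A' B'))"
| m_And_I: "\<turnstile>\<^sub>m t u (MTy \<Gamma> KProp A) \<Longrightarrow> \<turnstile>\<^sub>m t u (MTy \<Gamma> KProp B) \<Longrightarrow> \<turnstile>\<^sub>m t u (MTm \<Gamma> a A) \<Longrightarrow> \<turnstile>\<^sub>m t u (MTm \<Gamma> b B)
    \<Longrightarrow> \<turnstile>\<^sub>m t u (MTm \<Gamma> (MAndPair a b) (MAnd A B))"
| m_And_E1: "\<turnstile>\<^sub>m t u (MTy \<Gamma> KProp A) \<Longrightarrow> \<turnstile>\<^sub>m t u (MTy \<Gamma> KProp B) \<Longrightarrow> \<turnstile>\<^sub>m t u (MTm \<Gamma> d (MAnd A B))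
    \<Longrightarrow> \<turnstile>\<^sub>m t u (MTm \<Gamma> (MPr1 d) A)"
| m_And_E2: "\<turnstile>\<^sub>m t u (MTy \<Gamma> KProp A) \<Longrightarrow> \<turnstile>\<^sub>m t u (MTy \<Gamma> KProp B) \<Longrightarrow> \<turnstile>\<^sub>m t u (MTm \<Gamma> d (MAnd A B))
    \<Longrightarrow> \<turnstile>\<^sub>m t u (MTm \<Gamma> (MPr2 d) B)"
| m_And_C1: "\<turnstile>\<^sub>m t u (MTy \<Gamma> KProp A) \<Longrightarrow> \<turnstile>\<^sub>m t u (MTy \<Gamma> KProp B) \<Longrightarrow> \<turnstile>\<^sub>m t u (MTm \<Gamma> a A) \<Longrightarrow> \<turnstile>\<^sub>m t u (MTm \<Gamma> b B)
    \<Longrightarrow> \<turnstile>\<^sub>m t u (MTmEq \<Gamma> (MPr1 (MAndPair a b)) a A)"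
| m_And_C2: "\<turnstile>\<^sub>m t u (MTy \<Gamma> KProp A) \<Longrightarrow> \<turnstile>\<^sub>m t u (MTy \<Gamma> KProp B) \<Longrightarrow> \<turnstile>\<^sub>m t u (MTm \<Gamma> a A) \<Longrightarrow> \<turnstile>\<^sub>m t u (MTm \<Gamma> b B)
    \<Longrightarrow> \<turnstile>\<^sub>m t u (MTmEq \<Gamma> (MPr2 (MAndPair a b)) b B)"

| m_Or_F: "k \<in> {KProp, KProps} \<Longrightarrow> \<turnstile>\<^sub>m t u (MTy \<Gamma> k A) \<Longrightarrow> \<turnstile>\<^sub>m t u (MTy \<Gamma> k B) \<Longrightarrow> \<turnstile>\<^sub>m t u (MTy \<Gamma> k (MOr A B))"
| m_Or_F_eq: "k \<in> {KProp, KProps} \<Longrightarrow> \<turnstile>\<^sub>m t u (MTyEq \<Gamma> k A A') \<Longrightarrow> \<turnstile>\<^sub>m t u (MTyEq \<Gamma> k B B')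
    \<Longrightarrow> \<turnstile>\<^sub>m t u (MTyEq \<Gamma> k (MOr A B) (MOr A' B'))"
| m_Or_I1: "\<turnstile>\<^sub>m t u (MTy \<Gamma> KProp A) \<Longrightarrow> \<turnstile>\<^sub>m t u (MTy \<Gamma> KProp B) \<Longrightarrow> \<turnstile>\<^sub>m t u (MTm \<Gamma> a A)
    \<Longrightarrow> \<turnstile>\<^sub>m t u (MTm \<Gamma> (MOrInl a) (MOr A B))"
| m_Or_I2: "\<turnstile>\<^sub>m t u (MTy \<Gamma> KProp A) \<Longrightarrow> \<turnstile>\<^sub>m t u (MTy \<Gamma> KProp B) \<Longrightarrow> \<turnstile>\<^sub>m t u (MTm \<Gamma> b B)
    \<Longrightarrow> \<turnstile>\<^sub>m t u (MTm \<Gamma> (MOrInr b) (MOr A B))"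
| m_Or_E: "\<turnstile>\<^sub>m t u (MTy \<Gamma> KProp A) \<Longrightarrow> \<turnstile>\<^sub>m t u (MTy \<Gamma> KProp B) \<Longrightarrow> \<turnstile>\<^sub>m t u (MTy \<Gamma> KProp P) \<Longrightarrow> \<turnstile>\<^sub>m t u (MTm \<Gamma> w (MOr A B))
    \<Longrightarrow> \<turnstile>\<^sub>m t u (MTm (A # \<Gamma>) c (mlift 0 1 P)) \<Longrightarrow> \<turnstile>\<^sub>m t u (MTm (B # \<Gamma>) d (mlift 0 1 P))
    \<Longrightarrow> \<turnstile>\<^sub>m t u (MTm \<Gamma> (MElOr w c d) P)"
| m_Or_C1: "\<turnstile>\<^sub>m t u (MTy \<Gamma> KProp A) \<Longrightarrow> \<turnstile>\<^sub>m t u (MTy \<Gamma> KProp B) \<Longrightarrow> \<turnstile>\<^sub>m t u (MTy \<Gamma> KProp P) \<Longrightarrow> \<turnstile>\<^sub>m t u (MTm \<Gamma> a A)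
    \<Longrightarrow> \<turnstile>\<^sub>m t u (MTm (A # \<Gamma>) c (mlift 0 1 P)) \<Longrightarrow> \<turnstile>\<^sub>m t u (MTm (B # \<Gamma>) d (mlift 0 1 P))
    \<Longrightarrow> \<turnstile>\<^sub>m t u (MTmEq \<Gamma> (MElOr (MOrInl a) c d) (minst 0 c [a]) P)"
| m_Or_C2: "\<turnstile>\<^sub>m t u (MTy \<Gamma> KProp A) \<Longrightarrow> \<turnstile>\<^sub>m t u (MTy \<Gamma> KProp B) \<Longrightarrow> \<turnstile>\<^sub>m t u (MTy \<Gamma> KProp P) \<Longrightarrow> \<turnstile>\<^sub>m t u (MTm \<Gamma> b B)
    \<Longrightarrow> \<turnstile>\<^sub>m t u (MTm (A # \<Gamma>) c (mlift 0 1 P)) \<Longrightarrow> \<turnstile>\<^sub>m t u (MTm (B # \<Gamma>) d (mlift 0 1 P))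
    \<Longrightarrow> \<turnstile>\<^sub>m t u (MTmEq \<Gamma> (MElOr (MOrInr b) c d) (minst 0 d [b]) P)"

| m_Imp_F: "k \<in> {KProp, KProps} \<Longrightarrow> \<turnstile>\<^sub>m t u (MTy \<Gamma> k A) \<Longrightarrow> \<turnstile>\<^sub>m t u (MTy \<Gamma> k B) \<Longrightarrow> \<turnstile>\<^sub>m t u (MTy \<Gamma> k (MImp A B))"
| m_Imp_F_eq: "k \<in> {KProp, KProps} \<Longrightarrow> \<turnstile>\<^sub>m t u (MTyEq \<Gamma> k A A') \<Longrightarrow> \<turnstile>\<^sub>m t u (MTyEq \<Gamma> k B B')
    \<Longrightarrow> \<turnstile>\<^sub>m t u (MTyEq \<Gamma> k (MImp A B) (MImp A' B'))"
| m_Imp_I: "\<turnstile>\<^sub>m t u (MTy \<Gamma> KProp A) \<Longrightarrow> \<turnstile>\<^sub>m t u (MTy \<Gamma> KProp B) \<Longrightarrow> \<turnstile>\<^sub>m t u (MTm (A # \<Gamma>) b (mlift 0 1 B))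
    \<Longrightarrow> \<turnstile>\<^sub>m t u (MTm \<Gamma> (MLam b) (MImp A B))"
| m_Imp_E: "\<turnstile>\<^sub>m t u (MTy \<Gamma> KProp A) \<Longrightarrow> \<turnstile>\<^sub>m t u (MTy \<Gamma> KProp B) \<Longrightarrow> \<turnstile>\<^sub>m t u (MTm \<Gamma> f (MImp A B)) \<Longrightarrow> \<turnstile>\<^sub>m t u (MTm \<Gamma> a A)
    \<Longrightarrow> \<turnstile>\<^sub>m t u (MTm \<Gamma> (MAp f a) B)"
| m_Imp_C: "\<turnstile>\<^sub>m t u (MTy \<Gamma> KProp A) \<Longrightarrow> \<turnstile>\<^sub>m t u (MTy \<Gamma> KProp B) \<Longrightarrow> \<turnstile>\<^sub>m t u (MTm (A # \<Gamma>) b (mlift 0 1 B))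
    \<Longrightarrow> \<turnstile>\<^sub>m t u (MTm \<Gamma> a A) \<Longrightarrow> \<turnstile>\<^sub>m t u (MTmEq \<Gamma> (MAp (MLam b) a) (minst 0 b [a]) B)"

| m_All_F: "k \<in> {KProp, KProps} \<Longrightarrow> \<turnstile>\<^sub>m t u (MTy \<Gamma> (dom_kind k) A) \<Longrightarrow> \<turnstile>\<^sub>m t u (MTy (A # \<Gamma>) k B)
    \<Longrightarrow> \<turnstile>\<^sub>m t u (MTy \<Gamma> k (MAll A B))"
| m_All_F_eq: "k \<in> {KProp, KProps} \<Longrightarrow> \<turnstile>\<^sub>m t u (MTyEq \<Gamma> (dom_kind k) A A') \<Longrightarrow> \<turnstile>\<^sub>m t u (MTyEq (A # \<Gamma>) k B B')
    \<Longrightarrow> \<turnstile>\<^sub>m t u (MTyEq \<Gamma> k (MAll A B) (MAll A' B'))"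
| m_All_I: "\<turnstile>\<^sub>m t u (MTy \<Gamma> KCol A) \<Longrightarrow> \<turnstile>\<^sub>m t u (MTy (A # \<Gamma>) KProp B) \<Longrightarrow> \<turnstile>\<^sub>m t u (MTm (A # \<Gamma>) b B)
    \<Longrightarrow> \<turnstile>\<^sub>m t u (MTm \<Gamma> (MLam b) (MAll A B))"
| m_All_E: "\<turnstile>\<^sub>m t u (MTy \<Gamma> KCol A) \<Longrightarrow> \<turnstile>\<^sub>m t u (MTy (A # \<Gamma>) KProp B) \<Longrightarrow> \<turnstile>\<^sub>m t u (MTm \<Gamma> f (MAll A B)) \<Longrightarrow> \<turnstile>\<^sub>m t u (MTm \<Gamma> a A)
    \<Longrightarrow> \<turnstile>\<^sub>m t u (MTm \<Gamma> (MAp f a) (minst 0 B [a]))"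
| m_All_C: "\<turnstile>\<^sub>m t u (MTy \<Gamma> KCol A) \<Longrightarrow> \<turnstile>\<^sub>m t u (MTy (A # \<Gamma>) KProp B) \<Longrightarrow> \<turnstile>\<^sub>m t u (MTm (A # \<Gamma>) b B)
    \<Longrightarrow> \<turnstile>\<^sub>m t u (MTm \<Gamma> a A) \<Longrightarrow> \<turnstile>\<^sub>m t u (MTmEq \<Gamma> (MAp (MLam b) a) (minst 0 b [a]) (minst 0 B [a]))"

| m_Ex_F: "k \<in> {KProp, KProps} \<Longrightarrow> \<turnstile>\<^sub>m t u (MTy \<Gamma> (dom_kind k) A) \<Longrightarrow> \<turnstile>\<^sub>m t u (MTy (A # \<Gamma>) k B)
    \<Longrightarrow> \<turnstile>\<^sub>m t u (MTy \<Gamma> k (MEx A B))"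
| m_Ex_F_eq: "k \<in> {KProp, KProps} \<Longrightarrow> \<turnstile>\<^sub>m t u (MTyEq \<Gamma> (dom_kind k) A A') \<Longrightarrow> \<turnstile>\<^sub>m t u (MTyEq (A # \<Gamma>) k B B')
    \<Longrightarrow> \<turnstile>\<^sub>m t u (MTyEq \<Gamma> k (MEx A B) (MEx A' B'))"
| m_Ex_I: "\<turnstile>\<^sub>m t u (MTy \<Gamma> KCol A) \<Longrightarrow> \<turnstile>\<^sub>m t u (MTy (A # \<Gamma>) KProp B) \<Longrightarrow> \<turnstile>\<^sub>m t u (MTm \<Gamma> a A)
    \<Longrightarrow> \<turnstile>\<^sub>m t u (MTm \<Gamma> b (minst 0 B [a])) \<Longrightarrow> \<turnstile>\<^sub>m t u (MTm \<Gamma> (MExPair a b) (MEx A B))"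
| m_Ex_E: "\<turnstile>\<^sub>m t u (MTy \<Gamma> KCol A) \<Longrightarrow> \<turnstile>\<^sub>m t u (MTy (A # \<Gamma>) KProp B) \<Longrightarrow> \<turnstile>\<^sub>m t u (MTy \<Gamma> KProp P)
    \<Longrightarrow> \<turnstile>\<^sub>m t u (MTm \<Gamma> d (MEx A B)) \<Longrightarrow> \<turnstile>\<^sub>m t u (MTm (B # A # \<Gamma>) m (mlift 0 2 P))
    \<Longrightarrow> \<turnstile>\<^sub>m t u (MTm \<Gamma> (MElEx d m) P)"
| m_Ex_C: "\<turnstile>\<^sub>m t u (MTy \<Gamma> KCol A) \<Longrightarrow> \<turnstile>\<^sub>m t u (MTy (A # \<Gamma>) KProp B) \<Longrightarrow> \<turnstile>\<^sub>m t u (MTy \<Gamma> KProp P)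
    \<Longrightarrow> \<turnstile>\<^sub>m t u (MTm \<Gamma> a A) \<Longrightarrow> \<turnstile>\<^sub>m t u (MTm \<Gamma> b (minst 0 B [a])) \<Longrightarrow> \<turnstile>\<^sub>m t u (MTm (B # A # \<Gamma>) m (mlift 0 2 P))
    \<Longrightarrow> \<turnstile>\<^sub>m t u (MTmEq \<Gamma> (MElEx (MExPair a b) m) (minst 0 m [a, b]) P)"

| m_Id_F: "k \<in> {KProp, KProps} \<Longrightarrow> \<turnstile>\<^sub>m t u (MTy \<Gamma> (dom_kind k) A) \<Longrightarrow> \<turnstile>\<^sub>m t u (MTm \<Gamma> a A) \<Longrightarrow> \<turnstile>\<^sub>m t u (MTm \<Gamma> b A)
    \<Longrightarrow> \<turnstile>\<^sub>m t u (MTy \<Gamma> k (MId A a b))"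
| m_Id_F_eq: "k \<in> {KProp, KProps} \<Longrightarrow> \<turnstile>\<^sub>m t u (MTyEq \<Gamma> (dom_kind k) A A') \<Longrightarrow> \<turnstile>\<^sub>m t u (MTmEq \<Gamma> a a' A)
    \<Longrightarrow> \<turnstile>\<^sub>m t u (MTmEq \<Gamma> b b' A) \<Longrightarrow> \<turnstile>\<^sub>m t u (MTyEq \<Gamma> k (MId A a b) (MId A' a' b'))"
| m_Id_I: "\<turnstile>\<^sub>m t u (MTy \<Gamma> KCol A) \<Longrightarrow> \<turnstile>\<^sub>m t u (MTm \<Gamma> a A) \<Longrightarrow> \<turnstile>\<^sub>m t u (MTm \<Gamma> (MRefl a) (MId A a a))"
| m_Id_E: "\<turnstile>\<^sub>m t u (MTy \<Gamma> KCol A) \<Longrightarrow> \<turnstile>\<^sub>m t u (MTy (mlift 0 1 A # A # \<Gamma>) KProp P)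
    \<Longrightarrow> \<turnstile>\<^sub>m t u (MTm \<Gamma> a A) \<Longrightarrow> \<turnstile>\<^sub>m t u (MTm \<Gamma> b A) \<Longrightarrow> \<turnstile>\<^sub>m t u (MTm \<Gamma> p (MId A a b))
    \<Longrightarrow> \<turnstile>\<^sub>m t u (MTm (A # \<Gamma>) c (minst 1 P [MVar 0, MVar 0]))
    \<Longrightarrow> \<turnstile>\<^sub>m t u (MTm \<Gamma> (MElId p c) (minst 0 P [a, b]))"
| m_Id_C: "\<turnstile>\<^sub>m t u (MTy \<Gamma> KCol A) \<Longrightarrow> \<turnstile>\<^sub>m t u (MTy (mlift 0 1 A # A # \<Gamma>) KProp P) \<Longrightarrow> \<turnstile>\<^sub>m t u (MTm \<Gamma> a A)
    \<Longrightarrow> \<turnstile>\<^sub>m t u (MTm (A # \<Gamma>) c (minst 1 P [MVar 0, MVar 0]))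
    \<Longrightarrow> \<turnstile>\<^sub>m t u (MTmEq \<Gamma> (MElId (MRefl a) c) (minst 0 c [a]) (minst 0 P [a, a]))"

| m_Cov_F: "m_axset (\<turnstile>\<^sub>m t u) \<Gamma> A I C V \<Longrightarrow> \<turnstile>\<^sub>m t u (MTm \<Gamma> a A) \<Longrightarrow> \<turnstile>\<^sub>m t u (MTy \<Gamma> KProps (MCov A I C V a))"
| m_Cov_rf: "m_axset (\<turnstile>\<^sub>m t u) \<Gamma> A I C V \<Longrightarrow> \<turnstile>\<^sub>m t u (MTm \<Gamma> a A) \<Longrightarrow> \<turnstile>\<^sub>m t u (MTm \<Gamma> r (MAp V a))
    \<Longrightarrow> \<turnstile>\<^sub>m t u (MTm \<Gamma> (MRf a r) (MCov A I C V a))"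
| m_Cov_tr: "m_axset (\<turnstile>\<^sub>m t u) \<Gamma> A I C V \<Longrightarrow> \<turnstile>\<^sub>m t u (MTm \<Gamma> a A) \<Longrightarrow> \<turnstile>\<^sub>m t u (MTm \<Gamma> j (minst 0 I [a]))
    \<Longrightarrow> \<turnstile>\<^sub>m t u (MTm \<Gamma> r (mall_in 0 A C (mcov_fam A I C V) a j))
    \<Longrightarrow> \<turnstile>\<^sub>m t u (MTm \<Gamma> (MTr a j r) (MCov A I C V a))"
| m_Cov_E: "m_axset (\<turnstile>\<^sub>m t u) \<Gamma> A I C V \<Longrightarrow> \<turnstile>\<^sub>m t u (MTy (A # \<Gamma>) KProp P) \<Longrightarrow> \<turnstile>\<^sub>m t u (MTm \<Gamma> a A)
    \<Longrightarrow> \<turnstile>\<^sub>m t u (MTm \<Gamma> m (MCov A I C V a))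
    \<Longrightarrow> \<turnstile>\<^sub>m t u (MTm (MAp (mlift 0 1 V) (MVar 0) # A # \<Gamma>) q1 (minst 2 P [MVar 1]))
    \<Longrightarrow> \<turnstile>\<^sub>m t u (MTm (mall_in 3 A C P (MVar 2) (MVar 1)
             # mall_in 2 A C (mcov_fam A I C V) (MVar 1) (MVar 0) # I # A # \<Gamma>)
             q2 (minst 4 P [MVar 3]))
    \<Longrightarrow> \<turnstile>\<^sub>m t u (MTm \<Gamma> (MInd m q1 q2) (minst 0 P [a]))"
| m_Cov_C1: "m_axset (\<turnstile>\<^sub>m t u) \<Gamma> A I C V \<Longrightarrow> \<turnstile>\<^sub>m t u (MTy (A # \<Gamma>) KProp P) \<Longrightarrow> \<turnstile>\<^sub>m t u (MTm \<Gamma> a A)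
    \<Longrightarrow> \<turnstile>\<^sub>m t u (MTm \<Gamma> r (MAp V a))
    \<Longrightarrow> \<turnstile>\<^sub>m t u (MTm (MAp (mlift 0 1 V) (MVar 0) # A # \<Gamma>) q1 (minst 2 P [MVar 1]))
    \<Longrightarrow> \<turnstile>\<^sub>m t u (MTm (mall_in 3 A C P (MVar 2) (MVar 1)
             # mall_in 2 A C (mcov_fam A I C V) (MVar 1) (MVar 0) # I # A # \<Gamma>)
             q2 (minst 4 P [MVar 3]))
    \<Longrightarrow> \<turnstile>\<^sub>m t u (MTmEq \<Gamma> (MInd (MRf a r) q1 q2) (minst 0 q1 [a, r]) (minst 0 P [a]))"
| m_Cov_C2: "m_axset (\<turnstile>\<^sub>m t u) \<Gamma> A I C V \<Longrightarrow> \<turnstile>\<^sub>m t u (MTy (A # \<Gamma>) KProp P) \<Longrightarrow> \<turnstile>\<^sub>m t u (MTm \<Gamma> a A)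
    \<Longrightarrow> \<turnstile>\<^sub>m t u (MTm \<Gamma> j (minst 0 I [a])) \<Longrightarrow> \<turnstile>\<^sub>m t u (MTm \<Gamma> r (mall_in 0 A C (mcov_fam A I C V) a j))
    \<Longrightarrow> \<turnstile>\<^sub>m t u (MTm (MAp (mlift 0 1 V) (MVar 0) # A # \<Gamma>) q1 (minst 2 P [MVar 1]))
    \<Longrightarrow> \<turnstile>\<^sub>m t u (MTm (mall_in 3 A C P (MVar 2) (MVar 1)
             # mall_in 2 A C (mcov_fam A I C V) (MVar 1) (MVar 0) # I # A # \<Gamma>)
             q2 (minst 4 P [MVar 3]))
    \<Longrightarrow> \<turnstile>\<^sub>m t u (MTmEq \<Gamma> (MInd (MTr a j r) q1 q2)
             (minst 0 q2 [a, j, r,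
                MLam (MLam (MInd (MAp (MAp (mlift 0 2 r) (MVar 1)) (MVar 0))
                                 (mlift 2 2 q1) (mlift 4 2 q2)))])
             (minst 0 P [a]))"

| m_Pos_F: "m_axset (\<turnstile>\<^sub>m t u) \<Gamma> A I C V \<Longrightarrow> \<turnstile>\<^sub>m t u (MTm \<Gamma> a A) \<Longrightarrow> \<turnstile>\<^sub>m t u (MTy \<Gamma> KProps (MPos A I C V a))"
| m_Pos_ax1: "m_axset (\<turnstile>\<^sub>m t u) \<Gamma> A I C V \<Longrightarrow> \<turnstile>\<^sub>m t u (MTm \<Gamma> a A) \<Longrightarrow> \<turnstile>\<^sub>m t u (MTm \<Gamma> q (MPos A I C V a))
    \<Longrightarrow> \<turnstile>\<^sub>m t u (MTm \<Gamma> (MAx1 a q) (MAp V a))"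
| m_Pos_ax2: "m_axset (\<turnstile>\<^sub>m t u) \<Gamma> A I C V \<Longrightarrow> \<turnstile>\<^sub>m t u (MTm \<Gamma> a A) \<Longrightarrow> \<turnstile>\<^sub>m t u (MTm \<Gamma> j (minst 0 I [a]))
    \<Longrightarrow> \<turnstile>\<^sub>m t u (MTm \<Gamma> q (MPos A I C V a))
    \<Longrightarrow> \<turnstile>\<^sub>m t u (MTm \<Gamma> (MAx2 a j q)
             (MEx A (MAnd (MAp (minst 1 C [mlift 0 1 a, mlift 0 1 j]) (MVar 0))
                          (mpos_fam A I C V))))"
| m_Pos_ax3: "m_axset (\<turnstile>\<^sub>m t u) \<Gamma> A I C V \<Longrightarrow> \<turnstile>\<^sub>m t u (MTy (A # \<Gamma>) KProp P) \<Longrightarrow> \<turnstile>\<^sub>m t u (MTm \<Gamma> a A)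
    \<Longrightarrow> \<turnstile>\<^sub>m t u (MTm \<Gamma> m (minst 0 P [a]))
    \<Longrightarrow> \<turnstile>\<^sub>m t u (MTm (P # A # \<Gamma>) q1 (MAp (mlift 0 2 V) (MVar 1)))
    \<Longrightarrow> \<turnstile>\<^sub>m t u (MTm (minst 2 P [MVar 1] # I # A # \<Gamma>) q2
             (MEx (mlift 0 3 A) (MAnd (minst 4 P [MVar 0])
                                      (MAp (minst 4 C [MVar 3, MVar 2]) (MVar 0)))))
    \<Longrightarrow> \<turnstile>\<^sub>m t u (MTm \<Gamma> (MAx3 a m q1 q2) (MPos A I C V a))"

| m_AC: "\<turnstile>\<^sub>m t u (MTy \<Gamma> KCol A) \<Longrightarrow> \<turnstile>\<^sub>m t u (MTy (A # \<Gamma>) KCol B) \<Longrightarrow> \<turnstile>\<^sub>m t u (MTy \<Gamma> KCol (MPi A B))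
    \<Longrightarrow> \<turnstile>\<^sub>m t u (MTy (B # A # \<Gamma>) KProp R) \<Longrightarrow> \<turnstile>\<^sub>m t u (MTm \<Gamma> MAc (mAC A B R))"
| m_CT: "\<turnstile>\<^sub>m t u (MCtx \<Gamma>) \<Longrightarrow> \<turnstile>\<^sub>m t u (MTm \<Gamma> MCt (mCT t u))"

no_notation mTT_cind_AC_CT (\<open>\<turnstile>\<^sub>m\<close>)


section \<open>The theory \<open>MLtt_cind + CT\<close>\<close>

text \<open>
  \<open>LT\<close> decodes the elements of the universe \<open>LU\<close>, whose codes are the constructors with prefix \<open>Lc\<close>.
\<close>

datatype lexp =
    LVar nat
  | LN0 | LN1 | LNat
  | LList lexp
  | LPlus lexp lexp
  | LSigma lexp lexp              (* A, (x)B *)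
  | LPi lexp lexp                 (* A, (x)B *)
  | LId lexp lexp lexp
  | LU
  | LT lexp
  | LCov lexp lexp lexp lexp lexp (* s, (x)i, (x,j)c, v, a *)
  | LPos lexp lexp lexp lexp lexp (* s, (x)i, (x,j)c, v, a *)
  | LcN0 | LcN1 | LcNat
  | LcList lexp
  | LcPlus lexp lexp
  | LcSigma lexp lexp             (* a, (x)b *)
  | LcPi lexp lexp                (* a, (x)b *)
  | LcId lexp lexp lexp
  | LcCov lexp lexp lexp lexp lexp (* as for LCov *)
  | LcPos lexp lexp lexp lexp lexp (* as for LPos *)
  | LEl0 lexp
  | LStar
  | LEl1 lexp lexp
  | LZero
  | LSuc lexp
  | LElN lexp lexp lexp           (* n, c, (x,y)l *)
  | LNil
  | LCons lexp lexp               (* list, new last element *)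
  | LElList lexp lexp lexp        (* s, c, (x,y,z)l *)
  | LInl lexp
  | LInr lexp
  | LElPlus lexp lexp lexp        (* w, (x)c, (y)d *)
  | LPair lexp lexp
  | LElSigma lexp lexp            (* d, (x,y)m *)
  | LLam lexp                     (* (x)b *)
  | LAp lexp lexp
  | LRefl lexp
  | LElId lexp lexp               (* p, (x)c *)
  | LRf lexp lexp
  | LTr lexp lexp lexp
  | LInd lexp lexp lexp           (* m, (x,w)q1, (x,h,k,f)q2 *)
  | LAx1 lexp lexp
  | LAx2 lexp lexp lexp
  | LAx3 lexp lexp lexp           (* m, (x,z)q1, (x,j,z)q2 *)
  | LCt                           (* the term postulated by CT *)

primrec lren :: "(nat \<Rightarrow> nat) \<Rightarrow> lexp \<Rightarrow> lexp" where
  "lren \<rho> (LVar i) = LVar (\<rho> i)"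
| "lren \<rho> LN0 = LN0"
| "lren \<rho> LN1 = LN1"
| "lren \<rho> LNat = LNat"
| "lren \<rho> (LList a) = LList (lren \<rho> a)"
| "lren \<rho> (LPlus a b) = LPlus (lren \<rho> a) (lren \<rho> b)"
| "lren \<rho> (LSigma a b) = LSigma (lren \<rho> a) (lren (upr 1 \<rho>) b)"
| "lren \<rho> (LPi a b) = LPi (lren \<rho> a) (lren (upr 1 \<rho>) b)"
| "lren \<rho> (LId a b c) = LId (lren \<rho> a) (lren \<rho> b) (lren \<rho> c)"
| "lren \<rho> LU = LU"
| "lren \<rho> (LT a) = LT (lren \<rho> a)"
| "lren \<rho> (LCov a b c d e) = LCov (lren \<rho> a) (lren (upr 1 \<rho>) b) (lren (upr 2 \<rho>) c) (lren \<rho> d) (lren \<rho> e)"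
| "lren \<rho> (LPos a b c d e) = LPos (lren \<rho> a) (lren (upr 1 \<rho>) b) (lren (upr 2 \<rho>) c) (lren \<rho> d) (lren \<rho> e)"
| "lren \<rho> LcN0 = LcN0"
| "lren \<rho> LcN1 = LcN1"
| "lren \<rho> LcNat = LcNat"
| "lren \<rho> (LcList a) = LcList (lren \<rho> a)"
| "lren \<rho> (LcPlus a b) = LcPlus (lren \<rho> a) (lren \<rho> b)"
| "lren \<rho> (LcSigma a b) = LcSigma (lren \<rho> a) (lren (upr 1 \<rho>) b)"
| "lren \<rho> (LcPi a b) = LcPi (lren \<rho> a) (lren (upr 1 \<rho>) b)"
| "lren \<rho> (LcId a b c) = LcId (lren \<rho> a) (lren \<rho> b) (lren \<rho> c)"
| "lren \<rho> (LcCov a b c d e) = LcCov (lren \<rho> a) (lren (upr 1 \<rho>) b) (lren (upr 2 \<rho>) c) (lren \<rho> d) (lren \<rho> e)"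
| "lren \<rho> (LcPos a b c d e) = LcPos (lren \<rho> a) (lren (upr 1 \<rho>) b) (lren (upr 2 \<rho>) c) (lren \<rho> d) (lren \<rho> e)"
| "lren \<rho> (LEl0 a) = LEl0 (lren \<rho> a)"
| "lren \<rho> LStar = LStar"
| "lren \<rho> (LEl1 a b) = LEl1 (lren \<rho> a) (lren \<rho> b)"
| "lren \<rho> LZero = LZero"
| "lren \<rho> (LSuc a) = LSuc (lren \<rho> a)"
| "lren \<rho> (LElN a b c) = LElN (lren \<rho> a) (lren \<rho> b) (lren (upr 2 \<rho>) c)"
| "lren \<rho> LNil = LNil"
| "lren \<rho> (LCons a b) = LCons (lren \<rho> a) (lren \<rho> b)"
| "lren \<rho> (LElList a b c) = LElList (lren \<rho> a) (lren \<rho> b) (lren (upr 3 \<rho>) c)"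
| "lren \<rho> (LInl a) = LInl (lren \<rho> a)"
| "lren \<rho> (LInr a) = LInr (lren \<rho> a)"
| "lren \<rho> (LElPlus a b c) = LElPlus (lren \<rho> a) (lren (upr 1 \<rho>) b) (lren (upr 1 \<rho>) c)"
| "lren \<rho> (LPair a b) = LPair (lren \<rho> a) (lren \<rho> b)"
| "lren \<rho> (LElSigma a b) = LElSigma (lren \<rho> a) (lren (upr 2 \<rho>) b)"
| "lren \<rho> (LLam a) = LLam (lren (upr 1 \<rho>) a)"
| "lren \<rho> (LAp a b) = LAp (lren \<rho> a) (lren \<rho> b)"
| "lren \<rho> (LRefl a) = LRefl (lren \<rho> a)"
| "lren \<rho> (LElId a b) = LElId (lren \<rho> a) (lren (upr 1 \<rho>) b)"
| "lren \<rho> (LRf a b) = LRf (lren \<rho> a) (lren \<rho> b)"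
| "lren \<rho> (LTr a b c) = LTr (lren \<rho> a) (lren \<rho> b) (lren \<rho> c)"
| "lren \<rho> (LInd a b c) = LInd (lren \<rho> a) (lren (upr 2 \<rho>) b) (lren (upr 4 \<rho>) c)"
| "lren \<rho> (LAx1 a b) = LAx1 (lren \<rho> a) (lren \<rho> b)"
| "lren \<rho> (LAx2 a b c) = LAx2 (lren \<rho> a) (lren \<rho> b) (lren \<rho> c)"
| "lren \<rho> (LAx3 a b c) = LAx3 (lren \<rho> a) (lren (upr 2 \<rho>) b) (lren (upr 3 \<rho>) c)"
| "lren \<rho> LCt = LCt"

text \<open>\<open>llift k n e\<close> inserts \<open>n\<close> fresh variables beneath the \<open>k\<close> innermost ones.\<close>

definition llift :: "nat \<Rightarrow> nat \<Rightarrow> lexp \<Rightarrow> lexp" where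
  "llift k n = lren (upr k (\<lambda>i. i + n))"

definition lups :: "nat \<Rightarrow> (nat \<Rightarrow> lexp) \<Rightarrow> nat \<Rightarrow> lexp" where
  "lups k \<sigma> i = (if i < k then LVar i else llift 0 k (\<sigma> (i - k)))"

primrec lsub :: "(nat \<Rightarrow> lexp) \<Rightarrow> lexp \<Rightarrow> lexp" where
  "lsub \<sigma> (LVar i) = \<sigma> i"
| "lsub \<sigma> LN0 = LN0"
| "lsub \<sigma> LN1 = LN1"
| "lsub \<sigma> LNat = LNat"
| "lsub \<sigma> (LList a) = LList (lsub \<sigma> a)"
| "lsub \<sigma> (LPlus a b) = LPlus (lsub \<sigma> a) (lsub \<sigma> b)"
| "lsub \<sigma> (LSigma a b) = LSigma (lsub \<sigma> a) (lsub (lups 1 \<sigma>) b)"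
| "lsub \<sigma> (LPi a b) = LPi (lsub \<sigma> a) (lsub (lups 1 \<sigma>) b)"
| "lsub \<sigma> (LId a b c) = LId (lsub \<sigma> a) (lsub \<sigma> b) (lsub \<sigma> c)"
| "lsub \<sigma> LU = LU"
| "lsub \<sigma> (LT a) = LT (lsub \<sigma> a)"
| "lsub \<sigma> (LCov a b c d e) = LCov (lsub \<sigma> a) (lsub (lups 1 \<sigma>) b) (lsub (lups 2 \<sigma>) c) (lsub \<sigma> d) (lsub \<sigma> e)"
| "lsub \<sigma> (LPos a b c d e) = LPos (lsub \<sigma> a) (lsub (lups 1 \<sigma>) b) (lsub (lups 2 \<sigma>) c) (lsub \<sigma> d) (lsub \<sigma> e)"
| "lsub \<sigma> LcN0 = LcN0"
| "lsub \<sigma> LcN1 = LcN1"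
| "lsub \<sigma> LcNat = LcNat"
| "lsub \<sigma> (LcList a) = LcList (lsub \<sigma> a)"
| "lsub \<sigma> (LcPlus a b) = LcPlus (lsub \<sigma> a) (lsub \<sigma> b)"
| "lsub \<sigma> (LcSigma a b) = LcSigma (lsub \<sigma> a) (lsub (lups 1 \<sigma>) b)"
| "lsub \<sigma> (LcPi a b) = LcPi (lsub \<sigma> a) (lsub (lups 1 \<sigma>) b)"
| "lsub \<sigma> (LcId a b c) = LcId (lsub \<sigma> a) (lsub \<sigma> b) (lsub \<sigma> c)"
| "lsub \<sigma> (LcCov a b c d e) = LcCov (lsub \<sigma> a) (lsub (lups 1 \<sigma>) b) (lsub (lups 2 \<sigma>) c) (lsub \<sigma> d) (lsub \<sigma> e)"
| "lsub \<sigma> (LcPos a b c d e) = LcPos (lsub \<sigma> a) (lsub (lups 1 \<sigma>) b) (lsub (lups 2 \<sigma>) c) (lsub \<sigma> d) (lsub \<sigma> e)"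
| "lsub \<sigma> (LEl0 a) = LEl0 (lsub \<sigma> a)"
| "lsub \<sigma> LStar = LStar"
| "lsub \<sigma> (LEl1 a b) = LEl1 (lsub \<sigma> a) (lsub \<sigma> b)"
| "lsub \<sigma> LZero = LZero"
| "lsub \<sigma> (LSuc a) = LSuc (lsub \<sigma> a)"
| "lsub \<sigma> (LElN a b c) = LElN (lsub \<sigma> a) (lsub \<sigma> b) (lsub (lups 2 \<sigma>) c)"
| "lsub \<sigma> LNil = LNil"
| "lsub \<sigma> (LCons a b) = LCons (lsub \<sigma> a) (lsub \<sigma> b)"
| "lsub \<sigma> (LElList a b c) = LElList (lsub \<sigma> a) (lsub \<sigma> b) (lsub (lups 3 \<sigma>) c)"
| "lsub \<sigma> (LInl a) = LInl (lsub \<sigma> a)"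
| "lsub \<sigma> (LInr a) = LInr (lsub \<sigma> a)"
| "lsub \<sigma> (LElPlus a b c) = LElPlus (lsub \<sigma> a) (lsub (lups 1 \<sigma>) b) (lsub (lups 1 \<sigma>) c)"
| "lsub \<sigma> (LPair a b) = LPair (lsub \<sigma> a) (lsub \<sigma> b)"
| "lsub \<sigma> (LElSigma a b) = LElSigma (lsub \<sigma> a) (lsub (lups 2 \<sigma>) b)"
| "lsub \<sigma> (LLam a) = LLam (lsub (lups 1 \<sigma>) a)"
| "lsub \<sigma> (LAp a b) = LAp (lsub \<sigma> a) (lsub \<sigma> b)"
| "lsub \<sigma> (LRefl a) = LRefl (lsub \<sigma> a)"
| "lsub \<sigma> (LElId a b) = LElId (lsub \<sigma> a) (lsub (lups 1 \<sigma>) b)"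
| "lsub \<sigma> (LRf a b) = LRf (lsub \<sigma> a) (lsub \<sigma> b)"
| "lsub \<sigma> (LTr a b c) = LTr (lsub \<sigma> a) (lsub \<sigma> b) (lsub \<sigma> c)"
| "lsub \<sigma> (LInd a b c) = LInd (lsub \<sigma> a) (lsub (lups 2 \<sigma>) b) (lsub (lups 4 \<sigma>) c)"
| "lsub \<sigma> (LAx1 a b) = LAx1 (lsub \<sigma> a) (lsub \<sigma> b)"
| "lsub \<sigma> (LAx2 a b c) = LAx2 (lsub \<sigma> a) (lsub \<sigma> b) (lsub \<sigma> c)"
| "lsub \<sigma> (LAx3 a b c) = LAx3 (lsub \<sigma> a) (lsub (lups 2 \<sigma>) b) (lsub (lups 3 \<sigma>) c)"
| "lsub \<sigma> LCt = LCt"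

definition linst :: "nat \<Rightarrow> lexp \<Rightarrow> lexp list \<Rightarrow> lexp" where
  "linst n e as =
     lsub (\<lambda>i. if i < length as then rev as ! i else LVar (i - length as + n)) e"

definition lvty :: "lexp list \<Rightarrow> nat \<Rightarrow> lexp" where
  "lvty \<Gamma> i = llift 0 (Suc i) (\<Gamma> ! i)"


definition lprod :: "lexp \<Rightarrow> lexp \<Rightarrow> lexp" where
  "lprod A B = LSigma A (llift 0 1 B)"

definition larrow :: "lexp \<Rightarrow> lexp \<Rightarrow> lexp" where
  "larrow A B = LPi A (llift 0 1 B)"

definition lfst :: "lexp \<Rightarrow> lexp" where
  "lfst d = LElSigma d (LVar 1)"

definition lsnd :: "lexp \<Rightarrow> lexp" where
  "lsnd d = LElSigma d (LVar 0)"

fun lpr :: "recf \<Rightarrow> lexp list \<Rightarrow> lexp" where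
  "lpr RZero as = LZero"
| "lpr RSucc as = LSuc (as ! 0)"
| "lpr (RProj i) as = as ! i"
| "lpr (RComp f gs) as = lpr f (map (\<lambda>g. lpr g as) gs)"
| "lpr (RPrec g h) as =
     LElN (as ! 0) (lpr g (tl as)) (lpr h ([LVar 1, LVar 0] @ map (llift 0 2) (tl as)))"
| "lpr (RMin f) as = LZero"

definition lCT :: "recf \<Rightarrow> recf \<Rightarrow> lexp" where
  "lCT t u =
     LPi (LPi LNat LNat) (LSigma LNat (LPi LNat (LSigma LNat
       (lprod (LId LNat (lpr t [LVar 2, LVar 1, LVar 0]) (LSuc LZero))
              (LId LNat (LAp (LVar 3) (LVar 1)) (lpr u [LVar 0]))))))"

datatype ljudg =
    LCtx "lexp list"
  | LTy "lexp list" lexp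
  | LTyEq "lexp list" lexp lexp
  | LTm "lexp list" lexp lexp           (* \<Gamma>, a, A: a is an element of A *)
  | LTmEq "lexp list" lexp lexp lexp    (* \<Gamma>, a, b, A *)

abbreviation l_subst :: "(ljudg \<Rightarrow> bool) \<Rightarrow> lexp list \<Rightarrow> (nat \<Rightarrow> lexp) \<Rightarrow> lexp list \<Rightarrow> bool" where
  "l_subst D \<Gamma> \<sigma> \<Delta> \<equiv> D (LCtx \<Gamma>) \<and> D (LCtx \<Delta>)
     \<and> (\<forall>i<length \<Delta>. D (LTm \<Gamma> (\<sigma> i) (lsub \<sigma> (lvty \<Delta> i))))"

abbreviation l_subst_eq ::
    "(ljudg \<Rightarrow> bool) \<Rightarrow> lexp list \<Rightarrow> (nat \<Rightarrow> lexp) \<Rightarrow> (nat \<Rightarrow> lexp) \<Rightarrow> lexp list \<Rightarrow> bool" where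
  "l_subst_eq D \<Gamma> \<sigma> \<tau> \<Delta> \<equiv> l_subst D \<Gamma> \<sigma> \<Delta> \<and> l_subst D \<Gamma> \<tau> \<Delta>
     \<and> (\<forall>i<length \<Delta>. D (LTmEq \<Gamma> (\<sigma> i) (\<tau> i) (lsub \<sigma> (lvty \<Delta> i))))"

abbreviation l_axset ::
    "(ljudg \<Rightarrow> bool) \<Rightarrow> lexp list \<Rightarrow> lexp \<Rightarrow> lexp \<Rightarrow> lexp \<Rightarrow> lexp \<Rightarrow> bool" where
  "l_axset D \<Gamma> s i c v \<equiv> D (LTm \<Gamma> s LU) \<and> D (LTm (LT s # \<Gamma>) i LU)
     \<and> D (LTm (LT i # LT s # \<Gamma>) c (LPi (LT (llift 0 2 s)) LU)) \<and> D (LTm \<Gamma> v (LPi (LT s) LU))"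

definition lcov_fam :: "lexp \<Rightarrow> lexp \<Rightarrow> lexp \<Rightarrow> lexp \<Rightarrow> lexp" where
  "lcov_fam s i c v = LCov (llift 0 1 s) (llift 1 1 i) (llift 2 1 c) (llift 0 1 v) (LVar 0)"

definition lpos_fam :: "lexp \<Rightarrow> lexp \<Rightarrow> lexp \<Rightarrow> lexp \<Rightarrow> lexp" where
  "lpos_fam s i c v = LPos (llift 0 1 s) (llift 1 1 i) (llift 2 1 c) (llift 0 1 v) (LVar 0)"

text \<open>\<open>(\<Pi>z \<in> T(s)) (z \<epsilon> c(x,j) \<rightarrow> z \<triangleleft> v)\<close> over an extension of \<open>\<Gamma>\<close> by \<open>n\<close> variables.\<close>

definition lall_cov :: "nat \<Rightarrow> lexp \<Rightarrow> lexp \<Rightarrow> lexp \<Rightarrow> lexp \<Rightarrow> lexp \<Rightarrow> lexp \<Rightarrow> lexp" where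
  "lall_cov n s i c v x j =
     LPi (LT (llift 0 n s))
       (larrow (LT (LAp (linst (n + 1) c [llift 0 1 x, llift 0 1 j]) (LVar 0)))
               (linst (n + 1) (lcov_fam s i c v) [LVar 0]))"

text \<open>
  \<open>(\<Pi>z \<in> T(s)) (\<Pi>u \<in> z \<epsilon> c(x,h)) P(z, Ap(Ap(k,z),u))\<close> over \<open>\<Gamma>, x, h, k\<close>, for \<open>P\<close> over
  \<open>\<Gamma>, x \<in> T(s), u \<in> x \<triangleleft> v\<close>.
\<close>

definition lind_hyp :: "lexp \<Rightarrow> lexp \<Rightarrow> lexp \<Rightarrow> lexp" where
  "lind_hyp s c P =
     LPi (LT (llift 0 3 s))
       (LPi (LT (LAp (linst 4 c [LVar 3, LVar 2]) (LVar 0)))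
          (linst 5 P [LVar 1, LAp (LAp (LVar 2) (LVar 1)) (LVar 0)]))"

inductive MLtt_cind_CT :: "recf \<Rightarrow> recf \<Rightarrow> ljudg \<Rightarrow> bool" (\<open>\<turnstile>\<^sub>l\<close>)
  for t u :: recf where
  l_ctx_nil: "\<turnstile>\<^sub>l t u (LCtx [])"
| l_ctx_cons: "\<turnstile>\<^sub>l t u (LCtx \<Gamma>) \<Longrightarrow> \<turnstile>\<^sub>l t u (LTy \<Gamma> A) \<Longrightarrow> \<turnstile>\<^sub>l t u (LCtx (A # \<Gamma>))"
| l_var: "\<turnstile>\<^sub>l t u (LCtx \<Gamma>) \<Longrightarrow> i < length \<Gamma> \<Longrightarrow> \<turnstile>\<^sub>l t u (LTm \<Gamma> (LVar i) (lvty \<Gamma> i))"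

| l_ty_sub: "l_subst (\<turnstile>\<^sub>l t u) \<Gamma> \<sigma> \<Delta> \<Longrightarrow> \<turnstile>\<^sub>l t u (LTy \<Delta> A) \<Longrightarrow> \<turnstile>\<^sub>l t u (LTy \<Gamma> (lsub \<sigma> A))"
| l_tyeq_sub: "l_subst (\<turnstile>\<^sub>l t u) \<Gamma> \<sigma> \<Delta> \<Longrightarrow> \<turnstile>\<^sub>l t u (LTyEq \<Delta> A B) \<Longrightarrow> \<turnstile>\<^sub>l t u (LTyEq \<Gamma> (lsub \<sigma> A) (lsub \<sigma> B))"
| l_tm_sub: "l_subst (\<turnstile>\<^sub>l t u) \<Gamma> \<sigma> \<Delta> \<Longrightarrow> \<turnstile>\<^sub>l t u (LTm \<Delta> a A) \<Longrightarrow> \<turnstile>\<^sub>l t u (LTm \<Gamma> (lsub \<sigma> a) (lsub \<sigma> A))"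
| l_tmeq_sub: "l_subst (\<turnstile>\<^sub>l t u) \<Gamma> \<sigma> \<Delta> \<Longrightarrow> \<turnstile>\<^sub>l t u (LTmEq \<Delta> a b A)
    \<Longrightarrow> \<turnstile>\<^sub>l t u (LTmEq \<Gamma> (lsub \<sigma> a) (lsub \<sigma> b) (lsub \<sigma> A))"
| l_ty_repl: "l_subst_eq (\<turnstile>\<^sub>l t u) \<Gamma> \<sigma> \<tau> \<Delta> \<Longrightarrow> \<turnstile>\<^sub>l t u (LTy \<Delta> A) \<Longrightarrow> \<turnstile>\<^sub>l t u (LTyEq \<Gamma> (lsub \<sigma> A) (lsub \<tau> A))"
| l_repl: "l_subst_eq (\<turnstile>\<^sub>l t u) \<Gamma> \<sigma> \<tau> \<Delta> \<Longrightarrow> \<turnstile>\<^sub>l t u (LTm \<Delta> c C)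
    \<Longrightarrow> \<turnstile>\<^sub>l t u (LTmEq \<Gamma> (lsub \<sigma> c) (lsub \<tau> c) (lsub \<sigma> C))"

| l_tyeq_refl: "\<turnstile>\<^sub>l t u (LTy \<Gamma> A) \<Longrightarrow> \<turnstile>\<^sub>l t u (LTyEq \<Gamma> A A)"
| l_tyeq_sym: "\<turnstile>\<^sub>l t u (LTyEq \<Gamma> A B) \<Longrightarrow> \<turnstile>\<^sub>l t u (LTyEq \<Gamma> B A)"
| l_tyeq_trans: "\<turnstile>\<^sub>l t u (LTyEq \<Gamma> A B) \<Longrightarrow> \<turnstile>\<^sub>l t u (LTyEq \<Gamma> B C) \<Longrightarrow> \<turnstile>\<^sub>l t u (LTyEq \<Gamma> A C)"
| l_tmeq_refl: "\<turnstile>\<^sub>l t u (LTm \<Gamma> a A) \<Longrightarrow> \<turnstile>\<^sub>l t u (LTmEq \<Gamma> a a A)"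
| l_tmeq_sym: "\<turnstile>\<^sub>l t u (LTmEq \<Gamma> a b A) \<Longrightarrow> \<turnstile>\<^sub>l t u (LTmEq \<Gamma> b a A)"
| l_tmeq_trans: "\<turnstile>\<^sub>l t u (LTmEq \<Gamma> a b A) \<Longrightarrow> \<turnstile>\<^sub>l t u (LTmEq \<Gamma> b c A) \<Longrightarrow> \<turnstile>\<^sub>l t u (LTmEq \<Gamma> a c A)"
| l_tm_conv: "\<turnstile>\<^sub>l t u (LTm \<Gamma> a A) \<Longrightarrow> \<turnstile>\<^sub>l t u (LTyEq \<Gamma> A B) \<Longrightarrow> \<turnstile>\<^sub>l t u (LTm \<Gamma> a B)"
| l_tmeq_conv: "\<turnstile>\<^sub>l t u (LTmEq \<Gamma> a b A) \<Longrightarrow> \<turnstile>\<^sub>l t u (LTyEq \<Gamma> A B) \<Longrightarrow> \<turnstile>\<^sub>l t u (LTmEq \<Gamma> a b B)"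

| l_N0_F: "\<turnstile>\<^sub>l t u (LCtx \<Gamma>) \<Longrightarrow> \<turnstile>\<^sub>l t u (LTy \<Gamma> LN0)"
| l_N0_E: "\<turnstile>\<^sub>l t u (LTy (LN0 # \<Gamma>) M) \<Longrightarrow> \<turnstile>\<^sub>l t u (LTm \<Gamma> c LN0) \<Longrightarrow> \<turnstile>\<^sub>l t u (LTm \<Gamma> (LEl0 c) (linst 0 M [c]))"

| l_N1_F: "\<turnstile>\<^sub>l t u (LCtx \<Gamma>) \<Longrightarrow> \<turnstile>\<^sub>l t u (LTy \<Gamma> LN1)"
| l_N1_I: "\<turnstile>\<^sub>l t u (LCtx \<Gamma>) \<Longrightarrow> \<turnstile>\<^sub>l t u (LTm \<Gamma> LStar LN1)"
| l_N1_E: "\<turnstile>\<^sub>l t u (LTy (LN1 # \<Gamma>) M) \<Longrightarrow> \<turnstile>\<^sub>l t u (LTm \<Gamma> a LN1) \<Longrightarrow> \<turnstile>\<^sub>l t u (LTm \<Gamma> c (linst 0 M [LStar]))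
    \<Longrightarrow> \<turnstile>\<^sub>l t u (LTm \<Gamma> (LEl1 a c) (linst 0 M [a]))"
| l_N1_C: "\<turnstile>\<^sub>l t u (LTy (LN1 # \<Gamma>) M) \<Longrightarrow> \<turnstile>\<^sub>l t u (LTm \<Gamma> c (linst 0 M [LStar]))
    \<Longrightarrow> \<turnstile>\<^sub>l t u (LTmEq \<Gamma> (LEl1 LStar c) c (linst 0 M [LStar]))"

| l_N_F: "\<turnstile>\<^sub>l t u (LCtx \<Gamma>) \<Longrightarrow> \<turnstile>\<^sub>l t u (LTy \<Gamma> LNat)"
| l_N_I1: "\<turnstile>\<^sub>l t u (LCtx \<Gamma>) \<Longrightarrow> \<turnstile>\<^sub>l t u (LTm \<Gamma> LZero LNat)"
| l_N_I2: "\<turnstile>\<^sub>l t u (LTm \<Gamma> a LNat) \<Longrightarrow> \<turnstile>\<^sub>l t u (LTm \<Gamma> (LSuc a) LNat)"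
| l_N_E: "\<turnstile>\<^sub>l t u (LTy (LNat # \<Gamma>) M) \<Longrightarrow> \<turnstile>\<^sub>l t u (LTm \<Gamma> a LNat) \<Longrightarrow> \<turnstile>\<^sub>l t u (LTm \<Gamma> c (linst 0 M [LZero]))
    \<Longrightarrow> \<turnstile>\<^sub>l t u (LTm (M # LNat # \<Gamma>) l (linst 2 M [LSuc (LVar 1)]))
    \<Longrightarrow> \<turnstile>\<^sub>l t u (LTm \<Gamma> (LElN a c l) (linst 0 M [a]))"
| l_N_C1: "\<turnstile>\<^sub>l t u (LTy (LNat # \<Gamma>) M) \<Longrightarrow> \<turnstile>\<^sub>l t u (LTm \<Gamma> c (linst 0 M [LZero]))
    \<Longrightarrow> \<turnstile>\<^sub>l t u (LTm (M # LNat # \<Gamma>) l (linst 2 M [LSuc (LVar 1)]))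
    \<Longrightarrow> \<turnstile>\<^sub>l t u (LTmEq \<Gamma> (LElN LZero c l) c (linst 0 M [LZero]))"
| l_N_C2: "\<turnstile>\<^sub>l t u (LTy (LNat # \<Gamma>) M) \<Longrightarrow> \<turnstile>\<^sub>l t u (LTm \<Gamma> a LNat) \<Longrightarrow> \<turnstile>\<^sub>l t u (LTm \<Gamma> c (linst 0 M [LZero]))
    \<Longrightarrow> \<turnstile>\<^sub>l t u (LTm (M # LNat # \<Gamma>) l (linst 2 M [LSuc (LVar 1)]))
    \<Longrightarrow> \<turnstile>\<^sub>l t u (LTmEq \<Gamma> (LElN (LSuc a) c l) (linst 0 l [a, LElN a c l]) (linst 0 M [LSuc a]))"

| l_List_F: "\<turnstile>\<^sub>l t u (LTy \<Gamma> A) \<Longrightarrow> \<turnstile>\<^sub>l t u (LTy \<Gamma> (LList A))"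
| l_List_F_eq: "\<turnstile>\<^sub>l t u (LTyEq \<Gamma> A A') \<Longrightarrow> \<turnstile>\<^sub>l t u (LTyEq \<Gamma> (LList A) (LList A'))"
| l_List_I1: "\<turnstile>\<^sub>l t u (LTy \<Gamma> A) \<Longrightarrow> \<turnstile>\<^sub>l t u (LTm \<Gamma> LNil (LList A))"
| l_List_I2: "\<turnstile>\<^sub>l t u (LTy \<Gamma> A) \<Longrightarrow> \<turnstile>\<^sub>l t u (LTm \<Gamma> s (LList A)) \<Longrightarrow> \<turnstile>\<^sub>l t u (LTm \<Gamma> a A)
    \<Longrightarrow> \<turnstile>\<^sub>l t u (LTm \<Gamma> (LCons s a) (LList A))"
| l_List_E: "\<turnstile>\<^sub>l t u (LTy \<Gamma> A) \<Longrightarrow> \<turnstile>\<^sub>l t u (LTy (LList A # \<Gamma>) M) \<Longrightarrow> \<turnstile>\<^sub>l t u (LTm \<Gamma> s (LList A))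
    \<Longrightarrow> \<turnstile>\<^sub>l t u (LTm \<Gamma> c (linst 0 M [LNil]))
    \<Longrightarrow> \<turnstile>\<^sub>l t u (LTm (linst 2 M [LVar 1] # llift 0 1 A # LList A # \<Gamma>) l
             (linst 3 M [LCons (LVar 2) (LVar 1)]))
    \<Longrightarrow> \<turnstile>\<^sub>l t u (LTm \<Gamma> (LElList s c l) (linst 0 M [s]))"
| l_List_C1: "\<turnstile>\<^sub>l t u (LTy \<Gamma> A) \<Longrightarrow> \<turnstile>\<^sub>l t u (LTy (LList A # \<Gamma>) M)
    \<Longrightarrow> \<turnstile>\<^sub>l t u (LTm \<Gamma> c (linst 0 M [LNil]))
    \<Longrightarrow> \<turnstile>\<^sub>l t u (LTm (linst 2 M [LVar 1] # llift 0 1 A # LList A # \<Gamma>) l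
             (linst 3 M [LCons (LVar 2) (LVar 1)]))
    \<Longrightarrow> \<turnstile>\<^sub>l t u (LTmEq \<Gamma> (LElList LNil c l) c (linst 0 M [LNil]))"
| l_List_C2: "\<turnstile>\<^sub>l t u (LTy \<Gamma> A) \<Longrightarrow> \<turnstile>\<^sub>l t u (LTy (LList A # \<Gamma>) M) \<Longrightarrow> \<turnstile>\<^sub>l t u (LTm \<Gamma> s (LList A))
    \<Longrightarrow> \<turnstile>\<^sub>l t u (LTm \<Gamma> a A) \<Longrightarrow> \<turnstile>\<^sub>l t u (LTm \<Gamma> c (linst 0 M [LNil]))
    \<Longrightarrow> \<turnstile>\<^sub>l t u (LTm (linst 2 M [LVar 1] # llift 0 1 A # LList A # \<Gamma>) l
             (linst 3 M [LCons (LVar 2) (LVar 1)]))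
    \<Longrightarrow> \<turnstile>\<^sub>l t u (LTmEq \<Gamma> (LElList (LCons s a) c l) (linst 0 l [s, a, LElList s c l])
             (linst 0 M [LCons s a]))"

| l_Plus_F: "\<turnstile>\<^sub>l t u (LTy \<Gamma> A) \<Longrightarrow> \<turnstile>\<^sub>l t u (LTy \<Gamma> B) \<Longrightarrow> \<turnstile>\<^sub>l t u (LTy \<Gamma> (LPlus A B))"
| l_Plus_F_eq: "\<turnstile>\<^sub>l t u (LTyEq \<Gamma> A A') \<Longrightarrow> \<turnstile>\<^sub>l t u (LTyEq \<Gamma> B B') \<Longrightarrow> \<turnstile>\<^sub>l t u (LTyEq \<Gamma> (LPlus A B) (LPlus A' B'))"
| l_Plus_I1: "\<turnstile>\<^sub>l t u (LTy \<Gamma> A) \<Longrightarrow> \<turnstile>\<^sub>l t u (LTy \<Gamma> B) \<Longrightarrow> \<turnstile>\<^sub>l t u (LTm \<Gamma> a A) \<Longrightarrow> \<turnstile>\<^sub>l t u (LTm \<Gamma> (LInl a) (LPlus A B))"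
| l_Plus_I2: "\<turnstile>\<^sub>l t u (LTy \<Gamma> A) \<Longrightarrow> \<turnstile>\<^sub>l t u (LTy \<Gamma> B) \<Longrightarrow> \<turnstile>\<^sub>l t u (LTm \<Gamma> b B) \<Longrightarrow> \<turnstile>\<^sub>l t u (LTm \<Gamma> (LInr b) (LPlus A B))"
| l_Plus_E: "\<turnstile>\<^sub>l t u (LTy \<Gamma> A) \<Longrightarrow> \<turnstile>\<^sub>l t u (LTy \<Gamma> B) \<Longrightarrow> \<turnstile>\<^sub>l t u (LTy (LPlus A B # \<Gamma>) M) \<Longrightarrow> \<turnstile>\<^sub>l t u (LTm \<Gamma> w (LPlus A B))
    \<Longrightarrow> \<turnstile>\<^sub>l t u (LTm (A # \<Gamma>) c (linst 1 M [LInl (LVar 0)])) \<Longrightarrow> \<turnstile>\<^sub>l t u (LTm (B # \<Gamma>) d (linst 1 M [LInr (LVar 0)]))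
    \<Longrightarrow> \<turnstile>\<^sub>l t u (LTm \<Gamma> (LElPlus w c d) (linst 0 M [w]))"
| l_Plus_C1: "\<turnstile>\<^sub>l t u (LTy \<Gamma> A) \<Longrightarrow> \<turnstile>\<^sub>l t u (LTy \<Gamma> B) \<Longrightarrow> \<turnstile>\<^sub>l t u (LTy (LPlus A B # \<Gamma>) M) \<Longrightarrow> \<turnstile>\<^sub>l t u (LTm \<Gamma> a A)
    \<Longrightarrow> \<turnstile>\<^sub>l t u (LTm (A # \<Gamma>) c (linst 1 M [LInl (LVar 0)])) \<Longrightarrow> \<turnstile>\<^sub>l t u (LTm (B # \<Gamma>) d (linst 1 M [LInr (LVar 0)]))
    \<Longrightarrow> \<turnstile>\<^sub>l t u (LTmEq \<Gamma> (LElPlus (LInl a) c d) (linst 0 c [a]) (linst 0 M [LInl a]))"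
| l_Plus_C2: "\<turnstile>\<^sub>l t u (LTy \<Gamma> A) \<Longrightarrow> \<turnstile>\<^sub>l t u (LTy \<Gamma> B) \<Longrightarrow> \<turnstile>\<^sub>l t u (LTy (LPlus A B # \<Gamma>) M) \<Longrightarrow> \<turnstile>\<^sub>l t u (LTm \<Gamma> b B)
    \<Longrightarrow> \<turnstile>\<^sub>l t u (LTm (A # \<Gamma>) c (linst 1 M [LInl (LVar 0)])) \<Longrightarrow> \<turnstile>\<^sub>l t u (LTm (B # \<Gamma>) d (linst 1 M [LInr (LVar 0)]))
    \<Longrightarrow> \<turnstile>\<^sub>l t u (LTmEq \<Gamma> (LElPlus (LInr b) c d) (linst 0 d [b]) (linst 0 M [LInr b]))"

| l_Sigma_F: "\<turnstile>\<^sub>l t u (LTy \<Gamma> A) \<Longrightarrow> \<turnstile>\<^sub>l t u (LTy (A # \<Gamma>) B) \<Longrightarrow> \<turnstile>\<^sub>l t u (LTy \<Gamma> (LSigma A B))"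
| l_Sigma_F_eq: "\<turnstile>\<^sub>l t u (LTyEq \<Gamma> A A') \<Longrightarrow> \<turnstile>\<^sub>l t u (LTyEq (A # \<Gamma>) B B')
    \<Longrightarrow> \<turnstile>\<^sub>l t u (LTyEq \<Gamma> (LSigma A B) (LSigma A' B'))"
| l_Sigma_I: "\<turnstile>\<^sub>l t u (LTy \<Gamma> A) \<Longrightarrow> \<turnstile>\<^sub>l t u (LTy (A # \<Gamma>) B) \<Longrightarrow> \<turnstile>\<^sub>l t u (LTm \<Gamma> a A) \<Longrightarrow> \<turnstile>\<^sub>l t u (LTm \<Gamma> b (linst 0 B [a]))
    \<Longrightarrow> \<turnstile>\<^sub>l t u (LTm \<Gamma> (LPair a b) (LSigma A B))"
| l_Sigma_E: "\<turnstile>\<^sub>l t u (LTy \<Gamma> A) \<Longrightarrow> \<turnstile>\<^sub>l t u (LTy (A # \<Gamma>) B) \<Longrightarrow> \<turnstile>\<^sub>l t u (LTy (LSigma A B # \<Gamma>) M)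
    \<Longrightarrow> \<turnstile>\<^sub>l t u (LTm \<Gamma> d (LSigma A B)) \<Longrightarrow> \<turnstile>\<^sub>l t u (LTm (B # A # \<Gamma>) m (linst 2 M [LPair (LVar 1) (LVar 0)]))
    \<Longrightarrow> \<turnstile>\<^sub>l t u (LTm \<Gamma> (LElSigma d m) (linst 0 M [d]))"
| l_Sigma_C: "\<turnstile>\<^sub>l t u (LTy \<Gamma> A) \<Longrightarrow> \<turnstile>\<^sub>l t u (LTy (A # \<Gamma>) B) \<Longrightarrow> \<turnstile>\<^sub>l t u (LTy (LSigma A B # \<Gamma>) M)
    \<Longrightarrow> \<turnstile>\<^sub>l t u (LTm \<Gamma> a A) \<Longrightarrow> \<turnstile>\<^sub>l t u (LTm \<Gamma> b (linst 0 B [a]))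
    \<Longrightarrow> \<turnstile>\<^sub>l t u (LTm (B # A # \<Gamma>) m (linst 2 M [LPair (LVar 1) (LVar 0)]))
    \<Longrightarrow> \<turnstile>\<^sub>l t u (LTmEq \<Gamma> (LElSigma (LPair a b) m) (linst 0 m [a, b]) (linst 0 M [LPair a b]))"

| l_Pi_F: "\<turnstile>\<^sub>l t u (LTy \<Gamma> A) \<Longrightarrow> \<turnstile>\<^sub>l t u (LTy (A # \<Gamma>) B) \<Longrightarrow> \<turnstile>\<^sub>l t u (LTy \<Gamma> (LPi A B))"
| l_Pi_F_eq: "\<turnstile>\<^sub>l t u (LTyEq \<Gamma> A A') \<Longrightarrow> \<turnstile>\<^sub>l t u (LTyEq (A # \<Gamma>) B B') \<Longrightarrow> \<turnstile>\<^sub>l t u (LTyEq \<Gamma> (LPi A B) (LPi A' B'))"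
| l_Pi_I: "\<turnstile>\<^sub>l t u (LTy \<Gamma> A) \<Longrightarrow> \<turnstile>\<^sub>l t u (LTy (A # \<Gamma>) B) \<Longrightarrow> \<turnstile>\<^sub>l t u (LTm (A # \<Gamma>) b B)
    \<Longrightarrow> \<turnstile>\<^sub>l t u (LTm \<Gamma> (LLam b) (LPi A B))"
| l_Pi_E: "\<turnstile>\<^sub>l t u (LTy \<Gamma> A) \<Longrightarrow> \<turnstile>\<^sub>l t u (LTy (A # \<Gamma>) B) \<Longrightarrow> \<turnstile>\<^sub>l t u (LTm \<Gamma> f (LPi A B)) \<Longrightarrow> \<turnstile>\<^sub>l t u (LTm \<Gamma> a A)
    \<Longrightarrow> \<turnstile>\<^sub>l t u (LTm \<Gamma> (LAp f a) (linst 0 B [a]))"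
| l_Pi_C: "\<turnstile>\<^sub>l t u (LTy \<Gamma> A) \<Longrightarrow> \<turnstile>\<^sub>l t u (LTy (A # \<Gamma>) B) \<Longrightarrow> \<turnstile>\<^sub>l t u (LTm (A # \<Gamma>) b B) \<Longrightarrow> \<turnstile>\<^sub>l t u (LTm \<Gamma> a A)
    \<Longrightarrow> \<turnstile>\<^sub>l t u (LTmEq \<Gamma> (LAp (LLam b) a) (linst 0 b [a]) (linst 0 B [a]))"

| l_Id_F: "\<turnstile>\<^sub>l t u (LTy \<Gamma> A) \<Longrightarrow> \<turnstile>\<^sub>l t u (LTm \<Gamma> a A) \<Longrightarrow> \<turnstile>\<^sub>l t u (LTm \<Gamma> b A) \<Longrightarrow> \<turnstile>\<^sub>l t u (LTy \<Gamma> (LId A a b))"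
| l_Id_F_eq: "\<turnstile>\<^sub>l t u (LTyEq \<Gamma> A A') \<Longrightarrow> \<turnstile>\<^sub>l t u (LTmEq \<Gamma> a a' A) \<Longrightarrow> \<turnstile>\<^sub>l t u (LTmEq \<Gamma> b b' A)
    \<Longrightarrow> \<turnstile>\<^sub>l t u (LTyEq \<Gamma> (LId A a b) (LId A' a' b'))"
| l_Id_I: "\<turnstile>\<^sub>l t u (LTy \<Gamma> A) \<Longrightarrow> \<turnstile>\<^sub>l t u (LTm \<Gamma> a A) \<Longrightarrow> \<turnstile>\<^sub>l t u (LTm \<Gamma> (LRefl a) (LId A a a))"
| l_Id_E: "\<turnstile>\<^sub>l t u (LTy \<Gamma> A)
    \<Longrightarrow> \<turnstile>\<^sub>l t u (LTy (LId (llift 0 2 A) (LVar 1) (LVar 0) # llift 0 1 A # A # \<Gamma>) P)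
    \<Longrightarrow> \<turnstile>\<^sub>l t u (LTm \<Gamma> a A) \<Longrightarrow> \<turnstile>\<^sub>l t u (LTm \<Gamma> b A) \<Longrightarrow> \<turnstile>\<^sub>l t u (LTm \<Gamma> p (LId A a b))
    \<Longrightarrow> \<turnstile>\<^sub>l t u (LTm (A # \<Gamma>) c (linst 1 P [LVar 0, LVar 0, LRefl (LVar 0)]))
    \<Longrightarrow> \<turnstile>\<^sub>l t u (LTm \<Gamma> (LElId p c) (linst 0 P [a, b, p]))"
| l_Id_C: "\<turnstile>\<^sub>l t u (LTy \<Gamma> A)
    \<Longrightarrow> \<turnstile>\<^sub>l t u (LTy (LId (llift 0 2 A) (LVar 1) (LVar 0) # llift 0 1 A # A # \<Gamma>) P)
    \<Longrightarrow> \<turnstile>\<^sub>l t u (LTm \<Gamma> a A) \<Longrightarrow> \<turnstile>\<^sub>l t u (LTm (A # \<Gamma>) c (linst 1 P [LVar 0, LVar 0, LRefl (LVar 0)]))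
    \<Longrightarrow> \<turnstile>\<^sub>l t u (LTmEq \<Gamma> (LElId (LRefl a) c) (linst 0 c [a]) (linst 0 P [a, a, LRefl a]))"

| l_U_F: "\<turnstile>\<^sub>l t u (LCtx \<Gamma>) \<Longrightarrow> \<turnstile>\<^sub>l t u (LTy \<Gamma> LU)"
| l_T_F: "\<turnstile>\<^sub>l t u (LTm \<Gamma> a LU) \<Longrightarrow> \<turnstile>\<^sub>l t u (LTy \<Gamma> (LT a))"
| l_cN0: "\<turnstile>\<^sub>l t u (LCtx \<Gamma>) \<Longrightarrow> \<turnstile>\<^sub>l t u (LTm \<Gamma> LcN0 LU)"
| l_T_cN0: "\<turnstile>\<^sub>l t u (LCtx \<Gamma>) \<Longrightarrow> \<turnstile>\<^sub>l t u (LTyEq \<Gamma> (LT LcN0) LN0)"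
| l_cN1: "\<turnstile>\<^sub>l t u (LCtx \<Gamma>) \<Longrightarrow> \<turnstile>\<^sub>l t u (LTm \<Gamma> LcN1 LU)"
| l_T_cN1: "\<turnstile>\<^sub>l t u (LCtx \<Gamma>) \<Longrightarrow> \<turnstile>\<^sub>l t u (LTyEq \<Gamma> (LT LcN1) LN1)"
| l_cN: "\<turnstile>\<^sub>l t u (LCtx \<Gamma>) \<Longrightarrow> \<turnstile>\<^sub>l t u (LTm \<Gamma> LcNat LU)"
| l_T_cN: "\<turnstile>\<^sub>l t u (LCtx \<Gamma>) \<Longrightarrow> \<turnstile>\<^sub>l t u (LTyEq \<Gamma> (LT LcNat) LNat)"
| l_cList: "\<turnstile>\<^sub>l t u (LTm \<Gamma> a LU) \<Longrightarrow> \<turnstile>\<^sub>l t u (LTm \<Gamma> (LcList a) LU)"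
| l_T_cList: "\<turnstile>\<^sub>l t u (LTm \<Gamma> a LU) \<Longrightarrow> \<turnstile>\<^sub>l t u (LTyEq \<Gamma> (LT (LcList a)) (LList (LT a)))"
| l_cPlus: "\<turnstile>\<^sub>l t u (LTm \<Gamma> a LU) \<Longrightarrow> \<turnstile>\<^sub>l t u (LTm \<Gamma> b LU) \<Longrightarrow> \<turnstile>\<^sub>l t u (LTm \<Gamma> (LcPlus a b) LU)"
| l_T_cPlus: "\<turnstile>\<^sub>l t u (LTm \<Gamma> a LU) \<Longrightarrow> \<turnstile>\<^sub>l t u (LTm \<Gamma> b LU)
    \<Longrightarrow> \<turnstile>\<^sub>l t u (LTyEq \<Gamma> (LT (LcPlus a b)) (LPlus (LT a) (LT b)))"
| l_cSigma: "\<turnstile>\<^sub>l t u (LTm \<Gamma> a LU) \<Longrightarrow> \<turnstile>\<^sub>l t u (LTm (LT a # \<Gamma>) b LU) \<Longrightarrow> \<turnstile>\<^sub>l t u (LTm \<Gamma> (LcSigma a b) LU)"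
| l_T_cSigma: "\<turnstile>\<^sub>l t u (LTm \<Gamma> a LU) \<Longrightarrow> \<turnstile>\<^sub>l t u (LTm (LT a # \<Gamma>) b LU)
    \<Longrightarrow> \<turnstile>\<^sub>l t u (LTyEq \<Gamma> (LT (LcSigma a b)) (LSigma (LT a) (LT b)))"
| l_cPi: "\<turnstile>\<^sub>l t u (LTm \<Gamma> a LU) \<Longrightarrow> \<turnstile>\<^sub>l t u (LTm (LT a # \<Gamma>) b LU) \<Longrightarrow> \<turnstile>\<^sub>l t u (LTm \<Gamma> (LcPi a b) LU)"
| l_T_cPi: "\<turnstile>\<^sub>l t u (LTm \<Gamma> a LU) \<Longrightarrow> \<turnstile>\<^sub>l t u (LTm (LT a # \<Gamma>) b LU)
    \<Longrightarrow> \<turnstile>\<^sub>l t u (LTyEq \<Gamma> (LT (LcPi a b)) (LPi (LT a) (LT b)))"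
| l_cId: "\<turnstile>\<^sub>l t u (LTm \<Gamma> a LU) \<Longrightarrow> \<turnstile>\<^sub>l t u (LTm \<Gamma> b (LT a)) \<Longrightarrow> \<turnstile>\<^sub>l t u (LTm \<Gamma> c (LT a)) \<Longrightarrow> \<turnstile>\<^sub>l t u (LTm \<Gamma> (LcId a b c) LU)"
| l_T_cId: "\<turnstile>\<^sub>l t u (LTm \<Gamma> a LU) \<Longrightarrow> \<turnstile>\<^sub>l t u (LTm \<Gamma> b (LT a)) \<Longrightarrow> \<turnstile>\<^sub>l t u (LTm \<Gamma> c (LT a))
    \<Longrightarrow> \<turnstile>\<^sub>l t u (LTyEq \<Gamma> (LT (LcId a b c)) (LId (LT a) b c))"
| l_cCov: "l_axset (\<turnstile>\<^sub>l t u) \<Gamma> s i c v \<Longrightarrow> \<turnstile>\<^sub>l t u (LTm \<Gamma> a (LT s)) \<Longrightarrow> \<turnstile>\<^sub>l t u (LTm \<Gamma> (LcCov s i c v a) LU)"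
| l_T_cCov: "l_axset (\<turnstile>\<^sub>l t u) \<Gamma> s i c v \<Longrightarrow> \<turnstile>\<^sub>l t u (LTm \<Gamma> a (LT s))
    \<Longrightarrow> \<turnstile>\<^sub>l t u (LTyEq \<Gamma> (LT (LcCov s i c v a)) (LCov s i c v a))"
| l_cPos: "l_axset (\<turnstile>\<^sub>l t u) \<Gamma> s i c v \<Longrightarrow> \<turnstile>\<^sub>l t u (LTm \<Gamma> a (LT s)) \<Longrightarrow> \<turnstile>\<^sub>l t u (LTm \<Gamma> (LcPos s i c v a) LU)"
| l_T_cPos: "l_axset (\<turnstile>\<^sub>l t u) \<Gamma> s i c v \<Longrightarrow> \<turnstile>\<^sub>l t u (LTm \<Gamma> a (LT s))
    \<Longrightarrow> \<turnstile>\<^sub>l t u (LTyEq \<Gamma> (LT (LcPos s i c v a)) (LPos s i c v a))"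

| l_Cov_F: "l_axset (\<turnstile>\<^sub>l t u) \<Gamma> s i c v \<Longrightarrow> \<turnstile>\<^sub>l t u (LTm \<Gamma> a (LT s)) \<Longrightarrow> \<turnstile>\<^sub>l t u (LTy \<Gamma> (LCov s i c v a))"
| l_Cov_rf: "l_axset (\<turnstile>\<^sub>l t u) \<Gamma> s i c v \<Longrightarrow> \<turnstile>\<^sub>l t u (LTm \<Gamma> a (LT s)) \<Longrightarrow> \<turnstile>\<^sub>l t u (LTm \<Gamma> r (LT (LAp v a)))
    \<Longrightarrow> \<turnstile>\<^sub>l t u (LTm \<Gamma> (LRf a r) (LCov s i c v a))"
| l_Cov_tr: "l_axset (\<turnstile>\<^sub>l t u) \<Gamma> s i c v \<Longrightarrow> \<turnstile>\<^sub>l t u (LTm \<Gamma> a (LT s)) \<Longrightarrow> \<turnstile>\<^sub>l t u (LTm \<Gamma> j (LT (linst 0 i [a])))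
    \<Longrightarrow> \<turnstile>\<^sub>l t u (LTm \<Gamma> r (lall_cov 0 s i c v a j)) \<Longrightarrow> \<turnstile>\<^sub>l t u (LTm \<Gamma> (LTr a j r) (LCov s i c v a))"
| l_Cov_E: "l_axset (\<turnstile>\<^sub>l t u) \<Gamma> s i c v \<Longrightarrow> \<turnstile>\<^sub>l t u (LTy (lcov_fam s i c v # LT s # \<Gamma>) P)
    \<Longrightarrow> \<turnstile>\<^sub>l t u (LTm \<Gamma> a (LT s)) \<Longrightarrow> \<turnstile>\<^sub>l t u (LTm \<Gamma> m (LCov s i c v a))
    \<Longrightarrow> \<turnstile>\<^sub>l t u (LTm (LT (LAp (llift 0 1 v) (LVar 0)) # LT s # \<Gamma>) q1
             (linst 2 P [LVar 1, LRf (LVar 1) (LVar 0)]))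
    \<Longrightarrow> \<turnstile>\<^sub>l t u (LTm (lind_hyp s c P # lall_cov 2 s i c v (LVar 1) (LVar 0) # LT i # LT s # \<Gamma>) q2
             (linst 4 P [LVar 3, LTr (LVar 3) (LVar 2) (LVar 1)]))
    \<Longrightarrow> \<turnstile>\<^sub>l t u (LTm \<Gamma> (LInd m q1 q2) (linst 0 P [a, m]))"
| l_Cov_C1: "l_axset (\<turnstile>\<^sub>l t u) \<Gamma> s i c v \<Longrightarrow> \<turnstile>\<^sub>l t u (LTy (lcov_fam s i c v # LT s # \<Gamma>) P)
    \<Longrightarrow> \<turnstile>\<^sub>l t u (LTm \<Gamma> a (LT s)) \<Longrightarrow> \<turnstile>\<^sub>l t u (LTm \<Gamma> r (LT (LAp v a)))
    \<Longrightarrow> \<turnstile>\<^sub>l t u (LTm (LT (LAp (llift 0 1 v) (LVar 0)) # LT s # \<Gamma>) q1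
             (linst 2 P [LVar 1, LRf (LVar 1) (LVar 0)]))
    \<Longrightarrow> \<turnstile>\<^sub>l t u (LTm (lind_hyp s c P # lall_cov 2 s i c v (LVar 1) (LVar 0) # LT i # LT s # \<Gamma>) q2
             (linst 4 P [LVar 3, LTr (LVar 3) (LVar 2) (LVar 1)]))
    \<Longrightarrow> \<turnstile>\<^sub>l t u (LTmEq \<Gamma> (LInd (LRf a r) q1 q2) (linst 0 q1 [a, r]) (linst 0 P [a, LRf a r]))"
| l_Cov_C2: "l_axset (\<turnstile>\<^sub>l t u) \<Gamma> s i c v \<Longrightarrow> \<turnstile>\<^sub>l t u (LTy (lcov_fam s i c v # LT s # \<Gamma>) P)
    \<Longrightarrow> \<turnstile>\<^sub>l t u (LTm \<Gamma> a (LT s)) \<Longrightarrow> \<turnstile>\<^sub>l t u (LTm \<Gamma> j (LT (linst 0 i [a])))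
    \<Longrightarrow> \<turnstile>\<^sub>l t u (LTm \<Gamma> r (lall_cov 0 s i c v a j))
    \<Longrightarrow> \<turnstile>\<^sub>l t u (LTm (LT (LAp (llift 0 1 v) (LVar 0)) # LT s # \<Gamma>) q1
             (linst 2 P [LVar 1, LRf (LVar 1) (LVar 0)]))
    \<Longrightarrow> \<turnstile>\<^sub>l t u (LTm (lind_hyp s c P # lall_cov 2 s i c v (LVar 1) (LVar 0) # LT i # LT s # \<Gamma>) q2
             (linst 4 P [LVar 3, LTr (LVar 3) (LVar 2) (LVar 1)]))
    \<Longrightarrow> \<turnstile>\<^sub>l t u (LTmEq \<Gamma> (LInd (LTr a j r) q1 q2)
             (linst 0 q2 [a, j, r,
                LLam (LLam (LInd (LAp (LAp (llift 0 2 r) (LVar 1)) (LVar 0))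
                                 (llift 2 2 q1) (llift 4 2 q2)))])
             (linst 0 P [a, LTr a j r]))"

| l_Pos_F: "l_axset (\<turnstile>\<^sub>l t u) \<Gamma> s i c v \<Longrightarrow> \<turnstile>\<^sub>l t u (LTm \<Gamma> a (LT s)) \<Longrightarrow> \<turnstile>\<^sub>l t u (LTy \<Gamma> (LPos s i c v a))"
| l_Pos_ax1: "l_axset (\<turnstile>\<^sub>l t u) \<Gamma> s i c v \<Longrightarrow> \<turnstile>\<^sub>l t u (LTm \<Gamma> a (LT s)) \<Longrightarrow> \<turnstile>\<^sub>l t u (LTm \<Gamma> q (LPos s i c v a))
    \<Longrightarrow> \<turnstile>\<^sub>l t u (LTm \<Gamma> (LAx1 a q) (LT (LAp v a)))"
| l_Pos_ax2: "l_axset (\<turnstile>\<^sub>l t u) \<Gamma> s i c v \<Longrightarrow> \<turnstile>\<^sub>l t u (LTm \<Gamma> a (LT s)) \<Longrightarrow> \<turnstile>\<^sub>l t u (LTm \<Gamma> j (LT (linst 0 i [a])))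
    \<Longrightarrow> \<turnstile>\<^sub>l t u (LTm \<Gamma> q (LPos s i c v a))
    \<Longrightarrow> \<turnstile>\<^sub>l t u (LTm \<Gamma> (LAx2 a j q)
             (LSigma (LT s) (lprod (LT (LAp (linst 1 c [llift 0 1 a, llift 0 1 j]) (LVar 0)))
                                   (lpos_fam s i c v))))"
| l_Pos_ax3: "l_axset (\<turnstile>\<^sub>l t u) \<Gamma> s i c v \<Longrightarrow> \<turnstile>\<^sub>l t u (LTy (LT s # \<Gamma>) P) \<Longrightarrow> \<turnstile>\<^sub>l t u (LTm \<Gamma> a (LT s))
    \<Longrightarrow> \<turnstile>\<^sub>l t u (LTm \<Gamma> m (linst 0 P [a]))
    \<Longrightarrow> \<turnstile>\<^sub>l t u (LTm (P # LT s # \<Gamma>) q1 (LT (LAp (llift 0 2 v) (LVar 1))))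
    \<Longrightarrow> \<turnstile>\<^sub>l t u (LTm (linst 2 P [LVar 1] # LT i # LT s # \<Gamma>) q2
             (LSigma (LT (llift 0 3 s)) (lprod (LT (LAp (linst 4 c [LVar 3, LVar 2]) (LVar 0)))
                                               (linst 4 P [LVar 0]))))
    \<Longrightarrow> \<turnstile>\<^sub>l t u (LTm \<Gamma> (LAx3 m q1 q2) (LPos s i c v a))"

| l_CT: "\<turnstile>\<^sub>l t u (LCtx \<Gamma>) \<Longrightarrow> \<turnstile>\<^sub>l t u (LTm \<Gamma> LCt (lCT t u))"

no_notation MLtt_cind_CT (\<open>\<turnstile>\<^sub>l\<close>)


section \<open>The interpretation\<close>

text \<open>
  \<open>m2l_t\<close> is the interpretation of pre-terms; on a set or small proposition it yields the
  code of its interpretation as a pre-type, and its value on pre-types without a code is irrelevant.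
  In the clause for \<open>MAx3\<close> the pair produced by \<open>q\<^sub>2\<close> is swapped, as the two theories list the
  conjuncts \<open>P(y)\<close> and \<open>y \<epsilon> C(x,j)\<close> in opposite orders.  The axiom of choice is interpreted by
  its propositions-as-types proof.
\<close>

primrec m2l_t :: "mexp \<Rightarrow> lexp" where
  "m2l_t (MVar i) = LVar i"
| "m2l_t MN0 = LcN0"
| "m2l_t MN1 = LcN1"
| "m2l_t MNat = LcNat"
| "m2l_t (MList A) = LcList (m2l_t A)"
| "m2l_t (MPlus A B) = LcPlus (m2l_t A) (m2l_t B)"
| "m2l_t (MSigma A B) = LcSigma (m2l_t A) (m2l_t B)"
| "m2l_t (MPi A B) = LcPi (m2l_t A) (m2l_t B)"
| "m2l_t MFalsum = LcN0"
| "m2l_t (MAnd A B) = LcSigma (m2l_t A) (llift 0 1 (m2l_t B))"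
| "m2l_t (MOr A B) = LcPlus (m2l_t A) (m2l_t B)"
| "m2l_t (MImp A B) = LcPi (m2l_t A) (llift 0 1 (m2l_t B))"
| "m2l_t (MAll A B) = LcPi (m2l_t A) (m2l_t B)"
| "m2l_t (MEx A B) = LcSigma (m2l_t A) (m2l_t B)"
| "m2l_t (MId A a b) = LcId (m2l_t A) (m2l_t a) (m2l_t b)"
| "m2l_t MPropS = LU"
| "m2l_t (MCov A I C V a) = LcCov (m2l_t A) (m2l_t I) (m2l_t C) (m2l_t V) (m2l_t a)"
| "m2l_t (MPos A I C V a) = LcPos (m2l_t A) (m2l_t I) (m2l_t C) (m2l_t V) (m2l_t a)"
| "m2l_t (MEl0 c) = LEl0 (m2l_t c)"
| "m2l_t MStar = LStar"
| "m2l_t (MEl1 a c) = LEl1 (m2l_t a) (m2l_t c)"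
| "m2l_t MZero = LZero"
| "m2l_t (MSuc a) = LSuc (m2l_t a)"
| "m2l_t (MElN a c l) = LElN (m2l_t a) (m2l_t c) (m2l_t l)"
| "m2l_t MNil = LNil"
| "m2l_t (MCons s a) = LCons (m2l_t s) (m2l_t a)"
| "m2l_t (MElList s c l) = LElList (m2l_t s) (m2l_t c) (m2l_t l)"
| "m2l_t (MInl a) = LInl (m2l_t a)"
| "m2l_t (MInr b) = LInr (m2l_t b)"
| "m2l_t (MElPlus w c d) = LElPlus (m2l_t w) (m2l_t c) (m2l_t d)"
| "m2l_t (MPair a b) = LPair (m2l_t a) (m2l_t b)"
| "m2l_t (MElSigma d m) = LElSigma (m2l_t d) (m2l_t m)"
| "m2l_t (MLam b) = LLam (m2l_t b)"
| "m2l_t (MAp f a) = LAp (m2l_t f) (m2l_t a)"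
| "m2l_t (MElFalsum c) = LEl0 (m2l_t c)"
| "m2l_t (MAndPair a b) = LPair (m2l_t a) (m2l_t b)"
| "m2l_t (MPr1 d) = lfst (m2l_t d)"
| "m2l_t (MPr2 d) = lsnd (m2l_t d)"
| "m2l_t (MOrInl a) = LInl (m2l_t a)"
| "m2l_t (MOrInr b) = LInr (m2l_t b)"
| "m2l_t (MElOr w c d) = LElPlus (m2l_t w) (m2l_t c) (m2l_t d)"
| "m2l_t (MExPair a b) = LPair (m2l_t a) (m2l_t b)"
| "m2l_t (MElEx d m) = LElSigma (m2l_t d) (m2l_t m)"
| "m2l_t (MRefl a) = LRefl (m2l_t a)"
| "m2l_t (MElId p c) = LElId (m2l_t p) (m2l_t c)"
| "m2l_t (MRf a r) = LRf (m2l_t a) (m2l_t r)"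
| "m2l_t (MTr a j r) = LTr (m2l_t a) (m2l_t j) (m2l_t r)"
| "m2l_t (MInd m q1 q2) = LInd (m2l_t m) (m2l_t q1) (m2l_t q2)"
| "m2l_t (MAx1 a q) = LAx1 (m2l_t a) (m2l_t q)"
| "m2l_t (MAx2 a j q) = LAx2 (m2l_t a) (m2l_t j) (m2l_t q)"
| "m2l_t (MAx3 a m q1 q2) =
     LAx3 (m2l_t m) (m2l_t q1)
       (LElSigma (m2l_t q2) (LPair (LVar 1) (LPair (lsnd (LVar 0)) (lfst (LVar 0)))))"
| "m2l_t MAc =
     LLam (LPair (LLam (lfst (LAp (LVar 1) (LVar 0)))) (LLam (lsnd (LAp (LVar 1) (LVar 0)))))"
| "m2l_t MCt = LCt"

text \<open>
  \<open>m2l_T\<close> is the interpretation of pre-types.  A pre-type that is not headed by a type constructor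
  is an element of \<open>prop_s\<close>, and is interpreted by decoding its interpretation as a pre-term.
\<close>

fun m2l_T :: "mexp \<Rightarrow> lexp" where
  "m2l_T MN0 = LN0"
| "m2l_T MN1 = LN1"
| "m2l_T MNat = LNat"
| "m2l_T (MList A) = LList (m2l_T A)"
| "m2l_T (MPlus A B) = LPlus (m2l_T A) (m2l_T B)"
| "m2l_T (MSigma A B) = LSigma (m2l_T A) (m2l_T B)"
| "m2l_T (MPi A B) = LPi (m2l_T A) (m2l_T B)"
| "m2l_T MFalsum = LN0"
| "m2l_T (MAnd A B) = lprod (m2l_T A) (m2l_T B)"
| "m2l_T (MOr A B) = LPlus (m2l_T A) (m2l_T B)"
| "m2l_T (MImp A B) = larrow (m2l_T A) (m2l_T B)"
| "m2l_T (MAll A B) = LPi (m2l_T A) (m2l_T B)"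
| "m2l_T (MEx A B) = LSigma (m2l_T A) (m2l_T B)"
| "m2l_T (MId A a b) = LId (m2l_T A) (m2l_t a) (m2l_t b)"
| "m2l_T MPropS = LU"
| "m2l_T (MCov A I C V a) = LCov (m2l_t A) (m2l_t I) (m2l_t C) (m2l_t V) (m2l_t a)"
| "m2l_T (MPos A I C V a) = LPos (m2l_t A) (m2l_t I) (m2l_t C) (m2l_t V) (m2l_t a)"
| "m2l_T e = LT (m2l_t e)"

fun m2l :: "mjudg \<Rightarrow> ljudg" where
  "m2l (MCtx \<Gamma>) = LCtx (map m2l_T \<Gamma>)"
| "m2l (MTy \<Gamma> k A) = LTy (map m2l_T \<Gamma>) (m2l_T A)"
| "m2l (MTyEq \<Gamma> k A B) = LTyEq (map m2l_T \<Gamma>) (m2l_T A) (m2l_T B)"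
| "m2l (MTm \<Gamma> a A) = LTm (map m2l_T \<Gamma>) (m2l_t a) (m2l_T A)"
| "m2l (MTmEq \<Gamma> a b A) = LTmEq (map m2l_T \<Gamma>) (m2l_t a) (m2l_t b) (m2l_T A)"

definition mTT_consistent :: "recf \<Rightarrow> recf \<Rightarrow> bool" where
  "mTT_consistent t u \<longleftrightarrow> (\<nexists>a. mTT_cind_AC_CT t u (MTm [] a MFalsum))"

definition MLtt_consistent :: "recf \<Rightarrow> recf \<Rightarrow> bool" where
  "MLtt_consistent t u \<longleftrightarrow> (\<nexists>a. MLtt_cind_CT t u (LTm [] a LN0))"

end

theory Submission
  imports Defs
begin

text \<open>
  Substitution commutes with the interpretation of pre-terms on the nose, but with that of pre-types
  only up to judgemental equality: a variable in the place of a type is interpreted by decoding it,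
  and a small proposition substituted for it is interpreted by a type that merely equals its
  decoding.  Hence soundness is proved by induction over derivations for a stronger invariant: the
  interpretation of a type is stable under all interpreted substitutions up to equality, the code
  of a set or small proposition decodes to its interpretation as a type stably under substitution,
  and so does every term that happens to be headed by a type constructor.  As the congruence rules
  for types do not carry the typing of both sides as premises, presuppositions have to be recovered
  in the target theory first.
\<close>


section \<open>Renaming and substitution\<close>

text \<open>Congruence of terms exists in both theories only as replacement, and replacement
  transports unchanged because terms commute strictly with substitution. Types do have congruence
  rules, in which a body is given over just one of two equal domains, while the code of a binder
  wants its body over the decoded domain. Hence stability quantifies over arbitrary target contexts
  \<open>G\<close> and substitutions into them, in the manner of a Kripke-style logical relation: it
  is then closed under composition and can be carried under a binder into a context whose head
  merely equals the interpreted domain. Coherence of terms closes the circle at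
  \<open>prop_s\<close>: an element of \<open>prop_s\<close> is used as a type by the next rule, so
  its decoding must be known already. It is a disjunction because it is imposed on all terms. For a
  term outside the universe \<open>LT (m2l_t e)\<close> need not be a type, so no judgemental
  equation can be demanded; syntactic identity is available instead whenever the head is not a type
  constructor.\<close>

lemma upr_upr: "upr k \<rho> \<circ> upr k \<rho>' = upr k (\<rho> \<circ> \<rho>')"
  by (auto simp: upr_def fun_eq_iff)

text \<open>The composition laws come in the order renaming-renaming, substitution-renaming,
  renaming-substitution, substitution-substitution: a substitution passing under a binder has its
  values weakened by a renaming, so the binder cases of the last two laws rest on the earlier
  ones.\<close>

lemma lren_lren: "lren \<rho> (lren \<rho>' e) = lren (\<rho> \<circ> \<rho>') e"
  by (induction e arbitrary: \<rho> \<rho>') (simp_all add: upr_upr)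

lemma lups_upr: "lups k \<sigma> \<circ> upr k \<rho> = lups k (\<sigma> \<circ> \<rho>)"
  by (auto simp: upr_def lups_def fun_eq_iff)

lemma lsub_lren: "lsub \<sigma> (lren \<rho> e) = lsub (\<sigma> \<circ> \<rho>) e"
  by (induction e arbitrary: \<sigma> \<rho>) (simp_all add: lups_upr)

lemma lren_upr_llift: "lren (upr k \<rho>) (llift 0 k e) = llift 0 k (lren \<rho> e)"
proof -
  have "upr k \<rho> \<circ> upr 0 (\<lambda>i. i + k) = upr 0 (\<lambda>i. i + k) \<circ> \<rho>"
    by (auto simp: upr_def fun_eq_iff)
  then show ?thesis by (simp add: llift_def lren_lren)
qed

lemma lren_lups: "lren (upr k \<rho>) \<circ> lups k \<sigma> = lups k (lren \<rho> \<circ> \<sigma>)"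
proof
  fix i
  show "(lren (upr k \<rho>) \<circ> lups k \<sigma>) i = lups k (lren \<rho> \<circ> \<sigma>) i"
    by (cases "i < k") (simp_all add: lups_def lren_upr_llift, simp add: upr_def)
qed

lemma lren_lsub: "lren \<rho> (lsub \<sigma> e) = lsub (lren \<rho> \<circ> \<sigma>) e"
  by (induction e arbitrary: \<sigma> \<rho>) (simp_all add: lren_lups)

lemma lsub_lups_llift: "lsub (lups k \<sigma>) (llift 0 k e) = llift 0 k (lsub \<sigma> e)"
proof -
  have "lups k \<sigma> \<circ> upr 0 (\<lambda>i. i + k) = lren (upr 0 (\<lambda>i. i + k)) \<circ> \<sigma>"
    by (auto simp: lups_def upr_def fun_eq_iff llift_def)
  then show ?thesis by (simp add: llift_def lren_lsub lsub_lren)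
qed

lemma lsub_lups: "lsub (lups k \<sigma>) \<circ> lups k \<tau> = lups k (lsub \<sigma> \<circ> \<tau>)"
proof
  fix i
  show "(lsub (lups k \<sigma>) \<circ> lups k \<tau>) i = lups k (lsub \<sigma> \<circ> \<tau>) i"
    by (cases "i < k") (simp_all add: lups_def[of k \<tau>] lups_def[of k "lsub \<sigma> \<circ> \<tau>"]
      lsub_lups_llift, simp add: lups_def)
qed

lemma lsub_lsub: "lsub \<sigma> (lsub \<tau> e) = lsub (lsub \<sigma> \<circ> \<tau>) e"
  by (induction e arbitrary: \<sigma> \<tau>) (simp_all add: lsub_lups)

lemma lups_LVar: "lups k LVar = LVar"
  by (auto simp: lups_def fun_eq_iff llift_def upr_def)

lemma lsub_LVar [simp]: "lsub LVar e = e"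
  by (induction e) (simp_all add: lups_LVar)

lemma lren_eq_lsub: "lren \<rho> e = lsub (LVar \<circ> \<rho>) e"
  using lsub_lren[of LVar \<rho> e] by simp

lemma llift_eq_lsub: "llift k n e = lsub (\<lambda>i. LVar (if i < k then i else i + n)) e"
  unfolding llift_def lren_eq_lsub
  by (rule arg_cong[where f = "\<lambda>\<sigma>. lsub \<sigma> e"]) (auto simp: upr_def fun_eq_iff)

section \<open>The same calculus for the source syntax\<close>

lemma mren_mren: "mren \<rho> (mren \<rho>' e) = mren (\<rho> \<circ> \<rho>') e"
  by (induction e arbitrary: \<rho> \<rho>') (simp_all add: upr_upr)

lemma mups_upr: "mups k \<sigma> \<circ> upr k \<rho> = mups k (\<sigma> \<circ> \<rho>)"
  by (auto simp: upr_def mups_def fun_eq_iff)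

lemma msub_mren: "msub \<sigma> (mren \<rho> e) = msub (\<sigma> \<circ> \<rho>) e"
  by (induction e arbitrary: \<sigma> \<rho>) (simp_all add: mups_upr)

lemma mren_upr_mlift: "mren (upr k \<rho>) (mlift 0 k e) = mlift 0 k (mren \<rho> e)"
proof -
  have "upr k \<rho> \<circ> upr 0 (\<lambda>i. i + k) = upr 0 (\<lambda>i. i + k) \<circ> \<rho>"
    by (auto simp: upr_def fun_eq_iff)
  then show ?thesis by (simp add: mlift_def mren_mren)
qed

lemma mren_mups: "mren (upr k \<rho>) \<circ> mups k \<sigma> = mups k (mren \<rho> \<circ> \<sigma>)"
proof
  fix i
  show "(mren (upr k \<rho>) \<circ> mups k \<sigma>) i = mups k (mren \<rho> \<circ> \<sigma>) i"
    by (cases "i < k") (simp_all add: mups_def mren_upr_mlift, simp add: upr_def)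
qed

lemma mren_msub: "mren \<rho> (msub \<sigma> e) = msub (mren \<rho> \<circ> \<sigma>) e"
  by (induction e arbitrary: \<sigma> \<rho>) (simp_all add: mren_mups)

lemma msub_mups_mlift: "msub (mups k \<sigma>) (mlift 0 k e) = mlift 0 k (msub \<sigma> e)"
proof -
  have "mups k \<sigma> \<circ> upr 0 (\<lambda>i. i + k) = mren (upr 0 (\<lambda>i. i + k)) \<circ> \<sigma>"
    by (auto simp: mups_def upr_def fun_eq_iff mlift_def)
  then show ?thesis by (simp add: mlift_def mren_msub msub_mren)
qed

lemma msub_mups: "msub (mups k \<sigma>) \<circ> mups k \<tau> = mups k (msub \<sigma> \<circ> \<tau>)"
proof
  fix i
  show "(msub (mups k \<sigma>) \<circ> mups k \<tau>) i = mups k (msub \<sigma> \<circ> \<tau>) i"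
    by (cases "i < k") (simp_all add: mups_def[of k \<tau>] mups_def[of k "msub \<sigma> \<circ> \<tau>"]
      msub_mups_mlift, simp add: mups_def)
qed

lemma msub_msub: "msub \<sigma> (msub \<tau> e) = msub (msub \<sigma> \<circ> \<tau>) e"
  by (induction e arbitrary: \<sigma> \<tau>) (simp_all add: msub_mups)

lemma mups_MVar: "mups k MVar = MVar"
  by (auto simp: mups_def fun_eq_iff mlift_def upr_def)

lemma msub_MVar [simp]: "msub MVar e = e"
  by (induction e) (simp_all add: mups_MVar)

lemma mren_eq_msub: "mren \<rho> e = msub (MVar \<circ> \<rho>) e"
  using msub_mren[of MVar \<rho> e] by simp

lemma mlift_eq_msub: "mlift k n e = msub (\<lambda>i. MVar (if i < k then i else i + n)) e"
  unfolding mlift_def mren_eq_msub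
  by (rule arg_cong[where f = "\<lambda>\<sigma>. msub \<sigma> e"]) (auto simp: upr_def fun_eq_iff)


section \<open>The interpretation commutes with substitution up to decoding\<close>

lemma lfst_lren: "lren \<rho> (lfst d) = lfst (lren \<rho> d)"
  by (simp add: lfst_def upr_def)

lemma lsnd_lren: "lren \<rho> (lsnd d) = lsnd (lren \<rho> d)"
  by (simp add: lsnd_def upr_def)

lemma lfst_lsub: "lsub \<sigma> (lfst d) = lfst (lsub \<sigma> d)"
  by (simp add: lfst_def lups_def)

lemma lsnd_lsub: "lsub \<sigma> (lsnd d) = lsnd (lsub \<sigma> d)"
  by (simp add: lsnd_def lups_def)

text \<open>The clauses for \<open>MAx3\<close> and \<open>MAc\<close> introduce target binders of
  their own; their explicit bound variables are what remains for the second simplification, which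
  unfolds \<open>upr\<close>.\<close>

lemma m2l_t_mren: "m2l_t (mren \<rho> e) = lren \<rho> (m2l_t e)"
proof (induction e arbitrary: \<rho>)
qed (simp_all add: lfst_lren lsnd_lren lren_upr_llift, simp_all add: upr_def lfst_def lsnd_def)

lemma m2l_t_mlift: "m2l_t (mlift k n e) = llift k n (m2l_t e)"
  by (simp add: mlift_def llift_def m2l_t_mren)

lemma m2l_t_mups: "m2l_t \<circ> mups k \<sigma> = lups k (m2l_t \<circ> \<sigma>)"
  by (auto simp: mups_def lups_def fun_eq_iff m2l_t_mlift)

lemma m2l_t_msub: "m2l_t (msub \<sigma> e) = lsub (m2l_t \<circ> \<sigma>) (m2l_t e)"
proof (induction e arbitrary: \<sigma>)
qed (simp_all add: lfst_lsub lsnd_lsub lsub_lups_llift m2l_t_mups,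
     simp_all add: lups_def lfst_def lsnd_def llift_def upr_def)

lemma m2l_t_minst: "m2l_t (minst n e as) = linst n (m2l_t e) (map m2l_t as)"
  unfolding minst_def linst_def m2l_t_msub
  by (rule arg_cong[where f = "\<lambda>\<sigma>. lsub \<sigma> (m2l_t e)"]) (auto simp: fun_eq_iff rev_nth)

text \<open>Unlike a substitution, a renaming cannot put a type constructor in the place of a
  variable, so here even the interpretation of types commutes strictly.\<close>

lemma m2l_T_mren: "m2l_T (mren \<rho> e) = lren \<rho> (m2l_T e)"
proof (induction e arbitrary: \<rho>)
qed (simp_all add: m2l_t_mren lren_upr_llift lprod_def larrow_def lfst_lren lsnd_lren,
     simp_all add: upr_def lfst_def lsnd_def)

lemma m2l_T_mlift: "m2l_T (mlift k n e) = llift k n (m2l_T e)"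
  by (simp add: mlift_def llift_def m2l_T_mren)


section \<open>Derived rules of the target theory\<close>

text \<open>The rules are stated with \<open>1\<close>, which has to survive simplification for them to unify.\<close>

declare One_nat_def [simp del] One_nat_def [symmetric, simp] Suc_eq_plus1 [symmetric, simp]

lemma lsub_eqI: "(\<And>i. \<sigma> i = \<tau> i) \<Longrightarrow> lsub \<sigma> e = lsub \<tau> e"
  by (metis ext)

lemma msub_eqI: "(\<And>i. \<sigma> i = \<tau> i) \<Longrightarrow> msub \<sigma> e = msub \<tau> e"
  by (metis ext)

lemma case_nat_1 [simp]: "case_nat a \<sigma> 1 = \<sigma> 0"
  by (simp only: One_nat_def nat.case)

text \<open>An instantiation by a list becomes a chain of one-variable extensions, the last argument
  landing at index 0. This is the shape that \<open>lsubst_cons\<close> produces and that evaluates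
  on explicit variables.\<close>

lemma fold_case_nat:
  "fold case_nat as \<sigma> i = (if i < length as then rev as ! i else \<sigma> (i - length as))"
proof (induction as arbitrary: i rule: rev_induct)
  case (snoc a as)
  then show ?case by (cases i) auto
qed simp

lemma linst_eq_lsub: "linst n e as = lsub (fold case_nat as (\<lambda>i. LVar (i + n))) e"
  unfolding linst_def by (rule lsub_eqI) (simp add: fold_case_nat)

lemma minst_eq_msub: "minst n e as = msub (fold case_nat as (\<lambda>i. MVar (i + n))) e"
  unfolding minst_def by (rule msub_eqI) (simp add: fold_case_nat)

lemma llift_llift: "llift 0 m (llift 0 n e) = llift 0 (m + n) e"
  by (auto simp: llift_def lren_lren upr_def intro!: arg_cong[where f = "\<lambda>\<rho>. lren \<rho> e"])

abbreviation lshift :: "nat \<Rightarrow> nat \<Rightarrow> lexp" where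
  "lshift n \<equiv> \<lambda>i. LVar (i + n)"

lemmas lsub_norms = linst_eq_lsub llift_eq_lsub lsub_lsub lups_def lfst_lsub lsnd_lsub

lemma lvty_0 [simp]: "lvty (A # \<Gamma>) 0 = llift 0 1 A"
  by (simp add: lvty_def)

lemma lvty_Suc [simp]: "lvty (A # \<Gamma>) (Suc i) = llift 0 1 (lvty \<Gamma> i)"
  by (auto simp: lvty_def lsub_norms intro!: lsub_eqI)

lemma llift_0_lsub: "llift 0 n (lsub \<sigma> e) = lsub (llift 0 n \<circ> \<sigma>) e"
  by (simp add: llift_def lren_lsub)

lemma lsub_case_nat_llift: "lsub (case_nat a \<sigma>) (llift 0 1 e) = lsub \<sigma> e"
  by (auto simp: lsub_norms intro!: lsub_eqI)

primrec lctx :: "ljudg \<Rightarrow> lexp list" where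
  "lctx (LCtx \<Gamma>) = \<Gamma>"
| "lctx (LTy \<Gamma> A) = \<Gamma>"
| "lctx (LTyEq \<Gamma> A B) = \<Gamma>"
| "lctx (LTm \<Gamma> a A) = \<Gamma>"
| "lctx (LTmEq \<Gamma> a b A) = \<Gamma>"

lemmas l_Id_F = MLtt_cind_CT.l_Id_F
  and l_Id_F_eq = MLtt_cind_CT.l_Id_F_eq
  and l_List_F_eq = MLtt_cind_CT.l_List_F_eq
  and l_List_I2 = MLtt_cind_CT.l_List_I2
  and l_N_F = MLtt_cind_CT.l_N_F
  and l_N_I1 = MLtt_cind_CT.l_N_I1
  and l_N_I2 = MLtt_cind_CT.l_N_I2
  and l_Pi_C = MLtt_cind_CT.l_Pi_C
  and l_Pi_E = MLtt_cind_CT.l_Pi_E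
  and l_Pi_F = MLtt_cind_CT.l_Pi_F
  and l_Pi_F_eq = MLtt_cind_CT.l_Pi_F_eq
  and l_Pi_I = MLtt_cind_CT.l_Pi_I
  and l_Plus_F_eq = MLtt_cind_CT.l_Plus_F_eq
  and l_Plus_I1 = MLtt_cind_CT.l_Plus_I1
  and l_Plus_I2 = MLtt_cind_CT.l_Plus_I2
  and l_Sigma_E = MLtt_cind_CT.l_Sigma_E
  and l_Sigma_F = MLtt_cind_CT.l_Sigma_F
  and l_Sigma_F_eq = MLtt_cind_CT.l_Sigma_F_eq
  and l_Sigma_I = MLtt_cind_CT.l_Sigma_I
  and l_T_F = MLtt_cind_CT.l_T_F
  and l_U_F = MLtt_cind_CT.l_U_F
  and l_cPos = MLtt_cind_CT.l_cPos
  and l_tm_conv = MLtt_cind_CT.l_tm_conv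
  and l_tmeq_conv = MLtt_cind_CT.l_tmeq_conv
  and l_tmeq_refl = MLtt_cind_CT.l_tmeq_refl
  and l_tyeq_refl = MLtt_cind_CT.l_tyeq_refl
  and l_tyeq_sym = MLtt_cind_CT.l_tyeq_sym
  and l_tyeq_trans = MLtt_cind_CT.l_tyeq_trans
  and l_var = MLtt_cind_CT.l_var

text \<open>Both theories are parametrised by the definitions of Kleene's \<open>T\<close> and
  \<open>U\<close>; admissibility supplies the arities by which \<open>CT\<close> is a well-formed
  type.\<close>

locale kleene_pair =
  fixes t u :: recf
  assumes kleene: "kleene_TU t u"
begin

abbreviation lderiv :: "ljudg \<Rightarrow> bool" (\<open>\<turnstile> _\<close> [60] 60) where
  "\<turnstile> J \<equiv> MLtt_cind_CT t u J"

section \<open>Contexts, substitution and replacement in the target theory\<close>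

lemma lctx_consD: "\<turnstile> LCtx (A # \<Gamma>) \<Longrightarrow> \<turnstile> LCtx \<Gamma> \<and> \<turnstile> LTy \<Gamma> A"
  by (cases rule: MLtt_cind_CT.cases) auto

lemma lctx_deriv: "\<turnstile> J \<Longrightarrow> \<turnstile> LCtx (lctx J)"
  by (induction rule: MLtt_cind_CT.induct) (simp_all add: MLtt_cind_CT.l_ctx_nil MLtt_cind_CT.l_ctx_cons)

lemma lctx_ty: "\<turnstile> LTy \<Gamma> A \<Longrightarrow> \<turnstile> LCtx \<Gamma>"
  and lctx_tyeq: "\<turnstile> LTyEq \<Gamma> A B \<Longrightarrow> \<turnstile> LCtx \<Gamma>"
  and lctx_tm: "\<turnstile> LTm \<Gamma> a A \<Longrightarrow> \<turnstile> LCtx \<Gamma>"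
  using lctx_deriv by fastforce+

lemma lctx_cons_ty: "\<turnstile> LTy \<Gamma> A \<Longrightarrow> \<turnstile> LCtx (A # \<Gamma>)"
  by (simp add: MLtt_cind_CT.l_ctx_cons lctx_ty)

text \<open>Well-formedness of contexts is built into derivability, so the derived rules below read
  off the types of bound variables from deeper premises instead of assuming them.\<close>

lemma lty_hd:
  "\<turnstile> LTy (A # \<Gamma>) B \<Longrightarrow> \<turnstile> LTy \<Gamma> A"
  "\<turnstile> LTm (A # \<Gamma>) a B \<Longrightarrow> \<turnstile> LTy \<Gamma> A"
  "\<turnstile> LTyEq (A # \<Gamma>) B C \<Longrightarrow> \<turnstile> LTy \<Gamma> A"
  using lctx_ty lctx_tm lctx_tyeq lctx_consD by blast+

lemma ltyeq_conv_trans: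
  "\<turnstile> LTyEq \<Gamma> A B \<Longrightarrow> \<turnstile> LTyEq \<Gamma> C B \<Longrightarrow> \<turnstile> LTyEq \<Gamma> A C"
  by (blast intro: l_tyeq_trans l_tyeq_sym)

lemma ltyeq_refls:
  assumes "\<turnstile> LTyEq \<Gamma> A B"
  shows "\<turnstile> LTyEq \<Gamma> A A" "\<turnstile> LTyEq \<Gamma> B B"
  using assms by (blast intro: l_tyeq_trans l_tyeq_sym)+

definition lsubst :: "lexp list \<Rightarrow> (nat \<Rightarrow> lexp) \<Rightarrow> lexp list \<Rightarrow> bool" where
  "lsubst G \<sigma> H \<longleftrightarrow> l_subst (MLtt_cind_CT t u) G \<sigma> H"

lemma lsubst_app:
  assumes "lsubst G \<sigma> H"
  shows "\<turnstile> LTy H A \<Longrightarrow> \<turnstile> LTy G (lsub \<sigma> A)"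
    "\<turnstile> LTyEq H A B \<Longrightarrow> \<turnstile> LTyEq G (lsub \<sigma> A) (lsub \<sigma> B)"
    "\<turnstile> LTm H a A \<Longrightarrow> \<turnstile> LTm G (lsub \<sigma> a) (lsub \<sigma> A)"
    "\<turnstile> LTmEq H a b A \<Longrightarrow> \<turnstile> LTmEq G (lsub \<sigma> a) (lsub \<sigma> b) (lsub \<sigma> A)"
  using assms unfolding lsubst_def
  by (blast intro: MLtt_cind_CT.l_ty_sub MLtt_cind_CT.l_tyeq_sub MLtt_cind_CT.l_tm_sub
      MLtt_cind_CT.l_tmeq_sub)+

lemma lsubst_ctx: "lsubst G \<sigma> H \<Longrightarrow> \<turnstile> LCtx G" "lsubst G \<sigma> H \<Longrightarrow> \<turnstile> LCtx H"
  by (simp_all add: lsubst_def)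

lemma lsubst_id: "\<turnstile> LCtx G \<Longrightarrow> lsubst G LVar G"
  by (simp add: lsubst_def l_var)

lemma lvar_0: "\<turnstile> LTy \<Gamma> A \<Longrightarrow> \<turnstile> LTm (A # \<Gamma>) (LVar 0) (llift 0 1 A)"
  using l_var[OF lctx_cons_ty, where i = 0] by fastforce

text \<open>Weakening is not a primitive rule; it is the substitution rule at the shift by
  one.\<close>

lemma
  assumes "\<turnstile> LTy G X"
  shows lwk_ty: "\<turnstile> LTy G A \<Longrightarrow> \<turnstile> LTy (X # G) (llift 0 1 A)"
    and lwk_tyeq: "\<turnstile> LTyEq G A B \<Longrightarrow> \<turnstile> LTyEq (X # G) (llift 0 1 A) (llift 0 1 B)"
    and lwk_tm: "\<turnstile> LTm G a A \<Longrightarrow> \<turnstile> LTm (X # G) (llift 0 1 a) (llift 0 1 A)"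
    and lwk_tmeq: "\<turnstile> LTmEq G a b A \<Longrightarrow> \<turnstile> LTmEq (X # G) (llift 0 1 a) (llift 0 1 b) (llift 0 1 A)"
proof -
  have eq: "llift 0 1 e = lsub (\<lambda>i. LVar (Suc i)) e" for e
    by (simp add: llift_eq_lsub)
  have "lsubst (X # G) (\<lambda>i. LVar (Suc i)) G"
    unfolding lsubst_def
  proof (intro conjI allI impI)
    fix i assume "i < length G"
    then show "\<turnstile> LTm (X # G) (LVar (Suc i)) (lsub (\<lambda>i. LVar (Suc i)) (lvty G i))"
      using l_var[OF lctx_cons_ty[OF assms], of "Suc i"] by (simp add: eq)
  qed (use assms in \<open>auto intro: lctx_cons_ty lctx_ty\<close>)
  from lsubst_app[OF this]
  show "\<turnstile> LTy G A \<Longrightarrow> \<turnstile> LTy (X # G) (llift 0 1 A)"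
    "\<turnstile> LTyEq G A B \<Longrightarrow> \<turnstile> LTyEq (X # G) (llift 0 1 A) (llift 0 1 B)"
    "\<turnstile> LTm G a A \<Longrightarrow> \<turnstile> LTm (X # G) (llift 0 1 a) (llift 0 1 A)"
    "\<turnstile> LTmEq G a b A \<Longrightarrow> \<turnstile> LTmEq (X # G) (llift 0 1 a) (llift 0 1 b) (llift 0 1 A)"
    by (simp_all add: eq)
qed

lemma lsubst_wk:
  assumes "lsubst G \<sigma> H" "\<turnstile> LTy G X"
  shows "lsubst (X # G) (llift 0 1 \<circ> \<sigma>) H"
  unfolding lsubst_def
proof (intro conjI allI impI)
  fix i assume "i < length H"
  then have "\<turnstile> LTm G (\<sigma> i) (lsub \<sigma> (lvty H i))" using assms by (simp add: lsubst_def)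
  from lwk_tm[OF assms(2) this]
  show "\<turnstile> LTm (X # G) ((llift 0 1 \<circ> \<sigma>) i) (lsub (llift 0 1 \<circ> \<sigma>) (lvty H i))"
    by (simp add: llift_0_lsub)
qed (use assms in \<open>auto intro: lctx_cons_ty simp: lsubst_def\<close>)

lemma lsubst_cons:
  assumes "lsubst G \<sigma> H" "\<turnstile> LTy H A" "\<turnstile> LTm G a (lsub \<sigma> A)"
  shows "lsubst G (case_nat a \<sigma>) (A # H)"
  unfolding lsubst_def
proof (intro conjI allI impI)
  fix i assume "i < length (A # H)"
  then show "\<turnstile> LTm G (case_nat a \<sigma> i) (lsub (case_nat a \<sigma>) (lvty (A # H) i))"
    using assms by (cases i) (simp_all add: lsubst_def lsub_case_nat_llift)
qed (use assms in \<open>auto intro: lctx_cons_ty simp: lsubst_def\<close>)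

lemma lups_1: "lups 1 \<sigma> = case_nat (LVar 0) (llift 0 1 \<circ> \<sigma>)"
  by (auto simp: lups_def fun_eq_iff split: nat.split)

text \<open>The new head \<open>X\<close> only has to equal the substituted type: later it is often
  a decoding \<open>LT a\<close>, while the substitution yields an interpreted type.\<close>

lemma lsubst_up:
  assumes "lsubst G \<sigma> H" "\<turnstile> LTy H A" "\<turnstile> LTy G X" "\<turnstile> LTyEq G X (lsub \<sigma> A)"
  shows "lsubst (X # G) (lups 1 \<sigma>) (A # H)"
  unfolding lups_1
proof (rule lsubst_cons[OF lsubst_wk[OF assms(1,3)] assms(2)])
  have "\<turnstile> LTyEq (X # G) (llift 0 1 X) (lsub (llift 0 1 \<circ> \<sigma>) A)"
    using lwk_tyeq[OF assms(3,4)] by (simp add: llift_0_lsub)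
  with lvar_0[OF assms(3)] show "\<turnstile> LTm (X # G) (LVar 0) (lsub (llift 0 1 \<circ> \<sigma>) A)"
    by (rule l_tm_conv)
qed

text \<open>Conversion of contexts is the identity substitution between two contexts with equal
  entries.\<close>

lemma lctx_conv_cons:
  assumes "lsubst G LVar H" "\<turnstile> LTy H A" "\<turnstile> LTy G X" "\<turnstile> LTyEq G X A"
  shows "lsubst (X # G) LVar (A # H)"
  using lsubst_up[OF assms(1-3)] assms(4) by (simp add: lups_LVar)

lemma lctx_conv:
  assumes "lsubst G LVar H"
  shows "\<turnstile> LTy H A \<Longrightarrow> \<turnstile> LTy G A"
    "\<turnstile> LTyEq H A B \<Longrightarrow> \<turnstile> LTyEq G A B"
    "\<turnstile> LTm H a A \<Longrightarrow> \<turnstile> LTm G a A"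
    "\<turnstile> LTmEq H a b A \<Longrightarrow> \<turnstile> LTmEq G a b A"
  using lsubst_app[OF assms] by simp_all

text \<open>Equal terms can enter a type only through replacement; here the two substitutions are
  the identity except at the newest variable.\<close>

lemma lty_repl1:
  assumes "\<turnstile> LTy (A # \<Gamma>) B" "\<turnstile> LTm \<Gamma> a A" "\<turnstile> LTm \<Gamma> b A" "\<turnstile> LTmEq \<Gamma> a b A"
  shows "\<turnstile> LTyEq \<Gamma> (lsub (case_nat a LVar) B) (lsub (case_nat b LVar) B)"
proof -
  have \<Gamma>: "\<turnstile> LCtx \<Gamma>" using assms(2) by (rule lctx_tm)
  have A: "\<turnstile> LTy \<Gamma> A" using assms(1) by (rule lty_hd)
  have s: "lsubst \<Gamma> (case_nat c LVar) (A # \<Gamma>)" if "\<turnstile> LTm \<Gamma> c A" for c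
    using lsubst_cons[OF lsubst_id[OF \<Gamma>] A, of c] that by simp
  have "\<forall>i<length (A # \<Gamma>). \<turnstile> LTmEq \<Gamma> (case_nat a LVar i) (case_nat b LVar i)
      (lsub (case_nat a LVar) (lvty (A # \<Gamma>) i))"
  proof (intro allI impI)
    fix i assume "i < length (A # \<Gamma>)"
    then show "\<turnstile> LTmEq \<Gamma> (case_nat a LVar i) (case_nat b LVar i)
      (lsub (case_nat a LVar) (lvty (A # \<Gamma>) i))"
      using assms(4) \<Gamma> lsub_case_nat_llift[of a LVar]
      by (cases i) (auto intro!: l_tmeq_refl l_var)
  qed
  from MLtt_cind_CT.l_ty_repl[OF _ assms(1), of \<Gamma> "case_nat a LVar" "case_nat b LVar"] this
    s[OF assms(2)] s[OF assms(3)]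
  show ?thesis by (simp add: lsubst_def)
qed

text \<open>The decoding has no congruence rule of its own; replacement in the type
  \<open>LT (LVar 0)\<close> over \<open>LU\<close> supplies it.\<close>

lemma lT_cong:
  assumes "\<turnstile> LTm \<Gamma> a LU" "\<turnstile> LTm \<Gamma> b LU" "\<turnstile> LTmEq \<Gamma> a b LU"
  shows "\<turnstile> LTyEq \<Gamma> (LT a) (LT b)"
proof -
  have "\<turnstile> LTy \<Gamma> LU" using lctx_tm[OF assms(1)] by (rule l_U_F)
  from lvar_0[OF this] have "\<turnstile> LTy (LU # \<Gamma>) (LT (LVar 0))"
    by (intro l_T_F) (simp add: llift_def)
  from lty_repl1[OF this assms] show ?thesis by simp
qed

lemma llift_zero [simp]: "llift k 0 e = e"
proof -
  have "(\<lambda>i. LVar (if i < k then i else i + 0)) = LVar" by auto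
  then show ?thesis by (simp only: llift_eq_lsub lsub_LVar)
qed

lemma linst_Nil: "linst n e [] = llift 0 n e"
  by (simp add: lsub_norms)

lemma linst_llift: "length as = k \<Longrightarrow> linst n (llift 0 k e) as = llift 0 n e"
  by (auto simp: lsub_norms fold_case_nat intro!: lsub_eqI)

lemma
  assumes "\<turnstile> LTy (A # \<Gamma>) B"
  shows lwk2_ty: "\<turnstile> LTy \<Gamma> C \<Longrightarrow> \<turnstile> LTy (B # A # \<Gamma>) (llift 0 2 C)"
    and lwk2_tm: "\<turnstile> LTm \<Gamma> c C \<Longrightarrow> \<turnstile> LTm (B # A # \<Gamma>) (llift 0 2 c) (llift 0 2 C)"
  using lwk_ty[OF assms lwk_ty[OF lty_hd(1)[OF assms]]]
    lwk_tm[OF assms lwk_tm[OF lty_hd(1)[OF assms]]]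
  by (simp_all add: llift_llift)

lemma lsubst_wk1: "\<turnstile> LTy \<Gamma> A \<Longrightarrow> lsubst (A # \<Gamma>) (lshift 1) \<Gamma>"
  using lsubst_wk[OF lsubst_id] lctx_ty by (simp add: o_def llift_def upr_def)

lemma lsubst_wk2: "\<turnstile> LTy (A # \<Gamma>) B \<Longrightarrow> lsubst (B # A # \<Gamma>) (lshift 2) \<Gamma>"
  using lsubst_wk[OF lsubst_wk1[OF lty_hd(1)]] by (simp add: o_def llift_def upr_def)

lemma lsubst_up_same:
  "lsubst G \<sigma> H \<Longrightarrow> \<turnstile> LTy H A \<Longrightarrow> lsubst (lsub \<sigma> A # G) (lups 1 \<sigma>) (A # H)"
  by (rule lsubst_up) (auto intro: lsubst_app l_tyeq_refl)

lemma lsubst_inst1: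
  assumes "\<turnstile> LTy \<Gamma> A" "\<turnstile> LTm \<Gamma> a A"
  shows "lsubst \<Gamma> (case_nat a LVar) (A # \<Gamma>)"
  using lsubst_cons[OF lsubst_id assms(1)] assms lctx_tm by simp

section \<open>Connectives as non-dependent instances of the type formers\<close>

lemma larrow_F: "\<turnstile> LTy \<Gamma> A \<Longrightarrow> \<turnstile> LTy \<Gamma> B \<Longrightarrow> \<turnstile> LTy \<Gamma> (larrow A B)"
  unfolding larrow_def by (intro l_Pi_F lwk_ty)

lemma larrow_I: "\<turnstile> LTy \<Gamma> B \<Longrightarrow> \<turnstile> LTm (A # \<Gamma>) b (llift 0 1 B) \<Longrightarrow> \<turnstile> LTm \<Gamma> (LLam b) (larrow A B)"
  unfolding larrow_def by (rule l_Pi_I) (auto dest: lty_hd intro: lwk_ty)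

lemma larrow_E:
  assumes "\<turnstile> LTy \<Gamma> A" "\<turnstile> LTy \<Gamma> B" "\<turnstile> LTm \<Gamma> f (larrow A B)" "\<turnstile> LTm \<Gamma> a A"
  shows "\<turnstile> LTm \<Gamma> (LAp f a) B"
  using l_Pi_E[OF assms(1) lwk_ty[OF assms(1,2)] assms(3)[unfolded larrow_def] assms(4)]
  by (simp add: linst_llift)

lemma larrow_C:
  assumes "\<turnstile> LTy \<Gamma> B" "\<turnstile> LTm (A # \<Gamma>) b (llift 0 1 B)" "\<turnstile> LTm \<Gamma> a A"
  shows "\<turnstile> LTmEq \<Gamma> (LAp (LLam b) a) (linst 0 b [a]) B"
proof -
  note A = lty_hd(2)[OF assms(2)]
  from l_Pi_C[OF A lwk_ty[OF A assms(1)] assms(2,3)] show ?thesis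
    by (simp add: linst_llift)
qed

lemma lprod_F: "\<turnstile> LTy \<Gamma> A \<Longrightarrow> \<turnstile> LTy \<Gamma> B \<Longrightarrow> \<turnstile> LTy \<Gamma> (lprod A B)"
  unfolding lprod_def by (intro l_Sigma_F lwk_ty)

lemma lprod_I:
  "\<turnstile> LTy \<Gamma> A \<Longrightarrow> \<turnstile> LTy \<Gamma> B \<Longrightarrow> \<turnstile> LTm \<Gamma> a A \<Longrightarrow> \<turnstile> LTm \<Gamma> b B \<Longrightarrow> \<turnstile> LTm \<Gamma> (LPair a b) (lprod A B)"
  unfolding lprod_def by (rule l_Sigma_I) (simp_all add: lwk_ty linst_llift)

text \<open>Propositions are eliminated only towards propositions that do not depend on the
  proof-term, so the target eliminator is used with a weakened motive. The same holds for the sums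
  and pairs that follow.\<close>

lemma lEl0_nondep:
  assumes "\<turnstile> LTy \<Gamma> P" "\<turnstile> LTm \<Gamma> c LN0"
  shows "\<turnstile> LTm \<Gamma> (LEl0 c) P"
proof -
  have "\<turnstile> LTy \<Gamma> LN0" using lctx_ty[OF assms(1)] by (rule MLtt_cind_CT.l_N0_F)
  from MLtt_cind_CT.l_N0_E[OF lwk_ty[OF this assms(1)] assms(2)] show ?thesis
    by (simp add: linst_llift)
qed

lemma lPlus_nondep:
  assumes P: "\<turnstile> LTy \<Gamma> P" and c: "\<turnstile> LTm (A # \<Gamma>) c (llift 0 1 P)" and d: "\<turnstile> LTm (B # \<Gamma>) d (llift 0 1 P)"
  shows "\<turnstile> LTm \<Gamma> w (LPlus A B) \<Longrightarrow> \<turnstile> LTm \<Gamma> (LElPlus w c d) P"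
    and "\<turnstile> LTm \<Gamma> a A \<Longrightarrow> \<turnstile> LTmEq \<Gamma> (LElPlus (LInl a) c d) (linst 0 c [a]) P"
    and "\<turnstile> LTm \<Gamma> b B \<Longrightarrow> \<turnstile> LTmEq \<Gamma> (LElPlus (LInr b) c d) (linst 0 d [b]) P"
proof -
  note A = lty_hd(2)[OF c] and B = lty_hd(2)[OF d]
  have M: "\<turnstile> LTy (LPlus A B # \<Gamma>) (llift 0 1 P)"
    using MLtt_cind_CT.l_Plus_F[OF A B] P by (rule lwk_ty)
  show "\<turnstile> LTm \<Gamma> w (LPlus A B) \<Longrightarrow> \<turnstile> LTm \<Gamma> (LElPlus w c d) P"
    using MLtt_cind_CT.l_Plus_E[OF A B M] c d by (simp add: linst_llift)
  show "\<turnstile> LTm \<Gamma> a A \<Longrightarrow> \<turnstile> LTmEq \<Gamma> (LElPlus (LInl a) c d) (linst 0 c [a]) P"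
    using MLtt_cind_CT.l_Plus_C1[OF A B M] c d by (simp add: linst_llift)
  show "\<turnstile> LTm \<Gamma> b B \<Longrightarrow> \<turnstile> LTmEq \<Gamma> (LElPlus (LInr b) c d) (linst 0 d [b]) P"
    using MLtt_cind_CT.l_Plus_C2[OF A B M] c d by (simp add: linst_llift)
qed

lemma lSigma_nondep:
  assumes P: "\<turnstile> LTy \<Gamma> P" and m: "\<turnstile> LTm (B # A # \<Gamma>) m (llift 0 2 P)"
  shows "\<turnstile> LTm \<Gamma> d (LSigma A B) \<Longrightarrow> \<turnstile> LTm \<Gamma> (LElSigma d m) P"
    and "\<turnstile> LTm \<Gamma> a A \<Longrightarrow> \<turnstile> LTm \<Gamma> b (linst 0 B [a])
      \<Longrightarrow> \<turnstile> LTmEq \<Gamma> (LElSigma (LPair a b) m) (linst 0 m [a, b]) P"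
proof -
  note B = lty_hd(2)[OF m]
  note A = lty_hd(1)[OF B]
  have M: "\<turnstile> LTy (LSigma A B # \<Gamma>) (llift 0 1 P)"
    using l_Sigma_F[OF A B] P by (rule lwk_ty)
  show "\<turnstile> LTm \<Gamma> d (LSigma A B) \<Longrightarrow> \<turnstile> LTm \<Gamma> (LElSigma d m) P"
    using l_Sigma_E[OF A B M] m by (simp add: linst_llift)
  show "\<turnstile> LTm \<Gamma> a A \<Longrightarrow> \<turnstile> LTm \<Gamma> b (linst 0 B [a])
      \<Longrightarrow> \<turnstile> LTmEq \<Gamma> (LElSigma (LPair a b) m) (linst 0 m [a, b]) P"
    using MLtt_cind_CT.l_Sigma_C[OF A B M] m by (simp add: linst_llift)
qed

section \<open>Projections of dependent pairs\<close>

lemma lvar_1: "\<turnstile> LTy (A # \<Gamma>) B \<Longrightarrow> \<turnstile> LTm (B # A # \<Gamma>) (LVar 1) (llift 0 2 A)"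
proof -
  assume B: "\<turnstile> LTy (A # \<Gamma>) B"
  have "llift 0 1 (LVar 0) = LVar 1" by (simp add: llift_def upr_def)
  with lwk_tm[OF B lvar_0[OF lty_hd(1)[OF B]]] show ?thesis by (simp add: llift_llift)
qed

lemma lvar_0_prod: "\<turnstile> LTy \<Gamma> A \<Longrightarrow> \<turnstile> LTy \<Gamma> B \<Longrightarrow> \<turnstile> LTm (llift 0 1 B # A # \<Gamma>) (LVar 0) (llift 0 2 B)"
  using lvar_0[OF lwk_ty] by (force simp: llift_llift)

lemma lfst_I:
  "\<turnstile> LTy (A # \<Gamma>) B \<Longrightarrow> \<turnstile> LTm \<Gamma> d (LSigma A B) \<Longrightarrow> \<turnstile> LTm \<Gamma> (lfst d) A"
  unfolding lfst_def by (rule lSigma_nondep(1)[OF lty_hd(1) lvar_1])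

lemma lfst_C:
  assumes "\<turnstile> LTy (A # \<Gamma>) B" "\<turnstile> LTm \<Gamma> a A" "\<turnstile> LTm \<Gamma> b (linst 0 B [a])"
  shows "\<turnstile> LTmEq \<Gamma> (lfst (LPair a b)) a A"
  using lSigma_nondep(2)[OF lty_hd(1)[OF assms(1)] lvar_1[OF assms(1)] assms(2,3)]
  by (simp add: lfst_def linst_eq_lsub)

lemma lprod_E:
  assumes "\<turnstile> LTy \<Gamma> A" "\<turnstile> LTy \<Gamma> B"
  shows "\<turnstile> LTm \<Gamma> d (lprod A B) \<Longrightarrow> \<turnstile> LTm \<Gamma> (lfst d) A"
    and "\<turnstile> LTm \<Gamma> d (lprod A B) \<Longrightarrow> \<turnstile> LTm \<Gamma> (lsnd d) B"
    and "\<turnstile> LTm \<Gamma> a A \<Longrightarrow> \<turnstile> LTm \<Gamma> b B \<Longrightarrow> \<turnstile> LTmEq \<Gamma> (lfst (LPair a b)) a A"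
    and "\<turnstile> LTm \<Gamma> a A \<Longrightarrow> \<turnstile> LTm \<Gamma> b B \<Longrightarrow> \<turnstile> LTmEq \<Gamma> (lsnd (LPair a b)) b B"
proof -
  note B = lwk_ty[OF assms] and v = lvar_0_prod[OF assms]
  show "\<turnstile> LTm \<Gamma> d (lprod A B) \<Longrightarrow> \<turnstile> LTm \<Gamma> (lfst d) A"
    using lfst_I[OF B] by (simp add: lprod_def)
  show "\<turnstile> LTm \<Gamma> d (lprod A B) \<Longrightarrow> \<turnstile> LTm \<Gamma> (lsnd d) B"
    using lSigma_nondep(1)[OF assms(2) v] by (simp add: lprod_def lsnd_def)
  show "\<turnstile> LTm \<Gamma> a A \<Longrightarrow> \<turnstile> LTm \<Gamma> b B \<Longrightarrow> \<turnstile> LTmEq \<Gamma> (lfst (LPair a b)) a A"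
    using lfst_C[OF B] by (simp add: linst_llift)
  show "\<turnstile> LTm \<Gamma> a A \<Longrightarrow> \<turnstile> LTm \<Gamma> b B \<Longrightarrow> \<turnstile> LTmEq \<Gamma> (lsnd (LPair a b)) b B"
    using lSigma_nondep(2)[OF assms(2) v] by (simp add: linst_llift lsnd_def) (simp add: linst_eq_lsub)
qed

text \<open>Dependent elimination with motive \<open>B(lfst d)\<close>. The branch returns the
  second component, whose type is \<open>B(x)\<close> and not \<open>B(lfst (x, y))\<close>; the
  computation rule for the first projection and replacement in \<open>B\<close> bridge the
  gap.\<close>

lemma lsnd_I:
  assumes B: "\<turnstile> LTy (A # \<Gamma>) B" and d: "\<turnstile> LTm \<Gamma> d (LSigma A B)"
  shows "\<turnstile> LTm \<Gamma> (lsnd d) (linst 0 B [lfst d])"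
proof -
  let ?w = "\<lambda>i. LVar (i + 2)" and ?p = "lfst (LPair (LVar 1) (LVar 0))"
  let ?B = "lsub (lups 1 ?w) B" and ?\<Delta> = "B # A # \<Gamma>" and ?M = "linst 1 B [lfst (LVar 0)]"
  note A = lty_hd(1)[OF B]
  have S: "\<turnstile> LTy \<Gamma> (LSigma A B)" using A B by (rule l_Sigma_F)
  note w = lsubst_wk2[OF B]
  note A2 = lsubst_app(1)[OF w A] and B2 = lsubst_app(1)[OF lsubst_up_same[OF w A] B]
  have v1: "\<turnstile> LTm ?\<Delta> (LVar 1) (lsub ?w A)"
    using lvar_1[OF B] by (simp add: llift_eq_lsub)
  have v0: "\<turnstile> LTm ?\<Delta> (LVar 0) (lsub (case_nat (LVar 1) LVar) ?B)"
  proof -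
    have "llift 0 1 B = lsub (case_nat (LVar 1) LVar) ?B"
      by (auto simp: lsub_norms split: nat.split intro!: lsub_eqI)
    with lvar_0[OF B] show ?thesis by simp
  qed
  have v0': "\<turnstile> LTm ?\<Delta> (LVar 0) (linst 0 ?B [LVar 1])"
    using v0 by (simp add: linst_eq_lsub)
  have p: "\<turnstile> LTm ?\<Delta> ?p (lsub ?w A)" and eq: "\<turnstile> LTmEq ?\<Delta> ?p (LVar 1) (lsub ?w A)"
    using lfst_I[OF B2 l_Sigma_I[OF A2 B2 v1 v0']] lfst_C[OF B2 v1 v0'] .
  have "linst 2 ?M [LPair (LVar 1) (LVar 0)] = lsub (case_nat ?p LVar) ?B"
    by (auto simp: lsub_norms split: nat.split intro!: lsub_eqI)
  with lty_repl1[OF B2 p v1 eq] v0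
  have m: "\<turnstile> LTm ?\<Delta> (LVar 0) (linst 2 ?M [LPair (LVar 1) (LVar 0)])"
    by (metis l_tm_conv l_tyeq_sym)
  note wS = lsubst_wk1[OF S]
  have "\<turnstile> LTm (LSigma A B # \<Gamma>) (lfst (LVar 0)) (lsub (lshift 1) A)"
    by (rule lfst_I[OF lsubst_app(1)[OF lsubst_up_same[OF wS A] B]])
      (use lvar_0[OF S] in \<open>simp add: llift_eq_lsub\<close>)
  from lsubst_app(1)[OF lsubst_cons[OF wS A this] B]
  have M: "\<turnstile> LTy (LSigma A B # \<Gamma>) ?M" by (simp add: linst_eq_lsub)
  have "linst 0 ?M [d] = linst 0 B [lfst d]"
    by (auto simp: lsub_norms split: nat.split intro!: lsub_eqI)
  with l_Sigma_E[OF A B M d m] show ?thesis by (simp add: lsnd_def)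
qed

text \<open>The target motive may depend on the identity proof, the source motive may not, so the
  latter is weakened by the proof variable.\<close>

lemma lId_nondep:
  assumes P: "\<turnstile> LTy (llift 0 1 A # A # \<Gamma>) P" and c: "\<turnstile> LTm (A # \<Gamma>) c (linst 1 P [LVar 0, LVar 0])"
    and a: "\<turnstile> LTm \<Gamma> a A"
  shows "\<turnstile> LTm \<Gamma> b A \<Longrightarrow> \<turnstile> LTm \<Gamma> p (LId A a b) \<Longrightarrow> \<turnstile> LTm \<Gamma> (LElId p c) (linst 0 P [a, b])"
    and "\<turnstile> LTmEq \<Gamma> (LElId (LRefl a) c) (linst 0 c [a]) (linst 0 P [a, a])"
proof -
  note A1 = lty_hd(1)[OF P]
  note A = lty_hd(1)[OF A1]
  have v: "\<turnstile> LTm (llift 0 1 A # A # \<Gamma>) (LVar 0) (llift 0 2 A)" using lvar_0_prod[OF A A] .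
  have "\<turnstile> LTy (llift 0 1 A # A # \<Gamma>) (LId (llift 0 2 A) (LVar 1) (LVar 0))"
    by (rule l_Id_F[OF lwk2_ty[OF A1 A] lvar_1[OF A1] v])
  from lwk_ty[OF this P]
  have M: "\<turnstile> LTy (LId (llift 0 2 A) (LVar 1) (LVar 0) # llift 0 1 A # A # \<Gamma>) (llift 0 1 P)" .
  have inst: "linst n (llift 0 1 P) [x, y, z] = linst n P [x, y]" for n x y z
    by (auto simp: lsub_norms split: nat.split intro!: lsub_eqI)
  show "\<turnstile> LTm \<Gamma> b A \<Longrightarrow> \<turnstile> LTm \<Gamma> p (LId A a b) \<Longrightarrow> \<turnstile> LTm \<Gamma> (LElId p c) (linst 0 P [a, b])"
    using MLtt_cind_CT.l_Id_E[OF A M a, of b p c] c by (simp add: inst)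
  show "\<turnstile> LTmEq \<Gamma> (LElId (LRefl a) c) (linst 0 c [a]) (linst 0 P [a, a])"
    using MLtt_cind_CT.l_Id_C[OF A M a, of c] c by (simp add: inst)
qed

section \<open>Type-theoretic choice\<close>

lemma lapp_vars:
  assumes C: "\<turnstile> LTy (A # \<Gamma>) C"
  shows "\<turnstile> LTm (llift 0 1 A # LPi A C # \<Gamma>) (LAp (LVar 1) (LVar 0))
    (lsub (case_nat (LVar 0) (lshift 2)) C)"
proof -
  note A = lty_hd(1)[OF C]
  note P = l_Pi_F[OF A C]
  note A1 = lwk_ty[OF P A]
  note w = lsubst_wk2[OF A1]
  note A2 = lsubst_app(1)[OF w A] and C2 = lsubst_app(1)[OF lsubst_up_same[OF w A] C]
  let ?C = "lsub (lups 1 (lshift 2)) C"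
  have "\<turnstile> LTm (llift 0 1 A # LPi A C # \<Gamma>) (LVar 1) (lsub (lshift 2) (LPi A C))"
    using lvar_1[OF A1] by (simp only: llift_eq_lsub) simp
  moreover have "\<turnstile> LTm (llift 0 1 A # LPi A C # \<Gamma>) (LVar 0) (lsub (lshift 2) A)"
    using lvar_0[OF A1] by (simp add: llift_llift) (simp add: llift_eq_lsub)
  ultimately have "\<turnstile> LTm (llift 0 1 A # LPi A C # \<Gamma>) (LAp (LVar 1) (LVar 0)) (linst 0 ?C [LVar 0])"
    using l_Pi_E[OF A2 C2] by simp
  moreover have "linst 0 ?C [LVar 0] = lsub (case_nat (LVar 0) (lshift 2)) C"
    by (auto simp: lsub_norms split: nat.split intro!: lsub_eqI)
  ultimately show ?thesis by simp
qed

text \<open>From \<open>h\<close> the choice function takes the first projection of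
  \<open>h(x)\<close> and its correctness proof the second. That proof has type
  \<open>R(x, lfst (h(x)))\<close>, whereas the conclusion speaks of \<open>R(x, f(x))\<close>, and
  \<open>f(x)\<close> is only judgementally equal to that projection: one beta step and replacement
  in \<open>R\<close> are needed.\<close>

lemma lchoice:
  assumes R: "\<turnstile> LTy (B # A # \<Gamma>) R"
  shows "\<turnstile> LTm \<Gamma>
    (LLam (LPair (LLam (lfst (LAp (LVar 1) (LVar 0)))) (LLam (lsnd (LAp (LVar 1) (LVar 0))))))
    (larrow (LPi A (LSigma B R))
      (LSigma (LPi A B) (LPi (llift 0 1 A) (linst 2 R [LVar 0, LAp (LVar 1) (LVar 0)]))))"
    (is "\<turnstile> LTm \<Gamma> (LLam (LPair ?f (LLam ?y))) (larrow ?H (LSigma ?F (LPi ?A ?R)))")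
proof -
  note B = lty_hd(1)[OF R]
  note A = lty_hd(1)[OF B]
  \<comment> \<open>This substitution inserts one hypothesis between \<open>\<Gamma>\<close> and
    \<open>x\<close>; it is used both for the premise \<open>?H\<close> and for the type
    \<open>?F\<close> of choice functions.\<close>
  let ?\<rho> = "case_nat (LVar 0) (lshift 2)" and ?B = "llift 1 1 B"
  let ?\<Delta> = "?A # ?H # \<Gamma>" and ?x = "lfst (LAp (LVar 1) (LVar 0))"
  \<comment> \<open>The choice function weakened by \<open>x\<close>: the hypothesis is one index
    further away than in \<open>?f\<close>.\<close>
  let ?f' = "LLam (lfst (LAp (LVar 2) (LVar 0)))"
  have H: "\<turnstile> LTy \<Gamma> ?H" and F: "\<turnstile> LTy \<Gamma> ?F"
    by (intro l_Pi_F l_Sigma_F A B R)+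
  have \<rho>: "lsubst (?A # X # \<Gamma>) ?\<rho> (A # \<Gamma>)" if X: "\<turnstile> LTy \<Gamma> X" for X
    by (rule lsubst_cons[OF lsubst_wk2[OF lwk_ty[OF X A]] A])
      (use lvar_0[OF lwk_ty[OF X A]] in \<open>simp add: llift_llift, simp add: llift_eq_lsub\<close>)
  have Beq: "?B = lsub ?\<rho> B" by (auto simp: llift_eq_lsub split: nat.split intro!: lsub_eqI)
  have B': "\<turnstile> LTy (?A # X # \<Gamma>) ?B" if X: "\<turnstile> LTy \<Gamma> X" for X
    using lsubst_app(1)[OF \<rho>[OF X] B] by (simp add: Beq)
  have R': "\<turnstile> LTy (?B # ?\<Delta>) (lsub (lups 1 ?\<rho>) R)"
    unfolding Beq by (rule lsubst_app(1)[OF lsubst_up_same[OF \<rho>[OF H] B] R])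
  have hx: "\<turnstile> LTm ?\<Delta> (LAp (LVar 1) (LVar 0)) (LSigma ?B (lsub (lups 1 ?\<rho>) R))"
    using lapp_vars[OF l_Sigma_F[OF B R]] by (simp add: Beq)
  note x = lfst_I[OF R' hx]
  have y: "\<turnstile> LTm ?\<Delta> ?y (lsub (case_nat ?x LVar) (lsub (lups 1 ?\<rho>) R))"
    using lsnd_I[OF R' hx] by (simp add: linst_eq_lsub)
  note A1 = lwk_ty[OF H A]
  have f: "\<turnstile> LTm (?H # \<Gamma>) ?f (LPi ?A ?B)"
    by (rule l_Pi_I[OF A1 B'[OF H] x])
  have fx: "\<turnstile> LTm ?\<Delta> (LAp ?f' (LVar 0)) ?B" "\<turnstile> LTmEq ?\<Delta> (LAp ?f' (LVar 0)) ?x ?B"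
  proof -
    note wA = lsubst_wk1[OF A1]
    note A2 = lsubst_app(1)[OF wA A1] and up = lsubst_up_same[OF wA A1]
    let ?C = "lsub (lups 1 (lshift 1)) ?B"
    note C = lsubst_app(1)[OF up B'[OF H]]
    have b: "\<turnstile> LTm (lsub (lshift 1) ?A # ?\<Delta>) (lfst (LAp (LVar 2) (LVar 0))) ?C"
      using lsubst_app(3)[OF up x] by (simp add: lfst_lsub lups_def llift_eq_lsub)
    have v: "\<turnstile> LTm ?\<Delta> (LVar 0) (lsub (lshift 1) ?A)"
      using lvar_0[OF A1] by (simp add: llift_eq_lsub)
    have ty: "linst 0 ?C [LVar 0] = ?B"
      by (auto simp: lsub_norms split: nat.split intro!: lsub_eqI)
    from l_Pi_E[OF A2 C l_Pi_I[OF A2 C b] v]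
    show "\<turnstile> LTm ?\<Delta> (LAp ?f' (LVar 0)) ?B" by (simp only: ty)
    have "linst 0 (lfst (LAp (LVar 2) (LVar 0))) [LVar 0] = ?x"
      by (simp add: linst_eq_lsub lfst_lsub)
    with l_Pi_C[OF A2 C b v] show "\<turnstile> LTmEq ?\<Delta> (LAp ?f' (LVar 0)) ?x ?B"
      by (simp only: ty)
  qed
  have R: "\<turnstile> LTy (?F # \<Gamma>) (LPi ?A ?R)"
  proof (rule l_Pi_F[OF lwk_ty[OF F A]])
    have "lsubst (?A # ?F # \<Gamma>) (case_nat (LAp (LVar 1) (LVar 0)) ?\<rho>) (B # A # \<Gamma>)"
      by (rule lsubst_cons[OF \<rho>[OF F] B]) (rule lapp_vars[OF B])
    from lsubst_app(1)[OF this R] show "\<turnstile> LTy (?A # ?F # \<Gamma>) ?R"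
      by (simp add: linst_eq_lsub)
  qed
  let ?S = "lsub (lups 1 (lshift 1)) (LPi ?A ?R)"
  have wk: "llift 0 1 e = lsub (lshift 1) e" for e
    by (simp add: llift_eq_lsub)
  have Feq: "lsub (lshift 1) ?F = LPi ?A ?B"
    by (auto simp: lsub_norms intro!: lsub_eqI)
  have S: "\<turnstile> LTy (LPi ?A ?B # ?H # \<Gamma>) ?S"
    using lsubst_app(1)[OF lsubst_up_same[OF lsubst_wk1[OF H] F] R] by (simp only: Feq)
  have Seq: "linst 0 ?S [?f] = LPi ?A (lsub (case_nat (LAp ?f' (LVar 0)) LVar) (lsub (lups 1 ?\<rho>) R))"
    by (auto simp: lsub_norms split: nat.split intro!: lsub_eqI)
  \<comment> \<open>The conversion from \<open>R(x, lfst (h(x)))\<close> to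
    \<open>R(x, f(x))\<close>.\<close>
  have y': "\<turnstile> LTm ?\<Delta> ?y (lsub (case_nat (LAp ?f' (LVar 0)) LVar) (lsub (lups 1 ?\<rho>) R))"
    by (rule l_tm_conv[OF y l_tyeq_sym[OF lty_repl1[OF R' fx(1) x fx(2)]]])
  have g: "\<turnstile> LTm (?H # \<Gamma>) (LLam ?y) (linst 0 ?S [?f])"
    unfolding Seq
    by (rule l_Pi_I[OF A1 lsubst_app(1)[OF lsubst_inst1[OF B'[OF H] fx(1)] R'] y'])
  show ?thesis
  proof (rule larrow_I)
    show "\<turnstile> LTy \<Gamma> (LSigma ?F (LPi ?A ?R))" using F R by (rule l_Sigma_F)
    have "\<turnstile> LTm (?H # \<Gamma>) (LPair ?f (LLam ?y)) (LSigma (LPi ?A ?B) ?S)"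
      by (rule l_Sigma_I[OF l_Pi_F[OF A1 B'[OF H]] S f g])
    then show "\<turnstile> LTm (?H # \<Gamma>) (LPair ?f (LLam ?y)) (llift 0 1 (LSigma ?F (LPi ?A ?R)))"
      by (simp only: wk[of "LSigma ?F (LPi ?A ?R)"] lsub.simps(7) Feq)
  qed
qed

section \<open>Terms for primitive recursive functions\<close>

lemma llift_LNat [simp]: "llift k n LNat = LNat"
  by (simp add: llift_def)

text \<open>The arity keeps every access to the argument list in range. The context is generalised
  because the step of a recursion lives over two further natural numbers.\<close>

lemma lpr_typed:
  assumes "rec_arity n f" "length as = n" "\<forall>a\<in>set as. \<turnstile> LTm \<Gamma> a LNat" "\<turnstile> LCtx \<Gamma>"
  shows "\<turnstile> LTm \<Gamma> (lpr f as) LNat"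
  using assms
proof (induction arbitrary: as \<Gamma> rule: rec_arity.induct)
  case (4 gs f n)
  then show ?case by auto
next
  case (5 n g h)
  then obtain a as' where as: "as = a # as'" by (cases as) auto
  have N: "\<turnstile> LTy \<Gamma> LNat" using 5 by (intro l_N_F)
  have NN: "\<turnstile> LTy (LNat # \<Gamma>) LNat" using lwk_ty[OF N N] by simp
  have "\<turnstile> LTm (LNat # LNat # \<Gamma>) (lpr h ([LVar 1, LVar 0] @ map (llift 0 2) as')) LNat"
  proof (rule 5(4))
    show "\<forall>a\<in>set ([LVar 1, LVar 0] @ map (llift 0 2) as'). \<turnstile> LTm (LNat # LNat # \<Gamma>) a LNat"
      using 5(6) lvar_1[OF NN] lvar_0[OF NN] lwk2_tm[OF NN] by (force simp: as)
  qed (use 5(5) NN as in \<open>auto intro: lctx_cons_ty\<close>)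
  moreover have "\<turnstile> LTm \<Gamma> (lpr g as') LNat" using 5 as by simp
  ultimately show ?case
    using MLtt_cind_CT.l_N_E[OF NN, of a] 5(6) by (simp add: as linst_eq_lsub)
qed (auto intro: l_N_I1 l_N_I2)

text \<open>The arity is what lets \<open>map\<close> commute with \<open>nth\<close> and, in the
  recursion case, exposes a head argument.\<close>

lemma m2l_t_mpr: "rec_arity n f \<Longrightarrow> length as = n \<Longrightarrow> m2l_t (mpr f as) = lpr f (map m2l_t as)"
proof (induction arbitrary: as rule: rec_arity.induct)
  case (4 gs f n)
  then show ?case by (simp add: o_def cong: map_cong)
next
  case (5 n g h)
  then obtain a as' where "as = a # as'" by (cases as) auto
  with 5 show ?case by (simp add: m2l_t_mlift o_def)
qed simp_all

subsection \<open>Covers and positivity relations\<close>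

abbreviation laxset :: "lexp list \<Rightarrow> lexp \<Rightarrow> lexp \<Rightarrow> lexp \<Rightarrow> lexp \<Rightarrow> bool" where
  "laxset \<equiv> l_axset (MLtt_cind_CT t u)"

lemma upr_0 [simp]: "upr 0 \<rho> = \<rho>"
  by (simp add: upr_def fun_eq_iff)

lemma lups_0 [simp]: "lups 0 \<rho> = \<rho>"
  by (simp add: lups_def fun_eq_iff)

lemma lups_lups: "lups j (lups k \<sigma>) = lups (j + k) \<sigma>"
proof
  fix i
  show "lups j (lups k \<sigma>) i = lups (j + k) \<sigma> i"
    by (cases "i < j"; cases "i - j < k")
      (auto simp: lups_def llift_llift diff_diff_add, auto simp: llift_def upr_def)
qed

lemma lups_2: "lups 2 \<sigma> = lups 1 (lups 1 \<sigma>)" and lups_3: "lups 3 \<sigma> = lups 1 (lups 2 \<sigma>)"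
  and lups_4: "lups 4 \<sigma> = lups 1 (lups 3 \<sigma>)"
  by (simp_all add: lups_lups)

text \<open>The parameters \<open>i\<close> and \<open>c\<close> of a cover bind variables, so
  weakening the family inserts a fresh variable beneath theirs; this is the commutation for such an
  insertion.\<close>

lemma lsub_llift_lups: "lsub (lups j (lups k \<rho>)) (llift j k e) = llift j k (lsub (lups j \<rho>) e)"
proof -
  have "lups k \<rho> \<circ> (\<lambda>i. i + k) = lren (\<lambda>i. i + k) \<circ> \<rho>"
    by (auto simp: fun_eq_iff lups_def llift_def upr_def)
  then show ?thesis by (simp add: llift_def lsub_lren lren_lsub lups_upr lren_lups)
qed

lemma linst_lsub:
  "lsub (lups n \<rho>) (linst n e as) = linst n (lsub (lups (length as) \<rho>) e) (map (lsub (lups n \<rho>)) as)"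
proof -
  have "lsub (fold case_nat (map (lsub (lups n \<rho>)) as) (lshift n)) (llift 0 (length as) d)
      = llift 0 n d" for d
    using linst_llift[of "map (lsub (lups n \<rho>)) as" "length as" n d] by (simp add: linst_eq_lsub)
  then show ?thesis
    by (auto simp: linst_eq_lsub lsub_lsub fold_case_nat lups_def rev_nth intro!: lsub_eqI)
qed

lemma larrow_lsub: "lsub \<sigma> (larrow A B) = larrow (lsub \<sigma> A) (lsub \<sigma> B)"
  by (simp add: larrow_def lsub_lups_llift)

lemma llift_LT [simp]: "llift k n (LT e) = LT (llift k n e)"
  by (simp add: llift_def)

lemma lcov_fam_inst:
  "linst n (lcov_fam s i c v) [a] = LCov (llift 0 n s) (llift 1 n i) (llift 2 n c) (llift 0 n v) a"
  by (auto simp: lcov_fam_def lsub_norms split: nat.split intro!: lsub_eqI)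

lemma lsub_case_nat_LVar_Suc [simp]:
  "lsub (case_nat a \<sigma>) \<circ> (\<lambda>i. LVar (Suc i)) = \<sigma>"
  "lsub (case_nat b (case_nat a \<sigma>)) \<circ> (\<lambda>i. LVar (Suc (Suc i))) = \<sigma>"
  by (simp_all add: fun_eq_iff)

lemma lsub_case_nat_LVar_3 [simp]:
  "lsub (case_nat d (case_nat b (case_nat a \<sigma>))) \<circ> (lshift 3) = \<sigma>"
proof
  fix i
  have "i + 3 = Suc (Suc (Suc i))" by arith
  then show "(lsub (case_nat d (case_nat b (case_nat a \<sigma>))) \<circ> (lshift 3)) i = \<sigma> i"
    by (simp only: o_def lsub.simps nat.case)
qed

lemma laxset_sub:
  assumes \<rho>: "lsubst G \<rho> \<Gamma>" and ax: "laxset \<Gamma> s i c v"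
  shows "laxset G (lsub \<rho> s) (lsub (lups 1 \<rho>) i) (lsub (lups 2 \<rho>) c) (lsub \<rho> v)"
proof -
  from ax have s: "\<turnstile> LTm \<Gamma> s LU" and i: "\<turnstile> LTm (LT s # \<Gamma>) i LU"
    and c: "\<turnstile> LTm (LT i # LT s # \<Gamma>) c (LPi (LT (llift 0 2 s)) LU)" and v: "\<turnstile> LTm \<Gamma> v (LPi (LT s) LU)" by auto
  note up = lsubst_up_same[OF \<rho> l_T_F[OF s]]
  note up2 = lsubst_up_same[OF up l_T_F[OF i]]
  have "lsub (lups 2 \<rho>) (llift 0 2 s) = llift 0 2 (lsub \<rho> s)" by (rule lsub_lups_llift)
  with lsubst_app(3)[OF \<rho> s] lsubst_app(3)[OF up i] lsubst_app(3)[OF up2 c] lsubst_app(3)[OF \<rho> v]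
  show ?thesis by (simp add: lups_2[symmetric] lups_def)
qed

lemma lapp_U: "\<turnstile> LTm G f (LPi (LT S) LU) \<Longrightarrow> \<turnstile> LTm G S LU \<Longrightarrow> \<turnstile> LTm G a (LT S) \<Longrightarrow> \<turnstile> LTm G (LAp f a) LU"
proof -
  assume f: "\<turnstile> LTm G f (LPi (LT S) LU)" and S: "\<turnstile> LTm G S LU" and a: "\<turnstile> LTm G a (LT S)"
  note S' = l_T_F[OF S]
  from l_Pi_E[OF S' l_U_F[OF lctx_cons_ty[OF S']] f a] show ?thesis
    by (simp add: linst_eq_lsub)
qed

lemma laxset_c:
  assumes \<rho>: "lsubst G \<rho> \<Gamma>" and ax: "laxset \<Gamma> s i c v"
    and x: "\<turnstile> LTm G x (LT (lsub \<rho> s))" and j: "\<turnstile> LTm G j (LT (lsub (case_nat x \<rho>) i))"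
  shows "\<turnstile> LTm G (lsub (case_nat j (case_nat x \<rho>)) c) (LPi (LT (lsub \<rho> s)) LU)"
proof -
  have 1: "lsubst G (case_nat x \<rho>) (LT s # \<Gamma>)"
    using ax x by (intro lsubst_cons[OF \<rho>] l_T_F) auto
  have 2: "lsubst G (case_nat j (case_nat x \<rho>)) (LT i # LT s # \<Gamma>)"
    using ax j by (intro lsubst_cons[OF 1] l_T_F) auto
  have "lsub (case_nat j (case_nat x \<rho>)) (llift 0 2 s) = lsub \<rho> s"
    by (auto simp: lsub_norms intro!: lsub_eqI)
  with lsubst_app(3)[OF 2] ax show ?thesis by fastforce
qed

lemma lfam_typed:
  assumes "laxset \<Gamma> s i c v"
  shows "\<turnstile> LTy (LT s # \<Gamma>) (lcov_fam s i c v)" "\<turnstile> LTy (LT s # \<Gamma>) (lpos_fam s i c v)"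
    "\<turnstile> LTm (LT s # \<Gamma>) (LcPos (llift 0 1 s) (llift 1 1 i) (llift 2 1 c) (llift 0 1 v) (LVar 0)) LU"
proof -
  from assms have s: "\<turnstile> LTy \<Gamma> (LT s)" by (auto intro: l_T_F)
  have l: "lsub (lshift 1) e = llift 0 1 e" "lsub (lups 1 (lshift 1)) e = llift 1 1 e"
    "lsub (lups 2 (lshift 1)) e = llift 2 1 e" for e
    by (auto simp: lsub_norms intro!: lsub_eqI)
  have a: "\<turnstile> LTm (LT s # \<Gamma>) (LVar 0) (LT (llift 0 1 s))" using lvar_0[OF s] by (simp add: llift_def)
  from laxset_sub[OF lsubst_wk1[OF s] assms]
  have "laxset (LT s # \<Gamma>) (llift 0 1 s) (llift 1 1 i) (llift 2 1 c) (llift 0 1 v)"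
    unfolding l .
  with a show "\<turnstile> LTy (LT s # \<Gamma>) (lcov_fam s i c v)" "\<turnstile> LTy (LT s # \<Gamma>) (lpos_fam s i c v)"
    "\<turnstile> LTm (LT s # \<Gamma>) (LcPos (llift 0 1 s) (llift 1 1 i) (llift 2 1 c) (llift 0 1 v) (LVar 0)) LU"
    unfolding lcov_fam_def lpos_fam_def
    by (auto intro!: MLtt_cind_CT.l_Cov_F MLtt_cind_CT.l_Pos_F l_cPos)
qed

text \<open>Of \<open>G\<close> only the shift by \<open>n\<close> from \<open>\<Gamma>\<close> is
  assumed, so that one lemma serves the premise of \<open>tr\<close> at \<open>n = 0\<close> and the
  contexts of the induction and coinduction steps at \<open>n = 2\<close> and
  \<open>n = 3\<close>.\<close>

lemma lall_cov_typed:
  assumes \<rho>: "lsubst G (lshift n) \<Gamma>" and ax: "laxset \<Gamma> s i c v"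
    and x: "\<turnstile> LTm G x (LT (llift 0 n s))" and j: "\<turnstile> LTm G j (LT (linst n i [x]))"
  shows "\<turnstile> LTm (LT (llift 0 n s) # G) (LAp (linst (n + 1) c [llift 0 1 x, llift 0 1 j]) (LVar 0)) LU"
    and "\<turnstile> LTy (LT (llift 0 n s) # G) (linst (n + 1) (lcov_fam s i c v) [LVar 0])"
    and "\<turnstile> LTy (LT (llift 0 n s) # G) (larrow (LT (LAp (linst (n + 1) c [llift 0 1 x, llift 0 1 j]) (LVar 0)))
      (linst (n + 1) (lcov_fam s i c v) [LVar 0]))"
    and "\<turnstile> LTy G (lall_cov n s i c v x j)"
proof -
  let ?\<rho> = "\<lambda>i. LVar (i + n)"
  have wk: "llift 0 n e = lsub ?\<rho> e" for e by (simp add: llift_eq_lsub)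
  from ax have s: "\<turnstile> LTm \<Gamma> s LU" by simp
  have s': "\<turnstile> LTm G (llift 0 n s) LU" using lsubst_app(3)[OF \<rho> s] by (simp add: wk)
  note S = l_T_F[OF s']
  have c: "\<turnstile> LTm G (linst n c [x, j]) (LPi (LT (llift 0 n s)) LU)"
    using laxset_c[OF \<rho> ax] x j by (simp add: wk linst_eq_lsub)
  have "llift 0 1 (linst n c [x, j]) = linst (n + 1) c [llift 0 1 x, llift 0 1 j]"
    by (auto simp: lsub_norms split: nat.split intro!: lsub_eqI)
  with lwk_tm[OF S c]
  have "\<turnstile> LTm (LT (llift 0 n s) # G) (linst (n + 1) c [llift 0 1 x, llift 0 1 j])
      (LPi (LT (llift 0 1 (llift 0 n s))) LU)" by (simp add: llift_def)
  from lapp_U[OF this] lwk_tm[OF S s'] lvar_0[OF S]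
  show eps: "\<turnstile> LTm (LT (llift 0 n s) # G) (LAp (linst (n + 1) c [llift 0 1 x, llift 0 1 j]) (LVar 0)) LU"
    by (simp add: llift_def)
  have "linst (n + 1) (lcov_fam s i c v) [LVar 0] = lsub (lups 1 ?\<rho>) (lcov_fam s i c v)"
    by (auto simp: lsub_norms split: nat.split intro!: lsub_eqI)
  with lsubst_app(1)[OF lsubst_up_same[OF \<rho> l_T_F[OF s]] lfam_typed(1)[OF ax]]
  show cov: "\<turnstile> LTy (LT (llift 0 n s) # G) (linst (n + 1) (lcov_fam s i c v) [LVar 0])"
    by (simp add: wk)
  show body: "\<turnstile> LTy (LT (llift 0 n s) # G) (larrow (LT (LAp (linst (n + 1) c [llift 0 1 x, llift 0 1 j]) (LVar 0)))
      (linst (n + 1) (lcov_fam s i c v) [LVar 0]))"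
    using eps cov by (intro larrow_F l_T_F)
  show "\<turnstile> LTy G (lall_cov n s i c v x j)"
    unfolding lall_cov_def by (rule l_Pi_F[OF S body])
qed

text \<open>This types the argument of the recursive call in the computation rule for
  \<open>tr\<close>.\<close>

lemma lall_cov_app:
  assumes \<rho>: "lsubst G (lshift n) \<Gamma>" and ax: "laxset \<Gamma> s i c v"
    and x: "\<turnstile> LTm G x (LT (llift 0 n s))" and j: "\<turnstile> LTm G j (LT (linst n i [x]))"
    and r: "\<turnstile> LTm G r (lall_cov n s i c v x j)" and a: "\<turnstile> LTm G a (LT (llift 0 n s))"
    and w: "\<turnstile> LTm G w (LT (LAp (linst n c [x, j]) a))"
  shows "\<turnstile> LTm G (LAp (LAp r a) w) (linst n (lcov_fam s i c v) [a])"
proof -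
  note T = lall_cov_typed[OF \<rho> ax x j]
  note S = lty_hd(1)[OF T(3)]
  have inst: "linst 0 (larrow (LT (LAp (linst (n + 1) c [llift 0 1 x, llift 0 1 j]) (LVar 0)))
      (linst (n + 1) (lcov_fam s i c v) [LVar 0])) [a]
    = larrow (LT (LAp (linst n c [x, j]) a)) (linst n (lcov_fam s i c v) [a])"
    by (auto simp: larrow_def lsub_norms split: nat.split intro!: lsub_eqI)
  have ra: "\<turnstile> LTm G (LAp r a) (larrow (LT (LAp (linst n c [x, j]) a)) (linst n (lcov_fam s i c v) [a]))"
    using l_Pi_E[OF S T(3) r[unfolded lall_cov_def] a] by (simp only: inst)
  note i = lsubst_inst1[OF S a]
  have eps: "\<turnstile> LTy G (LT (LAp (linst n c [x, j]) a))"
  proof -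
    have "lsub (case_nat a LVar) (linst (n + 1) c [llift 0 1 x, llift 0 1 j]) = linst n c [x, j]"
      by (auto simp: lsub_norms split: nat.split intro!: lsub_eqI)
    with lsubst_app(3)[OF i T(1)] show ?thesis by (auto intro: l_T_F)
  qed
  have cov: "\<turnstile> LTy G (linst n (lcov_fam s i c v) [a])"
  proof -
    have "lsub (case_nat a LVar) (linst (n + 1) (lcov_fam s i c v) [LVar 0]) = linst n (lcov_fam s i c v) [a]"
      by (auto simp: lsub_norms split: nat.split intro!: lsub_eqI)
    with lsubst_app(1)[OF i T(2)] show ?thesis by simp
  qed
  show ?thesis by (rule larrow_E[OF eps cov ra w])
qed

lemma lall_cov_llift: "llift 0 m (lall_cov n s i c v x j) = lall_cov (n + m) s i c v (llift 0 m x) (llift 0 m j)"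
  by (auto simp: lall_cov_def larrow_def lsub_norms split: nat.split intro!: lsub_eqI)

lemma lall_cov_lsub: "lsub (lups n \<rho>) (lall_cov n s i c v x j)
    = lall_cov n (lsub \<rho> s) (lsub (lups 1 \<rho>) i) (lsub (lups 2 \<rho>) c) (lsub \<rho> v)
        (lsub (lups n \<rho>) x) (lsub (lups n \<rho>) j)"
proof -
  have n: "lups 1 (lups n \<rho>) = lups (n + 1) \<rho>" "lups 1 (lups (n + 1) \<rho>) = lups 1 (lups n (lups 1 \<rho>))"
    by (simp_all add: lups_lups plus_1_eq_Suc)
  have l: "lsub (lups (n + 1) \<rho>) (llift 0 1 e) = llift 0 1 (lsub (lups n \<rho>) e)" for e
    unfolding n(1)[symmetric] by (rule lsub_lups_llift)
  have 0: "lsub (lups (n + 1) \<rho>) (LVar 0) = LVar 0" by (simp add: lups_def)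
  show ?thesis
    unfolding lall_cov_def lcov_fam_inst
    by (simp only: lsub.simps larrow_lsub n(1) lsub_lups_llift linst_lsub lsub_llift_lups l 0
      list.map list.size) (simp add: lups_def)
qed

lemma lind_hyp_lsub: "lsub (lups 3 \<rho>) (lind_hyp s c P)
    = lind_hyp (lsub \<rho> s) (lsub (lups 2 \<rho>) c) (lsub (lups 2 \<rho>) P)"
  by (auto simp: lind_hyp_def lsub_norms split: nat.split intro!: lsub_eqI)

text \<open>The recursive calls occur under two abstractions, hence in an extended context with all
  data of the elimination weakened. Every premise is transported along \<open>\<rho>\<close> and the
  elimination rule is then applied in \<open>G\<close>.\<close>

lemma lCov_E_sub:
  assumes \<rho>: "lsubst G \<rho> \<Gamma>" and ax: "laxset \<Gamma> s i c v"
    and P: "\<turnstile> LTy (lcov_fam s i c v # LT s # \<Gamma>) P"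
    and q1: "\<turnstile> LTm (LT (LAp (llift 0 1 v) (LVar 0)) # LT s # \<Gamma>) q1 (linst 2 P [LVar 1, LRf (LVar 1) (LVar 0)])"
    and q2: "\<turnstile> LTm (lind_hyp s c P # lall_cov 2 s i c v (LVar 1) (LVar 0) # LT i # LT s # \<Gamma>) q2
      (linst 4 P [LVar 3, LTr (LVar 3) (LVar 2) (LVar 1)])"
    and a: "\<turnstile> LTm G a (LT (lsub \<rho> s))" and m: "\<turnstile> LTm G m (lsub (case_nat a \<rho>) (lcov_fam s i c v))"
  shows "\<turnstile> LTm G (LInd m (lsub (lups 2 \<rho>) q1) (lsub (lups 4 \<rho>) q2)) (lsub (case_nat m (case_nat a \<rho>)) P)"
proof -
  let ?s = "lsub \<rho> s" and ?i = "lsub (lups 1 \<rho>) i" and ?c = "lsub (lups 2 \<rho>) c" and ?v = "lsub \<rho> v"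
    and ?P = "lsub (lups 2 \<rho>) P"
  note ax' = laxset_sub[OF \<rho> ax]
  from ax have S: "\<turnstile> LTy \<Gamma> (LT s)" and I: "\<turnstile> LTy (LT s # \<Gamma>) (LT i)" by (auto intro: l_T_F)
  note up = lsubst_up_same[OF \<rho> S]
  note upP = lsubst_up_same[OF up lty_hd(1)[OF P]]
  have fam: "lsub (lups 1 \<rho>) (lcov_fam s i c v) = lcov_fam ?s ?i ?c ?v"
    using lsub_llift_lups[of 0 1 \<rho>] lsub_llift_lups[of 1 1 \<rho>] lsub_llift_lups[of 2 1 \<rho>]
    by (simp add: lcov_fam_def lups_lups add.commute) (simp add: lups_def)
  have P': "\<turnstile> LTy (lcov_fam ?s ?i ?c ?v # LT ?s # G) ?P"
    using lsubst_app(1)[OF upP P] by (simp add: fam lups_2)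
  have m': "\<turnstile> LTm G m (LCov ?s ?i ?c ?v a)"
  proof -
    have "lsub (case_nat a \<rho>) (lcov_fam s i c v) = linst 0 (lsub (lups 1 \<rho>) (lcov_fam s i c v)) [a]"
      by (auto simp: lsub_norms split: nat.split intro!: lsub_eqI)
    with m show ?thesis by (simp add: fam lcov_fam_inst)
  qed
  have q1': "\<turnstile> LTm (LT (LAp (llift 0 1 ?v) (LVar 0)) # LT ?s # G) (lsub (lups 2 \<rho>) q1)
      (linst 2 ?P [LVar 1, LRf (LVar 1) (LVar 0)])"
    using lsubst_app(3)[OF lsubst_up_same[OF up lty_hd(2)[OF q1]] q1] lsub_lups_llift[of 1 \<rho> v]
      linst_lsub[of 2 \<rho> P "[LVar 1, LRf (LVar 1) (LVar 0)]"]
    by (simp add: lups_2[symmetric]) (simp add: lups_def)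
  note K = lty_hd(1)[OF lty_hd(2)[OF q2]]
  note up3 = lsubst_up_same[OF lsubst_up_same[OF up I] K]
  note up4 = lsubst_up_same[OF up3 lty_hd(2)[OF q2]]
  have K': "lsub (lups 2 \<rho>) (lall_cov 2 s i c v (LVar 1) (LVar 0)) = lall_cov 2 ?s ?i ?c ?v (LVar 1) (LVar 0)"
    unfolding lall_cov_lsub by (simp add: lups_def)
  have r: "linst 4 ?P (map (lsub (lups 4 \<rho>)) [LVar 3, LTr (LVar 3) (LVar 2) (LVar 1)])
      = linst 4 ?P [LVar 3, LTr (LVar 3) (LVar 2) (LVar 1)]" by (simp add: lups_def)
  have len: "length [x, y] = 2" for x y :: lexp by simp
  have q2': "\<turnstile> LTm (lind_hyp ?s ?c ?P # lall_cov 2 ?s ?i ?c ?v (LVar 1) (LVar 0) # LT ?i # LT ?s # G)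
      (lsub (lups 4 \<rho>) q2) (linst 4 ?P [LVar 3, LTr (LVar 3) (LVar 2) (LVar 1)])"
    using lsubst_app(3)[OF up4 q2]
    by (simp only: lups_2[symmetric] lups_3[symmetric] lups_4[symmetric] lsub.simps K' lind_hyp_lsub
      linst_lsub len r)
  have "linst 0 ?P [a, m] = lsub (case_nat m (case_nat a \<rho>)) P"
    by (auto simp: lsub_norms split: nat.split intro!: lsub_eqI)
  with MLtt_cind_CT.l_Cov_E[OF ax' P' a m' q1' q2'] show ?thesis by simp
qed

text \<open>The right-hand side of the second computation rule contains the recursive calls. They
  are typed over \<open>z\<close> and its membership proof by \<open>lCov_E_sub\<close>, abstracted
  twice, and substituted for the induction hypothesis of \<open>q2\<close>.\<close>

lemma lCov_C2_typed:
  assumes ax: "laxset \<Gamma> s i c v"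
    and P: "\<turnstile> LTy (lcov_fam s i c v # LT s # \<Gamma>) P"
    and a: "\<turnstile> LTm \<Gamma> a (LT s)" and j: "\<turnstile> LTm \<Gamma> j (LT (linst 0 i [a]))"
    and r: "\<turnstile> LTm \<Gamma> r (lall_cov 0 s i c v a j)"
    and q1: "\<turnstile> LTm (LT (LAp (llift 0 1 v) (LVar 0)) # LT s # \<Gamma>) q1 (linst 2 P [LVar 1, LRf (LVar 1) (LVar 0)])"
    and q2: "\<turnstile> LTm (lind_hyp s c P # lall_cov 2 s i c v (LVar 1) (LVar 0) # LT i # LT s # \<Gamma>) q2
      (linst 4 P [LVar 3, LTr (LVar 3) (LVar 2) (LVar 1)])"
  shows "\<turnstile> LTm \<Gamma> (linst 0 q2 [a, j, r,
      LLam (LLam (LInd (LAp (LAp (llift 0 2 r) (LVar 1)) (LVar 0)) (llift 2 2 q1) (llift 4 2 q2)))])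
    (linst 0 P [a, LTr a j r])"
proof -
  let ?m = "LAp (LAp (llift 0 2 r) (LVar 1)) (LVar 0)"
  let ?ih = "LInd ?m (llift 2 2 q1) (llift 4 2 q2)"
  from ax have s: "\<turnstile> LTm \<Gamma> s LU" and S: "\<turnstile> LTy \<Gamma> (LT s)" and I: "\<turnstile> LTy (LT s # \<Gamma>) (LT i)"
    by (auto intro: l_T_F)
  have ctx: "\<turnstile> LCtx \<Gamma>" using lctx_tm[OF s] .
  have id: "lsubst \<Gamma> (lshift 0) \<Gamma>" using lsubst_id[OF ctx] by simp
  have a0: "\<turnstile> LTm \<Gamma> a (LT (llift 0 0 s))" using a by simp
  note E = l_T_F[OF lall_cov_typed(1)[OF id ax a0 j]]
  let ?E = "LT (LAp (linst (0 + 1) c [llift 0 1 a, llift 0 1 j]) (LVar 0))"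
  let ?G = "?E # LT s # \<Gamma>"
  have E': "\<turnstile> LTy (LT s # \<Gamma>) ?E" using E by simp
  note w = lsubst_wk2[OF E']
  have wk: "lsub (lshift 2) e = llift 0 2 e" for e by (simp add: llift_eq_lsub)
  have a2: "\<turnstile> LTm ?G (llift 0 2 a) (LT (llift 0 2 s))"
    using lsubst_app(3)[OF w a] by (simp add: wk[simplified])
  have "linst 2 i [llift 0 2 a] = lsub (lshift 2) (linst 0 i [a])"
    by (auto simp: lsub_norms split: nat.split intro!: lsub_eqI)
  with lsubst_app(3)[OF w j] have j2: "\<turnstile> LTm ?G (llift 0 2 j) (LT (linst 2 i [llift 0 2 a]))"
    by (simp add: wk[simplified])
  have r2: "\<turnstile> LTm ?G (llift 0 2 r) (lall_cov 2 s i c v (llift 0 2 a) (llift 0 2 j))"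
    using lsubst_app(3)[OF w r] lall_cov_llift[of 2 0 s i c v a j] by (simp add: wk[simplified])
  have v1: "\<turnstile> LTm ?G (LVar 1) (LT (llift 0 2 s))" using lvar_1[OF E'] by (simp add: llift_def)
  have v0: "\<turnstile> LTm ?G (LVar 0) (LT (LAp (linst 2 c [llift 0 2 a, llift 0 2 j]) (LVar 1)))"
  proof -
    have "llift 0 1 ?E = LT (LAp (linst 2 c [llift 0 2 a, llift 0 2 j]) (LVar 1))"
      by (auto simp: lsub_norms split: nat.split intro!: lsub_eqI)
    with lvar_0[OF E'] show ?thesis by simp
  qed
  have m: "\<turnstile> LTm ?G ?m (linst 2 (lcov_fam s i c v) [LVar 1])"
    by (rule lall_cov_app[OF w ax a2 j2 r2 v1 v0])
  have ih: "\<turnstile> LTm ?G ?ih (lsub (case_nat ?m (case_nat (LVar 1) (lshift 2))) P)"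
  proof -
    have "lsub (lups k (lshift 2)) e = llift k 2 e" for k e
      by (auto simp: lsub_norms intro!: lsub_eqI)
    with lCov_E_sub[OF w ax P q1 q2, of "LVar 1" ?m] v1 m show ?thesis
      by (simp add: wk[simplified] linst_eq_lsub)
  qed
  note S1 = lty_hd(1)[OF E'] and tI = lty_hd(2)[OF ih]
  have sub: "lsubst \<Gamma> (case_nat r (case_nat j (case_nat a LVar)))
      (lall_cov 2 s i c v (LVar 1) (LVar 0) # LT i # LT s # \<Gamma>)"
  proof (rule lsubst_cons[OF lsubst_cons[OF lsubst_inst1[OF S a] I]])
    show "\<turnstile> LTm \<Gamma> j (lsub (case_nat a LVar) (LT i))" using j by (simp add: linst_eq_lsub)
    show "\<turnstile> LTy (LT i # LT s # \<Gamma>) (lall_cov 2 s i c v (LVar 1) (LVar 0))"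
      using lty_hd(1)[OF lty_hd(2)[OF q2]] .
    have "lsub (case_nat j (case_nat a LVar)) (lall_cov 2 s i c v (LVar 1) (LVar 0)) = lall_cov 0 s i c v a j"
      by (auto simp: lall_cov_def larrow_def lcov_fam_def lsub_norms split: nat.split intro!: lsub_eqI)
    with r show "\<turnstile> LTm \<Gamma> r (lsub (case_nat j (case_nat a LVar)) (lall_cov 2 s i c v (LVar 1) (LVar 0)))"
      by simp
  qed
  \<comment> \<open>After \<open>a\<close>, \<open>j\<close> and \<open>r\<close> are substituted,
    the type of the induction hypothesis is literally that of the twice abstracted recursive
    call.\<close>
  have H: "lsub (case_nat r (case_nat j (case_nat a LVar))) (lind_hyp s c P)
      = LPi (LT s) (LPi ?E (lsub (case_nat ?m (case_nat (LVar 1) (lshift 2))) P))"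
    by (auto simp: lind_hyp_def lsub_norms split: nat.split intro!: lsub_eqI)
  have PP: "\<turnstile> LTy ?G (lsub (case_nat ?m (case_nat (LVar 1) (lshift 2))) P)"
  proof (rule lsubst_app(1)[OF _ P], rule lsubst_cons[OF lsubst_cons[OF w S] lty_hd(1)[OF P]])
    show "\<turnstile> LTm ?G (LVar 1) (lsub (lshift 2) (LT s))" using v1 by (simp add: wk[simplified])
    show "\<turnstile> LTm ?G ?m (lsub (case_nat (LVar 1) (lshift 2)) (lcov_fam s i c v))"
      using m by (simp add: linst_eq_lsub)
  qed
  have lam: "\<turnstile> LTm \<Gamma> (LLam (LLam ?ih)) (lsub (case_nat r (case_nat j (case_nat a LVar))) (lind_hyp s c P))"
    unfolding H
    by (rule l_Pi_I[OF S l_Pi_F[OF E' PP] l_Pi_I[OF E' PP ih]])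
  note full = lsubst_cons[OF sub lty_hd(2)[OF q2] lam]
  have "lsub (case_nat f (case_nat r (case_nat j (case_nat a LVar)))) (linst 4 P [LVar 3, LTr (LVar 3) (LVar 2) (LVar 1)])
      = linst 0 P [a, LTr a j r]" for f
    by (auto simp: lsub_norms split: nat.split intro!: lsub_eqI)
  with lsubst_app(3)[OF full q2] show ?thesis by (simp add: linst_eq_lsub)
qed

lemma lCT_typed:
  assumes "\<turnstile> LCtx \<Gamma>"
  shows "\<turnstile> LTy \<Gamma> (lCT t u)"
proof -
  from kleene have t: "rec_arity 3 t" and u: "rec_arity 1 u"
    by (auto simp: kleene_TU_def prim_rec_def)
  have N: "\<turnstile> LTy G LNat" if "\<turnstile> LCtx G" for G using that by (rule l_N_F)
  let ?F = "LPi LNat LNat"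
  have c1: "\<turnstile> LCtx (?F # \<Gamma>)"
    by (intro lctx_cons_ty l_Pi_F N assms lctx_cons_ty[OF N])
  let ?G = "LNat # LNat # LNat # ?F # \<Gamma>"
  have c2: "\<turnstile> LCtx (LNat # ?F # \<Gamma>)" and c3: "\<turnstile> LCtx (LNat # LNat # ?F # \<Gamma>)" and c4: "\<turnstile> LCtx ?G"
    by (intro lctx_cons_ty N c1)+
  have v: "\<turnstile> LTm ?G (LVar 0) LNat" "\<turnstile> LTm ?G (LVar 1) LNat" "\<turnstile> LTm ?G (LVar 2) LNat"
    "\<turnstile> LTm ?G (LVar 3) (LPi LNat LNat)"
    using l_var[OF c4, of 0] l_var[OF c4, of 1]
      l_var[OF c4, of 2] l_var[OF c4, of 3]
    by (simp_all add: lvty_def llift_def)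
  have "\<turnstile> LTm ?G (LAp (LVar 3) (LVar 1)) (linst 0 LNat [LVar 1])"
    using N[OF c4] v by (intro l_Pi_E[OF _ N[OF lctx_cons_ty]]) auto
  then have ap: "\<turnstile> LTm ?G (LAp (LVar 3) (LVar 1)) LNat" by (simp add: linst_eq_lsub)
  have "\<turnstile> LTm ?G (lpr t [LVar 2, LVar 1, LVar 0]) LNat" "\<turnstile> LTm ?G (lpr u [LVar 0]) LNat"
    using v c4 by (auto intro!: lpr_typed[OF t] lpr_typed[OF u])
  with ap c4 show ?thesis
    unfolding lCT_def
    by (intro l_Pi_F l_Sigma_F lprod_F l_Id_F N
      l_N_I1 l_N_I2 c1 c2 c3 assms lctx_cons_ty)
qed

subsection \<open>Presuppositions of judgements\<close>

lemma lvty_typed: "\<turnstile> LCtx \<Gamma> \<Longrightarrow> i < length \<Gamma> \<Longrightarrow> \<turnstile> LTy \<Gamma> (lvty \<Gamma> i)"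
proof (induction \<Gamma> arbitrary: i)
  case (Cons A \<Gamma>)
  from lctx_consD[OF Cons.prems(1)] have A: "\<turnstile> LTy \<Gamma> A" by simp
  with Cons lctx_ty[OF A] show ?case by (cases i) (auto intro: lwk_ty[OF A])
qed simp

lemma
  assumes "\<turnstile> LTm \<Gamma> a A"
  shows linst1_ty: "\<turnstile> LTy (A # \<Gamma>) M \<Longrightarrow> \<turnstile> LTy \<Gamma> (linst 0 M [a])"
    and linst1_tm: "\<turnstile> LTm (A # \<Gamma>) b B \<Longrightarrow> \<turnstile> LTm \<Gamma> (linst 0 b [a]) (linst 0 B [a])"
  using lsubst_app(1)[OF lsubst_inst1[OF lty_hd(1) assms]] lsubst_app(3)[OF lsubst_inst1[OF lty_hd(2) assms]]
  by (simp_all add: linst_eq_lsub)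

lemma linst2_tm:
  assumes a: "\<turnstile> LTm \<Gamma> a A" and b: "\<turnstile> LTm \<Gamma> b (linst 0 B [a])" and e: "\<turnstile> LTm (B # A # \<Gamma>) e E"
  shows "\<turnstile> LTm \<Gamma> (linst 0 e [a, b]) (linst 0 E [a, b])"
  using lsubst_app(3)[OF lsubst_cons[OF lsubst_inst1[OF _ a] lty_hd(2)[OF e]] e] lty_hd(1)[OF lty_hd(2)[OF e]] b
  by (simp add: linst_eq_lsub)

lemma lId_inst_ty:
  assumes P: "\<turnstile> LTy (LId (llift 0 2 A) (LVar 1) (LVar 0) # llift 0 1 A # A # \<Gamma>) P"
    and a: "\<turnstile> LTm \<Gamma> a A" and b: "\<turnstile> LTm \<Gamma> b A" and p: "\<turnstile> LTm \<Gamma> p (LId A a b)"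
  shows "\<turnstile> LTy \<Gamma> (linst 0 P [a, b, p])"
proof -
  note ID = lty_hd(1)[OF P]
  note A1 = lty_hd(1)[OF ID]
  have "lsubst \<Gamma> (case_nat p (case_nat b (case_nat a LVar)))
      (LId (llift 0 2 A) (LVar 1) (LVar 0) # llift 0 1 A # A # \<Gamma>)"
  proof (rule lsubst_cons[OF lsubst_cons[OF lsubst_inst1[OF lty_hd(1)[OF A1] a] A1] ID])
    show "\<turnstile> LTm \<Gamma> b (lsub (case_nat a LVar) (llift 0 1 A))"
      using b by (simp add: lsub_case_nat_llift)
    have "lsub (case_nat b (case_nat a LVar)) (LId (llift 0 2 A) (LVar 1) (LVar 0)) = LId A a b"
      by (auto simp: lsub_norms split: nat.split intro!: lsub_eqI)
    with p show "\<turnstile> LTm \<Gamma> p (lsub (case_nat b (case_nat a LVar)) (LId (llift 0 2 A) (LVar 1) (LVar 0)))"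
      by simp
  qed
  from lsubst_app(1)[OF this P] show ?thesis by (simp add: linst_eq_lsub)
qed

lemma lCov_inst_ty:
  assumes "laxset \<Gamma> s i c v" and P: "\<turnstile> LTy (lcov_fam s i c v # LT s # \<Gamma>) P"
    and a: "\<turnstile> LTm \<Gamma> a (LT s)" and m: "\<turnstile> LTm \<Gamma> m (LCov s i c v a)"
  shows "\<turnstile> LTy \<Gamma> (linst 0 P [a, m])"
proof -
  note F = lty_hd(1)[OF P]
  have "\<turnstile> LTm \<Gamma> m (lsub (case_nat a LVar) (lcov_fam s i c v))"
    using m lcov_fam_inst[of 0 s i c v a] by (simp add: linst_eq_lsub)
  from lsubst_app(1)[OF lsubst_cons[OF lsubst_inst1[OF lty_hd(1)[OF F] a] F this] P]
  show ?thesis by (simp add: linst_eq_lsub)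
qed

primrec lpresup :: "ljudg \<Rightarrow> bool" where
  "lpresup (LCtx \<Gamma>) \<longleftrightarrow> True"
| "lpresup (LTy \<Gamma> A) \<longleftrightarrow> True"
| "lpresup (LTyEq \<Gamma> A B) \<longleftrightarrow> \<turnstile> LTy \<Gamma> A \<and> \<turnstile> LTy \<Gamma> B"
| "lpresup (LTm \<Gamma> a A) \<longleftrightarrow> \<turnstile> LTy \<Gamma> A"
| "lpresup (LTmEq \<Gamma> a b A) \<longleftrightarrow> \<turnstile> LTm \<Gamma> a A \<and> \<turnstile> LTm \<Gamma> b A \<and> \<turnstile> LTy \<Gamma> A"

text \<open>The content lies in the equations: replacement, where the two sides are first typed at
  different instances; congruence for binders, where the second body is given over the wrong domain;
  and computation, where the reduct must be typed by substituting into the branches.\<close>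

lemma lpresup_if_lderiv: "\<turnstile> J \<Longrightarrow> lpresup J"
proof (induction rule: MLtt_cind_CT.induct)
  case (l_ty_sub \<Gamma> \<sigma> \<Delta> A)
  then show ?case by simp
next
  case (l_tyeq_sub \<Gamma> \<sigma> \<Delta> A B)
  then have "lsubst \<Gamma> \<sigma> \<Delta>" by (simp add: lsubst_def)
  from lsubst_app[OF this] l_tyeq_sub show ?case by simp
next
  case (l_tm_sub \<Gamma> \<sigma> \<Delta> a A)
  then have "lsubst \<Gamma> \<sigma> \<Delta>" by (simp add: lsubst_def)
  from lsubst_app[OF this] l_tm_sub show ?case by simp
next
  case (l_tmeq_sub \<Gamma> \<sigma> \<Delta> a b A)
  then have "lsubst \<Gamma> \<sigma> \<Delta>" by (simp add: lsubst_def)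
  from lsubst_app[OF this] l_tmeq_sub show ?case by simp
next
  case (l_ty_repl \<Gamma> \<sigma> \<tau> \<Delta> A)
  then have "lsubst \<Gamma> \<sigma> \<Delta>" "lsubst \<Gamma> \<tau> \<Delta>" by (simp_all add: lsubst_def)
  from lsubst_app[OF this(1)] lsubst_app[OF this(2)] l_ty_repl show ?case by simp
next
  case (l_repl \<Gamma> \<sigma> \<tau> \<Delta> c C)
  then have \<sigma>: "lsubst \<Gamma> \<sigma> \<Delta>" and \<tau>: "lsubst \<Gamma> \<tau> \<Delta>" by (simp_all add: lsubst_def)
  from l_repl have c: "\<turnstile> LTm \<Delta> c C" and C: "\<turnstile> LTy \<Delta> C" by simp_all
  \<comment> \<open>The right-hand term is typed at \<open>lsub \<tau> C\<close>; replacement in the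
    type \<open>C\<close> brings it back to \<open>lsub \<sigma> C\<close>.\<close>
  have "\<turnstile> LTyEq \<Gamma> (lsub \<sigma> C) (lsub \<tau> C)"
    using l_repl by (intro MLtt_cind_CT.l_ty_repl[OF _ C]) simp
  then have "\<turnstile> LTm \<Gamma> (lsub \<tau> c) (lsub \<sigma> C)"
    using lsubst_app(3)[OF \<tau> c] by (blast intro: l_tm_conv l_tyeq_sym)
  with lsubst_app(1)[OF \<sigma> C] lsubst_app(3)[OF \<sigma> c] show ?case by simp
next
  case (l_N1_C \<Gamma> M c)
  then have N: "\<turnstile> LCtx \<Gamma>" by (auto dest: lctx_tm)
  from l_N1_C show ?case
    by (auto intro: MLtt_cind_CT.l_N1_E MLtt_cind_CT.l_N1_I[OF N])
next
  case (l_N_C1 \<Gamma> M c l)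
  then have N: "\<turnstile> LCtx \<Gamma>" by (auto dest: lctx_tm)
  from l_N_C1 show ?case by (auto intro: MLtt_cind_CT.l_N_E l_N_I1[OF N])
next
  case (l_N_C2 \<Gamma> M a c l)
  \<comment> \<open>The open premise is filled twice, with \<open>a\<close> for the recursive call
    and with its successor for the left-hand side.\<close>
  note E = MLtt_cind_CT.l_N_E[OF l_N_C2.hyps(1) _ l_N_C2.hyps(3,4)]
  have "linst 0 (linst 2 M [LSuc (LVar 1)]) [a, LElN a c l] = linst 0 M [LSuc a]"
    by (auto simp: lsub_norms split: nat.split intro!: lsub_eqI)
  with linst2_tm[OF l_N_C2.hyps(2) E[OF l_N_C2.hyps(2)] l_N_C2.hyps(4)]
    E[OF l_N_I2[OF l_N_C2.hyps(2)]] linst1_ty[OF l_N_I2[OF l_N_C2.hyps(2)] l_N_C2.hyps(1)]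
  show ?case by simp
next
  case (l_List_C1 \<Gamma> A M c l)
  then show ?case by (auto intro: MLtt_cind_CT.l_List_E MLtt_cind_CT.l_List_I1)
next
  case (l_List_C2 \<Gamma> A M s a c l)
  note E = MLtt_cind_CT.l_List_E[OF l_List_C2.hyps(1,2) _ l_List_C2.hyps(5,6)]
  note s = l_List_C2.hyps(3) and a = l_List_C2.hyps(4) and l = l_List_C2.hyps(6)
  note cons = l_List_I2[OF l_List_C2.hyps(1) s a]
  note L = lty_hd(1)[OF l_List_C2.hyps(2)] and P = lty_hd(2)[OF l]
  have "lsubst \<Gamma> (case_nat (LElList s c l) (case_nat a (case_nat s LVar)))
      (linst 2 M [LVar 1] # llift 0 1 A # LList A # \<Gamma>)"
  proof (rule lsubst_cons[OF lsubst_cons[OF lsubst_inst1[OF L s] lty_hd(1)[OF P]] P])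
    show "\<turnstile> LTm \<Gamma> a (lsub (case_nat s LVar) (llift 0 1 A))" using a by (simp add: lsub_case_nat_llift)
    have "lsub (case_nat a (case_nat s LVar)) (linst 2 M [LVar 1]) = linst 0 M [s]"
      by (auto simp: lsub_norms split: nat.split intro!: lsub_eqI)
    with E[OF s] show "\<turnstile> LTm \<Gamma> (LElList s c l) (lsub (case_nat a (case_nat s LVar)) (linst 2 M [LVar 1]))"
      by simp
  qed
  from lsubst_app(3)[OF this l]
  have "\<turnstile> LTm \<Gamma> (linst 0 l [s, a, LElList s c l])
      (lsub (case_nat (LElList s c l) (case_nat a (case_nat s LVar))) (linst 3 M [LCons (LVar 2) (LVar 1)]))"
    by (simp add: linst_eq_lsub)
  moreover have "lsub (case_nat x (case_nat a (case_nat s LVar))) (linst 3 M [LCons (LVar 2) (LVar 1)])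
      = linst 0 M [LCons s a]" for x
    by (auto simp: lsub_norms split: nat.split intro!: lsub_eqI)
  ultimately show ?case using E[OF cons] linst1_ty[OF cons l_List_C2.hyps(2)] by simp
next
  case (l_Plus_C1 \<Gamma> A B M a c d)
  note inl = l_Plus_I1[OF l_Plus_C1.hyps(1,2,4)]
  have "linst 0 (linst 1 M [LInl (LVar 0)]) [a] = linst 0 M [LInl a]"
    by (auto simp: lsub_norms split: nat.split intro!: lsub_eqI)
  with linst1_tm[OF l_Plus_C1.hyps(4,5)] linst1_ty[OF inl l_Plus_C1.hyps(3)]
    MLtt_cind_CT.l_Plus_E[OF l_Plus_C1.hyps(1-3) inl l_Plus_C1.hyps(5,6)]
  show ?case by simp
next
  case (l_Plus_C2 \<Gamma> A B M b c d)
  note inr = l_Plus_I2[OF l_Plus_C2.hyps(1,2,4)]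
  have "linst 0 (linst 1 M [LInr (LVar 0)]) [b] = linst 0 M [LInr b]"
    by (auto simp: lsub_norms split: nat.split intro!: lsub_eqI)
  with linst1_tm[OF l_Plus_C2.hyps(4,6)] linst1_ty[OF inr l_Plus_C2.hyps(3)]
    MLtt_cind_CT.l_Plus_E[OF l_Plus_C2.hyps(1-3) inr l_Plus_C2.hyps(5,6)]
  show ?case by simp
next
  case (l_Sigma_F_eq \<Gamma> A A' B B')
  then have A: "\<turnstile> LTy \<Gamma> A" "\<turnstile> LTy \<Gamma> A'" "\<turnstile> LTyEq \<Gamma> A A'" by simp_all
  \<comment> \<open>The congruence rule gives \<open>B'\<close> over \<open>A\<close>, but forming
    the right-hand side needs it over \<open>A'\<close>.\<close>
  from lctx_conv(1)[OF lctx_conv_cons[OF lsubst_id[OF lctx_ty[OF A(1)]] A(1,2) l_tyeq_sym[OF A(3)]]]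
    l_Sigma_F_eq show ?case by (auto intro: l_Sigma_F)
next
  case (l_Sigma_C \<Gamma> A B M a b m)
  note pair = l_Sigma_I[OF l_Sigma_C.hyps(1,2,4,5)]
  have "linst 0 (linst 2 M [LPair (LVar 1) (LVar 0)]) [a, b] = linst 0 M [LPair a b]"
    by (auto simp: lsub_norms split: nat.split intro!: lsub_eqI)
  with linst2_tm[OF l_Sigma_C.hyps(4-6)] linst1_ty[OF pair l_Sigma_C.hyps(3)]
    l_Sigma_E[OF l_Sigma_C.hyps(1-3) pair l_Sigma_C.hyps(6)]
  show ?case by simp
next
  case (l_Pi_F_eq \<Gamma> A A' B B')
  then have A: "\<turnstile> LTy \<Gamma> A" "\<turnstile> LTy \<Gamma> A'" "\<turnstile> LTyEq \<Gamma> A A'" by simp_all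
  from lctx_conv(1)[OF lctx_conv_cons[OF lsubst_id[OF lctx_ty[OF A(1)]] A(1,2) l_tyeq_sym[OF A(3)]]]
    l_Pi_F_eq show ?case by (auto intro: l_Pi_F)
next
  case (l_Pi_C \<Gamma> A B b a)
  from linst1_tm[OF l_Pi_C.hyps(4,3)] linst1_ty[OF l_Pi_C.hyps(4,2)]
    l_Pi_E[OF l_Pi_C.hyps(1,2) l_Pi_I[OF l_Pi_C.hyps(1-3)] l_Pi_C.hyps(4)]
  show ?case by simp
next
  case (l_Id_F_eq \<Gamma> A A' a a' b b')
  then show ?case by (auto intro: l_Id_F l_tm_conv)
next
  case (l_Id_E \<Gamma> A P a b p c)
  from lId_inst_ty[OF l_Id_E.hyps(2-5)] show ?case by simp
next
  case (l_Id_C \<Gamma> A P a c)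
  note E = MLtt_cind_CT.l_Id_E[OF l_Id_C.hyps(1,2,3,3) MLtt_cind_CT.l_Id_I[OF l_Id_C.hyps(1,3)] l_Id_C.hyps(4)]
  have "linst 0 (linst 1 P [LVar 0, LVar 0, LRefl (LVar 0)]) [a] = linst 0 P [a, a, LRefl a]"
    by (auto simp: lsub_norms split: nat.split intro!: lsub_eqI)
  with linst1_tm[OF l_Id_C.hyps(3,4)] E lId_inst_ty[OF l_Id_C.hyps(2,3,3) MLtt_cind_CT.l_Id_I[OF l_Id_C.hyps(1,3)]]
  show ?case by simp
next
  case (l_Cov_E \<Gamma> s i c v P a m q1 q2)
  then show ?case by (auto intro: lCov_inst_ty)
next
  case (l_Cov_C1 \<Gamma> s i c v P a r q1 q2)
  then have ax: "laxset \<Gamma> s i c v" by simp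
  note rf = MLtt_cind_CT.l_Cov_rf[OF ax l_Cov_C1.hyps(2,3)]
  have "linst 0 (LT (LAp (llift 0 1 v) (LVar 0))) [a] = LT (LAp v a)"
    by (auto simp: lsub_norms split: nat.split intro!: lsub_eqI)
  with l_Cov_C1.hyps(3) have r: "\<turnstile> LTm \<Gamma> r (linst 0 (LT (LAp (llift 0 1 v) (LVar 0))) [a])" by simp
  have "linst 0 (linst 2 P [LVar 1, LRf (LVar 1) (LVar 0)]) [a, r] = linst 0 P [a, LRf a r]"
    by (auto simp: lsub_norms split: nat.split intro!: lsub_eqI)
  with linst2_tm[OF l_Cov_C1.hyps(2) r l_Cov_C1.hyps(4)]
    MLtt_cind_CT.l_Cov_E[OF ax l_Cov_C1.hyps(1,2) rf l_Cov_C1.hyps(4,5)]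
    lCov_inst_ty[OF ax l_Cov_C1.hyps(1,2) rf]
  show ?case by simp
next
  case (l_Cov_C2 \<Gamma> s i c v P a j r q1 q2)
  then have ax: "laxset \<Gamma> s i c v" by simp
  note tr = MLtt_cind_CT.l_Cov_tr[OF ax l_Cov_C2.hyps(2,3,4)]
  from lCov_C2_typed[OF ax l_Cov_C2.hyps(1-6)]
    MLtt_cind_CT.l_Cov_E[OF ax l_Cov_C2.hyps(1,2) tr l_Cov_C2.hyps(5,6)]
    lCov_inst_ty[OF ax l_Cov_C2.hyps(1,2) tr]
  show ?case by simp
next
  case (l_Pos_ax1 \<Gamma> s i c v a q)
  then show ?case by (auto intro: lapp_U l_T_F)
next
  case (l_Pos_ax2 \<Gamma> s i c v a j q)
  then have ax: "laxset \<Gamma> s i c v" and s: "\<turnstile> LTm \<Gamma> s LU" by auto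
  have id: "lsubst \<Gamma> (lshift 0) \<Gamma>" using lsubst_id[OF lctx_tm[OF s]] by simp
  have "\<turnstile> LTm (LT s # \<Gamma>) (LAp (linst 1 c [llift 0 1 a, llift 0 1 j]) (LVar 0)) LU"
    using lall_cov_typed(1)[OF id ax] l_Pos_ax2.hyps(1,2) by simp
  with s lfam_typed(2)[OF ax] show ?case
    by (auto intro!: l_Sigma_F lprod_F l_T_F)
next
  case (l_tmeq_conv \<Gamma> a b A B)
  then show ?case by (auto intro: l_tm_conv)
qed (simp_all add: lvty_typed lCT_typed MLtt_cind_CT.l_N0_F MLtt_cind_CT.l_N1_F l_N_F
    l_U_F l_T_F MLtt_cind_CT.l_List_F MLtt_cind_CT.l_Plus_F l_Sigma_F
    l_Pi_F l_Id_F MLtt_cind_CT.l_Cov_F MLtt_cind_CT.l_Pos_F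
    MLtt_cind_CT.l_cN0 MLtt_cind_CT.l_cN1 MLtt_cind_CT.l_cN MLtt_cind_CT.l_cList MLtt_cind_CT.l_cPlus
    MLtt_cind_CT.l_cSigma MLtt_cind_CT.l_cPi MLtt_cind_CT.l_cId MLtt_cind_CT.l_cCov l_cPos, (rule linst1_ty; assumption)+)

lemma ltyeq_lty: "\<turnstile> LTyEq \<Gamma> A B \<Longrightarrow> \<turnstile> LTy \<Gamma> A" "\<turnstile> LTyEq \<Gamma> A B \<Longrightarrow> \<turnstile> LTy \<Gamma> B"
  and ltmeq_ltm: "\<turnstile> LTmEq \<Gamma> a b A \<Longrightarrow> \<turnstile> LTm \<Gamma> a A" "\<turnstile> LTmEq \<Gamma> a b A \<Longrightarrow> \<turnstile> LTm \<Gamma> b A"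
  using lpresup_if_lderiv by fastforce+


section \<open>Stability of the interpretation of types\<close>

lemma lsubst_comp: "lsubst G \<tau> H \<Longrightarrow> lsubst H \<sigma> K \<Longrightarrow> lsubst G (lsub \<tau> \<circ> \<sigma>) K"
  using lsubst_app(3)[of G \<tau> H] by (auto simp: lsubst_def lsub_lsub[symmetric])

abbreviation lcx :: "mexp list \<Rightarrow> lexp list" where
  "lcx \<Gamma> \<equiv> map m2l_T \<Gamma>"

text \<open>
  A pre-term in the place of a type is decoded by \<open>LT\<close> or, if it is headed by a type constructor,
  is interpreted by a type which must be equal to its decoding.
\<close>

definition coherent :: "lexp list \<Rightarrow> mexp \<Rightarrow> bool" where
  "coherent G e \<longleftrightarrow> m2l_T e = LT (m2l_t e)
     \<or> \<turnstile> LTyEq G (LT (m2l_t e)) (m2l_T e)"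

text \<open>
  The context \<open>G\<close> is one of the target theory, since the decoding of a binder leads into contexts
  \<open>LT a # G\<close> that interpret no context of the source theory.
\<close>

definition msubst :: "lexp list \<Rightarrow> (nat \<Rightarrow> mexp) \<Rightarrow> mexp list \<Rightarrow> bool" where
  "msubst G \<sigma> \<Delta> \<longleftrightarrow> lsubst G (m2l_t \<circ> \<sigma>) (lcx \<Delta>) \<and> (\<forall>i<length \<Delta>. coherent G (\<sigma> i))"

text \<open>Coherence of the term alone would not survive: a variable is coherent, but a
  substitution may replace it by a type constructor. Hence all interpreted instances are
  considered.\<close>

definition stable_coh :: "mexp list \<Rightarrow> mexp \<Rightarrow> bool" where
  "stable_coh \<Gamma> e \<longleftrightarrow> (\<forall>G \<sigma>. msubst G \<sigma> \<Gamma> \<longrightarrow> coherent G (msub \<sigma> e))"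

definition stable_sub :: "mexp list \<Rightarrow> mexp \<Rightarrow> bool" where
  "stable_sub \<Gamma> A \<longleftrightarrow> (\<forall>G \<sigma>. msubst G \<sigma> \<Gamma>
     \<longrightarrow> \<turnstile> LTyEq G (m2l_T (msub \<sigma> A)) (lsub (m2l_t \<circ> \<sigma>) (m2l_T A)))"

definition stable_dec :: "mexp list \<Rightarrow> mexp \<Rightarrow> bool" where
  "stable_dec \<Gamma> A \<longleftrightarrow> (\<forall>G \<sigma>. msubst G \<sigma> \<Gamma> \<longrightarrow> \<turnstile> LTyEq G (LT (m2l_t (msub \<sigma> A))) (m2l_T (msub \<sigma> A)))"

text \<open>These are the substitutions of the source rules. Stable coherence of the entries is what
  allows composition with an arbitrary \<open>msubst\<close>.\<close>

definition msubsts :: "mexp list \<Rightarrow> (nat \<Rightarrow> mexp) \<Rightarrow> mexp list \<Rightarrow> bool" where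
  "msubsts \<Gamma> \<sigma> \<Delta> \<longleftrightarrow> lsubst (lcx \<Gamma>) (m2l_t \<circ> \<sigma>) (lcx \<Delta>) \<and> (\<forall>i<length \<Delta>. stable_coh \<Gamma> (\<sigma> i))"

section \<open>Interpreted substitutions and their composition\<close>

lemma coherent_wk:
  assumes "coherent G e" "\<turnstile> LTy G X"
  shows "coherent (X # G) (mlift 0 1 e)"
proof -
  have "llift 0 1 (LT (m2l_t e)) = LT (llift 0 1 (m2l_t e))" by (simp add: llift_def)
  with assms lwk_tyeq[OF assms(2)] show ?thesis
    by (fastforce simp: coherent_def m2l_T_mlift m2l_t_mlift)
qed

lemma coherent_var: "coherent G (MVar i)"
  by (simp add: coherent_def)

lemma m2l_t_MVar: "m2l_t \<circ> MVar = LVar"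
  by (simp add: fun_eq_iff)

lemma msubst_id: "\<turnstile> LCtx (lcx \<Gamma>) \<Longrightarrow> msubst (lcx \<Gamma>) MVar \<Gamma>"
  by (simp add: msubst_def coherent_var m2l_t_MVar lsubst_id)

lemma msubst_lctx: "msubst G \<sigma> \<Gamma> \<Longrightarrow> \<turnstile> LCtx (lcx \<Gamma>)" "msubst G \<sigma> \<Gamma> \<Longrightarrow> \<turnstile> LCtx G"
  by (auto simp: msubst_def dest: lsubst_ctx)

lemma msubst_lsubst: "msubst G \<sigma> \<Gamma> \<Longrightarrow> lsubst G (m2l_t \<circ> \<sigma>) (lcx \<Gamma>)"
  by (simp add: msubst_def)

lemma mups_1: "mups 1 \<sigma> = case_nat (MVar 0) (mlift 0 1 \<circ> \<sigma>)"
  by (auto simp: mups_def fun_eq_iff split: nat.split)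

lemma msubst_up:
  assumes "msubst G \<sigma> \<Gamma>" "\<turnstile> LTy (lcx \<Gamma>) (m2l_T A)" "\<turnstile> LTy G X"
    "\<turnstile> LTyEq G X (lsub (m2l_t \<circ> \<sigma>) (m2l_T A))"
  shows "msubst (X # G) (mups 1 \<sigma>) (A # \<Gamma>)"
proof -
  have "coherent (X # G) (mups 1 \<sigma> i)" if "i < length (A # \<Gamma>)" for i
    using that assms(1,3) unfolding mups_1
    by (cases i) (auto simp: msubst_def coherent_var intro: coherent_wk)
  with lsubst_up[OF _ assms(2-4)] assms(1) show ?thesis
    by (simp add: msubst_def m2l_t_mups)
qed

lemma m2l_t_comp_msub: "m2l_t \<circ> (msub \<tau> \<circ> \<sigma>) = lsub (m2l_t \<circ> \<tau>) \<circ> (m2l_t \<circ> \<sigma>)"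
  by (simp add: fun_eq_iff m2l_t_msub)

lemma msubst_comp: "msubst G \<tau> \<Gamma> \<Longrightarrow> msubsts \<Gamma> \<sigma> \<Delta> \<Longrightarrow> msubst G (msub \<tau> \<circ> \<sigma>) \<Delta>"
  by (auto simp: msubst_def msubsts_def m2l_t_comp_msub stable_coh_def intro: lsubst_comp)

lemma msubsts_lctx: "msubsts \<Gamma> \<sigma> \<Delta> \<Longrightarrow> \<turnstile> LCtx (lcx \<Gamma>)"
  by (auto simp: msubsts_def dest: lsubst_ctx)

lemma msubsts_lsubst: "msubsts \<Gamma> \<sigma> \<Delta> \<Longrightarrow> lsubst (lcx \<Gamma>) (m2l_t \<circ> \<sigma>) (lcx \<Delta>)"
  by (simp add: msubsts_def)

lemma msubsts_msubst: "msubsts \<Gamma> \<sigma> \<Delta> \<Longrightarrow> msubst (lcx \<Gamma>) \<sigma> \<Delta>"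
  using msubst_comp[OF msubst_id[OF msubsts_lctx], of \<Gamma> \<sigma> \<Delta> \<sigma> \<Delta>] by (simp add: o_def)

lemma msubst_tl:
  assumes "msubst G \<sigma> (A # \<Gamma>)"
  shows "msubst G (\<lambda>i. \<sigma> (i + 1)) \<Gamma>"
  unfolding msubst_def
proof
  have "lsub (m2l_t \<circ> \<sigma>) (llift 0 1 e) = lsub (m2l_t \<circ> (\<lambda>i. \<sigma> (i + 1))) e" for e
    by (auto simp: lsub_norms intro!: lsub_eqI)
  with assms lctx_consD[OF msubst_lctx(1)[OF assms, simplified]]
  show "lsubst G (m2l_t \<circ> (\<lambda>i. \<sigma> (i + 1))) (lcx \<Gamma>)"
    by (fastforce simp: msubst_def lsubst_def)
qed (use assms in \<open>simp add: msubst_def\<close>)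

lemma msub_wk: "msub \<sigma> (mlift 0 1 e) = msub (\<lambda>i. \<sigma> (i + 1)) e"
  by (auto simp: mlift_eq_msub msub_msub intro!: msub_eqI)

lemma stable_coh_wk: "stable_coh \<Gamma> e \<Longrightarrow> stable_coh (A # \<Gamma>) (mlift 0 1 e)"
  by (auto simp: stable_coh_def msub_wk dest: msubst_tl)

lemma stable_coh_var: "i < length \<Gamma> \<Longrightarrow> stable_coh \<Gamma> (MVar i)"
  by (simp add: stable_coh_def msubst_def)

lemma stable_coh_neutral: "(\<And>\<sigma>. m2l_T (msub \<sigma> e) = LT (m2l_t (msub \<sigma> e))) \<Longrightarrow> stable_coh \<Gamma> e"
  by (simp add: stable_coh_def coherent_def)

lemma msubsts_id: "\<turnstile> LCtx (lcx \<Gamma>) \<Longrightarrow> msubsts \<Gamma> MVar \<Gamma>"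
  by (simp add: msubsts_def m2l_t_MVar lsubst_id stable_coh_var)

lemma msubsts_wk:
  assumes "msubsts \<Gamma> \<sigma> \<Delta>" "\<turnstile> LTy (lcx \<Gamma>) (m2l_T X)"
  shows "msubsts (X # \<Gamma>) (mlift 0 1 \<circ> \<sigma>) \<Delta>"
proof -
  have "m2l_t \<circ> (mlift 0 1 \<circ> \<sigma>) = llift 0 1 \<circ> (m2l_t \<circ> \<sigma>)"
    by (simp add: fun_eq_iff m2l_t_mlift)
  with assms lsubst_wk[OF _ assms(2)] show ?thesis by (auto simp: msubsts_def stable_coh_wk)
qed

lemma msubsts_wk1: "\<turnstile> LTy (lcx \<Gamma>) (m2l_T X) \<Longrightarrow> msubsts (X # \<Gamma>) (\<lambda>i. MVar (i + 1)) \<Gamma>"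
  using msubsts_wk[OF msubsts_id, of \<Gamma> X] by (simp add: o_def mlift_def upr_def lctx_ty)

lemma msubsts_wk':
  assumes "msubsts \<Gamma> (\<lambda>i. MVar (i + n)) \<Delta>" "\<turnstile> LTy (lcx \<Gamma>) (m2l_T X)" "m = n + 1"
  shows "msubsts (X # \<Gamma>) (\<lambda>i. MVar (i + m)) \<Delta>"
  using msubsts_wk[OF assms(1,2)] assms(3) by (simp add: o_def mlift_def upr_def add.assoc)

lemma case_nat_comp: "f \<circ> case_nat a \<sigma> = case_nat (f a) (f \<circ> \<sigma>)"
  by (auto simp: fun_eq_iff split: nat.split)

lemma msubsts_cons:
  assumes "msubsts \<Gamma> \<sigma> \<Delta>" "\<turnstile> LTy (lcx \<Delta>) (m2l_T A)"
    "\<turnstile> LTm (lcx \<Gamma>) (m2l_t a) (lsub (m2l_t \<circ> \<sigma>) (m2l_T A))" "stable_coh \<Gamma> a"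
  shows "msubsts \<Gamma> (case_nat a \<sigma>) (A # \<Delta>)"
  using assms lsubst_cons[OF msubsts_lsubst[OF assms(1)] assms(2,3)]
  by (auto simp: msubsts_def case_nat_comp split: nat.split)

lemma m2l_T_msub_eq: "msubsts \<Gamma> \<sigma> \<Delta> \<Longrightarrow> stable_sub \<Delta> A
    \<Longrightarrow> \<turnstile> LTyEq (lcx \<Gamma>) (m2l_T (msub \<sigma> A)) (lsub (m2l_t \<circ> \<sigma>) (m2l_T A))"
  using msubsts_msubst by (auto simp: stable_sub_def)

text \<open>Both sides are compared at the composite substitution: once by stability of
  \<open>A\<close> there, once by applying \<open>\<tau>\<close> to the equation that stability
  gives at \<open>\<sigma>\<close>.\<close>

lemma stable_sub_msub:
  assumes "msubsts \<Gamma> \<sigma> \<Delta>" "stable_sub \<Delta> A"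
  shows "stable_sub \<Gamma> (msub \<sigma> A)"
  unfolding stable_sub_def
proof (intro allI impI)
  fix G \<tau> assume \<tau>: "msubst G \<tau> \<Gamma>"
  have "\<turnstile> LTyEq G (m2l_T (msub (msub \<tau> \<circ> \<sigma>) A)) (lsub (m2l_t \<circ> (msub \<tau> \<circ> \<sigma>)) (m2l_T A))"
    using assms(2) msubst_comp[OF \<tau> assms(1)] by (simp add: stable_sub_def)
  moreover have "\<turnstile> LTyEq G (lsub (m2l_t \<circ> \<tau>) (m2l_T (msub \<sigma> A)))
      (lsub (m2l_t \<circ> \<tau>) (lsub (m2l_t \<circ> \<sigma>) (m2l_T A)))"
    by (rule lsubst_app(2)[OF msubst_lsubst[OF \<tau>] m2l_T_msub_eq[OF assms]])
  ultimately show "\<turnstile> LTyEq G (m2l_T (msub \<tau> (msub \<sigma> A))) (lsub (m2l_t \<circ> \<tau>) (m2l_T (msub \<sigma> A)))"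
    unfolding msub_msub lsub_lsub m2l_t_comp_msub by (rule ltyeq_conv_trans)
qed

lemma stable_dec_msub: "msubsts \<Gamma> \<sigma> \<Delta> \<Longrightarrow> stable_dec \<Delta> A \<Longrightarrow> stable_dec \<Gamma> (msub \<sigma> A)"
  by (auto simp: stable_dec_def msub_msub dest: msubst_comp)

lemma stable_coh_msub: "msubsts \<Gamma> \<sigma> \<Delta> \<Longrightarrow> stable_coh \<Delta> A \<Longrightarrow> stable_coh \<Gamma> (msub \<sigma> A)"
  by (auto simp: stable_coh_def msub_msub dest: msubst_comp)

lemma stable_sub_wk:
  assumes "\<turnstile> LTy (lcx \<Gamma>) (m2l_T X)" "stable_sub \<Gamma> A"
  shows "stable_sub (X # \<Gamma>) (mlift 0 1 A)"
  using stable_sub_msub[OF msubsts_wk1[OF assms(1)] assms(2)] by (simp add: mlift_eq_msub)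

lemma stable_sub_id: "stable_sub \<Gamma> A \<Longrightarrow> \<turnstile> LCtx (lcx \<Gamma>) \<Longrightarrow> \<turnstile> LTy (lcx \<Gamma>) (m2l_T A)"
  using msubst_id by (fastforce simp: stable_sub_def dest: ltyeq_lty)

lemma stable_dec_id: "stable_dec \<Gamma> A \<Longrightarrow> \<turnstile> LCtx (lcx \<Gamma>) \<Longrightarrow> \<turnstile> LTyEq (lcx \<Gamma>) (LT (m2l_t A)) (m2l_T A)"
  using msubst_id by (fastforce simp: stable_dec_def)

lemma stable_dec_sub:
  assumes "stable_dec \<Gamma> A" "msubst G \<sigma> \<Gamma>"
  shows "\<turnstile> LTyEq G (LT (m2l_t (msub \<sigma> A))) (lsub (m2l_t \<circ> \<sigma>) (m2l_T A))"
  using lsubst_app(2)[OF msubst_lsubst[OF assms(2)] stable_dec_id[OF assms(1) msubst_lctx(1)[OF assms(2)]]]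
  by (simp add: m2l_t_msub)

text \<open>Decoding reduces types to terms, where substitution commutes strictly: the
  interpretation of the instance equals the decoding of its code, which is the substituted decoding
  of the code of \<open>A\<close>, which equals the substituted interpretation of
  \<open>A\<close>.\<close>

lemma stable_dec_stable_sub: "stable_dec \<Gamma> A \<Longrightarrow> stable_sub \<Gamma> A"
  unfolding stable_sub_def
  by (blast intro: l_tyeq_trans l_tyeq_sym stable_dec_sub stable_dec_def[THEN iffD1, rule_format])

section \<open>The invariant of judgements\<close>

definition type_inv :: "mexp list \<Rightarrow> bool \<Rightarrow> mexp \<Rightarrow> bool" where
  "type_inv \<Gamma> s A \<longleftrightarrow> \<turnstile> LTy (lcx \<Gamma>) (m2l_T A) \<and> stable_sub \<Gamma> A
     \<and> (s \<longrightarrow> \<turnstile> LTm (lcx \<Gamma>) (m2l_t A) LU \<and> stable_dec \<Gamma> A)"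

primrec stable_ctx :: "mexp list \<Rightarrow> bool" where
  "stable_ctx [] \<longleftrightarrow> True"
| "stable_ctx (A # \<Gamma>) \<longleftrightarrow> stable_sub \<Gamma> A \<and> stable_ctx \<Gamma>"

text \<open>The kinds whose types must have a code in \<open>LU\<close>; the invariant asks
  collections and arbitrary propositions only for typing and stability.\<close>

fun small :: "kind \<Rightarrow> bool" where
  "small KSet \<longleftrightarrow> True"
| "small KProps \<longleftrightarrow> True"
| "small _ \<longleftrightarrow> False"

text \<open>An equation of types records the stability of both sides, since the conversion rule
  turns a typing at the left type into one at the right type.\<close>

fun judg_inv :: "mjudg \<Rightarrow> bool" where
  "judg_inv (MCtx \<Gamma>) \<longleftrightarrow> \<turnstile> LCtx (lcx \<Gamma>) \<and> stable_ctx \<Gamma>"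
| "judg_inv (MTy \<Gamma> k A) \<longleftrightarrow> type_inv \<Gamma> (small k) A"
| "judg_inv (MTyEq \<Gamma> k A B) \<longleftrightarrow> \<turnstile> LTyEq (lcx \<Gamma>) (m2l_T A) (m2l_T B) \<and> stable_sub \<Gamma> A \<and> stable_sub \<Gamma> B"
| "judg_inv (MTm \<Gamma> a A) \<longleftrightarrow> \<turnstile> LTm (lcx \<Gamma>) (m2l_t a) (m2l_T A) \<and> stable_sub \<Gamma> A \<and> stable_coh \<Gamma> a"
| "judg_inv (MTmEq \<Gamma> a b A) \<longleftrightarrow> \<turnstile> LTmEq (lcx \<Gamma>) (m2l_t a) (m2l_t b) (m2l_T A) \<and> stable_sub \<Gamma> A"

lemma mvty_0 [simp]: "mvty (A # \<Gamma>) 0 = mlift 0 1 A"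
  by (simp add: mvty_def)

lemma mvty_Suc: "mvty (A # \<Gamma>) (Suc i) = mlift 0 1 (mvty \<Gamma> i)"
  by (auto simp: mvty_def mlift_eq_msub msub_msub intro!: msub_eqI)

lemma m2l_T_mvty: "i < length \<Gamma> \<Longrightarrow> m2l_T (mvty \<Gamma> i) = lvty (lcx \<Gamma>) i"
  by (simp add: mvty_def lvty_def m2l_T_mlift)

lemma stable_sub_mvty: "stable_ctx \<Gamma> \<Longrightarrow> \<turnstile> LCtx (lcx \<Gamma>) \<Longrightarrow> i < length \<Gamma> \<Longrightarrow> stable_sub \<Gamma> (mvty \<Gamma> i)"
proof (induction \<Gamma> arbitrary: i)
  case (Cons A \<Gamma>)
  from lctx_consD[OF Cons.prems(2)[simplified]] have A: "\<turnstile> LTy (lcx \<Gamma>) (m2l_T A)" ..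
  from stable_sub_wk[OF A] Cons lctx_ty[OF A] show ?case by (cases i) (simp_all add: mvty_Suc)
qed simp

text \<open>The entries are typed at interpretations of substituted types, whereas a target
  substitution needs substituted interpretations. Stability of a context entry equates them, but
  applies only once the entries for the preceding variables form an \<open>msubst\<close>; hence the
  induction on \<open>\<Delta>\<close>.\<close>

lemma msubst_if_typed:
  assumes "stable_ctx \<Delta>" "\<turnstile> LCtx (lcx \<Delta>)" "\<turnstile> LCtx G"
    "\<forall>i<length \<Delta>. \<turnstile> LTm G (m2l_t (\<sigma> i)) (m2l_T (msub \<sigma> (mvty \<Delta> i))) \<and> coherent G (\<sigma> i)"
  shows "msubst G \<sigma> \<Delta>"
  using assms
proof (induction \<Delta> arbitrary: \<sigma>)
  case Nil
  then show ?case by (simp add: msubst_def lsubst_def)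
next
  case (Cons A \<Delta>)
  let ?\<sigma> = "\<lambda>i. \<sigma> (i + 1)"
  from lctx_consD[OF Cons.prems(2)[simplified]] have A: "\<turnstile> LTy (lcx \<Delta>) (m2l_T A)" ..
  have "msubst G ?\<sigma> \<Delta>"
  proof (rule Cons.IH)
    show "\<forall>i<length \<Delta>. \<turnstile> LTm G (m2l_t (?\<sigma> i)) (m2l_T (msub ?\<sigma> (mvty \<Delta> i))) \<and> coherent G (?\<sigma> i)"
    proof (intro allI impI)
      fix i assume "i < length \<Delta>"
      with Cons.prems(4)[rule_format, of "Suc i"]
      show "\<turnstile> LTm G (m2l_t (?\<sigma> i)) (m2l_T (msub ?\<sigma> (mvty \<Delta> i))) \<and> coherent G (?\<sigma> i)"
        by (simp add: mvty_Suc msub_wk)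
    qed
  qed (use Cons.prems A in \<open>auto intro: lctx_ty\<close>)
  moreover from this Cons.prems(1)
  have "\<turnstile> LTyEq G (m2l_T (msub ?\<sigma> A)) (lsub (m2l_t \<circ> ?\<sigma>) (m2l_T A))" by (simp add: stable_sub_def)
  with Cons.prems(4)[rule_format, of 0]
  have "\<turnstile> LTm G (m2l_t (\<sigma> 0)) (lsub (m2l_t \<circ> ?\<sigma>) (m2l_T A))"
    by (auto simp: msub_wk intro: l_tm_conv)
  ultimately have "lsubst G (case_nat (m2l_t (\<sigma> 0)) (m2l_t \<circ> ?\<sigma>)) (m2l_T A # lcx \<Delta>)"
    using A by (auto intro: lsubst_cons msubst_lsubst)
  moreover have "case_nat (m2l_t (\<sigma> 0)) (m2l_t \<circ> ?\<sigma>) = m2l_t \<circ> \<sigma>"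
    by (auto simp: fun_eq_iff split: nat.split)
  ultimately show ?case using Cons.prems(4) by (simp add: msubst_def)
qed

lemma msubsts_if_inv:
  assumes "judg_inv (MCtx \<Gamma>)" "judg_inv (MCtx \<Delta>)" "\<forall>i<length \<Delta>. judg_inv (MTm \<Gamma> (\<sigma> i) (msub \<sigma> (mvty \<Delta> i)))"
  shows "msubsts \<Gamma> \<sigma> \<Delta>"
proof -
  have "msubst (lcx \<Gamma>) \<sigma> \<Delta>"
  proof (rule msubst_if_typed)
    show "\<forall>i<length \<Delta>. \<turnstile> LTm (lcx \<Gamma>) (m2l_t (\<sigma> i)) (m2l_T (msub \<sigma> (mvty \<Delta> i)))
        \<and> coherent (lcx \<Gamma>) (\<sigma> i)"
      using assms msubst_id[of \<Gamma>] by (fastforce simp: stable_coh_def)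
  qed (use assms in auto)
  with assms(3) show ?thesis by (simp add: msubsts_def msubst_def)
qed


section \<open>Type formers\<close>

text \<open>The invariant sees a type only through the interpretations of its instances. As the
  logical constants are interpreted like set constructors, they inherit their lemmas this
  way.\<close>

lemma type_inv_cong:
  assumes "\<And>\<sigma>. m2l_T (msub \<sigma> A) = m2l_T (msub \<sigma> B)" "\<And>\<sigma>. m2l_t (msub \<sigma> A) = m2l_t (msub \<sigma> B)"
  shows "type_inv \<Gamma> s A \<longleftrightarrow> type_inv \<Gamma> s B"
  using assms(1)[of MVar] assms(2)[of MVar] assms
  by (simp add: type_inv_def stable_sub_def stable_dec_def)

lemma stable_sub_cong:
  assumes "\<And>\<sigma>. m2l_T (msub \<sigma> A) = m2l_T (msub \<sigma> B)"
  shows "stable_sub \<Gamma> A \<longleftrightarrow> stable_sub \<Gamma> B"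
  using assms(1)[of MVar] assms by (simp add: stable_sub_def)

lemma type_inv_const:
  assumes "\<And>\<sigma>. msub \<sigma> A = A" "\<And>\<sigma>. lsub \<sigma> (m2l_T A) = m2l_T A" "\<turnstile> LCtx (lcx \<Gamma>)"
    "\<And>G. \<turnstile> LCtx G \<Longrightarrow> \<turnstile> LTy G (m2l_T A)"
    "\<And>G. s \<Longrightarrow> \<turnstile> LCtx G \<Longrightarrow> \<turnstile> LTm G (m2l_t A) LU \<and> \<turnstile> LTyEq G (LT (m2l_t A)) (m2l_T A)"
  shows "type_inv \<Gamma> s A"
  using assms by (auto simp: type_inv_def stable_sub_def stable_dec_def msubst_lctx intro: l_tyeq_refl)

lemma type_inv_N0: "\<turnstile> LCtx (lcx \<Gamma>) \<Longrightarrow> type_inv \<Gamma> s MN0"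
  and type_inv_N1: "\<turnstile> LCtx (lcx \<Gamma>) \<Longrightarrow> type_inv \<Gamma> s MN1"
  and type_inv_Nat: "\<turnstile> LCtx (lcx \<Gamma>) \<Longrightarrow> type_inv \<Gamma> s MNat"
  and type_inv_PropS: "\<turnstile> LCtx (lcx \<Gamma>) \<Longrightarrow> type_inv \<Gamma> False MPropS"
  and type_inv_Falsum: "\<turnstile> LCtx (lcx \<Gamma>) \<Longrightarrow> type_inv \<Gamma> s MFalsum"
  by (rule type_inv_const; simp add: MLtt_cind_CT.l_N0_F MLtt_cind_CT.l_N1_F l_N_F
    l_U_F MLtt_cind_CT.l_cN0 MLtt_cind_CT.l_cN1 MLtt_cind_CT.l_cN
    MLtt_cind_CT.l_T_cN0 MLtt_cind_CT.l_T_cN1 MLtt_cind_CT.l_T_cN)+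

lemma msubst_lift_stable_dec:
  assumes "msubst G \<sigma> \<Gamma>" "\<turnstile> LTm (lcx \<Gamma>) (m2l_t A) LU"
  shows "\<turnstile> LTm G (m2l_t (msub \<sigma> A)) LU"
  using lsubst_app(3)[OF msubst_lsubst[OF assms(1)] assms(2)] by (simp add: m2l_t_msub)

lemma type_inv_List:
  assumes "type_inv \<Gamma> s A"
  shows "type_inv \<Gamma> s (MList A)"
  using assms
  by (auto simp: type_inv_def stable_sub_def stable_dec_def
    intro: MLtt_cind_CT.l_List_F l_List_F_eq MLtt_cind_CT.l_cList
      l_tyeq_trans[OF MLtt_cind_CT.l_T_cList l_List_F_eq]
    elim: msubst_lift_stable_dec)

lemma stable_sub_List: "stable_sub \<Gamma> A \<Longrightarrow> stable_sub \<Gamma> (MList A)"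
  by (auto simp: stable_sub_def intro: l_List_F_eq)

lemma type_inv_Plus:
  assumes "type_inv \<Gamma> s A" "type_inv \<Gamma> s B"
  shows "type_inv \<Gamma> s (MPlus A B)"
  using assms
  by (auto simp: type_inv_def stable_sub_def stable_dec_def
    intro: MLtt_cind_CT.l_Plus_F l_Plus_F_eq MLtt_cind_CT.l_cPlus
      l_tyeq_trans[OF MLtt_cind_CT.l_T_cPlus l_Plus_F_eq]
    elim: msubst_lift_stable_dec)

lemma stable_sub_Plus: "stable_sub \<Gamma> A \<Longrightarrow> stable_sub \<Gamma> B \<Longrightarrow> stable_sub \<Gamma> (MPlus A B)"
  by (auto simp: stable_sub_def intro: l_Plus_F_eq)

text \<open>Both sides are compared with \<open>F ?X ?B\<close>, where \<open>?X\<close> is the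
  substituted interpretation of \<open>A\<close>: over that head the stability of \<open>B'\<close>
  can be used. \<open>A\<close> and \<open>A'\<close> are kept apart because a congruence rule gives
  \<open>B'\<close> over \<open>A\<close> although the type former binds it over \<open>A'\<close>.
  \<open>F\<close> is \<open>LPi\<close> or \<open>LSigma\<close>.\<close>

lemma stable_sub_binder:
  assumes F: "\<And>G A A' B B'. \<turnstile> LTyEq G A A' \<Longrightarrow> \<turnstile> LTyEq (A # G) B B' \<Longrightarrow> \<turnstile> LTyEq G (F A B) (F A' B')"
    and A: "\<turnstile> LTy (lcx \<Gamma>) (m2l_T A)" "\<turnstile> LTyEq (lcx \<Gamma>) (m2l_T A) (m2l_T A')"
    and "stable_sub \<Gamma> A'" "stable_sub (A # \<Gamma>) B'" and \<sigma>: "msubst G \<sigma> \<Gamma>"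
  shows "\<turnstile> LTyEq G (F (m2l_T (msub \<sigma> A')) (m2l_T (msub (mups 1 \<sigma>) B')))
    (F (lsub (m2l_t \<circ> \<sigma>) (m2l_T A')) (lsub (lups 1 (m2l_t \<circ> \<sigma>)) (m2l_T B')))"
proof -
  let ?\<sigma> = "m2l_t \<circ> \<sigma>" and ?B = "m2l_T (msub (mups 1 \<sigma>) B')"
  let ?X = "lsub ?\<sigma> (m2l_T A)"
  have X: "\<turnstile> LTy G ?X" "\<turnstile> LTyEq G ?X (lsub ?\<sigma> (m2l_T A'))"
    using lsubst_app(1,2)[OF msubst_lsubst[OF \<sigma>]] A by auto
  have A': "\<turnstile> LTyEq G ?X (m2l_T (msub \<sigma> A'))"
    using assms(4) \<sigma> X(2) by (auto simp: stable_sub_def intro: ltyeq_conv_trans)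
  have "msubst (?X # G) (mups 1 \<sigma>) (A # \<Gamma>)"
    using X(1) by (intro msubst_up \<sigma> A l_tyeq_refl)
  then have B: "\<turnstile> LTyEq (?X # G) ?B (lsub (lups 1 ?\<sigma>) (m2l_T B'))"
    using assms(5)[unfolded stable_sub_def, rule_format, of "?X # G" "mups 1 \<sigma>"] by (simp add: m2l_t_mups)
  show ?thesis
    by (rule l_tyeq_trans[OF l_tyeq_sym[OF F[OF A' ltyeq_refls(1)[OF B]]] F[OF X(2) B]])
qed

lemma stable_sub_Pi:
  assumes "\<turnstile> LTy (lcx \<Gamma>) (m2l_T A)" "\<turnstile> LTyEq (lcx \<Gamma>) (m2l_T A) (m2l_T A')" "stable_sub \<Gamma> A'" "stable_sub (A # \<Gamma>) B'"
  shows "stable_sub \<Gamma> (MPi A' B')"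
  using stable_sub_binder[where F = LPi, OF l_Pi_F_eq assms] by (simp add: stable_sub_def)

lemma stable_sub_Sigma:
  assumes "\<turnstile> LTy (lcx \<Gamma>) (m2l_T A)" "\<turnstile> LTyEq (lcx \<Gamma>) (m2l_T A) (m2l_T A')" "stable_sub \<Gamma> A'" "stable_sub (A # \<Gamma>) B'"
  shows "stable_sub \<Gamma> (MSigma A' B')"
  using stable_sub_binder[where F = LSigma, OF l_Sigma_F_eq assms] by (simp add: stable_sub_def)

lemma stable_dec_lsubst_conv:
  assumes A: "\<turnstile> LTy (lcx \<Gamma>) (m2l_T A)" "\<turnstile> LTm (lcx \<Gamma>) (m2l_t A) LU" "stable_dec \<Gamma> A"
  shows "lsubst (LT (m2l_t A) # lcx \<Gamma>) LVar (lcx (A # \<Gamma>))"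
  using lctx_conv_cons[OF lsubst_id A(1) l_T_F[OF A(2)] stable_dec_id[OF A(3)]] lctx_ty[OF A(1)]
  by simp

text \<open>The code of a binder takes its body over the decoded domain. \<open>msubst_up\<close>
  reaches this context because \<open>stable_dec_sub\<close> equates the decoding with the
  substituted interpretation of \<open>A\<close>.\<close>

lemma stable_dec_binder:
  assumes A: "type_inv \<Gamma> True A" and B: "type_inv (A # \<Gamma>) True B" and \<sigma>: "msubst G \<sigma> \<Gamma>"
  shows "\<turnstile> LTm G (m2l_t (msub \<sigma> A)) LU"
    and "\<turnstile> LTm (LT (m2l_t (msub \<sigma> A)) # G) (m2l_t (msub (mups 1 \<sigma>) B)) LU"
    and "\<turnstile> LTyEq G (LT (m2l_t (msub \<sigma> A))) (m2l_T (msub \<sigma> A))"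
    and "\<turnstile> LTyEq (LT (m2l_t (msub \<sigma> A)) # G)
      (LT (m2l_t (msub (mups 1 \<sigma>) B))) (m2l_T (msub (mups 1 \<sigma>) B))"
proof -
  show A': "\<turnstile> LTm G (m2l_t (msub \<sigma> A)) LU" using A \<sigma> by (auto simp: type_inv_def intro: msubst_lift_stable_dec)
  show "\<turnstile> LTyEq G (LT (m2l_t (msub \<sigma> A))) (m2l_T (msub \<sigma> A))"
    using A \<sigma> by (simp add: type_inv_def stable_dec_def)
  have *: "msubst (LT (m2l_t (msub \<sigma> A)) # G) (mups 1 \<sigma>) (A # \<Gamma>)"
    using A \<sigma> A' by (intro msubst_up stable_dec_sub l_T_F) (simp_all add: type_inv_def)
  with B show "\<turnstile> LTm (LT (m2l_t (msub \<sigma> A)) # G) (m2l_t (msub (mups 1 \<sigma>) B)) LU"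
    and "\<turnstile> LTyEq (LT (m2l_t (msub \<sigma> A)) # G)
      (LT (m2l_t (msub (mups 1 \<sigma>) B))) (m2l_T (msub (mups 1 \<sigma>) B))"
    by (auto simp: type_inv_def stable_dec_def intro: msubst_lift_stable_dec)
qed

lemma type_inv_False: "type_inv \<Gamma> s A \<Longrightarrow> type_inv \<Gamma> False A"
  by (simp add: type_inv_def)

lemma type_inv_D:
  assumes "type_inv \<Gamma> s A"
  shows "\<turnstile> LTy (lcx \<Gamma>) (m2l_T A)" "stable_sub \<Gamma> A" "\<turnstile> LCtx (lcx \<Gamma>)"
  using assms by (auto simp: type_inv_def dest: lctx_ty)

lemma type_inv_Pi:
  assumes A: "type_inv \<Gamma> s A" and B: "type_inv (A # \<Gamma>) s B"
  shows "type_inv \<Gamma> s (MPi A B)"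
proof -
  have "\<turnstile> LTy (lcx \<Gamma>) (m2l_T (MPi A B))"
    using l_Pi_F type_inv_D(1)[OF A] type_inv_D(1)[OF B] by simp
  moreover have "stable_sub \<Gamma> (MPi A B)"
    using type_inv_D[OF A] type_inv_D[OF B] by (auto intro: stable_sub_Pi l_tyeq_refl)
  moreover have "\<turnstile> LTm (lcx \<Gamma>) (m2l_t (MPi A B)) LU \<and> stable_dec \<Gamma> (MPi A B)" if s
  proof
    note D = stable_dec_binder[OF A[unfolded eqTrueI[OF that]] B[unfolded eqTrueI[OF that]]]
    from MLtt_cind_CT.l_cPi[OF D(1,2)] msubst_id[OF type_inv_D(3)[OF A]]
    show "\<turnstile> LTm (lcx \<Gamma>) (m2l_t (MPi A B)) LU" by (fastforce simp: mups_MVar)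
    show "stable_dec \<Gamma> (MPi A B)"
      using l_tyeq_trans[OF MLtt_cind_CT.l_T_cPi[OF D(1,2)] l_Pi_F_eq[OF D(3,4)]]
      by (simp add: stable_dec_def)
  qed
  ultimately show ?thesis by (simp add: type_inv_def)
qed

lemma type_inv_Sigma:
  assumes A: "type_inv \<Gamma> s A" and B: "type_inv (A # \<Gamma>) s B"
  shows "type_inv \<Gamma> s (MSigma A B)"
proof -
  have "\<turnstile> LTy (lcx \<Gamma>) (m2l_T (MSigma A B))"
    using l_Sigma_F type_inv_D(1)[OF A] type_inv_D(1)[OF B] by simp
  moreover have "stable_sub \<Gamma> (MSigma A B)"
    using type_inv_D[OF A] type_inv_D[OF B] by (auto intro: stable_sub_Sigma l_tyeq_refl)
  moreover have "\<turnstile> LTm (lcx \<Gamma>) (m2l_t (MSigma A B)) LU \<and> stable_dec \<Gamma> (MSigma A B)" if s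
  proof
    note D = stable_dec_binder[OF A[unfolded eqTrueI[OF that]] B[unfolded eqTrueI[OF that]]]
    from MLtt_cind_CT.l_cSigma[OF D(1,2)] msubst_id[OF type_inv_D(3)[OF A]]
    show "\<turnstile> LTm (lcx \<Gamma>) (m2l_t (MSigma A B)) LU" by (fastforce simp: mups_MVar)
    show "stable_dec \<Gamma> (MSigma A B)"
      using l_tyeq_trans[OF MLtt_cind_CT.l_T_cSigma[OF D(1,2)] l_Sigma_F_eq[OF D(3,4)]]
      by (simp add: stable_dec_def)
  qed
  ultimately show ?thesis by (simp add: type_inv_def)
qed

lemma m2l_all: "m2l_T (msub \<sigma> (MAll A B)) = m2l_T (msub \<sigma> (MPi A B))"
    "m2l_t (msub \<sigma> (MAll A B)) = m2l_t (msub \<sigma> (MPi A B))"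
  and m2l_ex: "m2l_T (msub \<sigma> (MEx A B)) = m2l_T (msub \<sigma> (MSigma A B))"
    "m2l_t (msub \<sigma> (MEx A B)) = m2l_t (msub \<sigma> (MSigma A B))"
  and m2l_or: "m2l_T (msub \<sigma> (MOr A B)) = m2l_T (msub \<sigma> (MPlus A B))"
    "m2l_t (msub \<sigma> (MOr A B)) = m2l_t (msub \<sigma> (MPlus A B))"
  and m2l_imp: "m2l_T (msub \<sigma> (MImp A B)) = m2l_T (msub \<sigma> (MPi A (mlift 0 1 B)))"
    "m2l_t (msub \<sigma> (MImp A B)) = m2l_t (msub \<sigma> (MPi A (mlift 0 1 B)))"
  and m2l_and: "m2l_T (msub \<sigma> (MAnd A B)) = m2l_T (msub \<sigma> (MSigma A (mlift 0 1 B)))"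
    "m2l_t (msub \<sigma> (MAnd A B)) = m2l_t (msub \<sigma> (MSigma A (mlift 0 1 B)))"
  by (simp_all add: larrow_def lprod_def msub_mups_mlift m2l_T_mlift m2l_t_mlift)

lemmas type_inv_prop_eq = type_inv_cong[OF m2l_all] type_inv_cong[OF m2l_ex] type_inv_cong[OF m2l_or]
  type_inv_cong[OF m2l_imp] type_inv_cong[OF m2l_and]
lemmas stable_sub_prop_eq = stable_sub_cong[OF m2l_all(1)] stable_sub_cong[OF m2l_ex(1)] stable_sub_cong[OF m2l_or(1)]
  stable_sub_cong[OF m2l_imp(1)] stable_sub_cong[OF m2l_and(1)]

lemma type_inv_msub:
  assumes \<sigma>: "msubsts \<Gamma> \<sigma> \<Delta>" and A: "type_inv \<Delta> s A"
  shows "type_inv \<Gamma> s (msub \<sigma> A)"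
  using stable_sub_msub[OF \<sigma> type_inv_D(2)[OF A]] stable_dec_msub[OF \<sigma>] stable_sub_id[OF _ msubsts_lctx[OF \<sigma>]] msubst_lift_stable_dec[OF msubsts_msubst[OF \<sigma>]] A
  by (simp add: type_inv_def)

lemma type_inv_wk:
  assumes "\<turnstile> LTy (lcx \<Gamma>) (m2l_T X)" "type_inv \<Gamma> s A"
  shows "type_inv (X # \<Gamma>) s (mlift 0 1 A)"
  using type_inv_msub[OF msubsts_wk1[OF assms(1)] assms(2)] by (simp add: mlift_eq_msub)

lemma type_inv_Imp: "type_inv \<Gamma> s A \<Longrightarrow> type_inv \<Gamma> s B \<Longrightarrow> type_inv \<Gamma> s (MImp A B)"
  and type_inv_And: "type_inv \<Gamma> s A \<Longrightarrow> type_inv \<Gamma> s B \<Longrightarrow> type_inv \<Gamma> s (MAnd A B)"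
  and type_inv_Or: "type_inv \<Gamma> s A \<Longrightarrow> type_inv \<Gamma> s B \<Longrightarrow> type_inv \<Gamma> s (MOr A B)"
  and type_inv_All: "type_inv \<Gamma> s A \<Longrightarrow> type_inv (A # \<Gamma>) s C \<Longrightarrow> type_inv \<Gamma> s (MAll A C)"
  and type_inv_Ex: "type_inv \<Gamma> s A \<Longrightarrow> type_inv (A # \<Gamma>) s C \<Longrightarrow> type_inv \<Gamma> s (MEx A C)"
  unfolding type_inv_prop_eq by (intro type_inv_Pi type_inv_Sigma type_inv_Plus type_inv_wk type_inv_D; assumption)+

text \<open>The congruence rule for \<open>LId\<close> takes its terms at the left-hand type, so the
  substituted terms are first moved from the substituted interpretation of \<open>A\<close> to the
  interpretation of its instance.\<close>

lemma stable_sub_Id: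
  assumes A: "stable_sub \<Gamma> A" and a: "\<turnstile> LTm (lcx \<Gamma>) (m2l_t a) (m2l_T A)"
    and b: "\<turnstile> LTm (lcx \<Gamma>) (m2l_t b) (m2l_T A)"
  shows "stable_sub \<Gamma> (MId A a b)"
proof -
  have tm: "\<turnstile> LTmEq G (lsub (m2l_t \<circ> \<sigma>) (m2l_t e)) (lsub (m2l_t \<circ> \<sigma>) (m2l_t e)) (m2l_T (msub \<sigma> A))"
    if "msubst G \<sigma> \<Gamma>" "\<turnstile> LTm (lcx \<Gamma>) (m2l_t e) (m2l_T A)" for G \<sigma> e
    using l_tmeq_refl[OF lsubst_app(3)[OF msubst_lsubst[OF that(1)] that(2)]] A that(1)
    by (auto simp: stable_sub_def intro: l_tmeq_conv l_tyeq_sym)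
  show ?thesis
    unfolding stable_sub_def
  proof (intro allI impI)
    fix G \<sigma> assume \<sigma>: "msubst G \<sigma> \<Gamma>"
    with A have "\<turnstile> LTyEq G (m2l_T (msub \<sigma> A)) (lsub (m2l_t \<circ> \<sigma>) (m2l_T A))" by (simp add: stable_sub_def)
    from l_Id_F_eq[OF this tm[OF \<sigma> a] tm[OF \<sigma> b]]
    show "\<turnstile> LTyEq G (m2l_T (msub \<sigma> (MId A a b))) (lsub (m2l_t \<circ> \<sigma>) (m2l_T (MId A a b)))"
      by (simp add: m2l_t_msub)
  qed
qed

lemma type_inv_Id:
  assumes A: "type_inv \<Gamma> s A" and a: "\<turnstile> LTm (lcx \<Gamma>) (m2l_t a) (m2l_T A)"
    and b: "\<turnstile> LTm (lcx \<Gamma>) (m2l_t b) (m2l_T A)"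
  shows "type_inv \<Gamma> s (MId A a b)"
proof -
  have tm: "\<turnstile> LTm G (m2l_t (msub \<sigma> e)) (m2l_T (msub \<sigma> A))"
    if "msubst G \<sigma> \<Gamma>" "\<turnstile> LTm (lcx \<Gamma>) (m2l_t e) (m2l_T A)" for G \<sigma> e
    using lsubst_app(3)[OF msubst_lsubst[OF that(1)] that(2)] type_inv_D(2)[OF A] that(1)
    by (auto simp: m2l_t_msub stable_sub_def intro: l_tm_conv l_tyeq_sym)
  have "\<turnstile> LTy (lcx \<Gamma>) (m2l_T (MId A a b))"
    using l_Id_F[OF type_inv_D(1)[OF A] a b] by simp
  moreover have "stable_sub \<Gamma> (MId A a b)"
    by (intro stable_sub_Id type_inv_D(2)[OF A] a b)
  moreover have "\<turnstile> LTm (lcx \<Gamma>) (m2l_t (MId A a b)) LU \<and> stable_dec \<Gamma> (MId A a b)" if s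
  proof -
    from A that have small: "\<turnstile> LTm (lcx \<Gamma>) (m2l_t A) LU" "stable_dec \<Gamma> A" by (simp_all add: type_inv_def)
    have tmT: "\<turnstile> LTm G (m2l_t (msub \<sigma> e)) (LT (m2l_t (msub \<sigma> A)))"
      if "msubst G \<sigma> \<Gamma>" "\<turnstile> LTm (lcx \<Gamma>) (m2l_t e) (m2l_T A)" for G \<sigma> e
      using tm[OF that] small(2) that(1)
      by (auto simp: stable_dec_def intro: l_tm_conv l_tyeq_sym)
    have "\<turnstile> LTm G (LcId (m2l_t (msub \<sigma> A)) (m2l_t (msub \<sigma> a)) (m2l_t (msub \<sigma> b))) LU
      \<and> \<turnstile> LTyEq G (LT (LcId (m2l_t (msub \<sigma> A)) (m2l_t (msub \<sigma> a)) (m2l_t (msub \<sigma> b))))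
          (LId (m2l_T (msub \<sigma> A)) (m2l_t (msub \<sigma> a)) (m2l_t (msub \<sigma> b)))"
      if \<sigma>: "msubst G \<sigma> \<Gamma>" for G \<sigma>
    proof -
      note A' = msubst_lift_stable_dec[OF \<sigma> small(1)] and a' = tmT[OF \<sigma> a] and b' = tmT[OF \<sigma> b]
      have "\<turnstile> LTyEq G (LT (m2l_t (msub \<sigma> A))) (m2l_T (msub \<sigma> A))"
        using small(2) \<sigma> by (simp add: stable_dec_def)
      from l_tyeq_trans[OF MLtt_cind_CT.l_T_cId[OF A' a' b'] l_Id_F_eq[OF this]]
        MLtt_cind_CT.l_cId[OF A' a' b'] a' b'
      show ?thesis by (blast intro: l_tmeq_refl)
    qed
    from this this[OF msubst_id[OF type_inv_D(3)[OF A]]] show ?thesis by (simp add: stable_dec_def)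
  qed
  ultimately show ?thesis by (simp add: type_inv_def)
qed


section \<open>Soundness of the rules\<close>

text \<open>Well-formedness of the substitution behind \<open>minst n _ as\<close>: the list fills
  the newest entries of \<open>\<Delta>\<close>, and the remaining variables are shifted by
  \<open>n\<close>.\<close>

definition minsts :: "mexp list \<Rightarrow> nat \<Rightarrow> mexp list \<Rightarrow> mexp list \<Rightarrow> bool" where
  "minsts \<Gamma> n as \<Delta> \<longleftrightarrow> msubsts \<Gamma> (fold case_nat as (\<lambda>i. MVar (i + n))) \<Delta>"

lemma m2l_t_fold: "m2l_t \<circ> fold case_nat as (\<lambda>i. MVar (i + n))
    = fold case_nat (map m2l_t as) (lshift n)"
  by (auto simp: fun_eq_iff fold_case_nat rev_nth)

lemma minsts_lsubst:
  "minsts \<Gamma> n as \<Delta> \<Longrightarrow> lsubst (lcx \<Gamma>) (fold case_nat (map m2l_t as) (lshift n)) (lcx \<Delta>)"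
  unfolding minsts_def m2l_t_fold[symmetric] by (rule msubsts_lsubst)

lemma minsts_0: "\<turnstile> LCtx (lcx \<Gamma>) \<Longrightarrow> minsts \<Gamma> 0 [] \<Gamma>"
  by (simp add: minsts_def msubsts_id)

lemma minsts_wk:
  assumes "minsts \<Gamma> n [] \<Delta>" "\<turnstile> LTy (lcx \<Gamma>) (m2l_T X)" "m = n + 1"
  shows "minsts (X # \<Gamma>) m [] \<Delta>"
  using msubsts_wk'[OF _ assms(2,3)] assms(1) by (simp add: minsts_def)

lemma minsts_1: "\<turnstile> LTy (lcx \<Gamma>) (m2l_T X) \<Longrightarrow> minsts (X # \<Gamma>) 1 [] \<Gamma>"
  by (rule minsts_wk[OF minsts_0]) (auto dest: lctx_ty)

lemma minsts_2: "\<turnstile> LTy (lcx (X # \<Gamma>)) (m2l_T Y) \<Longrightarrow> minsts (Y # X # \<Gamma>) 2 [] \<Gamma>"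
  by (rule minsts_wk[OF minsts_1]) (auto dest: lty_hd)

lemma minsts_3: "\<turnstile> LTy (lcx (Y # X # \<Gamma>)) (m2l_T Z) \<Longrightarrow> minsts (Z # Y # X # \<Gamma>) 3 [] \<Gamma>"
  by (rule minsts_wk[OF minsts_2]) (auto dest: lty_hd)

lemma minsts_4: "\<turnstile> LTy (lcx (Z # Y # X # \<Gamma>)) (m2l_T W) \<Longrightarrow> minsts (W # Z # Y # X # \<Gamma>) 4 [] \<Gamma>"
  by (rule minsts_wk[OF minsts_3]) (auto dest: lty_hd)

lemma minsts_snoc:
  assumes "minsts \<Gamma> n as \<Delta>" "\<turnstile> LTy (lcx \<Delta>) (m2l_T A)"
    "\<turnstile> LTm (lcx \<Gamma>) (m2l_t a) (linst n (m2l_T A) (map m2l_t as))" "stable_coh \<Gamma> a"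
  shows "minsts \<Gamma> n (as @ [a]) (A # \<Delta>)"
  using msubsts_cons[OF assms(1)[unfolded minsts_def] assms(2) _ assms(4)] assms(3)
  by (simp add: minsts_def m2l_t_fold linst_eq_lsub)

lemma minsts_single:
  assumes "minsts \<Gamma> n [] \<Delta>" "\<turnstile> LTy (lcx \<Delta>) (m2l_T A)"
    "\<turnstile> LTm (lcx \<Gamma>) (m2l_t a) (llift 0 n (m2l_T A))" "stable_coh \<Gamma> a"
  shows "minsts \<Gamma> n [a] (A # \<Delta>)"
  using minsts_snoc[OF assms(1,2) _ assms(4)] assms(3) by (simp add: linst_Nil)

lemma minsts_hd:
  "\<turnstile> LTy (lcx \<Gamma>) (m2l_T A) \<Longrightarrow> \<turnstile> LTm (lcx \<Gamma>) (m2l_t a) (m2l_T A) \<Longrightarrow> stable_coh \<Gamma> a \<Longrightarrow> minsts \<Gamma> 0 [a] (A # \<Gamma>)"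
  by (rule minsts_single[OF minsts_0]) (auto dest: lctx_ty)

lemma minst_type_inv: "minsts \<Gamma> n as \<Delta> \<Longrightarrow> type_inv \<Delta> s A \<Longrightarrow> type_inv \<Gamma> s (minst n A as)"
  unfolding minsts_def minst_eq_msub by (rule type_inv_msub)

lemma minst_stable_sub: "minsts \<Gamma> n as \<Delta> \<Longrightarrow> stable_sub \<Delta> A \<Longrightarrow> stable_sub \<Gamma> (minst n A as)"
  unfolding minsts_def minst_eq_msub by (rule stable_sub_msub)

lemma minst_eq: "minsts \<Gamma> n as \<Delta> \<Longrightarrow> stable_sub \<Delta> A
    \<Longrightarrow> \<turnstile> LTyEq (lcx \<Gamma>) (m2l_T (minst n A as)) (linst n (m2l_T A) (map m2l_t as))"
  unfolding minsts_def minst_eq_msub linst_eq_lsub m2l_t_fold[symmetric] by (rule m2l_T_msub_eq)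

lemma minsts_lty: "minsts \<Gamma> n as \<Delta> \<Longrightarrow> \<turnstile> LTy (lcx \<Delta>) A \<Longrightarrow> \<turnstile> LTy (lcx \<Gamma>) (linst n A (map m2l_t as))"
  unfolding linst_eq_lsub using minsts_lsubst lsubst_app(1) by blast

text \<open>Source rules state types as \<open>minst\<close>, target rules as \<open>linst\<close>;
  stability of the motive \<open>M\<close> mediates. This lemma and \<open>inv_tmeqI\<close> return
  to the source form in conclusions, \<open>inv_tmD\<close> leaves it in premises.\<close>

lemma inv_tmI:
  assumes "minsts \<Gamma> n as \<Delta>" "stable_sub \<Delta> M"
    "\<turnstile> LTm (lcx \<Gamma>) (m2l_t e) (linst n (m2l_T M) (map m2l_t as))" "stable_coh \<Gamma> e"
  shows "judg_inv (MTm \<Gamma> e (minst n M as))"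
  using assms by (auto intro: minst_stable_sub l_tm_conv l_tyeq_sym minst_eq)

lemma inv_tmeqI:
  assumes "minsts \<Gamma> n as \<Delta>" "stable_sub \<Delta> M"
    "\<turnstile> LTmEq (lcx \<Gamma>) (m2l_t e) (m2l_t e') (linst n (m2l_T M) (map m2l_t as))"
  shows "judg_inv (MTmEq \<Gamma> e e' (minst n M as))"
  using assms by (auto intro: minst_stable_sub l_tmeq_conv l_tyeq_sym minst_eq)

lemma inv_tmD:
  assumes "minsts \<Gamma> n as \<Delta>" "stable_sub \<Delta> M" "judg_inv (MTm \<Gamma> e (minst n M as))"
  shows "\<turnstile> LTm (lcx \<Gamma>) (m2l_t e) (linst n (m2l_T M) (map m2l_t as))"
  using assms by (auto intro: l_tm_conv minst_eq)

text \<open>Introduction and elimination forms keep their head under substitution and are therefore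
  always decoded by \<open>LT\<close>.\<close>

lemma stable_coh_terms [simp]:
  "stable_coh \<Gamma> (MEl0 a)" "stable_coh \<Gamma> MStar" "stable_coh \<Gamma> (MEl1 a b)" "stable_coh \<Gamma> MZero" "stable_coh \<Gamma> (MSuc a)"
  "stable_coh \<Gamma> (MElN a b c)" "stable_coh \<Gamma> MNil" "stable_coh \<Gamma> (MCons a b)" "stable_coh \<Gamma> (MElList a b c)"
  "stable_coh \<Gamma> (MInl a)" "stable_coh \<Gamma> (MInr a)" "stable_coh \<Gamma> (MElPlus a b c)" "stable_coh \<Gamma> (MPair a b)"
  "stable_coh \<Gamma> (MElSigma a b)" "stable_coh \<Gamma> (MLam a)" "stable_coh \<Gamma> (MAp a b)" "stable_coh \<Gamma> (MElFalsum a)"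
  "stable_coh \<Gamma> (MAndPair a b)" "stable_coh \<Gamma> (MPr1 a)" "stable_coh \<Gamma> (MPr2 a)" "stable_coh \<Gamma> (MOrInl a)"
  "stable_coh \<Gamma> (MOrInr a)" "stable_coh \<Gamma> (MElOr a b c)" "stable_coh \<Gamma> (MExPair a b)" "stable_coh \<Gamma> (MElEx a b)"
  "stable_coh \<Gamma> (MRefl a)" "stable_coh \<Gamma> (MElId a b)" "stable_coh \<Gamma> (MRf a b)" "stable_coh \<Gamma> (MTr a b c)"
  "stable_coh \<Gamma> (MInd a b c)" "stable_coh \<Gamma> (MAx1 a b)" "stable_coh \<Gamma> (MAx2 a b c)" "stable_coh \<Gamma> (MAx3 a b c d)"
  "stable_coh \<Gamma> MAc" "stable_coh \<Gamma> MCt"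
  by (rule stable_coh_neutral; simp)+

lemma lctx_hd_conv:
  assumes "\<turnstile> LTm (X # G) a A" "\<turnstile> LTy G Y" "\<turnstile> LTyEq G Y X"
  shows "\<turnstile> LTm (Y # G) a A"
  by (rule lctx_conv(3)[OF lctx_conv_cons[OF lsubst_id lty_hd(2)[OF assms(1)] assms(2,3)] assms(1)])
    (rule lctx_ty[OF assms(2)])

lemma small_dom_kind: "k \<in> {KProp, KProps} \<Longrightarrow> small (dom_kind k) = small k"
  by auto

subsection \<open>Structural rules\<close>

lemma inv_var: "judg_inv (MCtx \<Gamma>) \<Longrightarrow> i < length \<Gamma> \<Longrightarrow> judg_inv (MTm \<Gamma> (MVar i) (mvty \<Gamma> i))"
  by (auto simp: m2l_T_mvty stable_coh_var intro: stable_sub_mvty l_var)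

lemma inv_ty_sub: "msubsts \<Gamma> \<sigma> \<Delta> \<Longrightarrow> judg_inv (MTy \<Delta> k A) \<Longrightarrow> judg_inv (MTy \<Gamma> k (msub \<sigma> A))"
  by (auto intro: type_inv_msub)

lemma inv_tyeq_sub:
  assumes \<sigma>: "msubsts \<Gamma> \<sigma> \<Delta>" and "judg_inv (MTyEq \<Delta> k A B)"
  shows "judg_inv (MTyEq \<Gamma> k (msub \<sigma> A) (msub \<sigma> B))"
proof -
  from assms(2) have eq: "\<turnstile> LTyEq (lcx \<Delta>) (m2l_T A) (m2l_T B)" and A: "stable_sub \<Delta> A" and B: "stable_sub \<Delta> B" by auto
  from l_tyeq_trans[OF m2l_T_msub_eq[OF \<sigma> A]
      ltyeq_conv_trans[OF lsubst_app(2)[OF msubsts_lsubst[OF \<sigma>] eq] m2l_T_msub_eq[OF \<sigma> B]]]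
    stable_sub_msub[OF \<sigma> A] stable_sub_msub[OF \<sigma> B]
  show ?thesis by simp
qed

lemma inv_tm_sub:
  assumes \<sigma>: "msubsts \<Gamma> \<sigma> \<Delta>" and "judg_inv (MTm \<Delta> a A)"
  shows "judg_inv (MTm \<Gamma> (msub \<sigma> a) (msub \<sigma> A))"
proof -
  from assms(2) have a: "\<turnstile> LTm (lcx \<Delta>) (m2l_t a) (m2l_T A)" and A: "stable_sub \<Delta> A" and "stable_coh \<Delta> a" by auto
  with l_tm_conv[OF lsubst_app(3)[OF msubsts_lsubst[OF \<sigma>] a]
      l_tyeq_sym[OF m2l_T_msub_eq[OF \<sigma> A]]]
    stable_sub_msub[OF \<sigma> A] stable_coh_msub[OF \<sigma>]
  show ?thesis by (simp add: m2l_t_msub)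
qed

lemma inv_tmeq_sub:
  assumes \<sigma>: "msubsts \<Gamma> \<sigma> \<Delta>" and "judg_inv (MTmEq \<Delta> a b A)"
  shows "judg_inv (MTmEq \<Gamma> (msub \<sigma> a) (msub \<sigma> b) (msub \<sigma> A))"
proof -
  from assms(2) have eq: "\<turnstile> LTmEq (lcx \<Delta>) (m2l_t a) (m2l_t b) (m2l_T A)" and A: "stable_sub \<Delta> A" by auto
  from l_tmeq_conv[OF lsubst_app(4)[OF msubsts_lsubst[OF \<sigma>] eq]
      l_tyeq_sym[OF m2l_T_msub_eq[OF \<sigma> A]]]
    stable_sub_msub[OF \<sigma> A]
  show ?thesis by (simp add: m2l_t_msub)
qed

lemma inv_msubst_eq:
  assumes "msubsts \<Gamma> \<sigma> \<Delta>" "msubsts \<Gamma> \<tau> \<Delta>" "judg_inv (MCtx \<Delta>)"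
    "\<forall>i<length \<Delta>. judg_inv (MTmEq \<Gamma> (\<sigma> i) (\<tau> i) (msub \<sigma> (mvty \<Delta> i)))"
  shows "l_subst_eq (MLtt_cind_CT t u) (lcx \<Gamma>) (m2l_t \<circ> \<sigma>) (m2l_t \<circ> \<tau>) (lcx \<Delta>)"
proof -
  have "\<turnstile> LTmEq (lcx \<Gamma>) (m2l_t (\<sigma> i)) (m2l_t (\<tau> i)) (lsub (m2l_t \<circ> \<sigma>) (lvty (lcx \<Delta>) i))"
    if "i < length \<Delta>" for i
  proof -
    have "stable_sub \<Delta> (mvty \<Delta> i)" using assms(3) that by (simp add: stable_sub_mvty)
    from m2l_T_msub_eq[OF assms(1) this] assms(4) that show ?thesis
      by (auto simp: m2l_T_mvty intro: l_tmeq_conv)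
  qed
  with msubsts_lsubst[OF assms(1)] msubsts_lsubst[OF assms(2)] show ?thesis
    by (simp add: lsubst_def)
qed

lemma inv_ty_repl:
  assumes "msubsts \<Gamma> \<sigma> \<Delta>" "msubsts \<Gamma> \<tau> \<Delta>" "judg_inv (MCtx \<Delta>)"
    "\<forall>i<length \<Delta>. judg_inv (MTmEq \<Gamma> (\<sigma> i) (\<tau> i) (msub \<sigma> (mvty \<Delta> i)))" "judg_inv (MTy \<Delta> k A)"
  shows "judg_inv (MTyEq \<Gamma> k (msub \<sigma> A) (msub \<tau> A))"
proof -
  from assms(5) have A: "\<turnstile> LTy (lcx \<Delta>) (m2l_T A)" "stable_sub \<Delta> A" by (auto simp: type_inv_def)
  from ltyeq_conv_trans[OF l_tyeq_trans[OF m2l_T_msub_eq[OF assms(1) A(2)]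
        MLtt_cind_CT.l_ty_repl[OF inv_msubst_eq[OF assms(1-4)] A(1)]] m2l_T_msub_eq[OF assms(2) A(2)]]
    stable_sub_msub[OF assms(1) A(2)] stable_sub_msub[OF assms(2) A(2)]
  show ?thesis by simp
qed

text \<open>Because terms commute strictly with substitution, source replacement becomes target
  replacement, and only the type has to be converted.\<close>

lemma inv_repl:
  assumes "msubsts \<Gamma> \<sigma> \<Delta>" "msubsts \<Gamma> \<tau> \<Delta>" "judg_inv (MCtx \<Delta>)"
    "\<forall>i<length \<Delta>. judg_inv (MTmEq \<Gamma> (\<sigma> i) (\<tau> i) (msub \<sigma> (mvty \<Delta> i)))" "judg_inv (MTm \<Delta> c C)"
  shows "judg_inv (MTmEq \<Gamma> (msub \<sigma> c) (msub \<tau> c) (msub \<sigma> C))"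
proof -
  from assms(5) have C: "\<turnstile> LTm (lcx \<Delta>) (m2l_t c) (m2l_T C)" "stable_sub \<Delta> C" by auto
  from l_tmeq_conv[OF MLtt_cind_CT.l_repl[OF inv_msubst_eq[OF assms(1-4)] C(1)]
      l_tyeq_sym[OF m2l_T_msub_eq[OF assms(1) C(2)]]]
    stable_sub_msub[OF assms(1) C(2)]
  show ?thesis by (simp add: m2l_t_msub o_def)
qed

text \<open>Stable decoding of a small proposition is precisely the second alternative of
  coherence.\<close>

lemma inv_propS_I: "judg_inv (MTy \<Gamma> KProps A) \<Longrightarrow> judg_inv (MTm \<Gamma> A MPropS)"
  using type_inv_D(2)[OF type_inv_PropS, of \<Gamma>]
  by (auto simp: type_inv_def stable_coh_def coherent_def stable_dec_def dest: lctx_ty)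

text \<open>Here the coherence of terms is spent: an element of \<open>prop_s\<close> becomes a type
  and must be equal to its decoding under every substitution. In the syntactic alternative
  reflexivity applies, as the instance has a code in \<open>LU\<close>.\<close>

lemma inv_propS_E:
  assumes "judg_inv (MTm \<Gamma> A MPropS)"
  shows "judg_inv (MTy \<Gamma> KProps A)"
proof -
  from assms have A: "\<turnstile> LTm (lcx \<Gamma>) (m2l_t A) LU" and coh: "stable_coh \<Gamma> A" by auto
  have "\<turnstile> LTyEq G (LT (m2l_t (msub \<sigma> A))) (m2l_T (msub \<sigma> A))"
    if \<sigma>: "msubst G \<sigma> \<Gamma>" for G \<sigma>
    using coh[unfolded stable_coh_def, rule_format, OF \<sigma>] l_T_F[OF msubst_lift_stable_dec[OF \<sigma> A]]
    by (auto simp: coherent_def intro: l_tyeq_refl)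
  then have "stable_dec \<Gamma> A" by (simp add: stable_dec_def)
  with A stable_sub_id[OF _ lctx_tm[OF A]] stable_dec_stable_sub show ?thesis by (simp add: type_inv_def)
qed

lemma inv_propS_E_eq:
  assumes "judg_inv (MTy \<Gamma> KProps A)" "judg_inv (MTy \<Gamma> KProps B)" "judg_inv (MTmEq \<Gamma> A B MPropS)"
  shows "judg_inv (MTyEq \<Gamma> KProps A B)"
proof -
  from assms have A: "\<turnstile> LTm (lcx \<Gamma>) (m2l_t A) LU" "stable_dec \<Gamma> A" and B: "\<turnstile> LTm (lcx \<Gamma>) (m2l_t B) LU" "stable_dec \<Gamma> B"
    and eq: "\<turnstile> LTmEq (lcx \<Gamma>) (m2l_t A) (m2l_t B) LU" by (auto simp: type_inv_def)
  note c = lctx_tm[OF A(1)]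
  from l_tyeq_trans[OF l_tyeq_sym[OF stable_dec_id[OF A(2) c]]
      l_tyeq_trans[OF lT_cong[OF A(1) B(1) eq] stable_dec_id[OF B(2) c]]]
  show ?thesis using A(2) B(2) by (simp add: stable_dec_stable_sub)
qed

subsection \<open>Sets\<close>

text \<open>The eliminations follow one scheme: each argument list of the motive is shown to be a
  substitution by \<open>minsts\<close>, the branches are brought to \<open>linst\<close> form, the
  target rule is applied, and the result is converted back.\<close>

lemma inv_N0_E:
  assumes "judg_inv (MTy (MN0 # \<Gamma>) KCol M)" "judg_inv (MTm \<Gamma> c MN0)"
  shows "judg_inv (MTm \<Gamma> (MEl0 c) (minst 0 M [c]))"
proof -
  from assms have M: "\<turnstile> LTy (LN0 # lcx \<Gamma>) (m2l_T M)" "stable_sub (MN0 # \<Gamma>) M"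
    and c: "\<turnstile> LTm (lcx \<Gamma>) (m2l_t c) LN0" "stable_coh \<Gamma> c" by (auto simp: type_inv_def)
  have "minsts \<Gamma> 0 [c] (MN0 # \<Gamma>)" using lty_hd(1)[OF M(1)] c by (intro minsts_hd) auto
  from MLtt_cind_CT.l_N0_E[OF M(1) c(1)] show ?thesis
    by (intro inv_tmI[OF \<open>minsts \<Gamma> 0 [c] (MN0 # \<Gamma>)\<close> M(2)]) simp_all
qed

lemma inv_N1:
  assumes M: "judg_inv (MTy (MN1 # \<Gamma>) KCol M)" and c: "judg_inv (MTm \<Gamma> c (minst 0 M [MStar]))"
  shows "judg_inv (MTm \<Gamma> a MN1) \<Longrightarrow> judg_inv (MTm \<Gamma> (MEl1 a c) (minst 0 M [a]))"
    and "judg_inv (MTmEq \<Gamma> (MEl1 MStar c) c (minst 0 M [MStar]))"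
proof -
  from M have M: "\<turnstile> LTy (LN1 # lcx \<Gamma>) (m2l_T M)" "stable_sub (MN1 # \<Gamma>) M" by (auto simp: type_inv_def)
  note N = lty_hd(1)[OF M(1)]
  have star: "minsts \<Gamma> 0 [MStar] (MN1 # \<Gamma>)"
    using N MLtt_cind_CT.l_N1_I[OF lctx_ty[OF N]] by (intro minsts_hd) auto
  from inv_tmD[OF star M(2) c] have c': "\<turnstile> LTm (lcx \<Gamma>) (m2l_t c) (linst 0 (m2l_T M) [LStar])" by simp
  show "judg_inv (MTm \<Gamma> (MEl1 a c) (minst 0 M [a]))" if "judg_inv (MTm \<Gamma> a MN1)"
    using that N MLtt_cind_CT.l_N1_E[OF M(1) _ c']
    by (intro inv_tmI[OF minsts_hd M(2)]) (simp_all)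
  show "judg_inv (MTmEq \<Gamma> (MEl1 MStar c) c (minst 0 M [MStar]))"
    using MLtt_cind_CT.l_N1_C[OF M(1) c']
    by (intro inv_tmeqI[OF star M(2)]) (simp_all)
qed

lemma inv_Nat:
  assumes M: "judg_inv (MTy (MNat # \<Gamma>) KCol M)" and c: "judg_inv (MTm \<Gamma> c (minst 0 M [MZero]))"
    and l: "judg_inv (MTm (M # MNat # \<Gamma>) l (minst 2 M [MSuc (MVar 1)]))"
  shows "judg_inv (MTm \<Gamma> a MNat) \<Longrightarrow> judg_inv (MTm \<Gamma> (MElN a c l) (minst 0 M [a]))"
    and "judg_inv (MTmEq \<Gamma> (MElN MZero c l) c (minst 0 M [MZero]))"
    and "judg_inv (MTm \<Gamma> a MNat)
      \<Longrightarrow> judg_inv (MTmEq \<Gamma> (MElN (MSuc a) c l) (minst 0 l [a, MElN a c l]) (minst 0 M [MSuc a]))"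
proof -
  from M have M: "\<turnstile> LTy (LNat # lcx \<Gamma>) (m2l_T M)" "stable_sub (MNat # \<Gamma>) M" by (auto simp: type_inv_def)
  note N = lty_hd(1)[OF M(1)]
  have hd: "minsts \<Gamma> 0 [a] (MNat # \<Gamma>)" if "\<turnstile> LTm (lcx \<Gamma>) (m2l_t a) LNat" "stable_coh \<Gamma> a" for a
    using N that by (intro minsts_hd) auto
  have zero: "minsts \<Gamma> 0 [MZero] (MNat # \<Gamma>)"
    using l_N_I1[OF lctx_ty[OF N]] by (intro hd) auto
  have suc: "minsts (M # MNat # \<Gamma>) 2 [MSuc (MVar 1)] (MNat # \<Gamma>)"
    using N M l_N_I2 lvar_1[OF M(1)] by (intro minsts_single minsts_2) auto
  from inv_tmD[OF zero M(2) c] have c': "\<turnstile> LTm (lcx \<Gamma>) (m2l_t c) (linst 0 (m2l_T M) [LZero])" by simp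
  from inv_tmD[OF suc M(2) l]
  have l': "\<turnstile> LTm (m2l_T M # LNat # lcx \<Gamma>) (m2l_t l) (linst 2 (m2l_T M) [LSuc (LVar 1)])" by simp
  show "judg_inv (MTm \<Gamma> (MElN a c l) (minst 0 M [a]))" if "judg_inv (MTm \<Gamma> a MNat)"
    using that MLtt_cind_CT.l_N_E[OF M(1) _ c' l']
    by (intro inv_tmI[OF hd M(2)]) (simp_all)
  show "judg_inv (MTmEq \<Gamma> (MElN MZero c l) c (minst 0 M [MZero]))"
    using MLtt_cind_CT.l_N_C1[OF M(1) c' l']
    by (intro inv_tmeqI[OF zero M(2)]) (simp_all)
  show "judg_inv (MTmEq \<Gamma> (MElN (MSuc a) c l) (minst 0 l [a, MElN a c l]) (minst 0 M [MSuc a]))"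
    if "judg_inv (MTm \<Gamma> a MNat)"
    using that MLtt_cind_CT.l_N_C2[OF M(1) _ c' l'] l_N_I2
    by (intro inv_tmeqI[OF hd M(2)]) (simp_all add: m2l_t_minst)
qed

lemma inv_List:
  assumes A: "judg_inv (MTy \<Gamma> KSet A)" and M: "judg_inv (MTy (MList A # \<Gamma>) KCol M)"
    and c: "judg_inv (MTm \<Gamma> c (minst 0 M [MNil]))"
    and l: "judg_inv (MTm (minst 2 M [MVar 1] # mlift 0 1 A # MList A # \<Gamma>) l (minst 3 M [MCons (MVar 2) (MVar 1)]))"
  shows "judg_inv (MTm \<Gamma> s (MList A)) \<Longrightarrow> judg_inv (MTm \<Gamma> (MElList s c l) (minst 0 M [s]))"
    and "judg_inv (MTmEq \<Gamma> (MElList MNil c l) c (minst 0 M [MNil]))"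
    and "judg_inv (MTm \<Gamma> s (MList A)) \<Longrightarrow> judg_inv (MTm \<Gamma> a A)
      \<Longrightarrow> judg_inv (MTmEq \<Gamma> (MElList (MCons s a) c l) (minst 0 l [s, a, MElList s c l]) (minst 0 M [MCons s a]))"
proof -
  from A have A: "\<turnstile> LTy (lcx \<Gamma>) (m2l_T A)" by (simp add: type_inv_def)
  from M have M: "\<turnstile> LTy (LList (m2l_T A) # lcx \<Gamma>) (m2l_T M)" "stable_sub (MList A # \<Gamma>) M" by (auto simp: type_inv_def)
  note L = lty_hd(1)[OF M(1)]
  let ?A = "m2l_T A" let ?G = "llift 0 1 ?A # LList ?A # lcx \<Gamma>"
  have A1: "\<turnstile> LTy (LList ?A # lcx \<Gamma>) (llift 0 1 ?A)" using lwk_ty[OF L A] .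
  have hd: "minsts \<Gamma> 0 [a] (MList A # \<Gamma>)" if "\<turnstile> LTm (lcx \<Gamma>) (m2l_t a) (LList ?A)" "stable_coh \<Gamma> a" for a
    using L that by (intro minsts_hd) auto
  have nil: "minsts \<Gamma> 0 [MNil] (MList A # \<Gamma>)"
    using MLtt_cind_CT.l_List_I1[OF A] by (intro hd) auto
  have prev: "minsts (mlift 0 1 A # MList A # \<Gamma>) 2 [MVar 1] (MList A # \<Gamma>)"
    using L A1 lvar_1[OF A1] by (intro minsts_single minsts_2) (auto simp: m2l_T_mlift stable_coh_var)
  have l1: "\<turnstile> LTm (m2l_T (minst 2 M [MVar 1]) # ?G) (m2l_t l) (m2l_T (minst 3 M [MCons (MVar 2) (MVar 1)]))"
    using l by (simp add: m2l_T_mlift)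
  note P = lty_hd(2)[OF l1]
  have w: "llift 0 1 (llift 0 2 e) = llift 0 3 e" for e by (simp add: llift_llift)
  have v: "\<turnstile> LTm (m2l_T (minst 2 M [MVar 1]) # ?G) (LVar 2) (LList (llift 0 3 ?A))"
    "\<turnstile> LTm (m2l_T (minst 2 M [MVar 1]) # ?G) (LVar 1) (llift 0 3 ?A)"
    using lwk_tm[OF P lvar_1[OF A1]] lvar_1[OF P]
    by (simp_all add: w llift_llift) (simp add: llift_def upr_def)
  have "\<turnstile> LTy (m2l_T (minst 2 M [MVar 1]) # ?G) (llift 0 3 ?A)"
    using lwk2_ty[OF P A1] by (simp add: llift_llift)
  from l_List_I2[OF this v]
  have cons: "minsts (minst 2 M [MVar 1] # mlift 0 1 A # MList A # \<Gamma>) 3 [MCons (MVar 2) (MVar 1)] (MList A # \<Gamma>)"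
    using L P by (intro minsts_single minsts_3) (auto simp: m2l_T_mlift llift_def)
  from inv_tmD[OF nil M(2) c] have c': "\<turnstile> LTm (lcx \<Gamma>) (m2l_t c) (linst 0 (m2l_T M) [LNil])" by simp
  \<comment> \<open>The induction hypothesis is a context entry whose interpretation only equals the
    \<open>linst\<close> form expected by the target rule, so the branch is moved by context
    conversion.\<close>
  have l': "\<turnstile> LTm (linst 2 (m2l_T M) [LVar 1] # ?G) (m2l_t l) (linst 3 (m2l_T M) [LCons (LVar 2) (LVar 1)])"
  proof (rule lctx_hd_conv)
    show "\<turnstile> LTm (m2l_T (minst 2 M [MVar 1]) # ?G) (m2l_t l) (linst 3 (m2l_T M) [LCons (LVar 2) (LVar 1)])"
      using inv_tmD[OF cons M(2) l] by (simp add: m2l_T_mlift)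
    show "\<turnstile> LTy ?G (linst 2 (m2l_T M) [LVar 1])"
      using minsts_lty[OF prev] M(1) by (simp add: m2l_T_mlift)
    show "\<turnstile> LTyEq ?G (linst 2 (m2l_T M) [LVar 1]) (m2l_T (minst 2 M [MVar 1]))"
      using minst_eq[OF prev M(2)] by (simp add: m2l_T_mlift l_tyeq_sym)
  qed
  show "judg_inv (MTm \<Gamma> (MElList s c l) (minst 0 M [s]))" if "judg_inv (MTm \<Gamma> s (MList A))"
    using that MLtt_cind_CT.l_List_E[OF A M(1) _ c' l']
    by (intro inv_tmI[OF hd M(2)]) (simp_all)
  show "judg_inv (MTmEq \<Gamma> (MElList MNil c l) c (minst 0 M [MNil]))"
    using MLtt_cind_CT.l_List_C1[OF A M(1) c' l']
    by (intro inv_tmeqI[OF nil M(2)]) (simp_all)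
  show "judg_inv (MTmEq \<Gamma> (MElList (MCons s a) c l) (minst 0 l [s, a, MElList s c l]) (minst 0 M [MCons s a]))"
    if "judg_inv (MTm \<Gamma> s (MList A))" "judg_inv (MTm \<Gamma> a A)"
    using that MLtt_cind_CT.l_List_C2[OF A M(1) _ _ c' l'] l_List_I2[OF A]
    by (intro inv_tmeqI[OF hd M(2)]) (simp_all add: m2l_t_minst)
qed

lemma inv_Plus:
  assumes A: "judg_inv (MTy \<Gamma> KSet A)" and B: "judg_inv (MTy \<Gamma> KSet B)" and M: "judg_inv (MTy (MPlus A B # \<Gamma>) KCol M)"
    and c: "judg_inv (MTm (A # \<Gamma>) c (minst 1 M [MInl (MVar 0)]))"
    and d: "judg_inv (MTm (B # \<Gamma>) d (minst 1 M [MInr (MVar 0)]))"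
  shows "judg_inv (MTm \<Gamma> w (MPlus A B)) \<Longrightarrow> judg_inv (MTm \<Gamma> (MElPlus w c d) (minst 0 M [w]))"
    and "judg_inv (MTm \<Gamma> a A) \<Longrightarrow> judg_inv (MTmEq \<Gamma> (MElPlus (MInl a) c d) (minst 0 c [a]) (minst 0 M [MInl a]))"
    and "judg_inv (MTm \<Gamma> b B) \<Longrightarrow> judg_inv (MTmEq \<Gamma> (MElPlus (MInr b) c d) (minst 0 d [b]) (minst 0 M [MInr b]))"
proof -
  from A B have A: "\<turnstile> LTy (lcx \<Gamma>) (m2l_T A)" and B: "\<turnstile> LTy (lcx \<Gamma>) (m2l_T B)" by (auto simp: type_inv_def)
  from M have M: "\<turnstile> LTy (LPlus (m2l_T A) (m2l_T B) # lcx \<Gamma>) (m2l_T M)" "stable_sub (MPlus A B # \<Gamma>) M"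
    by (auto simp: type_inv_def)
  note P = lty_hd(1)[OF M(1)]
  have hd: "minsts \<Gamma> 0 [a] (MPlus A B # \<Gamma>)"
    if "\<turnstile> LTm (lcx \<Gamma>) (m2l_t a) (LPlus (m2l_T A) (m2l_T B))" "stable_coh \<Gamma> a" for a
    using P that by (intro minsts_hd) auto
  have wk: "llift k n (LPlus X Y) = LPlus (llift k n X) (llift k n Y)" for k n X Y by (simp add: llift_def)
  have inl: "minsts (A # \<Gamma>) 1 [MInl (MVar 0)] (MPlus A B # \<Gamma>)"
    using P l_Plus_I1[OF lwk_ty[OF A A] lwk_ty[OF A B] lvar_0[OF A]] A
    by (intro minsts_single minsts_1) (auto simp: wk)
  have inr: "minsts (B # \<Gamma>) 1 [MInr (MVar 0)] (MPlus A B # \<Gamma>)"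
    using P l_Plus_I2[OF lwk_ty[OF B A] lwk_ty[OF B B] lvar_0[OF B]] B
    by (intro minsts_single minsts_1) (auto simp: wk)
  from inv_tmD[OF inl M(2) c]
  have c': "\<turnstile> LTm (m2l_T A # lcx \<Gamma>) (m2l_t c) (linst 1 (m2l_T M) [LInl (LVar 0)])" by simp
  from inv_tmD[OF inr M(2) d]
  have d': "\<turnstile> LTm (m2l_T B # lcx \<Gamma>) (m2l_t d) (linst 1 (m2l_T M) [LInr (LVar 0)])" by simp
  show "judg_inv (MTm \<Gamma> (MElPlus w c d) (minst 0 M [w]))" if "judg_inv (MTm \<Gamma> w (MPlus A B))"
    using that MLtt_cind_CT.l_Plus_E[OF A B M(1) _ c' d']
    by (intro inv_tmI[OF hd M(2)]) (simp_all)
  show "judg_inv (MTmEq \<Gamma> (MElPlus (MInl a) c d) (minst 0 c [a]) (minst 0 M [MInl a]))" if "judg_inv (MTm \<Gamma> a A)"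
    using that MLtt_cind_CT.l_Plus_C1[OF A B M(1) _ c' d'] l_Plus_I1[OF A B]
    by (intro inv_tmeqI[OF hd M(2)]) (simp_all add: m2l_t_minst)
  show "judg_inv (MTmEq \<Gamma> (MElPlus (MInr b) c d) (minst 0 d [b]) (minst 0 M [MInr b]))" if "judg_inv (MTm \<Gamma> b B)"
    using that MLtt_cind_CT.l_Plus_C2[OF A B M(1) _ c' d'] l_Plus_I2[OF A B]
    by (intro inv_tmeqI[OF hd M(2)]) (simp_all add: m2l_t_minst)
qed

lemma pair_typed:
  assumes "judg_inv (MTy (A # \<Gamma>) k B)" "judg_inv (MTm \<Gamma> a A)" "judg_inv (MTm \<Gamma> b (minst 0 B [a]))"
  shows "\<turnstile> LTy (lcx \<Gamma>) (m2l_T A)" "\<turnstile> LTy (m2l_T A # lcx \<Gamma>) (m2l_T B)"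
    "\<turnstile> LTm (lcx \<Gamma>) (m2l_t b) (linst 0 (m2l_T B) [m2l_t a])"
    "\<turnstile> LTm (lcx \<Gamma>) (LPair (m2l_t a) (m2l_t b)) (LSigma (m2l_T A) (m2l_T B))"
proof -
  from assms(1) show B: "\<turnstile> LTy (m2l_T A # lcx \<Gamma>) (m2l_T B)" by (simp add: type_inv_def)
  then show A: "\<turnstile> LTy (lcx \<Gamma>) (m2l_T A)" by (rule lty_hd)
  have "minsts \<Gamma> 0 [a] (A # \<Gamma>)" using A assms(2) by (intro minsts_hd) auto
  from inv_tmD[OF this _ assms(3)] assms(1)
  show b: "\<turnstile> LTm (lcx \<Gamma>) (m2l_t b) (linst 0 (m2l_T B) [m2l_t a])" by (simp add: type_inv_def)
  from assms(2) b show "\<turnstile> LTm (lcx \<Gamma>) (LPair (m2l_t a) (m2l_t b)) (LSigma (m2l_T A) (m2l_T B))"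
    by (auto intro: l_Sigma_I[OF A B])
qed

lemma inv_Sigma_I:
  assumes "judg_inv (MTy \<Gamma> KCol A)" "judg_inv (MTy (A # \<Gamma>) KCol B)" "judg_inv (MTm \<Gamma> a A)" "judg_inv (MTm \<Gamma> b (minst 0 B [a]))"
  shows "judg_inv (MTm \<Gamma> (MPair a b) (MSigma A B))"
  using pair_typed[OF assms(2-4)] type_inv_D(2)[OF type_inv_Sigma] assms(1,2) by simp

lemma inv_Sigma:
  assumes B: "judg_inv (MTy (A # \<Gamma>) KCol B)" and M: "judg_inv (MTy (MSigma A B # \<Gamma>) KCol M)"
    and m: "judg_inv (MTm (B # A # \<Gamma>) m (minst 2 M [MPair (MVar 1) (MVar 0)]))"
  shows "judg_inv (MTm \<Gamma> d (MSigma A B)) \<Longrightarrow> judg_inv (MTm \<Gamma> (MElSigma d m) (minst 0 M [d]))"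
    and "judg_inv (MTm \<Gamma> a A) \<Longrightarrow> judg_inv (MTm \<Gamma> b (minst 0 B [a]))
      \<Longrightarrow> judg_inv (MTmEq \<Gamma> (MElSigma (MPair a b) m) (minst 0 m [a, b]) (minst 0 M [MPair a b]))"
proof -
  let ?A = "m2l_T A" and ?B = "m2l_T B" and ?w = "\<lambda>i. LVar (i + 2)"
  from M have M: "\<turnstile> LTy (LSigma ?A ?B # lcx \<Gamma>) (m2l_T M)" "stable_sub (MSigma A B # \<Gamma>) M" by (auto simp: type_inv_def)
  from B have B': "\<turnstile> LTy (?A # lcx \<Gamma>) ?B" by (simp add: type_inv_def)
  note A = lty_hd(1)[OF B'] and S = lty_hd(1)[OF M(1)]
  have hd: "minsts \<Gamma> 0 [a] (MSigma A B # \<Gamma>)" if "\<turnstile> LTm (lcx \<Gamma>) (m2l_t a) (LSigma ?A ?B)" "stable_coh \<Gamma> a" for a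
    using S that by (intro minsts_hd) auto
  note w = lsubst_wk2[OF B']
  have "\<turnstile> LTm (?B # ?A # lcx \<Gamma>) (LVar 0) (linst 0 (lsub (lups 1 ?w) ?B) [LVar 1])"
  proof -
    have "linst 0 (lsub (lups 1 ?w) ?B) [LVar 1] = llift 0 1 ?B"
      by (auto simp: lsub_norms split: nat.split intro!: lsub_eqI)
    with lvar_0[OF B'] show ?thesis by simp
  qed
  moreover have "\<turnstile> LTm (?B # ?A # lcx \<Gamma>) (LVar 1) (lsub ?w ?A)"
    using lvar_1[OF B'] by (simp add: llift_eq_lsub)
  ultimately have "\<turnstile> LTm (?B # ?A # lcx \<Gamma>) (LPair (LVar 1) (LVar 0)) (LSigma (lsub ?w ?A) (lsub (lups 1 ?w) ?B))"
    by (intro l_Sigma_I lsubst_app(1)[OF w A] lsubst_app(1)[OF lsubst_up_same[OF w A] B'])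
  moreover have "llift 0 2 (LSigma ?A ?B) = LSigma (lsub ?w ?A) (lsub (lups 1 ?w) ?B)"
    by (simp add: llift_eq_lsub)
  ultimately have "minsts (B # A # \<Gamma>) 2 [MPair (MVar 1) (MVar 0)] (MSigma A B # \<Gamma>)"
    using S B' by (intro minsts_single minsts_2) auto
  from inv_tmD[OF this M(2) m]
  have m': "\<turnstile> LTm (?B # ?A # lcx \<Gamma>) (m2l_t m) (linst 2 (m2l_T M) [LPair (LVar 1) (LVar 0)])" by simp
  show "judg_inv (MTm \<Gamma> (MElSigma d m) (minst 0 M [d]))" if "judg_inv (MTm \<Gamma> d (MSigma A B))"
    using that l_Sigma_E[OF A B' M(1) _ m']
    by (intro inv_tmI[OF hd M(2)]) (simp_all)
  show "judg_inv (MTmEq \<Gamma> (MElSigma (MPair a b) m) (minst 0 m [a, b]) (minst 0 M [MPair a b]))"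
    if a: "judg_inv (MTm \<Gamma> a A)" and b: "judg_inv (MTm \<Gamma> b (minst 0 B [a]))"
    using a pair_typed[OF B a b] MLtt_cind_CT.l_Sigma_C[OF A B' M(1) _ _ m']
    by (intro inv_tmeqI[OF hd M(2)]) (simp_all add: m2l_t_minst)
qed

text \<open>The kind is arbitrary and \<open>f\<close> is typed by \<open>LPi\<close> directly, so
  that dependent products and universal quantifiers, which share abstraction and application, are
  both covered.\<close>

lemma lam_app:
  assumes "judg_inv (MTy (A # \<Gamma>) k B)"
  shows "judg_inv (MTm (A # \<Gamma>) b B) \<Longrightarrow> \<turnstile> LTm (lcx \<Gamma>) (LLam (m2l_t b)) (LPi (m2l_T A) (m2l_T B))"
    and "\<turnstile> LTm (lcx \<Gamma>) (m2l_t f) (LPi (m2l_T A) (m2l_T B)) \<Longrightarrow> judg_inv (MTm \<Gamma> a A)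
      \<Longrightarrow> judg_inv (MTm \<Gamma> (MAp f a) (minst 0 B [a]))"
    and "judg_inv (MTm (A # \<Gamma>) b B) \<Longrightarrow> judg_inv (MTm \<Gamma> a A)
      \<Longrightarrow> judg_inv (MTmEq \<Gamma> (MAp (MLam b) a) (minst 0 b [a]) (minst 0 B [a]))"
proof -
  from assms have B: "\<turnstile> LTy (m2l_T A # lcx \<Gamma>) (m2l_T B)" "stable_sub (A # \<Gamma>) B" by (auto simp: type_inv_def)
  note A = lty_hd(1)[OF B(1)]
  show "judg_inv (MTm (A # \<Gamma>) b B) \<Longrightarrow> \<turnstile> LTm (lcx \<Gamma>) (LLam (m2l_t b)) (LPi (m2l_T A) (m2l_T B))"
    by (auto intro: l_Pi_I[OF A B(1)])
  show "\<turnstile> LTm (lcx \<Gamma>) (m2l_t f) (LPi (m2l_T A) (m2l_T B)) \<Longrightarrow> judg_inv (MTm \<Gamma> a A)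
      \<Longrightarrow> judg_inv (MTm \<Gamma> (MAp f a) (minst 0 B [a]))"
    using l_Pi_E[OF A B(1)]
    by (intro inv_tmI[OF minsts_hd[OF A] B(2)]) (simp_all)
  show "judg_inv (MTm (A # \<Gamma>) b B) \<Longrightarrow> judg_inv (MTm \<Gamma> a A)
      \<Longrightarrow> judg_inv (MTmEq \<Gamma> (MAp (MLam b) a) (minst 0 b [a]) (minst 0 B [a]))"
    using l_Pi_C[OF A B(1)]
    by (intro inv_tmeqI[OF minsts_hd[OF A] B(2)]) (simp_all add: m2l_t_minst)
qed

subsection \<open>Propositions\<close>

lemma inv_Falsum_E: "judg_inv (MTy \<Gamma> KProp P) \<Longrightarrow> judg_inv (MTm \<Gamma> c MFalsum) \<Longrightarrow> judg_inv (MTm \<Gamma> (MElFalsum c) P)"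
  by (auto simp: type_inv_def intro: lEl0_nondep)

lemma inv_And:
  assumes A: "judg_inv (MTy \<Gamma> KProp A)" and B: "judg_inv (MTy \<Gamma> KProp B)"
  shows "judg_inv (MTm \<Gamma> a A) \<Longrightarrow> judg_inv (MTm \<Gamma> b B) \<Longrightarrow> judg_inv (MTm \<Gamma> (MAndPair a b) (MAnd A B))"
    and "judg_inv (MTm \<Gamma> d (MAnd A B)) \<Longrightarrow> judg_inv (MTm \<Gamma> (MPr1 d) A)"
    and "judg_inv (MTm \<Gamma> d (MAnd A B)) \<Longrightarrow> judg_inv (MTm \<Gamma> (MPr2 d) B)"
    and "judg_inv (MTm \<Gamma> a A) \<Longrightarrow> judg_inv (MTm \<Gamma> b B) \<Longrightarrow> judg_inv (MTmEq \<Gamma> (MPr1 (MAndPair a b)) a A)"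
    and "judg_inv (MTm \<Gamma> a A) \<Longrightarrow> judg_inv (MTm \<Gamma> b B) \<Longrightarrow> judg_inv (MTmEq \<Gamma> (MPr2 (MAndPair a b)) b B)"
proof -
  from A B have "type_inv \<Gamma> False (MAnd A B)" by (auto intro: type_inv_And)
  with type_inv_D[of \<Gamma> False A] type_inv_D[of \<Gamma> False B] type_inv_D[of \<Gamma> False "MAnd A B"] A B
  show "judg_inv (MTm \<Gamma> a A) \<Longrightarrow> judg_inv (MTm \<Gamma> b B) \<Longrightarrow> judg_inv (MTm \<Gamma> (MAndPair a b) (MAnd A B))"
    "judg_inv (MTm \<Gamma> d (MAnd A B)) \<Longrightarrow> judg_inv (MTm \<Gamma> (MPr1 d) A)"
    "judg_inv (MTm \<Gamma> d (MAnd A B)) \<Longrightarrow> judg_inv (MTm \<Gamma> (MPr2 d) B)"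
    "judg_inv (MTm \<Gamma> a A) \<Longrightarrow> judg_inv (MTm \<Gamma> b B) \<Longrightarrow> judg_inv (MTmEq \<Gamma> (MPr1 (MAndPair a b)) a A)"
    "judg_inv (MTm \<Gamma> a A) \<Longrightarrow> judg_inv (MTm \<Gamma> b B) \<Longrightarrow> judg_inv (MTmEq \<Gamma> (MPr2 (MAndPair a b)) b B)"
    by (auto intro: lprod_I lprod_E)
qed

lemma inv_Or_I:
  assumes A: "judg_inv (MTy \<Gamma> KProp A)" and B: "judg_inv (MTy \<Gamma> KProp B)"
  shows "judg_inv (MTm \<Gamma> a A) \<Longrightarrow> judg_inv (MTm \<Gamma> (MOrInl a) (MOr A B))"
    and "judg_inv (MTm \<Gamma> b B) \<Longrightarrow> judg_inv (MTm \<Gamma> (MOrInr b) (MOr A B))"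
proof -
  from A B have "type_inv \<Gamma> False (MOr A B)" by (auto intro: type_inv_Or)
  with type_inv_D[of \<Gamma> False A] type_inv_D[of \<Gamma> False B] type_inv_D[of \<Gamma> False "MOr A B"] A B
  show "judg_inv (MTm \<Gamma> a A) \<Longrightarrow> judg_inv (MTm \<Gamma> (MOrInl a) (MOr A B))"
    "judg_inv (MTm \<Gamma> b B) \<Longrightarrow> judg_inv (MTm \<Gamma> (MOrInr b) (MOr A B))"
    by (auto intro: l_Plus_I1 l_Plus_I2)
qed

lemma inv_Or:
  assumes P: "judg_inv (MTy \<Gamma> KProp P)" and c: "judg_inv (MTm (A # \<Gamma>) c (mlift 0 1 P))"
    and d: "judg_inv (MTm (B # \<Gamma>) d (mlift 0 1 P))"
  shows "judg_inv (MTm \<Gamma> w (MOr A B)) \<Longrightarrow> judg_inv (MTm \<Gamma> (MElOr w c d) P)"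
    and "judg_inv (MTm \<Gamma> a A) \<Longrightarrow> judg_inv (MTmEq \<Gamma> (MElOr (MOrInl a) c d) (minst 0 c [a]) P)"
    and "judg_inv (MTm \<Gamma> b B) \<Longrightarrow> judg_inv (MTmEq \<Gamma> (MElOr (MOrInr b) c d) (minst 0 d [b]) P)"
proof -
  from P c d have P': "\<turnstile> LTy (lcx \<Gamma>) (m2l_T P)" "stable_sub \<Gamma> P"
    and "\<turnstile> LTm (m2l_T A # lcx \<Gamma>) (m2l_t c) (llift 0 1 (m2l_T P))"
    and "\<turnstile> LTm (m2l_T B # lcx \<Gamma>) (m2l_t d) (llift 0 1 (m2l_T P))"
    by (auto simp: m2l_T_mlift type_inv_def)
  note R = lPlus_nondep[OF P'(1) this(3,4)]
  show "judg_inv (MTm \<Gamma> w (MOr A B)) \<Longrightarrow> judg_inv (MTm \<Gamma> (MElOr w c d) P)"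
    using R(1) P' by simp
  show "judg_inv (MTm \<Gamma> a A) \<Longrightarrow> judg_inv (MTmEq \<Gamma> (MElOr (MOrInl a) c d) (minst 0 c [a]) P)"
    using R(2) P' by (simp add: m2l_t_minst)
  show "judg_inv (MTm \<Gamma> b B) \<Longrightarrow> judg_inv (MTmEq \<Gamma> (MElOr (MOrInr b) c d) (minst 0 d [b]) P)"
    using R(3) P' by (simp add: m2l_t_minst)
qed

lemma inv_Imp:
  assumes A: "judg_inv (MTy \<Gamma> KProp A)" and B: "judg_inv (MTy \<Gamma> KProp B)"
  shows "judg_inv (MTm (A # \<Gamma>) b (mlift 0 1 B)) \<Longrightarrow> judg_inv (MTm \<Gamma> (MLam b) (MImp A B))"
    and "judg_inv (MTm \<Gamma> f (MImp A B)) \<Longrightarrow> judg_inv (MTm \<Gamma> a A) \<Longrightarrow> judg_inv (MTm \<Gamma> (MAp f a) B)"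
    and "judg_inv (MTm (A # \<Gamma>) b (mlift 0 1 B)) \<Longrightarrow> judg_inv (MTm \<Gamma> a A)
      \<Longrightarrow> judg_inv (MTmEq \<Gamma> (MAp (MLam b) a) (minst 0 b [a]) B)"
proof -
  from A B have I: "stable_sub \<Gamma> (MImp A B)" using type_inv_Imp type_inv_D(2) by fastforce
  from A B have A: "\<turnstile> LTy (lcx \<Gamma>) (m2l_T A)" and B: "\<turnstile> LTy (lcx \<Gamma>) (m2l_T B)" "stable_sub \<Gamma> B"
    by (auto simp: type_inv_def)
  show "judg_inv (MTm (A # \<Gamma>) b (mlift 0 1 B)) \<Longrightarrow> judg_inv (MTm \<Gamma> (MLam b) (MImp A B))"
    using larrow_I[OF B(1)] I by (simp add: m2l_T_mlift)
  show "judg_inv (MTm \<Gamma> f (MImp A B)) \<Longrightarrow> judg_inv (MTm \<Gamma> a A) \<Longrightarrow> judg_inv (MTm \<Gamma> (MAp f a) B)"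
    using larrow_E[OF A B(1)] B(2) by simp
  show "judg_inv (MTm (A # \<Gamma>) b (mlift 0 1 B)) \<Longrightarrow> judg_inv (MTm \<Gamma> a A)
      \<Longrightarrow> judg_inv (MTmEq \<Gamma> (MAp (MLam b) a) (minst 0 b [a]) B)"
    using larrow_C[OF B(1), of "m2l_T A" "m2l_t b"] B(2) by (simp add: m2l_T_mlift m2l_t_minst)
qed

lemma inv_Ex_I:
  assumes "judg_inv (MTy \<Gamma> KCol A)" "judg_inv (MTy (A # \<Gamma>) KProp B)" "judg_inv (MTm \<Gamma> a A)" "judg_inv (MTm \<Gamma> b (minst 0 B [a]))"
  shows "judg_inv (MTm \<Gamma> (MExPair a b) (MEx A B))"
  using pair_typed[OF assms(2-4)] type_inv_D(2)[OF type_inv_Ex] assms(1,2) by simp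

lemma inv_Ex:
  assumes B: "judg_inv (MTy (A # \<Gamma>) KProp B)" and P: "judg_inv (MTy \<Gamma> KProp P)"
    and m: "judg_inv (MTm (B # A # \<Gamma>) m (mlift 0 2 P))"
  shows "judg_inv (MTm \<Gamma> d (MEx A B)) \<Longrightarrow> judg_inv (MTm \<Gamma> (MElEx d m) P)"
    and "judg_inv (MTm \<Gamma> a A) \<Longrightarrow> judg_inv (MTm \<Gamma> b (minst 0 B [a]))
      \<Longrightarrow> judg_inv (MTmEq \<Gamma> (MElEx (MExPair a b) m) (minst 0 m [a, b]) P)"
proof -
  from P m have P': "\<turnstile> LTy (lcx \<Gamma>) (m2l_T P)" "stable_sub \<Gamma> P"
    and "\<turnstile> LTm (m2l_T B # m2l_T A # lcx \<Gamma>) (m2l_t m) (llift 0 2 (m2l_T P))"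
    by (auto simp: m2l_T_mlift type_inv_def)
  note R = lSigma_nondep[OF P'(1) this(3)]
  show "judg_inv (MTm \<Gamma> d (MEx A B)) \<Longrightarrow> judg_inv (MTm \<Gamma> (MElEx d m) P)"
    using R(1) P' by simp
  show "judg_inv (MTmEq \<Gamma> (MElEx (MExPair a b) m) (minst 0 m [a, b]) P)"
    if a: "judg_inv (MTm \<Gamma> a A)" and b: "judg_inv (MTm \<Gamma> b (minst 0 B [a]))"
    using a R(2)[OF _ pair_typed(3)[OF B a b]] P' by (simp add: m2l_t_minst)
qed

lemma inv_Id:
  assumes P: "judg_inv (MTy (mlift 0 1 A # A # \<Gamma>) KProp P)" and a: "judg_inv (MTm \<Gamma> a A)"
    and c: "judg_inv (MTm (A # \<Gamma>) c (minst 1 P [MVar 0, MVar 0]))"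
  shows "judg_inv (MTm \<Gamma> b A) \<Longrightarrow> judg_inv (MTm \<Gamma> p (MId A a b)) \<Longrightarrow> judg_inv (MTm \<Gamma> (MElId p c) (minst 0 P [a, b]))"
    and "judg_inv (MTmEq \<Gamma> (MElId (MRefl a) c) (minst 0 c [a]) (minst 0 P [a, a]))"
proof -
  let ?A = "m2l_T A"
  from P have P: "\<turnstile> LTy (llift 0 1 ?A # ?A # lcx \<Gamma>) (m2l_T P)" "stable_sub (mlift 0 1 A # A # \<Gamma>) P"
    by (auto simp: type_inv_def m2l_T_mlift)
  note A1 = lty_hd(1)[OF P(1)]
  note A = lty_hd(1)[OF A1]
  have two: "minsts \<Gamma> 0 [a, b] (mlift 0 1 A # A # \<Gamma>)" if "judg_inv (MTm \<Gamma> a A)" "judg_inv (MTm \<Gamma> b A)" for a b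
    using minsts_snoc[OF minsts_hd[OF A], of a "mlift 0 1 A" b] that A1
    by (simp add: m2l_T_mlift linst_llift)
  have v: "\<turnstile> LTm (?A # lcx \<Gamma>) (LVar 0) (llift 0 1 ?A)" using lvar_0[OF A] .
  have "minsts (A # \<Gamma>) 1 [MVar 0] (A # \<Gamma>)"
    using A v by (intro minsts_single minsts_1) (auto simp: stable_coh_var)
  from minsts_snoc[OF this, of "mlift 0 1 A" "MVar 0"] A1 v
  have diag: "minsts (A # \<Gamma>) 1 [MVar 0, MVar 0] (mlift 0 1 A # A # \<Gamma>)"
    by (simp add: m2l_T_mlift linst_llift stable_coh_var)
  from inv_tmD[OF diag P(2) c] have c': "\<turnstile> LTm (?A # lcx \<Gamma>) (m2l_t c) (linst 1 (m2l_T P) [LVar 0, LVar 0])"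
    by simp
  from a have a': "\<turnstile> LTm (lcx \<Gamma>) (m2l_t a) ?A" by simp
  note R = lId_nondep[OF P(1) c' a']
  show "judg_inv (MTm \<Gamma> (MElId p c) (minst 0 P [a, b]))" if "judg_inv (MTm \<Gamma> b A)" "judg_inv (MTm \<Gamma> p (MId A a b))"
    using that R(1) by (intro inv_tmI[OF two[OF a that(1)] P(2)]) simp_all
  show "judg_inv (MTmEq \<Gamma> (MElId (MRefl a) c) (minst 0 c [a]) (minst 0 P [a, a]))"
    using R(2) by (intro inv_tmeqI[OF two[OF a a] P(2)]) (simp_all add: m2l_t_minst)
qed

text \<open>\<open>B'\<close> is available over \<open>A\<close> only; the general form of
  \<open>stable_sub_Pi\<close> and \<open>stable_sub_Sigma\<close> was made for the right-hand sides
  here. The kinds are free, since the invariant of a type equation does not look at them.\<close>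

lemma inv_Pi_F_eq:
  assumes "judg_inv (MTyEq \<Gamma> k A A')" "judg_inv (MTyEq (A # \<Gamma>) k' B B')"
  shows "judg_inv (MTyEq \<Gamma> k'' (MPi A B) (MPi A' B'))" "judg_inv (MTyEq \<Gamma> k'' (MAll A B) (MAll A' B'))"
    and "judg_inv (MTyEq \<Gamma> k'' (MSigma A B) (MSigma A' B'))" "judg_inv (MTyEq \<Gamma> k'' (MEx A B) (MEx A' B'))"
proof -
  from assms have A: "\<turnstile> LTyEq (lcx \<Gamma>) (m2l_T A) (m2l_T A')" "stable_sub \<Gamma> A" "stable_sub \<Gamma> A'"
    and B: "\<turnstile> LTyEq (m2l_T A # lcx \<Gamma>) (m2l_T B) (m2l_T B')" "stable_sub (A # \<Gamma>) B" "stable_sub (A # \<Gamma>) B'"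
    by auto
  note ty = lty_hd(3)[OF B(1)]
  note p = stable_sub_Pi[OF ty ltyeq_refls(1)[OF A(1)] A(2) B(2)] stable_sub_Pi[OF ty A(1,3) B(3)]
  note s = stable_sub_Sigma[OF ty ltyeq_refls(1)[OF A(1)] A(2) B(2)] stable_sub_Sigma[OF ty A(1,3) B(3)]
  show "judg_inv (MTyEq \<Gamma> k'' (MPi A B) (MPi A' B'))" "judg_inv (MTyEq \<Gamma> k'' (MAll A B) (MAll A' B'))"
    using p l_Pi_F_eq[OF A(1) B(1)] by (simp_all add: stable_sub_prop_eq)
  show "judg_inv (MTyEq \<Gamma> k'' (MSigma A B) (MSigma A' B'))" "judg_inv (MTyEq \<Gamma> k'' (MEx A B) (MEx A' B'))"
    using s l_Sigma_F_eq[OF A(1) B(1)] by (simp_all add: stable_sub_prop_eq)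
qed

lemma inv_tyeq_wk:
  assumes "\<turnstile> LTy (lcx \<Gamma>) (m2l_T X)" "judg_inv (MTyEq \<Gamma> k A B)"
  shows "judg_inv (MTyEq (X # \<Gamma>) k (mlift 0 1 A) (mlift 0 1 B))"
  using inv_tyeq_sub[OF msubsts_wk1[OF assms(1)] assms(2)] by (simp add: mlift_eq_msub)

lemma inv_Imp_F_eq:
  assumes "judg_inv (MTyEq \<Gamma> k A A')" "judg_inv (MTyEq \<Gamma> k' B B')"
  shows "judg_inv (MTyEq \<Gamma> k'' (MImp A B) (MImp A' B'))" "judg_inv (MTyEq \<Gamma> k'' (MAnd A B) (MAnd A' B'))"
proof -
  from assms(1) have "\<turnstile> LTy (lcx \<Gamma>) (m2l_T A)" by (auto dest: ltyeq_lty)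
  from inv_Pi_F_eq[OF assms(1) inv_tyeq_wk[OF this assms(2)]]
  show "judg_inv (MTyEq \<Gamma> k'' (MImp A B) (MImp A' B'))" "judg_inv (MTyEq \<Gamma> k'' (MAnd A B) (MAnd A' B'))"
    by (simp_all add: stable_sub_prop_eq larrow_def lprod_def m2l_T_mlift)
qed

lemma inv_Plus_F_eq:
  assumes "judg_inv (MTyEq \<Gamma> k A A')" "judg_inv (MTyEq \<Gamma> k' B B')"
  shows "judg_inv (MTyEq \<Gamma> k'' (MPlus A B) (MPlus A' B'))" "judg_inv (MTyEq \<Gamma> k'' (MOr A B) (MOr A' B'))"
  using assms by (auto simp: stable_sub_prop_eq stable_sub_Plus intro: l_Plus_F_eq)

lemma inv_List_F_eq: "judg_inv (MTyEq \<Gamma> k A A') \<Longrightarrow> judg_inv (MTyEq \<Gamma> k (MList A) (MList A'))"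
  by (auto simp: stable_sub_List intro: l_List_F_eq)

text \<open>The premises on terms are mere equations; the typings needed for stability come from the
  presuppositions of the target theory.\<close>

lemma inv_Id_F_eq:
  assumes "judg_inv (MTyEq \<Gamma> k' A A')" "judg_inv (MTmEq \<Gamma> a a' A)" "judg_inv (MTmEq \<Gamma> b b' A)"
  shows "judg_inv (MTyEq \<Gamma> k (MId A a b) (MId A' a' b'))"
proof -
  from assms have A: "\<turnstile> LTyEq (lcx \<Gamma>) (m2l_T A) (m2l_T A')" "stable_sub \<Gamma> A" "stable_sub \<Gamma> A'"
    and a: "\<turnstile> LTmEq (lcx \<Gamma>) (m2l_t a) (m2l_t a') (m2l_T A)"
    and b: "\<turnstile> LTmEq (lcx \<Gamma>) (m2l_t b) (m2l_t b') (m2l_T A)" by auto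
  from stable_sub_Id[OF A(2) ltmeq_ltm(1)[OF a] ltmeq_ltm(1)[OF b]]
    stable_sub_Id[OF A(3) l_tm_conv[OF ltmeq_ltm(2)[OF a] A(1)]
      l_tm_conv[OF ltmeq_ltm(2)[OF b] A(1)]]
    l_Id_F_eq[OF A(1) a b]
  show ?thesis by simp
qed

subsection \<open>Covers and positivity relations\<close>

text \<open>Covers, positivity relations and memberships \<open>MAp V a\<close> are interpreted
  through term interpretations alone, so their type interpretation commutes strictly with
  substitution and a single decoding equation suffices.\<close>

lemma type_inv_syntactic:
  assumes "\<And>\<sigma>. m2l_T (msub \<sigma> A) = lsub (m2l_t \<circ> \<sigma>) (m2l_T A)"
    and "\<turnstile> LTm (lcx \<Gamma>) (m2l_t A) LU" "\<turnstile> LTyEq (lcx \<Gamma>) (LT (m2l_t A)) (m2l_T A)"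
  shows "type_inv \<Gamma> s A"
  using assms ltyeq_lty(2)[OF assms(3)] lsubst_app(1,2)[OF msubst_lsubst]
  by (fastforce simp: type_inv_def stable_sub_def stable_dec_def m2l_t_msub intro: l_tyeq_refl)

lemma lprod_lsub: "lsub \<sigma> (lprod A B) = lprod (lsub \<sigma> A) (lsub \<sigma> B)"
  by (simp add: lprod_def lsub_lups_llift)

lemma llift_wk2: "llift 0 1 \<circ> (lshift 2) = (lshift 3)"
  by (simp add: fun_eq_iff llift_def)

text \<open>This types the swap of conjuncts in the clause for \<open>MAx3\<close>. The resulting
  type does not depend on the pair, so the non-dependent eliminator applies.\<close>

lemma lSigma_swap:
  assumes X: "\<turnstile> LTy (S # G) X" and E: "\<turnstile> LTy (S # G) E" and q: "\<turnstile> LTm G q (LSigma S (lprod X E))"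
  shows "\<turnstile> LTm G (LElSigma q (LPair (LVar 1) (LPair (lsnd (LVar 0)) (lfst (LVar 0))))) (LSigma S (lprod E X))"
proof -
  note S = lty_hd(1)[OF X]
  note XE = lprod_F[OF X E] and EX = lprod_F[OF E X]
  let ?w = "\<lambda>i. LVar (i + 2)" and ?G = "lprod X E # S # G"
  note w = lsubst_wk2[OF XE]
  have v: "\<turnstile> LTm ?G (LVar 0) (lprod (llift 0 1 X) (llift 0 1 E))"
    using lvar_0[OF XE] by (simp only: llift_eq_lsub lprod_lsub)
  note X1 = lwk_ty[OF XE X] and E1 = lwk_ty[OF XE E]
  have p: "\<turnstile> LTm ?G (LPair (lsnd (LVar 0)) (lfst (LVar 0))) (linst 0 (lsub (lups 1 ?w) (lprod E X)) [LVar 1])"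
  proof -
    have "linst 0 (lsub (lups 1 ?w) (lprod E X)) [LVar 1] = lprod (llift 0 1 E) (llift 0 1 X)"
      by (auto simp: lprod_def lsub_norms split: nat.split intro!: lsub_eqI)
    with lprod_I[OF E1 X1 lprod_E(2)[OF X1 E1 v] lprod_E(1)[OF X1 E1 v]] show ?thesis by simp
  qed
  have "\<turnstile> LTm ?G (LVar 1) (lsub ?w S)" using lvar_1[OF XE] by (simp add: llift_eq_lsub)
  from l_Sigma_I[OF lsubst_app(1)[OF w S] lsubst_app(1)[OF lsubst_up_same[OF w S] EX] this p]
  have "\<turnstile> LTm ?G (LPair (LVar 1) (LPair (lsnd (LVar 0)) (lfst (LVar 0)))) (llift 0 2 (LSigma S (lprod E X)))"
    by (simp add: llift_eq_lsub)
  from lSigma_nondep(1)[OF l_Sigma_F[OF S EX] this q] show ?thesis .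
qed

lemma m2l_T_cov_inst: "m2l_T (minst n (mcov_fam A I C V) as)
    = linst n (lcov_fam (m2l_t A) (m2l_t I) (m2l_t C) (m2l_t V)) (map m2l_t as)"
  by (simp add: minst_eq_msub linst_eq_lsub mcov_fam_def lcov_fam_def m2l_t_msub m2l_t_mlift
    m2l_t_mups m2l_t_fold[symmetric])

lemma m2l_T_mall_in: "m2l_T (mall_in n A C F x j) = LPi (llift 0 n (m2l_T A))
    (larrow (LT (LAp (linst (n + 1) (m2l_t C) [llift 0 1 (m2l_t x), llift 0 1 (m2l_t j)]) (LVar 0)))
      (m2l_T (minst (n + 1) F [MVar 0])))"
  by (simp add: mall_in_def m2l_T_mlift m2l_t_minst m2l_t_mlift)

context
  fixes \<Gamma> :: "mexp list" and A I C V :: mexp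
  assumes max: "m_axset judg_inv \<Gamma> A I C V"
begin

lemma axset_A: "\<turnstile> LTy (lcx \<Gamma>) (m2l_T A)" "\<turnstile> LTm (lcx \<Gamma>) (m2l_t A) LU" "\<turnstile> LTyEq (lcx \<Gamma>) (LT (m2l_t A)) (m2l_T A)"
  using max stable_dec_id lctx_ty by (auto simp: type_inv_def)

text \<open>Source judgements arrive over interpreted types, while the target rules want decoded
  codes; \<open>axset_conv\<close> carries judgements from the former contexts to the
  latter.\<close>

lemma axset_I: "\<turnstile> LTy (m2l_T A # lcx \<Gamma>) (m2l_T I)" "\<turnstile> LTm (LT (m2l_t A) # lcx \<Gamma>) (m2l_t I) LU"
  "\<turnstile> LTyEq (LT (m2l_t A) # lcx \<Gamma>) (LT (m2l_t I)) (m2l_T I)"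
  and axset_conv: "lsubst (LT (m2l_t A) # lcx \<Gamma>) LVar (m2l_T A # lcx \<Gamma>)"
    "lsubst (LT (m2l_t I) # LT (m2l_t A) # lcx \<Gamma>) LVar (m2l_T I # m2l_T A # lcx \<Gamma>)"
proof -
  from max have I: "\<turnstile> LTm (m2l_T A # lcx \<Gamma>) (m2l_t I) LU" "stable_dec (A # \<Gamma>) I" by (auto simp: type_inv_def)
  from max show I': "\<turnstile> LTy (m2l_T A # lcx \<Gamma>) (m2l_T I)" by (simp add: type_inv_def)
  from stable_dec_id[OF I(2)] lctx_tm[OF I(1)]
  have eq: "\<turnstile> LTyEq (m2l_T A # lcx \<Gamma>) (LT (m2l_t I)) (m2l_T I)" by simp
  show c: "lsubst (LT (m2l_t A) # lcx \<Gamma>) LVar (m2l_T A # lcx \<Gamma>)"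
    using max stable_dec_lsubst_conv[of \<Gamma> A] by (simp add: type_inv_def)
  show i: "\<turnstile> LTm (LT (m2l_t A) # lcx \<Gamma>) (m2l_t I) LU" using lctx_conv(3)[OF c I(1)] .
  show e: "\<turnstile> LTyEq (LT (m2l_t A) # lcx \<Gamma>) (LT (m2l_t I)) (m2l_T I)" using lctx_conv(2)[OF c eq] .
  show "lsubst (LT (m2l_t I) # LT (m2l_t A) # lcx \<Gamma>) LVar (m2l_T I # m2l_T A # lcx \<Gamma>)"
    by (rule lctx_conv_cons[OF c I' l_T_F[OF i] e])
qed

lemma axset_wk_eq:
  assumes "lsubst G (lshift n) (lcx \<Gamma>)"
  shows "\<turnstile> LTyEq G (LT (llift 0 n (m2l_t A))) (llift 0 n (m2l_T A))"
  using lsubst_app(2)[OF assms axset_A(3)] by (simp add: llift_eq_lsub)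

text \<open>Once the context of \<open>C\<close> has been moved to decodings, only the domains of
  the function types of \<open>C\<close> and \<open>V\<close> need converting.\<close>

lemma axset_l: "laxset (lcx \<Gamma>) (m2l_t A) (m2l_t I) (m2l_t C) (m2l_t V)"
proof -
  from max have C: "\<turnstile> LTm (m2l_T I # m2l_T A # lcx \<Gamma>) (m2l_t C) (LPi (llift 0 2 (m2l_T A)) LU)"
    and V: "\<turnstile> LTm (lcx \<Gamma>) (m2l_t V) (LPi (m2l_T A) LU)" by (simp_all add: m2l_T_mlift)
  note T = l_T_F[OF axset_A(2)] and TI = l_T_F[OF axset_I(2)]
  have U: "\<turnstile> LTyEq (X # G) LU LU" if "\<turnstile> LTy G X" for X G
    using that by (intro l_tyeq_refl l_U_F lctx_cons_ty)
  have "\<turnstile> LTm (lcx \<Gamma>) (m2l_t V) (LPi (LT (m2l_t A)) LU)"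
    by (rule l_tm_conv[OF V l_tyeq_sym[OF l_Pi_F_eq[OF axset_A(3) U[OF T]]]])
  moreover have "\<turnstile> LTm (LT (m2l_t I) # LT (m2l_t A) # lcx \<Gamma>) (m2l_t C) (LPi (LT (llift 0 2 (m2l_t A))) LU)"
  proof -
    have e: "\<turnstile> LTyEq (LT (m2l_t I) # LT (m2l_t A) # lcx \<Gamma>) (LT (llift 0 2 (m2l_t A))) (llift 0 2 (m2l_T A))"
      by (rule axset_wk_eq[OF lsubst_wk2[OF TI]])
    show ?thesis
      by (rule l_tm_conv[OF lctx_conv(3)[OF axset_conv(2) C]
            l_tyeq_sym[OF l_Pi_F_eq[OF e U[OF ltyeq_lty(1)[OF e]]]]])
  qed
  ultimately show ?thesis using axset_A(2) axset_I(2) by simp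
qed

lemma axset_tm: "judg_inv (MTm \<Gamma> a A) \<Longrightarrow> \<turnstile> LTm (lcx \<Gamma>) (m2l_t a) (LT (m2l_t A))"
  using axset_A(3) by (auto intro: l_tm_conv l_tyeq_sym)

lemma axset_hd: "judg_inv (MTm \<Gamma> a A) \<Longrightarrow> minsts \<Gamma> 0 [a] (A # \<Gamma>)"
  using axset_A(1) by (intro minsts_hd) auto

lemma axset_index:
  assumes a: "judg_inv (MTm \<Gamma> a A)" and j: "judg_inv (MTm \<Gamma> j (minst 0 I [a]))"
  shows "\<turnstile> LTm (lcx \<Gamma>) (m2l_t j) (LT (linst 0 (m2l_t I) [m2l_t a]))"
proof -
  from max have "stable_sub (A # \<Gamma>) I" by (simp add: type_inv_def)
  from inv_tmD[OF axset_hd[OF a] this j]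
  have "\<turnstile> LTm (lcx \<Gamma>) (m2l_t j) (linst 0 (m2l_T I) [m2l_t a])" by simp
  moreover have "\<turnstile> LTyEq (lcx \<Gamma>) (LT (linst 0 (m2l_t I) [m2l_t a])) (linst 0 (m2l_T I) [m2l_t a])"
    using lsubst_app(2)[OF lsubst_inst1[OF l_T_F[OF axset_A(2)] axset_tm[OF a]] axset_I(3)]
    by (simp add: linst_eq_lsub)
  ultimately show ?thesis by (blast intro: l_tm_conv l_tyeq_sym)
qed

lemma type_inv_eps:
  assumes "judg_inv (MTm \<Gamma> a A)"
  shows "type_inv \<Gamma> s (MAp V a)"
proof -
  from axset_l have "\<turnstile> LTm (lcx \<Gamma>) (m2l_t V) (LPi (LT (m2l_t A)) LU)" by simp
  from lapp_U[OF this axset_A(2) axset_tm[OF assms]]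
  have "\<turnstile> LTm (lcx \<Gamma>) (m2l_t (MAp V a)) LU" by simp
  from this l_tyeq_refl[OF l_T_F[OF this]] show ?thesis
    by (intro type_inv_syntactic) (simp_all add: m2l_t_msub)
qed

lemma type_inv_Cov:
  assumes "judg_inv (MTm \<Gamma> a A)"
  shows "type_inv \<Gamma> s (MCov A I C V a)"
  using MLtt_cind_CT.l_cCov[OF axset_l axset_tm[OF assms]] MLtt_cind_CT.l_T_cCov[OF axset_l axset_tm[OF assms]]
  by (intro type_inv_syntactic) (simp_all add: m2l_t_msub m2l_t_mups)

lemma type_inv_Pos:
  assumes "judg_inv (MTm \<Gamma> a A)"
  shows "type_inv \<Gamma> s (MPos A I C V a)"
  using l_cPos[OF axset_l axset_tm[OF assms]] MLtt_cind_CT.l_T_cPos[OF axset_l axset_tm[OF assms]]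
  by (intro type_inv_syntactic) (simp_all add: m2l_t_msub m2l_t_mups)

text \<open>The two types differ only in the domain of the outer product, decoded on one side and
  interpreted on the other; the bodies are the same expression.\<close>

lemma all_cov_eq:
  assumes \<rho>: "lsubst G (lshift n) (lcx \<Gamma>)"
    and x: "\<turnstile> LTm G (m2l_t x) (LT (llift 0 n (m2l_t A)))"
    and j: "\<turnstile> LTm G (m2l_t j) (LT (linst n (m2l_t I) [m2l_t x]))"
  shows "\<turnstile> LTyEq G (lall_cov n (m2l_t A) (m2l_t I) (m2l_t C) (m2l_t V) (m2l_t x) (m2l_t j))
    (m2l_T (mall_in n A C (mcov_fam A I C V) x j))"
  using l_Pi_F_eq[OF axset_wk_eq[OF \<rho>] l_tyeq_refl[OF lall_cov_typed(3)[OF \<rho> axset_l x j]]]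
  by (simp add: lall_cov_def m2l_T_mall_in m2l_T_cov_inst)

lemma all_cov_tm:
  assumes a: "judg_inv (MTm \<Gamma> a A)" and j: "judg_inv (MTm \<Gamma> j (minst 0 I [a]))"
    and r: "judg_inv (MTm \<Gamma> r (mall_in 0 A C (mcov_fam A I C V) a j))"
  shows "\<turnstile> LTm (lcx \<Gamma>) (m2l_t r) (lall_cov 0 (m2l_t A) (m2l_t I) (m2l_t C) (m2l_t V) (m2l_t a) (m2l_t j))"
proof -
  have "lsubst (lcx \<Gamma>) (lshift 0) (lcx \<Gamma>)"
    using lsubst_id lctx_ty[OF axset_A(1)] by simp
  from all_cov_eq[OF this] axset_tm[OF a] axset_index[OF a j] r show ?thesis
    by (auto intro: l_tm_conv l_tyeq_sym)
qed

lemma inv_Cov_rf: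
  assumes "judg_inv (MTm \<Gamma> a A)" "judg_inv (MTm \<Gamma> r (MAp V a))"
  shows "judg_inv (MTm \<Gamma> (MRf a r) (MCov A I C V a))"
  using MLtt_cind_CT.l_Cov_rf[OF axset_l axset_tm[OF assms(1)]] assms(2) type_inv_D(2)[OF type_inv_Cov[OF assms(1)]]
  by simp

lemma inv_Cov_tr:
  assumes "judg_inv (MTm \<Gamma> a A)" "judg_inv (MTm \<Gamma> j (minst 0 I [a]))"
    "judg_inv (MTm \<Gamma> r (mall_in 0 A C (mcov_fam A I C V) a j))"
  shows "judg_inv (MTm \<Gamma> (MTr a j r) (MCov A I C V a))"
  using MLtt_cind_CT.l_Cov_tr[OF axset_l axset_tm[OF assms(1)] axset_index[OF assms(1,2)] all_cov_tm[OF assms]]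
    type_inv_D(2)[OF type_inv_Cov[OF assms(1)]]
  by simp

text \<open>Shared by induction on covers and coinduction for positivity. The third variable has
  type \<open>X\<close> in the source; its target version \<open>Y\<close>, the premise of
  \<open>tr\<close> or the motive at \<open>x\<close>, is only equal to the interpretation of
  \<open>X\<close>. The conclusions concern a further element \<open>z\<close> of the base
  set.\<close>

lemma axset_ctx3:
  assumes P: "stable_sub (A # \<Gamma>) P" and X: "\<turnstile> LTy (m2l_T I # m2l_T A # lcx \<Gamma>) (m2l_T X)"
    and eq: "\<turnstile> LTyEq (LT (m2l_t I) # LT (m2l_t A) # lcx \<Gamma>) Y (m2l_T X)"
  defines "\<Delta> \<equiv> Y # LT (m2l_t I) # LT (m2l_t A) # lcx \<Gamma>"
  shows "lsubst \<Delta> LVar (m2l_T X # m2l_T I # m2l_T A # lcx \<Gamma>)"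
    and "\<turnstile> LTyEq \<Delta> (LT (llift 0 3 (m2l_t A))) (llift 0 3 (m2l_T A))"
    and "\<turnstile> LTyEq (LT (llift 0 3 (m2l_t A)) # \<Delta>) (linst 4 (m2l_T P) [LVar 0]) (m2l_T (minst 4 P [MVar 0]))"
    and "\<turnstile> LTy (LT (llift 0 3 (m2l_t A)) # \<Delta>) (LT (LAp (linst 4 (m2l_t C) [LVar 3, LVar 2]) (LVar 0)))"
proof -
  let ?\<Delta> = "m2l_T X # m2l_T I # m2l_T A # lcx \<Gamma>"
  note TI = l_T_F[OF axset_I(2)] and Y = ltyeq_lty(1)[OF eq]
  show conv: "lsubst \<Delta> LVar ?\<Delta>"
    unfolding \<Delta>_def by (rule lctx_conv_cons[OF axset_conv(2) X Y eq])
  have w3: "lsubst \<Delta> (lshift 3) (lcx \<Gamma>)"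
    using lsubst_wk[OF lsubst_wk2[OF TI] Y] unfolding \<Delta>_def by (simp only: llift_wk2)
  show S3: "\<turnstile> LTyEq \<Delta> (LT (llift 0 3 (m2l_t A))) (llift 0 3 (m2l_T A))"
    using axset_wk_eq[OF w3] .
  have "lsubst ?\<Delta> (lshift 3) (lcx \<Gamma>)"
    using lsubst_wk[OF lsubst_wk2[OF axset_I(1)] X] by (simp only: llift_wk2)
  from lsubst_app(1)[OF this axset_A(1)] have A3: "\<turnstile> LTy ?\<Delta> (llift 0 3 (m2l_T A))"
    by (simp add: llift_eq_lsub)
  have "minsts (mlift 0 3 A # X # I # A # \<Gamma>) 4 [MVar 0] (A # \<Gamma>)"
    using axset_A(1) A3 lvar_0[OF A3]
    by (intro minsts_single minsts_4) (auto simp: stable_coh_var m2l_T_mlift llift_llift)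
  from minst_eq[OF this P]
  have "\<turnstile> LTyEq (llift 0 3 (m2l_T A) # ?\<Delta>) (m2l_T (minst 4 P [MVar 0])) (linst 4 (m2l_T P) [LVar 0])"
    by (simp add: m2l_T_mlift)
  from lctx_conv(2)[OF lctx_conv_cons[OF conv A3 ltyeq_lty(1)[OF S3] S3] l_tyeq_sym[OF this]]
  show "\<turnstile> LTyEq (LT (llift 0 3 (m2l_t A)) # \<Delta>) (linst 4 (m2l_T P) [LVar 0]) (m2l_T (minst 4 P [MVar 0]))" .
  have l: "llift 0 1 (LVar k) = LVar (k + 1)" for k by (simp add: llift_def)
  have x: "\<turnstile> LTm \<Delta> (LVar 2) (LT (llift 0 3 (m2l_t A)))"
    using lwk_tm[OF Y lvar_1[OF TI]] by (simp add: \<Delta>_def llift_llift l)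
  have j: "\<turnstile> LTm \<Delta> (LVar 1) (LT (linst 3 (m2l_t I) [LVar 2]))"
  proof -
    have "llift 0 1 (llift 0 1 (m2l_t I)) = linst 3 (m2l_t I) [LVar 2]"
      by (auto simp: lsub_norms split: nat.split intro!: lsub_eqI)
    with lwk_tm[OF Y lvar_0[OF TI]] show ?thesis by (simp add: \<Delta>_def l)
  qed
  show "\<turnstile> LTy (LT (llift 0 3 (m2l_t A)) # \<Delta>) (LT (LAp (linst 4 (m2l_t C) [LVar 3, LVar 2]) (LVar 0)))"
    using lall_cov_typed(1)[OF w3 axset_l x j] by (intro l_T_F) (simp add: l)
qed

lemma inv_Cov:
  assumes P: "judg_inv (MTy (A # \<Gamma>) KProp P)"
    and q1: "judg_inv (MTm (MAp (mlift 0 1 V) (MVar 0) # A # \<Gamma>) q1 (minst 2 P [MVar 1]))"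
    and q2: "judg_inv (MTm (mall_in 3 A C P (MVar 2) (MVar 1)
             # mall_in 2 A C (mcov_fam A I C V) (MVar 1) (MVar 0) # I # A # \<Gamma>)
             q2 (minst 4 P [MVar 3]))"
    and a: "judg_inv (MTm \<Gamma> a A)"
  shows "judg_inv (MTm \<Gamma> m (MCov A I C V a)) \<Longrightarrow> judg_inv (MTm \<Gamma> (MInd m q1 q2) (minst 0 P [a]))"
    and "judg_inv (MTm \<Gamma> r (MAp V a)) \<Longrightarrow> judg_inv (MTmEq \<Gamma> (MInd (MRf a r) q1 q2) (minst 0 q1 [a, r]) (minst 0 P [a]))"
    and "judg_inv (MTm \<Gamma> j (minst 0 I [a])) \<Longrightarrow> judg_inv (MTm \<Gamma> r (mall_in 0 A C (mcov_fam A I C V) a j))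
      \<Longrightarrow> judg_inv (MTmEq \<Gamma> (MInd (MTr a j r) q1 q2)
             (minst 0 q2 [a, j, r,
                MLam (MLam (MInd (MAp (MAp (mlift 0 2 r) (MVar 1)) (MVar 0))
                                 (mlift 2 2 q1) (mlift 4 2 q2)))])
             (minst 0 P [a]))"
proof -
  let ?s = "m2l_t A" and ?i = "m2l_t I" and ?c = "m2l_t C" and ?v = "m2l_t V"
  \<comment> \<open>The source motive does not see the proof of the cover, so the target motive is
    its weakening by that proof.\<close>
  let ?P = "llift 0 1 (m2l_T P)"
  note S = l_T_F[OF axset_A(2)] and TI = l_T_F[OF axset_I(2)]
  from P have P': "\<turnstile> LTy (m2l_T A # lcx \<Gamma>) (m2l_T P)" and sP: "stable_sub (A # \<Gamma>) P" by (auto simp: type_inv_def)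
  note PS = lctx_conv(1)[OF axset_conv(1) P']
  have PL: "\<turnstile> LTy (lcov_fam ?s ?i ?c ?v # LT ?s # lcx \<Gamma>) ?P"
    by (rule lwk_ty[OF lfam_typed(1)[OF axset_l] PS])
  have inst2: "linst n ?P [x, y] = linst n (m2l_T P) [x]" for n x y
    by (auto simp: lsub_norms split: nat.split intro!: lsub_eqI)

  have q1': "\<turnstile> LTm (LT (LAp (llift 0 1 ?v) (LVar 0)) # LT ?s # lcx \<Gamma>) (m2l_t q1)
      (linst 2 ?P [LVar 1, LRf (LVar 1) (LVar 0)])"
  proof -
    have E: "\<turnstile> LTy (m2l_T A # lcx \<Gamma>) (LT (LAp (llift 0 1 ?v) (LVar 0)))"
      using q1 lty_hd(2) by (fastforce simp: m2l_t_mlift)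
    have "minsts (MAp (mlift 0 1 V) (MVar 0) # A # \<Gamma>) 2 [MVar 1] (A # \<Gamma>)"
      using axset_A(1) E lvar_1[OF E]
      by (intro minsts_single minsts_2) (auto simp: stable_coh_var m2l_t_mlift)
    from inv_tmD[OF this sP q1]
    have q: "\<turnstile> LTm (LT (LAp (llift 0 1 ?v) (LVar 0)) # m2l_T A # lcx \<Gamma>) (m2l_t q1) (linst 2 (m2l_T P) [LVar 1])"
      by (simp add: m2l_t_mlift)
    note E' = lctx_conv(1)[OF axset_conv(1) E]
    show ?thesis
      unfolding inst2
      by (rule lctx_conv(3)[OF lctx_conv_cons[OF axset_conv(1) E E' l_tyeq_refl[OF E']] q])
  qed

  let ?K = "lall_cov 2 ?s ?i ?c ?v (LVar 1) (LVar 0)" and ?KM = "mall_in 2 A C (mcov_fam A I C V) (MVar 1) (MVar 0)"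
  let ?H = "mall_in 3 A C P (MVar 2) (MVar 1)"
  let ?G = "LT ?i # LT ?s # lcx \<Gamma>"
  from q2 have q2': "\<turnstile> LTm (m2l_T ?H # m2l_T ?KM # m2l_T I # m2l_T A # lcx \<Gamma>) (m2l_t q2) (m2l_T (minst 4 P [MVar 3]))"
    by simp
  note HM = lty_hd(2)[OF q2']
  note KM = lty_hd(1)[OF HM]
  have w2: "lsubst ?G (lshift 2) (lcx \<Gamma>)" by (rule lsubst_wk2[OF TI])
  have x: "\<turnstile> LTm ?G (LVar 1) (LT (llift 0 2 ?s))" using lvar_1[OF TI] by simp
  have j: "\<turnstile> LTm ?G (LVar 0) (LT (linst 2 ?i [LVar 1]))"
  proof -
    have "linst 2 ?i [LVar 1] = llift 0 1 ?i" by (auto simp: lsub_norms split: nat.split intro!: lsub_eqI)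
    with lvar_0[OF TI] show ?thesis by simp
  qed
  have "\<turnstile> LTyEq ?G ?K (m2l_T ?KM)" using all_cov_eq[OF w2, of "MVar 1" "MVar 0"] x j by simp
  note ctx3 = axset_ctx3[OF sP KM this]
  \<comment> \<open>With this motive the inner product of the induction hypothesis collapses to an
    arrow, as in the source; the domain and the instance of the motive remain to be
    converted.\<close>
  have H: "lind_hyp ?s ?c ?P = LPi (LT (llift 0 3 ?s)) (larrow (LT (LAp (linst 4 ?c [LVar 3, LVar 2]) (LVar 0)))
      (linst 4 (m2l_T P) [LVar 0]))"
    by (auto simp: lind_hyp_def larrow_def inst2 lsub_norms split: nat.split intro!: lsub_eqI)
  have HT: "m2l_T ?H = LPi (llift 0 3 (m2l_T A)) (larrow (LT (LAp (linst 4 ?c [LVar 3, LVar 2]) (LVar 0)))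
      (m2l_T (minst 4 P [MVar 0])))"
    by (simp add: m2l_T_mall_in) (simp add: llift_def upr_def)
  let ?E = "LT (LAp (linst 4 ?c [LVar 3, LVar 2]) (LVar 0))"
  have "\<turnstile> LTyEq (LT (llift 0 3 ?s) # ?K # ?G) (larrow ?E (linst 4 (m2l_T P) [LVar 0])) (larrow ?E (m2l_T (minst 4 P [MVar 0])))"
    unfolding larrow_def by (rule l_Pi_F_eq[OF l_tyeq_refl[OF ctx3(4)] lwk_tyeq[OF ctx3(4,3)]])
  from l_Pi_F_eq[OF ctx3(2) this]
  have heq: "\<turnstile> LTyEq (?K # ?G) (lind_hyp ?s ?c ?P) (m2l_T ?H)" unfolding H HT .
  have q2'': "\<turnstile> LTm (lind_hyp ?s ?c ?P # ?K # ?G) (m2l_t q2) (linst 4 ?P [LVar 3, LTr (LVar 3) (LVar 2) (LVar 1)])"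
  proof -
    have "\<turnstile> LTm (lcx (?H # ?KM # I # A # \<Gamma>)) (LVar 3) (llift 0 4 (m2l_T A))"
      using l_var[OF lctx_tm[OF q2'], of 3] by (simp add: lvty_def)
    then have "minsts (?H # ?KM # I # A # \<Gamma>) 4 [MVar 3] (A # \<Gamma>)"
      using axset_A(1) HM by (intro minsts_single minsts_4) (auto simp: stable_coh_var)
    from inv_tmD[OF this sP q2]
    have q: "\<turnstile> LTm (m2l_T ?H # m2l_T ?KM # m2l_T I # m2l_T A # lcx \<Gamma>) (m2l_t q2) (linst 4 (m2l_T P) [LVar 3])"
      by simp
    show ?thesis
      unfolding inst2 by (rule lctx_conv(3)[OF lctx_conv_cons[OF ctx3(1) HM ltyeq_lty(1)[OF heq] heq] q])
  qed

  note R = axset_l PL axset_tm[OF a]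
  show "judg_inv (MTm \<Gamma> (MInd m q1 q2) (minst 0 P [a]))" if "judg_inv (MTm \<Gamma> m (MCov A I C V a))"
    using that MLtt_cind_CT.l_Cov_E[OF R _ q1' q2'']
    by (intro inv_tmI[OF axset_hd[OF a] sP]) (simp_all add: inst2)
  show "judg_inv (MTmEq \<Gamma> (MInd (MRf a r) q1 q2) (minst 0 q1 [a, r]) (minst 0 P [a]))" if "judg_inv (MTm \<Gamma> r (MAp V a))"
    using that MLtt_cind_CT.l_Cov_C1[OF R _ q1' q2'']
    by (intro inv_tmeqI[OF axset_hd[OF a] sP]) (simp_all add: inst2 m2l_t_minst)
  show "judg_inv (MTmEq \<Gamma> (MInd (MTr a j r) q1 q2)
             (minst 0 q2 [a, j, r,
                MLam (MLam (MInd (MAp (MAp (mlift 0 2 r) (MVar 1)) (MVar 0))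
                                 (mlift 2 2 q1) (mlift 4 2 q2)))])
             (minst 0 P [a]))"
    if j: "judg_inv (MTm \<Gamma> j (minst 0 I [a]))" and r: "judg_inv (MTm \<Gamma> r (mall_in 0 A C (mcov_fam A I C V) a j))"
    using MLtt_cind_CT.l_Cov_C2[OF R axset_index[OF a j] all_cov_tm[OF a j r] q1' q2'']
    by (intro inv_tmeqI[OF axset_hd[OF a] sP]) (simp_all add: inst2 m2l_t_minst m2l_t_mlift)
qed

lemma inv_Pos_ax1:
  assumes "judg_inv (MTm \<Gamma> a A)" "judg_inv (MTm \<Gamma> q (MPos A I C V a))"
  shows "judg_inv (MTm \<Gamma> (MAx1 a q) (MAp V a))"
  using MLtt_cind_CT.l_Pos_ax1[OF axset_l axset_tm[OF assms(1)]] assms(2) type_inv_D(2)[OF type_inv_eps[OF assms(1)]]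
  by simp

lemma inv_Pos_ax2:
  assumes a: "judg_inv (MTm \<Gamma> a A)" and j: "judg_inv (MTm \<Gamma> j (minst 0 I [a]))" and q: "judg_inv (MTm \<Gamma> q (MPos A I C V a))"
  shows "judg_inv (MTm \<Gamma> (MAx2 a j q)
    (MEx A (MAnd (MAp (minst 1 C [mlift 0 1 a, mlift 0 1 j]) (MVar 0)) (mpos_fam A I C V))))"
proof -
  let ?E = "MAp (minst 1 C [mlift 0 1 a, mlift 0 1 j]) (MVar 0)" and ?F = "mpos_fam A I C V"
  let ?G = "LT (m2l_t A) # lcx \<Gamma>"
  note S = l_T_F[OF axset_A(2)]
  have id: "lsubst (lcx \<Gamma>) (lshift 0) (lcx \<Gamma>)" using lsubst_id lctx_ty[OF S] by simp
  have a': "\<turnstile> LTm (lcx \<Gamma>) (m2l_t a) (LT (llift 0 0 (m2l_t A)))" using axset_tm[OF a] by simp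
  have E: "m2l_t ?E = LAp (linst (0 + 1) (m2l_t C) [llift 0 1 (m2l_t a), llift 0 1 (m2l_t j)]) (LVar 0)"
    by (simp add: m2l_t_minst m2l_t_mlift)
  have F: "m2l_T ?F = lpos_fam (m2l_t A) (m2l_t I) (m2l_t C) (m2l_t V)"
    "m2l_t ?F = LcPos (llift 0 1 (m2l_t A)) (llift 1 1 (m2l_t I)) (llift 2 1 (m2l_t C)) (llift 0 1 (m2l_t V)) (LVar 0)"
    by (simp_all add: mpos_fam_def lpos_fam_def m2l_t_mlift)
  have Et: "\<turnstile> LTm ?G (m2l_t ?E) LU"
    using lall_cov_typed(1)[OF id axset_l a' axset_index[OF a j]] unfolding E by simp
  \<comment> \<open>Here judgements travel from the decoded to the interpreted domain: membership
    has been typed over \<open>LT (m2l_t A)\<close>, but \<open>type_inv\<close> speaks about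
    \<open>A # \<Gamma>\<close>.\<close>
  have conv: "lsubst (m2l_T A # lcx \<Gamma>) LVar ?G"
    by (rule lctx_conv_cons[OF lsubst_id[OF lctx_ty[OF S]] S axset_A(1) l_tyeq_sym[OF axset_A(3)]])
  note E' = lctx_conv(3)[OF conv Et]
  have tE: "type_inv (A # \<Gamma>) False ?E"
    using E' l_tyeq_refl[OF l_T_F[OF E']]
    by (intro type_inv_syntactic) (simp_all add: m2l_t_msub)
  have tF: "type_inv (A # \<Gamma>) False ?F"
  proof -
    have l: "lsub (lshift 1) e = llift 0 1 e" "lsub (lups 1 (lshift 1)) e = llift 1 1 e"
      "lsub (lups 2 (lshift 1)) e = llift 2 1 e" for e
      by (auto simp: lsub_norms intro!: lsub_eqI)
    from laxset_sub[OF lsubst_wk1[OF axset_A(1)] axset_l]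
    have ax: "laxset (m2l_T A # lcx \<Gamma>) (llift 0 1 (m2l_t A)) (llift 1 1 (m2l_t I)) (llift 2 1 (m2l_t C)) (llift 0 1 (m2l_t V))"
      unfolding l .
    have v: "\<turnstile> LTm (m2l_T A # lcx \<Gamma>) (LVar 0) (LT (llift 0 1 (m2l_t A)))"
      by (rule l_tm_conv[OF lvar_0[OF axset_A(1)]])
        (use lwk_tyeq[OF axset_A(1) l_tyeq_sym[OF axset_A(3)]] in simp)
    from l_cPos[OF ax v] MLtt_cind_CT.l_T_cPos[OF ax v] show ?thesis
      by (intro type_inv_syntactic) (simp_all add: F lpos_fam_def, simp add: mpos_fam_def m2l_t_msub m2l_t_mups m2l_t_mlift)
  qed
  have "type_inv \<Gamma> False (MEx A (MAnd ?E ?F))"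
    using max by (intro type_inv_Ex type_inv_And tE tF) (simp add: type_inv_def)
  moreover have "\<turnstile> LTm (lcx \<Gamma>) (LAx2 (m2l_t a) (m2l_t j) (m2l_t q)) (m2l_T (MEx A (MAnd ?E ?F)))"
  proof -
    have "\<turnstile> LTm (lcx \<Gamma>) (LAx2 (m2l_t a) (m2l_t j) (m2l_t q))
        (LSigma (LT (m2l_t A)) (lprod (LT (m2l_t ?E)) (m2l_T ?F)))"
      using MLtt_cind_CT.l_Pos_ax2[OF axset_l axset_tm[OF a] axset_index[OF a j]] q unfolding E F by simp
    moreover have "\<turnstile> LTy ?G (lprod (LT (m2l_t ?E)) (m2l_T ?F))"
      using l_T_F[OF Et] lfam_typed(2)[OF axset_l] unfolding F by (rule lprod_F)
    from l_Sigma_F_eq[OF axset_A(3) l_tyeq_refl[OF this]]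
    have "\<turnstile> LTyEq (lcx \<Gamma>) (LSigma (LT (m2l_t A)) (lprod (LT (m2l_t ?E)) (m2l_T ?F))) (m2l_T (MEx A (MAnd ?E ?F)))"
      by simp
    ultimately show ?thesis by (rule l_tm_conv)
  qed
  ultimately show ?thesis by (simp add: type_inv_D(2))
qed

lemma inv_Pos_ax3:
  assumes P: "judg_inv (MTy (A # \<Gamma>) KProp P)" and a: "judg_inv (MTm \<Gamma> a A)" and m: "judg_inv (MTm \<Gamma> m (minst 0 P [a]))"
    and q1: "judg_inv (MTm (P # A # \<Gamma>) q1 (MAp (mlift 0 2 V) (MVar 1)))"
    and q2: "judg_inv (MTm (minst 2 P [MVar 1] # I # A # \<Gamma>) q2
             (MEx (mlift 0 3 A) (MAnd (minst 4 P [MVar 0]) (MAp (minst 4 C [MVar 3, MVar 2]) (MVar 0)))))"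
  shows "judg_inv (MTm \<Gamma> (MAx3 a m q1 q2) (MPos A I C V a))"
proof -
  let ?s = "m2l_t A" and ?i = "m2l_t I" and ?c = "m2l_t C" and ?v = "m2l_t V" and ?P = "m2l_T P"
  from P have P': "\<turnstile> LTy (m2l_T A # lcx \<Gamma>) ?P" and sP: "stable_sub (A # \<Gamma>) P" by (auto simp: type_inv_def)
  note PS = lctx_conv(1)[OF axset_conv(1) P']
  from inv_tmD[OF axset_hd[OF a] sP m] have m': "\<turnstile> LTm (lcx \<Gamma>) (m2l_t m) (linst 0 ?P [m2l_t a])" by simp
  have q1': "\<turnstile> LTm (?P # LT ?s # lcx \<Gamma>) (m2l_t q1) (LT (LAp (llift 0 2 ?v) (LVar 1)))"
    using lctx_conv(3)[OF lctx_conv_cons[OF axset_conv(1) P' PS l_tyeq_refl[OF PS]]] q1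
    by (simp add: m2l_t_mlift)

  let ?G = "LT ?i # LT ?s # lcx \<Gamma>" and ?\<Delta> = "m2l_T (minst 2 P [MVar 1]) # m2l_T I # m2l_T A # lcx \<Gamma>"
  let ?Q = "linst 2 ?P [LVar 1]" and ?E = "LT (LAp (linst 4 ?c [LVar 3, LVar 2]) (LVar 0))"
  have q: "\<turnstile> LTm ?\<Delta> (m2l_t q2) (LSigma (llift 0 3 (m2l_T A)) (lprod (m2l_T (minst 4 P [MVar 0])) ?E))"
    using q2 by (simp add: m2l_T_mlift m2l_t_minst)
  note QM = lty_hd(2)[OF q]
  have "minsts (I # A # \<Gamma>) 2 [MVar 1] (A # \<Gamma>)"
    using axset_A(1) axset_I(1) lvar_1[OF axset_I(1)] by (intro minsts_single minsts_2) (auto simp: stable_coh_var)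
  from lctx_conv(2)[OF axset_conv(2)] minst_eq[OF this sP]
  have Qeq: "\<turnstile> LTyEq ?G (m2l_T (minst 2 P [MVar 1])) ?Q" by simp
  note ctx3 = axset_ctx3[OF sP QM l_tyeq_sym[OF Qeq]]
  note P4 = ltyeq_lty(1)[OF ctx3(3)]
  have "\<turnstile> LTyEq (LT (llift 0 3 ?s) # ?Q # ?G) (lprod (linst 4 ?P [LVar 0]) ?E) (lprod (m2l_T (minst 4 P [MVar 0])) ?E)"
    unfolding lprod_def
    by (rule l_Sigma_F_eq[OF ctx3(3) lwk_tyeq[OF P4 l_tyeq_refl[OF ctx3(4)]]])
  from l_tm_conv[OF lctx_conv(3)[OF ctx3(1) q]
      l_tyeq_sym[OF l_Sigma_F_eq[OF ctx3(2) this]]]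
  have "\<turnstile> LTm (?Q # ?G) (m2l_t q2) (LSigma (LT (llift 0 3 ?s)) (lprod (linst 4 ?P [LVar 0]) ?E))" .
  \<comment> \<open>Now that types agree with the target up to the order of conjuncts, the swap puts
    membership before the motive.\<close>
  from lSigma_swap[OF P4 ctx3(4) this]
  have q2': "\<turnstile> LTm (?Q # ?G) (LElSigma (m2l_t q2) (LPair (LVar 1) (LPair (lsnd (LVar 0)) (lfst (LVar 0)))))
      (LSigma (LT (llift 0 3 ?s)) (lprod ?E (linst 4 ?P [LVar 0])))" .
  from MLtt_cind_CT.l_Pos_ax3[OF axset_l PS axset_tm[OF a] m' q1' q2'] type_inv_D(2)[OF type_inv_Pos[OF a]]
  show ?thesis by simp
qed

end

subsection \<open>The axioms\<close>

text \<open>In \<open>mAC\<close> the relation is instantiated in the source, in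
  \<open>lchoice\<close> after interpretation. Stability of \<open>R\<close> equates the two types,
  and the choice term is converted along that equation.\<close>

lemma inv_AC:
  assumes A: "judg_inv (MTy \<Gamma> KCol A)" and B: "judg_inv (MTy (A # \<Gamma>) KCol B)" and R: "judg_inv (MTy (B # A # \<Gamma>) KProp R)"
  shows "judg_inv (MTm \<Gamma> MAc (mAC A B R))"
proof -
  from A B R have A: "type_inv \<Gamma> False A" and B: "type_inv (A # \<Gamma>) False B" and R: "type_inv (B # A # \<Gamma>) False R" by auto
  let ?A = "m2l_T A" and ?B = "m2l_T B" and ?R = "minst 2 R [MVar 0, MAp (MVar 1) (MVar 0)]"
  note A' = type_inv_D(1)[OF A]
  have B': "\<turnstile> LTy (?A # lcx \<Gamma>) ?B" using type_inv_D(1)[OF B] by simp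
  have R': "\<turnstile> LTy (?B # ?A # lcx \<Gamma>) (m2l_T R)" using type_inv_D(1)[OF R] by simp
  note F = l_Pi_F[OF A' B']
  note A1 = lwk_ty[OF F A']
  have "minsts (mlift 0 1 A # MPi A B # \<Gamma>) 2 [MVar 0] (A # \<Gamma>)"
    using A' A1 lvar_0[OF A1] by (intro minsts_single minsts_2) (auto simp: stable_coh_var m2l_T_mlift llift_llift)
  from minsts_snoc[OF this type_inv_D(1)[OF B], of "MAp (MVar 1) (MVar 0)"] lapp_vars[OF B']
  have i: "minsts (mlift 0 1 A # MPi A B # \<Gamma>) 2 [MVar 0, MAp (MVar 1) (MVar 0)] (B # A # \<Gamma>)"
    by (simp add: m2l_T_mlift linst_eq_lsub)
  have R2: "type_inv (MPi A B # \<Gamma>) False (MAll (mlift 0 1 A) ?R)"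
    using type_inv_wk[OF _ A, of "MPi A B"] F by (intro type_inv_All minst_type_inv[OF i R]) simp
  have t: "type_inv \<Gamma> False (mAC A B R)"
    unfolding mAC_def by (intro type_inv_Imp type_inv_All type_inv_Ex type_inv_Pi R2 A B R)
  have "\<turnstile> LTyEq (llift 0 1 ?A # LPi ?A ?B # lcx \<Gamma>) (linst 2 (m2l_T R) [LVar 0, LAp (LVar 1) (LVar 0)]) (m2l_T ?R)"
    using minst_eq[OF i type_inv_D(2)[OF R]] by (simp add: m2l_T_mlift l_tyeq_sym)
  note R_eq = l_Pi_F_eq[OF l_tyeq_refl[OF A1] this]
  note C_eq = l_Sigma_F_eq[OF l_tyeq_refl[OF F] R_eq]
  have "\<turnstile> LTy (lcx \<Gamma>) (LPi ?A (LSigma ?B (m2l_T R)))"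
    by (intro l_Pi_F l_Sigma_F A' B' R')
  note H = this
  have "\<turnstile> LTyEq (lcx \<Gamma>) (larrow (LPi ?A (LSigma ?B (m2l_T R)))
      (LSigma (LPi ?A ?B) (LPi (llift 0 1 ?A) (linst 2 (m2l_T R) [LVar 0, LAp (LVar 1) (LVar 0)]))))
      (m2l_T (mAC A B R))"
    using l_Pi_F_eq[OF l_tyeq_refl[OF H] lwk_tyeq[OF H C_eq]]
    by (simp add: mAC_def larrow_def m2l_T_mlift)
  from l_tm_conv[OF lchoice[OF R'] this] type_inv_D(2)[OF t] show ?thesis by simp
qed

text \<open>All types inside \<open>mCT\<close> are headed by explicit constructors down to
  equations over \<open>MNat\<close>, so its interpretation commutes strictly with substitution. The
  arities of \<open>t\<close> and \<open>u\<close> identify it with \<open>lCT t u\<close>.\<close>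

lemma inv_CT:
  assumes "judg_inv (MCtx \<Gamma>)"
  shows "judg_inv (MTm \<Gamma> MCt (mCT t u))"
proof -
  from assms have \<Gamma>: "\<turnstile> LCtx (lcx \<Gamma>)" by simp
  from kleene have t: "rec_arity 3 t" and u: "rec_arity 1 u"
    by (auto simp: kleene_TU_def prim_rec_def)
  have eq: "m2l_T (mCT t u) = lCT t u"
    by (simp add: mCT_def lCT_def lprod_def m2l_t_mpr[OF t] m2l_t_mpr[OF u])
  have mups_app: "m2l_t (mups k \<sigma> i) = lups k (m2l_t \<circ> \<sigma>) i" for k \<sigma> i
    using fun_cong[OF m2l_t_mups] by simp
  have "m2l_T (msub \<sigma> (mCT t u)) = lsub (m2l_t \<circ> \<sigma>) (m2l_T (mCT t u))" for \<sigma>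
    by (simp add: mups_app mCT_def m2l_t_msub m2l_t_mups lprod_lsub)
  with lsubst_app(1)[OF msubst_lsubst lCT_typed[OF \<Gamma>]] have "stable_sub \<Gamma> (mCT t u)"
    by (auto simp: stable_sub_def eq intro: l_tyeq_refl)
  with eq MLtt_cind_CT.l_CT[OF \<Gamma>] show ?thesis by simp
qed

subsection \<open>Derivations\<close>

text \<open>The substitution and replacement rules first need their entries assembled into an
  \<open>msubsts\<close>, and the rules on axiom sets need the four parts of the axiom set gathered
  again.\<close>

lemma inv_if_mderiv: "mTT_cind_AC_CT t u J \<Longrightarrow> judg_inv J"
proof (induction rule: mTT_cind_AC_CT.induct)
  case m_ctx_nil
  then show ?case by (simp add: MLtt_cind_CT.l_ctx_nil)
next
  case (m_ctx_cons \<Gamma> A)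
  then show ?case by (auto simp: type_inv_def intro: lctx_cons_ty)
next
  case (m_ty_sub \<Gamma> \<sigma> \<Delta> k A)
  then have "msubsts \<Gamma> \<sigma> \<Delta>" by (intro msubsts_if_inv) auto
  with m_ty_sub.IH show ?case by (intro inv_ty_sub) auto
next
  case (m_tyeq_sub \<Gamma> \<sigma> \<Delta> k A B)
  then have "msubsts \<Gamma> \<sigma> \<Delta>" by (intro msubsts_if_inv) auto
  with m_tyeq_sub.IH show ?case by (intro inv_tyeq_sub) auto
next
  case (m_tm_sub \<Gamma> \<sigma> \<Delta> a A)
  then have "msubsts \<Gamma> \<sigma> \<Delta>" by (intro msubsts_if_inv) auto
  with m_tm_sub.IH show ?case by (intro inv_tm_sub) auto
next
  case (m_tmeq_sub \<Gamma> \<sigma> \<Delta> a b A)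
  then have "msubsts \<Gamma> \<sigma> \<Delta>" by (intro msubsts_if_inv) auto
  with m_tmeq_sub.IH show ?case by (intro inv_tmeq_sub) auto
next
  case (m_ty_repl \<Gamma> \<sigma> \<tau> \<Delta> k A)
  then have "msubsts \<Gamma> \<sigma> \<Delta>" "msubsts \<Gamma> \<tau> \<Delta>" by (intro msubsts_if_inv; auto)+
  from inv_ty_repl[OF this] m_ty_repl.IH show ?case by blast
next
  case (m_repl \<Gamma> \<sigma> \<tau> \<Delta> c C)
  then have "msubsts \<Gamma> \<sigma> \<Delta>" "msubsts \<Gamma> \<tau> \<Delta>" by (intro msubsts_if_inv; auto)+
  from inv_repl[OF this] m_repl.IH show ?case by blast
next
  case (m_Fun_F \<Gamma> A)
  then have "type_inv \<Gamma> False (MPi A MPropS)"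
    by (intro type_inv_Pi type_inv_PropS) (auto simp: type_inv_def intro: lctx_cons_ty)
  then show ?case by simp
next
  case (m_Fun_F_eq \<Gamma> A A')
  then have eq: "judg_inv (MTyEq \<Gamma> KSet A A')" by simp
  then have "\<turnstile> LTy (lcx \<Gamma>) (m2l_T A)" by (auto dest: ltyeq_lty)
  then have "type_inv (A # \<Gamma>) False MPropS" by (intro type_inv_PropS) (simp add: lctx_cons_ty)
  \<comment> \<open>The universe is a constant type, so the rule is the congruence of products with
    a reflexive equation between the bodies.\<close>
  then have "judg_inv (MTyEq (A # \<Gamma>) KCol MPropS MPropS)"
    by (auto simp: type_inv_def intro: l_tyeq_refl)
  with eq show ?case by (intro inv_Pi_F_eq)
next
  case (m_Pi_I \<Gamma> A B b)
  then show ?case using lam_app(1)[of A \<Gamma> KCol B b] by (simp add: type_inv_def)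
next
  case (m_Pi_E A \<Gamma> B f a)
  then show ?case by (intro lam_app(2)[where k = KCol]) auto
next
  case (m_Pi_C \<Gamma> A B b a)
  then show ?case by (intro lam_app(3))
next
  case (m_And_F k \<Gamma> A B)
  then show ?case by (auto intro: type_inv_And)
next
  case (m_All_F k \<Gamma> A B)
  then show ?case by (auto simp: small_dom_kind intro: type_inv_All)
next
  case (m_All_I \<Gamma> A B b)
  then have "type_inv \<Gamma> False (MAll A B)" by (intro type_inv_All) auto
  with m_All_I show ?case using lam_app(1)[of A \<Gamma> KProp B b] by (simp add: type_inv_def)
next
  case (m_All_E \<Gamma> A B f a)
  then show ?case by (intro lam_app(2)[where k = KProp]) auto
next
  case (m_All_C \<Gamma> A B b a)
  then show ?case by (intro lam_app(3))
next
  case (m_Ex_F k \<Gamma> A B)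
  then show ?case by (auto simp: small_dom_kind intro: type_inv_Ex)
next
  case (m_Id_F k \<Gamma> A a b)
  then show ?case by (auto simp: small_dom_kind intro: type_inv_Id)
next
  case (m_Id_I \<Gamma> A a)
  then have "type_inv \<Gamma> False (MId A a a)" by (intro type_inv_Id) auto
  with m_Id_I show ?case by (auto simp: type_inv_def intro: MLtt_cind_CT.l_Id_I)
next
  case (m_Cov_F \<Gamma> A I C V a)
  then have "m_axset judg_inv \<Gamma> A I C V" by simp
  with m_Cov_F show ?case using type_inv_Cov by simp
next
  case (m_Cov_rf \<Gamma> A I C V a r)
  then have "m_axset judg_inv \<Gamma> A I C V" by simp
  from inv_Cov_rf[OF this] m_Cov_rf.IH show ?case by blast
next
  case (m_Cov_tr \<Gamma> A I C V a j r)
  then have "m_axset judg_inv \<Gamma> A I C V" by simp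
  from inv_Cov_tr[OF this] m_Cov_tr.IH show ?case by blast
next
  case (m_Cov_E \<Gamma> A I C V P a m q1 q2)
  then have "m_axset judg_inv \<Gamma> A I C V" by simp
  from inv_Cov(1)[OF this] m_Cov_E.IH show ?case by blast
next
  case (m_Cov_C1 \<Gamma> A I C V P a r q1 q2)
  then have "m_axset judg_inv \<Gamma> A I C V" by simp
  from inv_Cov(2)[OF this] m_Cov_C1.IH show ?case by blast
next
  case (m_Cov_C2 \<Gamma> A I C V P a j r q1 q2)
  then have "m_axset judg_inv \<Gamma> A I C V" by simp
  from inv_Cov(3)[OF this] m_Cov_C2.IH show ?case by blast
next
  case (m_Pos_F \<Gamma> A I C V a)
  then have "m_axset judg_inv \<Gamma> A I C V" by simp
  with m_Pos_F show ?case using type_inv_Pos by simp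
next
  case (m_Pos_ax1 \<Gamma> A I C V a q)
  then have "m_axset judg_inv \<Gamma> A I C V" by simp
  from inv_Pos_ax1[OF this] m_Pos_ax1.IH show ?case by blast
next
  case (m_Pos_ax2 \<Gamma> A I C V a j q)
  then have "m_axset judg_inv \<Gamma> A I C V" by simp
  from inv_Pos_ax2[OF this] m_Pos_ax2.IH show ?case by blast
next
  case (m_Pos_ax3 \<Gamma> A I C V P a m q1 q2)
  then have "m_axset judg_inv \<Gamma> A I C V" by simp
  from inv_Pos_ax3[OF this] m_Pos_ax3.IH show ?case by blast
next
  case (m_AC \<Gamma> A B R)
  from inv_AC[OF m_AC.IH(1,2,4)] show ?case .
next
  case (m_tm_conv \<Gamma> a A B)
  then show ?case by (auto intro: l_tm_conv)
next
  case (m_tmeq_conv \<Gamma> a b A B)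
  then show ?case by (auto intro: l_tmeq_conv)
next
  case (m_tyeq_trans \<Gamma> k A B C)
  then show ?case by (auto intro: l_tyeq_trans)
next
  case (m_tmeq_trans \<Gamma> a b A c)
  then show ?case by (auto intro: MLtt_cind_CT.l_tmeq_trans)
next
  case (m_Sigma_F k \<Gamma> A B)
  then show ?case by (auto intro: type_inv_Sigma)
qed ((rule inv_var inv_propS_I inv_propS_E inv_propS_E_eq inv_N0_E inv_N1 inv_Nat inv_List_F_eq
      inv_List inv_Plus_F_eq inv_Plus inv_Pi_F_eq inv_Sigma_I inv_Sigma inv_Falsum_E
      inv_Imp_F_eq inv_And inv_Or_I inv_Or inv_Imp inv_Ex_I inv_Ex inv_Id_F_eq inv_Id inv_CT;
      assumption)
    | (auto simp: type_inv_N0 type_inv_N1 type_inv_Nat type_inv_PropS type_inv_Falsum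
    type_inv_List type_inv_Plus type_inv_Or type_inv_Imp type_inv_Pi type_inv_D(2) stable_sub_List stable_sub_Plus
    intro: type_inv_False l_tyeq_refl l_tyeq_sym l_tmeq_refl
      MLtt_cind_CT.l_tmeq_sym MLtt_cind_CT.l_N1_I l_N_I1 l_N_I2
      MLtt_cind_CT.l_List_I1 l_List_I2 l_Plus_I1 l_Plus_I2 type_inv_D(1))[1])+

lemma m2l_if_inv: "judg_inv J \<Longrightarrow> \<turnstile> m2l J"
  by (cases J) (auto simp: type_inv_def)

end

theorem proposition3p1:
  fixes t u :: recf
  assumes "kleene_TU t u"
  shows "(\<forall>J. mTT_cind_AC_CT t u J \<longrightarrow> MLtt_cind_CT t u (m2l J))
         \<and> (MLtt_consistent t u \<longrightarrow> mTT_consistent t u)"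
proof -
  interpret kleene_pair t u by unfold_locales (rule assms)
  have sound: "mTT_cind_AC_CT t u J \<Longrightarrow> MLtt_cind_CT t u (m2l J)" for J
    by (rule m2l_if_inv[OF inv_if_mderiv])
  \<comment> \<open>Falsum is interpreted as \<open>LN0\<close> and the empty context as itself, so
    a closed proof of falsum is sent to a closed element of the empty type.\<close>
  moreover have "MLtt_cind_CT t u (LTm [] (m2l_t a) LN0)" if "mTT_cind_AC_CT t u (MTm [] a MFalsum)" for a
    using sound[OF that] by simp
  ultimately show ?thesis by (auto simp: MLtt_consistent_def mTT_consistent_def)
qed

end
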